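(* Consider the It\^o stochastic differential equation $dx_t=X(x_t)\,dB_t+A(x_t)\,dt$ on $\mathbb{R}^n$ with $C^2$ coefficients. Suppose there is a constant $c$ such that for all $x,v\in\mathbb{R}^n$: $$|X(x)|\le c(1+|x|^2)^{1/2},\qquad \langle x,A(x)\rangle\le c(1+|x|^2),$$ $$|\nabla X(x)|^2\le c[1+\ln(1+|x|^2)],\qquad \langle\nabla A(x)(v),v\rangle\le c[1+\ln(1+|x|^2)]\,|v|^2 .$$ Then the equation is strongly complete. In fact, under these conditions, for all $p>0$ there are constants $c_{1,p}$ and $c_{2,p}$ depending only on $p$ (for the given equation) such that $$E|x_t|^{2p}\le c_{1,p}(1+|x_0|^2)^p e^{c_{2,p}t}$$ for the solution starting from $x_0$, and $\sup_{x\in K}E\left(\sup_{s\le t}|T_xF_s|^p\right)<\infty$ for all $p>0$, all $t>0$ and all compact sets $K\subset\mathbb{R}^n$.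
   Context: $B_t$ is an $m$-dimensional Brownian motion; $X(x):\mathbb{R}^m\to\mathbb{R}^n$ is linear for each $x$, $X^i(x)=X(x)(e_i)$ for an orthonormal basis $(e_i)$ of $\mathbb{R}^m$, $|X(x)|^2=\sum_{i=1}^m|X^i(x)|^2$ and $|\nabla X(x)|^2=\sum_{i=1}^m|\nabla X^i(x)|^2$ (flat metric, so $\nabla$ is the usual derivative). $F_t(x)$, $0\le t<\xi(x)$, is the maximal solution (partial flow, $C^1$ in $x$ on the open set $\{x:t<\xi(x)\}$) starting at $x$ with explosion time $\xi(x)$; $T_xF_t$ is its derivative at $x$. The equation is strongly complete if the solution can be chosen jointly continuous in time and space on all of $\mathbb{R}^n$ for all time, i.e. $\inf_{x}\xi(x)=\infty$ a.s. *)

theory Defs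
  imports "HOL-Probability.Probability"
begin

section \<open>Filtered probability spaces and Brownian motion\<close>

text \<open>Time is indexed by \<open>real\<close> so that the library's \<open>filtration\<close> and \<open>stopping_time\<close> apply;
  only times \<open>t \<ge> 0\<close> carry any meaning.\<close>

definition usual_conditions :: "'w measure \<Rightarrow> (real \<Rightarrow> 'w measure) \<Rightarrow> bool" where
  "usual_conditions M \<F> \<longleftrightarrow>
     filtration (space M) \<F> \<and>
     (\<forall>t. subalgebra M (\<F> t)) \<and>
     (\<forall>N S. N \<in> null_sets M \<longrightarrow> S \<subseteq> N \<longrightarrow> S \<in> sets (\<F> 0)) \<and>
     (\<forall>t\<ge>0. sets (\<F> t) = (\<Inter>s\<in>{t<..}. sets (\<F> s)))"

definition brownian_motion ::
    "'w measure \<Rightarrow> (real \<Rightarrow> 'w measure) \<Rightarrow> (real \<Rightarrow> 'w \<Rightarrow> 'm::euclidean_space) \<Rightarrow> bool" where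
  "brownian_motion M \<F> B \<longleftrightarrow>
     (\<forall>t\<ge>0. B t \<in> borel_measurable (\<F> t)) \<and>
     (AE \<omega> in M. B 0 \<omega> = 0) \<and>
     (AE \<omega> in M. continuous_on {0..} (\<lambda>t. B t \<omega>)) \<and>
     (\<forall>s t. 0 \<le> s \<longrightarrow> s < t \<longrightarrow>
        prob_space.indep_set M (sets (\<F> s))
          {(\<lambda>\<omega>. B t \<omega> - B s \<omega>) -` S \<inter> space M | S. S \<in> sets borel} \<and>
        distributed M lborel (\<lambda>\<omega>. B t \<omega> - B s \<omega>)
          (\<lambda>y. ennreal (\<Prod>b\<in>Basis. normal_density 0 (sqrt (t - s)) (y \<bullet> b))))"

section \<open>The It\^o integral\<close>

text \<open>A simple integrand is given by a partition \<open>\<tau> 0 \<le> \<dots> \<le> \<tau> k\<close> and bounded coefficients \<open>\<eta> j\<close>,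
  measurable at time \<open>\<tau> j\<close>, in force on the interval from \<open>\<tau> j\<close> (excluded) to \<open>\<tau> (Suc j)\<close> (included).\<close>

definition simple_integrand ::
    "'w measure \<Rightarrow> (real \<Rightarrow> 'w measure) \<Rightarrow> nat \<Rightarrow> (nat \<Rightarrow> real)
      \<Rightarrow> (nat \<Rightarrow> 'w \<Rightarrow> 'm::euclidean_space \<Rightarrow>\<^sub>L 'n::euclidean_space) \<Rightarrow> bool" where
  "simple_integrand M \<F> k \<tau> \<eta> \<longleftrightarrow>
     0 \<le> \<tau> 0 \<and> (\<forall>j<k. \<tau> j \<le> \<tau> (Suc j)) \<and>
     (\<forall>j<k. \<eta> j \<in> borel_measurable (\<F> (\<tau> j)) \<and> bounded (\<eta> j ` space M))"

definition simple_process ::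
    "nat \<Rightarrow> (nat \<Rightarrow> real) \<Rightarrow> (nat \<Rightarrow> 'w \<Rightarrow> 'm::euclidean_space \<Rightarrow>\<^sub>L 'n::euclidean_space)
      \<Rightarrow> real \<Rightarrow> 'w \<Rightarrow> 'm \<Rightarrow>\<^sub>L 'n" where
  "simple_process k \<tau> \<eta> s \<omega> = (\<Sum>j<k. indicator {\<tau> j<..\<tau> (Suc j)} s *\<^sub>R \<eta> j \<omega>)"

definition simple_integral ::
    "(real \<Rightarrow> 'w \<Rightarrow> 'm::euclidean_space) \<Rightarrow> nat \<Rightarrow> (nat \<Rightarrow> real)
      \<Rightarrow> (nat \<Rightarrow> 'w \<Rightarrow> 'm \<Rightarrow>\<^sub>L 'n::euclidean_space) \<Rightarrow> real \<Rightarrow> 'w \<Rightarrow> 'n" where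
  "simple_integral B k \<tau> \<eta> t \<omega> =
     (\<Sum>j<k. blinfun_apply (\<eta> j \<omega>) (B (min t (\<tau> (Suc j))) \<omega> - B (min t (\<tau> j)) \<omega>))"

definition progressively_measurable ::
    "(real \<Rightarrow> 'w measure) \<Rightarrow> (real \<Rightarrow> 'w \<Rightarrow> 'a::topological_space) \<Rightarrow> bool" where
  "progressively_measurable \<F> H \<longleftrightarrow>
     (\<forall>t\<ge>0. (\<lambda>(s, \<omega>). H s \<omega>) \<in> borel_measurable (restrict_space borel {0..t} \<Otimes>\<^sub>M \<F> t))"

definition null_in_probability :: "'w measure \<Rightarrow> (nat \<Rightarrow> 'w \<Rightarrow> ennreal) \<Rightarrow> bool" where
  "null_in_probability M Z \<longleftrightarrow>
     (\<forall>\<epsilon>>0. (\<lambda>n. measure M {\<omega>\<in>space M. ennreal \<epsilon> < Z n \<omega>}) \<longlonglongrightarrow> 0)"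

text \<open>\<open>I\<close> is (a continuous version of) the process \<open>t \<mapsto> \<integral>\<^sub>0\<^sup>t H\<^sub>s dB\<^sub>s\<close>. The almost sure
  finiteness of \<open>\<integral>\<^sub>0\<^sup>T \<parallel>H\<^sub>s\<parallel>\<^sup>2 ds\<close> is implied by the approximation clause, as simple integrands
  are bounded. The events measured there are measurable under the usual conditions.\<close>

definition has_ito_integral ::
    "'w measure \<Rightarrow> (real \<Rightarrow> 'w measure) \<Rightarrow> (real \<Rightarrow> 'w \<Rightarrow> 'm::euclidean_space)
      \<Rightarrow> (real \<Rightarrow> 'w \<Rightarrow> 'm \<Rightarrow>\<^sub>L 'n::euclidean_space) \<Rightarrow> (real \<Rightarrow> 'w \<Rightarrow> 'n) \<Rightarrow> bool" where
  "has_ito_integral M \<F> B H I \<longleftrightarrow>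
     progressively_measurable \<F> H \<and>
     (\<forall>t\<ge>0. I t \<in> borel_measurable (\<F> t)) \<and>
     (AE \<omega> in M. continuous_on {0..} (\<lambda>t. I t \<omega>)) \<and>
     (\<exists>k \<tau> \<eta>. (\<forall>n. simple_integrand M \<F> (k n) (\<tau> n) (\<eta> n)) \<and>
        (\<forall>T>0.
           null_in_probability M (\<lambda>n \<omega>. \<integral>\<^sup>+s\<in>{0..T}.
             ennreal ((norm (simple_process (k n) (\<tau> n) (\<eta> n) s \<omega> - H s \<omega>))\<^sup>2) \<partial>lborel) \<and>
           null_in_probability M (\<lambda>n \<omega>. SUP t\<in>{0..T}.
             ennreal (norm (simple_integral B (k n) (\<tau> n) (\<eta> n) t \<omega> - I t \<omega>)))))"

section \<open>Stochastic differential equations\<close>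

text \<open>\<open>x\<close> solves \<open>dx = X(x) dB + A(x) dt\<close>, \<open>x\<^sub>0 = x0\<close>, on the stochastic interval \<open>[0, \<xi>)\<close>: the integral
  equation holds up to each term of a sequence of stopping times \<open>\<sigma> k < \<xi>\<close> increasing to \<open>\<xi>\<close>.
  Values of \<open>x\<close> at times \<open>t \<ge> \<xi>\<close> are irrelevant.\<close>

definition sde_solution ::
    "'w measure \<Rightarrow> (real \<Rightarrow> 'w measure) \<Rightarrow> (real \<Rightarrow> 'w \<Rightarrow> 'm::euclidean_space)
      \<Rightarrow> ('n::euclidean_space \<Rightarrow> 'm \<Rightarrow>\<^sub>L 'n) \<Rightarrow> ('n \<Rightarrow> 'n)
      \<Rightarrow> 'n \<Rightarrow> (real \<Rightarrow> 'w \<Rightarrow> 'n) \<Rightarrow> ('w \<Rightarrow> ereal) \<Rightarrow> bool" where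
  "sde_solution M \<F> B X A x0 x \<xi> \<longleftrightarrow>
     (\<forall>t\<ge>0. Measurable.pred (\<F> t) (\<lambda>\<omega>. \<xi> \<omega> \<le> ereal t)) \<and>
     (\<forall>t\<ge>0. (\<lambda>\<omega>. if ereal t < \<xi> \<omega> then x t \<omega> else 0) \<in> borel_measurable (\<F> t)) \<and>
     (AE \<omega> in M. 0 < \<xi> \<omega> \<and> x 0 \<omega> = x0 \<and> continuous_on {t. 0 \<le> t \<and> ereal t < \<xi> \<omega>} (\<lambda>t. x t \<omega>)) \<and>
     (\<exists>\<sigma>. (\<forall>k. stopping_time \<F> (\<sigma> k)) \<and>
        (AE \<omega> in M. incseq (\<lambda>k. \<sigma> k \<omega>) \<and> (\<forall>k. 0 \<le> \<sigma> k \<omega> \<and> ereal (\<sigma> k \<omega>) < \<xi> \<omega>) \<and>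
           (\<lambda>k. ereal (\<sigma> k \<omega>)) \<longlonglongrightarrow> \<xi> \<omega>) \<and>
        (\<forall>k. \<exists>I. has_ito_integral M \<F> B (\<lambda>s \<omega>. if s \<le> \<sigma> k \<omega> then X (x s \<omega>) else 0) I \<and>
           (AE \<omega> in M. \<forall>t. 0 \<le> t \<longrightarrow> t \<le> \<sigma> k \<omega> \<longrightarrow>
              x t \<omega> = x0 + I t \<omega> + integral {0..t} (\<lambda>s. A (x s \<omega>)))))"

definition maximal_solution ::
    "'w measure \<Rightarrow> (real \<Rightarrow> 'w measure) \<Rightarrow> (real \<Rightarrow> 'w \<Rightarrow> 'm::euclidean_space)
      \<Rightarrow> ('n::euclidean_space \<Rightarrow> 'm \<Rightarrow>\<^sub>L 'n) \<Rightarrow> ('n \<Rightarrow> 'n)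
      \<Rightarrow> 'n \<Rightarrow> (real \<Rightarrow> 'w \<Rightarrow> 'n) \<Rightarrow> ('w \<Rightarrow> ereal) \<Rightarrow> bool" where
  "maximal_solution M \<F> B X A x0 x \<xi> \<longleftrightarrow>
     sde_solution M \<F> B X A x0 x \<xi> \<and>
     (AE \<omega> in M. \<xi> \<omega> < \<infinity> \<longrightarrow> \<not> bounded ((\<lambda>t. x t \<omega>) ` {t. 0 \<le> t \<and> ereal t < \<xi> \<omega>}))"

text \<open>The maximal partial flow: outside one null set, simultaneously for all \<open>x\<close>, the trajectory explodes
  at a finite \<open>\<xi> x\<close>, \<open>{x. t < \<xi> x}\<close> is open, and \<open>F t\<close> is \<open>C\<^sup>1\<close> there, \<open>F\<close> and its spatial derivative
  depending continuously on \<open>(t, x)\<close>.\<close>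

definition partial_flow ::
    "'w measure \<Rightarrow> (real \<Rightarrow> 'w measure) \<Rightarrow> (real \<Rightarrow> 'w \<Rightarrow> 'm::euclidean_space)
      \<Rightarrow> ('n::euclidean_space \<Rightarrow> 'm \<Rightarrow>\<^sub>L 'n) \<Rightarrow> ('n \<Rightarrow> 'n)
      \<Rightarrow> (real \<Rightarrow> 'n \<Rightarrow> 'w \<Rightarrow> 'n) \<Rightarrow> ('n \<Rightarrow> 'w \<Rightarrow> ereal) \<Rightarrow> bool" where
  "partial_flow M \<F> B X A F \<xi> \<longleftrightarrow>
     (\<forall>x. maximal_solution M \<F> B X A x (\<lambda>t. F t x) (\<xi> x)) \<and>
     (AE \<omega> in M.
        (\<forall>x. \<xi> x \<omega> < \<infinity> \<longrightarrow> \<not> bounded ((\<lambda>t. F t x \<omega>) ` {t. 0 \<le> t \<and> ereal t < \<xi> x \<omega>})) \<and>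
        (\<forall>t\<ge>0. open {x. ereal t < \<xi> x \<omega>}) \<and>
        continuous_on {(t, x). 0 \<le> t \<and> ereal t < \<xi> x \<omega>} (\<lambda>(t, x). F t x \<omega>) \<and>
        (\<exists>DF :: real \<Rightarrow> 'n \<Rightarrow> 'n \<Rightarrow>\<^sub>L 'n.
           (\<forall>t x. 0 \<le> t \<longrightarrow> ereal t < \<xi> x \<omega> \<longrightarrow>
              ((\<lambda>y. F t y \<omega>) has_derivative blinfun_apply (DF t x)) (at x)) \<and>
           continuous_on {(t, x). 0 \<le> t \<and> ereal t < \<xi> x \<omega>} (\<lambda>(t, x). DF t x)))"

definition strongly_complete ::
    "'w measure \<Rightarrow> (real \<Rightarrow> 'w measure) \<Rightarrow> (real \<Rightarrow> 'w \<Rightarrow> 'm::euclidean_space)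
      \<Rightarrow> ('n::euclidean_space \<Rightarrow> 'm \<Rightarrow>\<^sub>L 'n) \<Rightarrow> ('n \<Rightarrow> 'n) \<Rightarrow> bool" where
  "strongly_complete M \<F> B X A \<longleftrightarrow>
     (\<exists>\<Phi>. (\<forall>x. sde_solution M \<F> B X A x (\<lambda>t. \<Phi> t x) (\<lambda>_. \<infinity>)) \<and>
        (AE \<omega> in M. continuous_on ({0..} \<times> UNIV) (\<lambda>(t, x). \<Phi> t x \<omega>)))"

definition C2 :: "('a::real_normed_vector \<Rightarrow> 'b::real_normed_vector) \<Rightarrow> bool" where
  "C2 f \<longleftrightarrow>
     (\<exists>(f' :: 'a \<Rightarrow> 'a \<Rightarrow>\<^sub>L 'b) (f'' :: 'a \<Rightarrow> 'a \<Rightarrow>\<^sub>L 'a \<Rightarrow>\<^sub>L 'b).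
        (\<forall>x. (f has_derivative blinfun_apply (f' x)) (at x)) \<and>
        (\<forall>x. (f' has_derivative blinfun_apply (f'' x)) (at x)) \<and>
        continuous_on UNIV f'')"

end

theory Submission
  imports Defs
begin

text \<open>Everything rests on one maximal inequality. If \<open>\<zeta> = z0 + \<integral>H dB + \<integral>a dt\<close> with \<open>|H|\<^sup>2\<close> and \<open>\<langle>\<zeta>, a\<rangle>\<close> at most
  \<open>q (e + |\<zeta>|\<^sup>2)\<close>, then \<open>(e + |\<zeta>|\<^sup>2)\<^sup>p\<close>, discounted by \<open>exp (- C q t)\<close>, is almost a supermartingale, so
  \<open>P(sup (e + |\<zeta>|\<^sup>2)\<^sup>p > b) \<le> C (e + |z0|\<^sup>2)\<^sup>p exp (C q T) / b\<close>. There is no need for It\^o's formula: the inequality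
  holds for Euler schemes by a Gaussian computation in each step, and passes to the limit because It\^o
  integrals are limits of discrete sums.

  With \<open>e = 1\<close> it bounds a solution, which gives non-explosion and moments. For the difference of two
  solutions take \<open>e = |x0 - y0|\<^sup>2\<close>: as long as both stay in the ball of radius \<open>\<rho>\<close> one may take \<open>q\<close> of order
  \<open>1 + ln \<rho>\<close>, so that the loss \<open>exp (C q T)\<close> is only a power of \<open>\<rho>\<close>. Choosing \<open>\<rho>\<close> as a power of \<open>u\<close>, the
  tails of the two solutions absorb it, and \<open>P(sup |x - y| > u |x0 - y0|) \<le> C u\<^sup>-\<^sup>p\<close> for every \<open>p\<close>.

  Kolmogorov's chaining argument turns this into a jointly continuous solution map, whose individual
  solutions are limits of Euler polygons. Any partial flow agrees with a continuous map before its explosion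
  time, hence it cannot explode. Its difference quotients inherit the two-point tails, and so do the derivatives.\<close>

section \<open>Outer probability bounds\<close>

text \<open>The estimate has to see paths that behave well only locally: before an explosion time,
  or while two solutions stay in a common ball. The maximal inequality puts this condition into the
  event. It bounds the probability that at some time t the path has obeyed the hypotheses throughout
  [0, t] and exceeds the level.

  The Gaussian step asks for coefficients bounded by some K, but K enters only an error of order
  h^(3/2) per step. Over T/h steps this error vanishes with the mesh h, so the final bound contains
  q but not K, and cut-offs can be removed afterwards. Since q occurs linearly in an exponent, a
  logarithmic Lipschitz constant turns into a power of the radius.

  Two Ito integrals come with unrelated sequences of simple integrands. Before they can be
  subtracted, both are resampled on one dyadic grid.

  Existence rests on the same inequality: differences of Euler polygons are controlled up to the lag
  of their coefficients, and the constant e absorbs this error.\<close>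

text \<open>Outer probabilities, because suprema over times or initial points need not be measurable.\<close>

definition outer_prob_le :: "'w measure \<Rightarrow> ('w \<Rightarrow> bool) \<Rightarrow> real \<Rightarrow> bool" where
  "outer_prob_le M P d \<longleftrightarrow> (\<exists>E\<in>sets M. {\<omega>\<in>space M. P \<omega>} \<subseteq> E \<and> measure M E \<le> d)"

context prob_space
begin

lemma outer_prob_leI:
  assumes "{\<omega>\<in>space M. P \<omega>} \<in> sets M" "prob {\<omega>\<in>space M. P \<omega>} \<le> d"
  shows "outer_prob_le M P d"
  using assms unfolding outer_prob_le_def by blast

lemma outer_prob_le_AE_mono:
  assumes "outer_prob_le M P d" "AE \<omega> in M. Q \<omega> \<longrightarrow> P \<omega>" "d \<le> d'"
  shows "outer_prob_le M Q d'"
proof -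
  obtain E where E: "E \<in> sets M" "{\<omega>\<in>space M. P \<omega>} \<subseteq> E" "prob E \<le> d"
    using assms(1) unfolding outer_prob_le_def by auto
  obtain N where N: "{\<omega>\<in>space M. \<not> (Q \<omega> \<longrightarrow> P \<omega>)} \<subseteq> N" "emeasure M N = 0" "N \<in> sets M"
    using assms(2) by (rule AE_E)
  have "prob (E \<union> N) \<le> prob E + prob N"
    using E N by (intro measure_Un_le)
  also have "prob N = 0" using N by (simp add: measure_def)
  finally have "prob (E \<union> N) \<le> d'" using E assms(3) by simp
  moreover have "{\<omega>\<in>space M. Q \<omega>} \<subseteq> E \<union> N" using E N by blast
  ultimately show ?thesis unfolding outer_prob_le_def using E N by blast
qed

lemma outer_prob_le_mono:
  assumes "outer_prob_le M P d" "\<And>\<omega>. \<omega> \<in> space M \<Longrightarrow> Q \<omega> \<Longrightarrow> P \<omega>" "d \<le> d'"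
  shows "outer_prob_le M Q d'"
  using assms by (intro outer_prob_le_AE_mono[OF assms(1)]) (auto intro!: AE_I2)

lemma outer_prob_le_one: "1 \<le> d \<Longrightarrow> outer_prob_le M P d"
  unfolding outer_prob_le_def by (intro bexI[of _ "space M"]) (auto simp: prob_space)

lemma outer_prob_le_disj:
  assumes "outer_prob_le M P d" "outer_prob_le M Q e"
  shows "outer_prob_le M (\<lambda>\<omega>. P \<omega> \<or> Q \<omega>) (d + e)"
proof -
  obtain E where E: "E \<in> sets M" "{\<omega>\<in>space M. P \<omega>} \<subseteq> E" "prob E \<le> d"
    using assms(1) unfolding outer_prob_le_def by auto
  obtain N where N: "N \<in> sets M" "{\<omega>\<in>space M. Q \<omega>} \<subseteq> N" "prob N \<le> e"
    using assms(2) unfolding outer_prob_le_def by auto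
  have "prob (E \<union> N) \<le> d + e"
    using measure_Un_le[OF E(1) N(1)] E N by linarith
  then show ?thesis unfolding outer_prob_le_def using E N by (intro bexI[of _ "E \<union> N"]) auto
qed

lemma outer_prob_le_finite_ex:
  assumes "finite I" "\<And>i. i \<in> I \<Longrightarrow> outer_prob_le M (P i) (d i)"
  shows "outer_prob_le M (\<lambda>\<omega>. \<exists>i\<in>I. P i \<omega>) (\<Sum>i\<in>I. d i)"
  using assms
proof (induction I)
  case empty
  then show ?case unfolding outer_prob_le_def by (intro bexI[of _ "{}"]) auto
next
  case (insert i I)
  then have "outer_prob_le M (\<lambda>\<omega>. P i \<omega> \<or> (\<exists>i\<in>I. P i \<omega>)) (d i + (\<Sum>i\<in>I. d i))"
    by (intro outer_prob_le_disj) auto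
  then show ?case using insert by simp
qed

text \<open>Fatou's lemma for sets, applied to measurable covers of the \<open>P n\<close>. The
  later passages to the limit go through it: finer grids, larger cut-offs, later localising times,
  difference quotients.\<close>

lemma outer_prob_le_liminf:
  assumes P: "\<And>n. outer_prob_le M (P n) d" and Q: "AE \<omega> in M. Q \<omega> \<longrightarrow> eventually (\<lambda>n. P n \<omega>) sequentially"
  shows "outer_prob_le M Q d"
proof -
  obtain E where E: "\<And>n. E n \<in> sets M" "\<And>n. {\<omega>\<in>space M. P n \<omega>} \<subseteq> E n" "\<And>n. prob (E n) \<le> d"
    using P unfolding outer_prob_le_def by metis
  define L where "L n = (\<Inter>k\<in>{n..}. E k)" for n
  have L[measurable]: "L n \<in> sets M" for n unfolding L_def using E by auto
  have inc: "incseq L" unfolding L_def incseq_def by force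
  have "(\<lambda>n. prob (L n)) \<longlonglongrightarrow> prob (\<Union>n. L n)"
    using L inc by (intro finite_Lim_measure_incseq) auto
  moreover have "prob (L n) \<le> d" for n
    using E(3)[of n] finite_measure_mono[of "L n" "E n"] E(1)[of n] unfolding L_def by force
  ultimately have "prob (\<Union>n. L n) \<le> d" by (meson LIMSEQ_le_const2)
  then have "outer_prob_le M (\<lambda>\<omega>. \<omega> \<in> (\<Union>n. L n)) d"
    unfolding outer_prob_le_def by (intro bexI[of _ "\<Union>n. L n"]) auto
  moreover have "AE \<omega> in M. Q \<omega> \<longrightarrow> \<omega> \<in> (\<Union>n. L n)"
    using Q AE_space
  proof eventually_elim
    case (elim \<omega>)
    show ?case
    proof
      assume "Q \<omega>"
      then obtain n where "\<And>k. k \<ge> n \<Longrightarrow> P k \<omega>" using elim unfolding eventually_sequentially by auto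
      then have "\<omega> \<in> L n" unfolding L_def using E(2) elim by auto
      then show "\<omega> \<in> (\<Union>n. L n)" by auto
    qed
  qed
  ultimately show ?thesis by (rule outer_prob_le_AE_mono) simp
qed

text \<open>Intersecting countably many covers attains the infimum, so an error that can be made
  arbitrarily small may be dropped.\<close>

lemma outer_prob_le_eps:
  assumes "\<And>e. e > 0 \<Longrightarrow> outer_prob_le M P (d + e)"
  shows "outer_prob_le M P d"
proof -
  have "\<And>n::nat. \<exists>E\<in>sets M. {\<omega>\<in>space M. P \<omega>} \<subseteq> E \<and> prob E \<le> d + 1 / Suc n"
    using assms unfolding outer_prob_le_def by simp
  then obtain E where E: "\<And>n. E n \<in> sets M" "\<And>n::nat. {\<omega>\<in>space M. P \<omega>} \<subseteq> E n" "\<And>n. prob (E n) \<le> d + 1 / Suc n"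
    by metis
  have "prob (\<Inter>n. E n) \<le> d + 1 / Suc n" for n
    using E(3)[of n] finite_measure_mono[of "\<Inter>n. E n" "E n"] E(1)[of n] by force
  moreover have "(\<lambda>n. d + 1 / Suc n) \<longlonglongrightarrow> d + 0"
    by (intro tendsto_intros LIMSEQ_Suc[OF lim_1_over_n])
  ultimately have "prob (\<Inter>n. E n) \<le> d"
    by (intro LIMSEQ_le_const[of "\<lambda>n. d + 1 / Suc n"]) auto
  then show ?thesis unfolding outer_prob_le_def using E by (intro bexI[of _ "\<Inter>n. E n"]) auto
qed

lemma outer_prob_le_0_AE:
  assumes "outer_prob_le M P 0"
  shows "AE \<omega> in M. \<not> P \<omega>"
proof -
  obtain E where E: "E \<in> sets M" "{\<omega>\<in>space M. P \<omega>} \<subseteq> E" "prob E \<le> 0"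
    using assms unfolding outer_prob_le_def by auto
  then have "emeasure M E = 0" by (simp add: emeasure_eq_measure measure_le_0_iff)
  then show ?thesis using E by (intro AE_I[of _ _ E]) auto
qed

lemma outer_prob_le_small_AE:
  assumes "\<And>e. e > 0 \<Longrightarrow> outer_prob_le M P e"
  shows "AE \<omega> in M. \<not> P \<omega>"
  by (rule outer_prob_le_0_AE, rule outer_prob_le_eps) (simp add: assms)

lemma outer_prob_le_Borel_Cantelli:
  assumes P: "\<And>n::nat. outer_prob_le M (P n) (d n)" and d: "summable d"
  shows "AE \<omega> in M. eventually (\<lambda>n. \<not> P n \<omega>) sequentially"
proof -
  obtain E where E: "\<And>n. E n \<in> sets M" "\<And>n. {\<omega>\<in>space M. P n \<omega>} \<subseteq> E n" "\<And>n. prob (E n) \<le> d n"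
    using P unfolding outer_prob_le_def by metis
  have "summable (\<lambda>n. prob (E n))"
    using E(3) by (intro summable_comparison_test_ev[OF _ d]) (auto intro: always_eventually)
  then have "AE \<omega> in M. eventually (\<lambda>n. \<omega> \<in> space M - E n) sequentially"
    using E by (intro borel_cantelli_AE1) (auto simp: emeasure_eq_measure suminf_ennreal_eq)
  then show ?thesis
    using AE_space
  proof eventually_elim
    case (elim \<omega>)
    show ?case using elim(1) by eventually_elim (use E(2) elim(2) in auto)
  qed
qed

text \<open>Continuity from above turns almost sure eventual failure into a small probability for a
  whole tail of indices. Outer measures lack this continuity, which is why the events are assumed
  measurable here.\<close>

lemma outer_prob_le_eventually:
  assumes [measurable]: "\<And>n::nat. {\<omega>\<in>space M. P n \<omega>} \<in> sets M"
    and ev: "AE \<omega> in M. eventually (\<lambda>n. \<not> P n \<omega>) sequentially" and e: "e > 0"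
  shows "\<exists>n0. outer_prob_le M (\<lambda>\<omega>. \<exists>n\<ge>n0. P n \<omega>) e"
proof -
  define A where "A n = (\<Union>k\<in>{n..}. {\<omega>\<in>space M. P k \<omega>})" for n
  have A[measurable]: "A n \<in> sets M" for n unfolding A_def by measurable
  have "decseq A" unfolding A_def decseq_def by force
  then have "(\<lambda>n. prob (A n)) \<longlonglongrightarrow> prob (\<Inter>n. A n)"
    using A by (intro finite_Lim_measure_decseq) auto
  moreover have "AE \<omega> in M. \<omega> \<notin> (\<Inter>n. A n)"
    using ev
  proof eventually_elim
    case (elim \<omega>)
    then show ?case unfolding A_def eventually_sequentially by auto
  qed
  then have "prob (\<Inter>n. A n) = 0"
    using A by (subst (asm) AE_iff_null_sets[symmetric]) (auto simp: measure_def dest: null_setsD1)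
  ultimately have "eventually (\<lambda>n. prob (A n) < e) sequentially"
    using e by (metis order_tendstoD(2))
  then obtain n where "prob (A n) < e" unfolding eventually_sequentially by auto
  then show ?thesis unfolding outer_prob_le_def A_def
    by (intro exI[of _ n] bexI[of _ "A n"]) (auto simp: A_def)
qed

text \<open>Layer-cake estimate over the levels D * 2^k. Tails 4^-k against weights 2^(k+1) leave a
  geometric series of sum 4 * D; the first level contributes D. The function itself may be
  non-measurable, as a supremum over uncountably many times can be; only the dominating series
  \<open>g\<close> is measurable.\<close>

lemma nn_integral_le_of_tails:
  fixes f :: "'a \<Rightarrow> ennreal"
  assumes D: "D \<ge> 0" and f: "\<And>k::nat. outer_prob_le M (\<lambda>\<omega>. f \<omega> > ennreal (D * 2^k)) (1 / 4^k)"
  shows "(\<integral>\<^sup>+\<omega>. f \<omega> \<partial>M) \<le> ennreal (5 * D)"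
proof -
  obtain E where E[measurable]: "\<And>n. E n \<in> sets M" and E2: "\<And>n. {\<omega>\<in>space M. f \<omega> > ennreal (D * 2^n)} \<subseteq> E n"
     and E3: "\<And>n. prob (E n) \<le> 1 / 4^n"
    using f unfolding outer_prob_le_def by metis
  define g where "g \<omega> = ennreal D + (\<Sum>k. ennreal (D * 2^Suc k) * indicator (E k) \<omega>)" for \<omega>
  have le: "f \<omega> \<le> g \<omega>" if w: "\<omega> \<in> space M" "\<forall>\<^sub>F n in sequentially. \<omega> \<notin> E n" for \<omega>
  proof (cases "\<omega> \<in> (\<Union>k. E k)")
    case False
    then have "f \<omega> \<le> ennreal D" using E2[of 0] w(1) by (auto simp: not_less[symmetric])
    also have "\<dots> \<le> g \<omega>" unfolding g_def by simp
    finally show ?thesis .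
  next
    case True
    then obtain k0 where k0: "\<omega> \<in> E k0" by auto
    obtain N where N: "\<And>n. n \<ge> N \<Longrightarrow> \<omega> \<notin> E n" using w(2) unfolding eventually_sequentially by auto
    \<comment> \<open>The last cover containing \<open>\<omega>\<close> decides: outside the next
      one the function is at most D * 2^(k+1), and this is one of the terms of the series.\<close>
    define k where "k = Max {k. \<omega> \<in> E k}"
    have fin: "finite {k. \<omega> \<in> E k}"
    proof (rule finite_subset[of _ "{..N}"])
      show "{k. \<omega> \<in> E k} \<subseteq> {..N}"
      proof
        fix i assume "i \<in> {k. \<omega> \<in> E k}"
        then show "i \<in> {..N}" using N[of i] by (cases "i \<le> N") auto
      qed
    qed simp
    have kE: "\<omega> \<in> E k" using Max_in[OF fin] k0 unfolding k_def by auto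
    have "\<omega> \<notin> E (Suc k)" using Max_ge[OF fin, of "Suc k"] unfolding k_def by auto
    then have "f \<omega> \<le> ennreal (D * 2^Suc k)" using E2[of "Suc k"] w(1) by (auto simp: not_less[symmetric])
    also have "\<dots> = (\<Sum>i\<in>{k}. ennreal (D * 2^Suc i) * indicator (E i) \<omega>)" using kE by simp
    also have "\<dots> \<le> (\<Sum>i. ennreal (D * 2^Suc i) * indicator (E i) \<omega>)"
      by (intro sum_le_suminf) auto
    also have "\<dots> \<le> g \<omega>" unfolding g_def by simp
    finally show ?thesis .
  qed
  have sm: "summable (\<lambda>n. 1 / 4^n :: real)" using summable_geometric[of "1/4::real"] by (simp add: power_divide)
  have "AE \<omega> in M. eventually (\<lambda>n. \<not> \<omega> \<in> E n) sequentially"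
    by (rule outer_prob_le_Borel_Cantelli[OF _ sm])
      (use E E3 in \<open>auto simp: outer_prob_le_def\<close>)
  then have "AE \<omega> in M. f \<omega> \<le> g \<omega>"
    using AE_space by eventually_elim (use le in auto)
  then have "(\<integral>\<^sup>+\<omega>. f \<omega> \<partial>M) \<le> (\<integral>\<^sup>+\<omega>. g \<omega> \<partial>M)" by (rule nn_integral_mono_AE)
  also have "\<dots> = ennreal D + (\<Sum>k. ennreal (D * 2^Suc k) * emeasure M (E k))"
    unfolding g_def by (simp add: nn_integral_add nn_integral_suminf nn_integral_cmult emeasure_space_1)
  also have "(\<Sum>k. ennreal (D * 2^Suc k) * emeasure M (E k)) \<le> (\<Sum>k. ennreal (2 * D * (1/2)^k))"
  proof (intro suminf_le)
    fix k
    have "ennreal (D * 2^Suc k) * emeasure M (E k) \<le> ennreal (D * 2^Suc k) * ennreal (1 / 4^k)"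
      using E3[of k] by (intro mult_left_mono) (auto simp: emeasure_eq_measure ennreal_leI)
    also have "\<dots> = ennreal (D * 2^Suc k * (1 / 4^k))"
      using D by (subst ennreal_mult) auto
    also have "D * 2^Suc k * (1 / 4^k) = 2 * D * (1/2)^k"
    proof -
      have "(4::real)^k = 2^k * 2^k" by (simp add: power_mult_distrib[symmetric])
      then show ?thesis by (simp add: power_one_over divide_simps)
    qed
    finally show "ennreal (D * 2^Suc k) * emeasure M (E k) \<le> ennreal (2 * D * (1/2)^k)" .
  qed auto
  also have "(\<Sum>k. ennreal (2 * D * (1/2)^k)) = ennreal (4 * D)"
  proof (rule suminf_ennreal_eq)
    show "(\<lambda>k. 2 * D * (1/2)^k) sums (4 * D)"
      using sums_mult[OF geometric_sums[of "1/2::real"], of "2 * D"] by simp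
  qed (use D in simp)
  also have "ennreal D + ennreal (4 * D) = ennreal (5 * D)"
    using D by (subst ennreal_plus[symmetric]) auto
  finally show ?thesis by simp
qed

end

section \<open>Expansion of powers with explicit remainder\<close>

lemma one_plus_power_le:
  fixes s :: real
  assumes "s \<ge> -1"
  shows "(1 + s)^p \<le> 1 + real p * s + (real p)\<^sup>2 * s\<^sup>2 * (1 + \<bar>s\<bar>)^p"
proof (induction p)
  case (Suc p)
  have "(1 + s)^Suc p \<le> (1 + s) * (1 + real p * s + (real p)\<^sup>2 * s\<^sup>2 * (1 + \<bar>s\<bar>)^p)"
    using mult_left_mono[OF Suc.IH, of "1 + s"] assms by simp
  also have "\<dots> = 1 + real (Suc p) * s + real p * s\<^sup>2 + (real p)\<^sup>2 * s\<^sup>2 * ((1 + s) * (1 + \<bar>s\<bar>)^p)"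
    by (simp add: algebra_simps power2_eq_square)
  also have "\<dots> \<le> 1 + real (Suc p) * s + real p * s\<^sup>2 * (1 + \<bar>s\<bar>)^Suc p + (real p)\<^sup>2 * s\<^sup>2 * (1 + \<bar>s\<bar>)^Suc p"
  proof (intro add_mono mult_left_mono order_refl)
    have "1 \<le> (1 + \<bar>s\<bar>)^Suc p" by (intro one_le_power) simp
    then show "real p * s\<^sup>2 \<le> real p * s\<^sup>2 * (1 + \<bar>s\<bar>)^Suc p" by (metis mult_left_mono mult.right_neutral mult_nonneg_nonneg of_nat_0_le_iff zero_le_power2)
    show "(1 + s) * (1 + \<bar>s\<bar>)^p \<le> (1 + \<bar>s\<bar>)^Suc p" unfolding power_Suc by (intro mult_right_mono) auto
  qed auto
  also have "\<dots> = 1 + real (Suc p) * s + (real p + (real p)\<^sup>2) * (s\<^sup>2 * (1 + \<bar>s\<bar>)^Suc p)"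
    by (simp add: algebra_simps)
  also have "\<dots> \<le> 1 + real (Suc p) * s + (real (Suc p))\<^sup>2 * (s\<^sup>2 * (1 + \<bar>s\<bar>)^Suc p)"
    by (intro add_left_mono mult_right_mono) (simp_all add: power2_eq_square[of "1 + real p"] power2_eq_square[of "real p"] distrib_left distrib_right)
  finally show ?case by (simp add: mult.assoc)
qed simp

text \<open>In a Gaussian step s has order sqrt h. The quadratic term then carries the order h that
  ends up in the growth rate, so its coefficient must be free of the factor (1 + |s|)^p; that factor
  may stay in the cubic term, which is only an error of order h^(3/2).\<close>

lemma one_plus_power_le_cubic:
  fixes s :: real
  assumes "s \<ge> -1"
  shows "(1 + s)^p \<le> 1 + real p * s + (real p)\<^sup>2 * s\<^sup>2 + (real p)^3 * \<bar>s\<bar>^3 * (1 + \<bar>s\<bar>)^p"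
proof -
  \<comment> \<open>Splits the factor (1 + |s|)^p of the quadratic remainder into 1 and a part of
    first order, which becomes the cubic term.\<close>
  have *: "(1 + y)^p \<le> 1 + real p * y * (1 + y)^p" if "y \<ge> 0" for y :: real
  proof (induction p)
    case (Suc p)
    have "(1+y)^Suc p \<le> (1+y) * (1 + real p * y * (1 + y)^p)"
      using mult_left_mono[OF Suc.IH, of "1 + y"] that by simp
    also have "\<dots> = 1 + y * 1 + real p * y * (1+y)^Suc p" by (simp add: algebra_simps)
    also have "\<dots> \<le> 1 + y * (1+y)^Suc p + real p * y * (1+y)^Suc p"
      using that by (intro add_mono mult_left_mono one_le_power) auto
    also have "\<dots> = 1 + real (Suc p) * y * (1+y)^Suc p" by (simp only: of_nat_Suc distrib_right mult_1_left)
    finally show ?case .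
  qed simp
  have "(1 + s)^p \<le> 1 + real p * s + ((real p)\<^sup>2 * s\<^sup>2) * (1 + \<bar>s\<bar>)^p"
    using one_plus_power_le[OF assms] .
  also have "\<dots> \<le> 1 + real p * s + ((real p)\<^sup>2 * s\<^sup>2) * (1 + real p * \<bar>s\<bar> * (1 + \<bar>s\<bar>)^p)"
    using *[of "\<bar>s\<bar>"] by (intro add_left_mono mult_left_mono) auto
  also have "\<dots> = 1 + real p * s + (real p)\<^sup>2 * s\<^sup>2 + (real p)^3 * \<bar>s\<bar>^3 * (1 + \<bar>s\<bar>)^p"
    by (simp add: algebra_simps power2_eq_square power3_eq_cube)
  finally show ?thesis .
qed

section \<open>One Gaussian step\<close>

text \<open>Needed so that Borel measurability of operator-valued maps survives sums, differences
  and application to vectors. In finite dimension balls are totally bounded, and the small balls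
  around finite nets of ever larger balls form a countable basis.\<close>

instance blinfun :: (euclidean_space, euclidean_space) second_countable_topology
proof
  have "\<exists>k. finite k \<and> cball (0 :: 'a \<Rightarrow>\<^sub>L 'b) (real n) \<subseteq> (\<Union>x\<in>k. ball x (1 / Suc m))" for n m :: nat
    using compact_cball[of "0 :: 'a \<Rightarrow>\<^sub>L 'b" "real n"] unfolding compact_eq_totally_bounded by simp
  then obtain k where k: "\<And>n m. finite (k n m)"
    "\<And>n m. cball (0 :: 'a \<Rightarrow>\<^sub>L 'b) (real n) \<subseteq> (\<Union>x\<in>k n m. ball x (1 / Suc m))"
    by metis
  define \<B> where "\<B> = (\<Union>n m. (\<lambda>x. ball x (1 / Suc m)) ` k n m)"
  have "topological_basis \<B>"
  proof (rule topological_basisI)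
    fix U :: "('a \<Rightarrow>\<^sub>L 'b) set" and x assume "open U" "x \<in> U"
    then obtain e where e: "e > 0" "ball x e \<subseteq> U" by (meson openE)
    obtain m where m: "1 / Suc m < e / 2" using e(1) nat_approx_posE[of "e / 2"] by auto
    obtain n :: nat where "norm x \<le> n" using real_arch_simple by blast
    then have "x \<in> cball 0 (real n)" by simp
    then have "x \<in> (\<Union>y\<in>k n m. ball y (1 / Suc m))" using k(2)[of n m] by (rule rev_subsetD)
    then obtain y where y: "y \<in> k n m" "dist y x < 1 / Suc m" by auto
    have "ball y (1 / Suc m) \<subseteq> ball x e"
    proof
      fix z assume "z \<in> ball y (1 / Suc m)"
      then show "z \<in> ball x e" using m y(2) dist_triangle[of x z y] by (auto simp: dist_commute)
    qed
    then show "\<exists>B'\<in>\<B>. x \<in> B' \<and> B' \<subseteq> U" using e y unfolding \<B>_def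
      by (intro bexI[of _ "ball y (1 / Suc m)"]) auto
  qed (auto simp: \<B>_def)
  moreover have "countable \<B>" unfolding \<B>_def using k(1) by (intro countable_UN countable_image) (auto intro: countable_finite)
  ultimately show "\<exists>B::('a \<Rightarrow>\<^sub>L 'b) set set. countable B \<and> open = generate_topology B"
    by (intro exI[of _ \<B>]) (auto intro: topological_basis_imp_subbasis)
qed

lemma borel_measurable_blinfun_apply[measurable (raw)]:
  fixes f :: "'c \<Rightarrow> 'a::euclidean_space \<Rightarrow>\<^sub>L 'b::euclidean_space"
  assumes "f \<in> borel_measurable N" "g \<in> borel_measurable N"
  shows "(\<lambda>x. blinfun_apply (f x) (g x)) \<in> borel_measurable N"
  using assms by (rule borel_measurable_continuous_Pair) (intro continuous_intros)

section \<open>Moments and symmetry of the Gaussian law\<close>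

definition gaussian_law :: "real \<Rightarrow> 'm::euclidean_space measure" where
  "gaussian_law h = density lborel (\<lambda>y. ennreal (\<Prod>b\<in>Basis. normal_density 0 (sqrt h) (y \<bullet> b)))"

text \<open>Not the moment of the norm but a product of one-dimensional moments. It dominates the
  N-th moment of 1 + |y| / sqrt h under \<open>gaussian_law h\<close> for every h > 0, so constants
  built from it do not depend on the mesh.\<close>

definition gauss_moment :: "'m::euclidean_space itself \<Rightarrow> nat \<Rightarrow> real" where
  "gauss_moment _ N = (\<integral>u. std_normal_density u * (1 + \<bar>u\<bar>)^N \<partial>lborel)^DIM('m)"

lemma one_plus_sum_le_prod:
  fixes f :: "'a \<Rightarrow> real"
  assumes "finite A" "\<And>x. x \<in> A \<Longrightarrow> 0 \<le> f x"
  shows "1 + sum f A \<le> (\<Prod>x\<in>A. 1 + f x)"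
  using assms
proof (induction A)
  case (insert x A)
  have "1 + (f x + sum f A) \<le> (1 + f x) * (1 + sum f A)"
    using insert by (auto simp: algebra_simps intro!: mult_nonneg_nonneg sum_nonneg)
  also have "\<dots> \<le> (1 + f x) * (\<Prod>x\<in>A. 1 + f x)"
    using insert by (intro mult_left_mono) auto
  finally show ?case using insert by simp
qed simp

lemma sets_gaussian_law[simp, measurable_cong]: "sets (gaussian_law h) = sets borel"
  and space_gaussian_law[simp]: "space (gaussian_law h) = UNIV"
  by (simp_all add: gaussian_law_def)

lemma integrable_std_normal_one_plus:
  "integrable lborel (\<lambda>u. std_normal_density u * (1 + \<bar>u\<bar>)^N)"
proof -
  have "integrable lborel (\<lambda>u. \<Sum>k\<le>N. real (N choose k) * (std_normal_density u * \<bar>u - 0\<bar>^k))"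
    by (intro Bochner_Integration.integrable_sum integrable_mult_right integrable_normal_moment_abs) auto
  also have "(\<lambda>u. \<Sum>k\<le>N. real (N choose k) * (std_normal_density u * \<bar>u - 0\<bar>^k))
    = (\<lambda>u. std_normal_density u * (1 + \<bar>u\<bar>)^N)"
    by (intro ext, subst add.commute, subst binomial_ring) (simp add: sum_distrib_left ac_simps)
  finally show ?thesis .
qed

text \<open>The norm couples the coordinates; 1 + |y| <= 1 + sum |y_b| <= prod (1 + |y_b|) decouples
  them, so that the integral factorises. Rescaling each coordinate by sqrt h removes h.\<close>

lemma nn_integral_gaussian_law_le:
  fixes h :: real
  assumes h: "h > 0"
  shows "(\<integral>\<^sup>+y. ennreal ((1 + norm y / sqrt h)^N) \<partial>(gaussian_law h :: 'm::euclidean_space measure))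
    \<le> ennreal (gauss_moment TYPE('m) N)"
proof -
  define f where "f t = ennreal (normal_density 0 (sqrt h) t * (1 + \<bar>t\<bar> / sqrt h)^N)" for t
  have [measurable]: "f \<in> borel_measurable borel" unfolding f_def by measurable
  have le: "(1 + norm y / sqrt h)^N \<le> (\<Prod>b\<in>Basis. (1 + \<bar>y \<bullet> b\<bar> / sqrt h)^N)" for y :: 'm
  proof -
    have "1 + norm y / sqrt h \<le> 1 + (\<Sum>b\<in>Basis. \<bar>y \<bullet> b\<bar> / sqrt h)"
      using norm_le_l1[of y] h by (simp add: sum_divide_distrib[symmetric] divide_right_mono)
    also have "\<dots> \<le> (\<Prod>b\<in>Basis. (1 + \<bar>y \<bullet> b\<bar> / sqrt h))"
      using h by (intro one_plus_sum_le_prod) auto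
    finally have "(1 + norm y / sqrt h)^N \<le> (\<Prod>b\<in>Basis. (1 + \<bar>y \<bullet> b\<bar> / sqrt h))^N"
      using h by (intro power_mono) auto
    then show ?thesis by (simp add: prod_power_distrib)
  qed
  have "(\<integral>\<^sup>+y. ennreal ((1 + norm y / sqrt h)^N) \<partial>(gaussian_law h :: 'm measure))
    = (\<integral>\<^sup>+y. ennreal (\<Prod>b\<in>Basis. normal_density 0 (sqrt h) (y \<bullet> b)) * ennreal ((1 + norm y / sqrt h)^N) \<partial>(lborel :: 'm measure))"
    unfolding gaussian_law_def by (subst nn_integral_density) auto
  also have "\<dots> \<le> (\<integral>\<^sup>+y. (\<Prod>b\<in>Basis. f (y \<bullet> b)) \<partial>(lborel :: 'm measure))"
  proof (intro nn_integral_mono)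
    fix y :: 'm
    have "ennreal (\<Prod>b\<in>Basis. normal_density 0 (sqrt h) (y \<bullet> b)) * ennreal ((1 + norm y / sqrt h)^N)
      \<le> ennreal (\<Prod>b\<in>Basis. normal_density 0 (sqrt h) (y \<bullet> b)) * ennreal (\<Prod>b\<in>Basis. (1 + \<bar>y \<bullet> b\<bar> / sqrt h)^N)"
      by (intro mult_left_mono ennreal_leI le) auto
    also have "\<dots> = (\<Prod>b\<in>Basis. f (y \<bullet> b))"
      unfolding f_def using h by (subst ennreal_mult[symmetric]) (auto intro!: prod_nonneg simp: prod_ennreal prod.distrib)
    finally show "ennreal (\<Prod>b\<in>Basis. normal_density 0 (sqrt h) (y \<bullet> b)) * ennreal ((1 + norm y / sqrt h)^N)
      \<le> (\<Prod>b\<in>Basis. f (y \<bullet> b))" .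
  qed
  also have "\<dots> = (\<Prod>b\<in>(Basis::'m set). (\<integral>\<^sup>+t. f t \<partial>lborel))"
    by (subst nn_integral_lborel_prod[of "\<lambda>_. f"]) (auto simp: f_def)
  also have "(\<integral>\<^sup>+t. f t \<partial>lborel) = ennreal (sqrt h) * (\<integral>\<^sup>+u. f (0 + sqrt h * u) \<partial>lborel)"
    using h by (subst nn_integral_real_affine[of f "sqrt h" 0]) auto
  also have "\<dots> = (\<integral>\<^sup>+u. ennreal (std_normal_density u * (1 + \<bar>u\<bar>)^N) \<partial>lborel)"
    using h unfolding f_def
    by (subst nn_integral_cmult[symmetric], simp, intro nn_integral_cong, subst ennreal_mult[symmetric])
      (auto simp: normal_density_def abs_mult real_sqrt_mult power_mult_distrib)
  also have "\<dots> = ennreal (\<integral>u. std_normal_density u * (1 + \<bar>u\<bar>)^N \<partial>lborel)"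
    by (intro nn_integral_eq_integral integrable_std_normal_one_plus) auto
  finally show ?thesis by (simp add: gauss_moment_def ennreal_power integral_nonneg_AE)
qed

lemma prob_space_gaussian_law:
  assumes h: "h > 0"
  shows "prob_space (gaussian_law h :: 'm::euclidean_space measure)"
proof
  have "emeasure (gaussian_law h :: 'm measure) UNIV = (\<integral>\<^sup>+y. (\<Prod>b\<in>Basis. ennreal (normal_density 0 (sqrt h) (y \<bullet> b))) \<partial>(lborel :: 'm measure))"
    unfolding gaussian_law_def by (subst emeasure_density) (auto simp: prod_ennreal)
  also have "\<dots> = (\<Prod>b\<in>(Basis::'m set). (\<integral>\<^sup>+t. ennreal (normal_density 0 (sqrt h) t) \<partial>lborel))"
    by (subst nn_integral_lborel_prod[of "\<lambda>_ t. ennreal (normal_density 0 (sqrt h) t)"]) auto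
  also have "(\<integral>\<^sup>+t. ennreal (normal_density 0 (sqrt h) t) \<partial>lborel) = 1"
    using prob_space.emeasure_space_1[OF prob_space_normal_density[of "sqrt h" 0]] h
    by (simp add: emeasure_density)
  finally show "emeasure (gaussian_law h :: 'm measure) (space (gaussian_law h)) = 1" by simp
qed

lemma integrable_gaussian_law:
  fixes h :: real
  assumes h: "h > 0"
  shows "integrable (gaussian_law h :: 'm::euclidean_space measure) (\<lambda>y. (1 + norm y / sqrt h)^N)"
    and "(\<integral>y. (1 + norm y / sqrt h)^N \<partial>(gaussian_law h :: 'm::euclidean_space measure)) \<le> gauss_moment TYPE('m) N"
proof -
  have m: "(\<lambda>y::'m. (1 + norm y / sqrt h)^N) \<in> borel_measurable (gaussian_law h)" by measurable
  show i: "integrable (gaussian_law h :: 'm measure) (\<lambda>y. (1 + norm y / sqrt h)^N)"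
    using nn_integral_gaussian_law_le[OF h, of N, where 'm='m] m h
    by (intro integrableI_nonneg) (auto simp: less_top[symmetric] top_unique dest!: neq_top_trans[rotated] )
  have "ennreal (\<integral>y. (1 + norm y / sqrt h)^N \<partial>(gaussian_law h :: 'm measure)) \<le> ennreal (gauss_moment TYPE('m) N)"
    using nn_integral_gaussian_law_le[OF h, of N, where 'm='m] i h by (subst nn_integral_eq_integral[symmetric]) auto
  then show "(\<integral>y. (1 + norm y / sqrt h)^N \<partial>(gaussian_law h :: 'm measure)) \<le> gauss_moment TYPE('m) N"
    by (subst (asm) ennreal_le_iff) (auto simp: gauss_moment_def integral_nonneg_AE)
qed

text \<open>Reflection y -> -y. The vanishing mean removes the term of order sqrt h from the
  Gaussian step.\<close>

lemma gaussian_law_symmetric: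
  fixes v :: "'m::euclidean_space"
  assumes h: "h > 0"
  shows "integrable (gaussian_law h) (\<lambda>y. v \<bullet> y)" "(\<integral>y. v \<bullet> y \<partial>gaussian_law h) = 0"
proof -
  show i: "integrable (gaussian_law h) (\<lambda>y. v \<bullet> y)"
  proof (rule Bochner_Integration.integrable_bound)
    show "integrable (gaussian_law h :: 'm measure) (\<lambda>y. (norm v * sqrt h) * (1 + norm y / sqrt h)^1)"
      by (intro integrable_mult_right integrable_gaussian_law h)
    show "AE y in gaussian_law h. norm (v \<bullet> y) \<le> norm ((norm v * sqrt h) * (1 + norm y / sqrt h)^1)"
    proof (rule AE_I2)
      fix y :: 'm
      have "norm (v \<bullet> y) \<le> norm v * norm y" using Cauchy_Schwarz_ineq2[of v y] by simp
      also have "\<dots> \<le> (norm v * sqrt h) * (1 + norm y / sqrt h)^1"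
        using h by (simp add: field_simps)
      finally show "norm (v \<bullet> y) \<le> norm ((norm v * sqrt h) * (1 + norm y / sqrt h)^1)" by (simp add: abs_le_iff)
    qed
  qed measurable
  define g where "g y = (\<Prod>b\<in>Basis. normal_density 0 (sqrt h) (y \<bullet> b))" for y :: 'm
  have [measurable]: "g \<in> borel_measurable borel" unfolding g_def by measurable
  have g: "g (- y) = g y" "g y \<ge> 0" for y unfolding g_def by (auto simp: normal_density_def intro: prod_nonneg)
  have lb: "(lborel :: 'm measure) = distr lborel borel uminus"
    using lborel_affine[of "-1" "0::'m"] by (simp add: density_1 one_ennreal_def[symmetric])
  have "(\<integral>y. v \<bullet> y \<partial>gaussian_law h) = (\<integral>y. g y *\<^sub>R (v \<bullet> y) \<partial>lborel)"
    unfolding gaussian_law_def g_def[symmetric] by (subst integral_density) (auto simp: g)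
  also have "\<dots> = (\<integral>y. g y *\<^sub>R (v \<bullet> y) \<partial>(distr lborel borel uminus))" by (subst lb) simp
  also have "\<dots> = (\<integral>y. g (-y) *\<^sub>R (v \<bullet> (-y)) \<partial>lborel)" by (subst integral_distr) auto
  also have "\<dots> = - (\<integral>y. g y *\<^sub>R (v \<bullet> y) \<partial>lborel)" by (simp add: g)
  also have "(\<integral>y. g y *\<^sub>R (v \<bullet> y) \<partial>lborel) = (\<integral>y. v \<bullet> y \<partial>gaussian_law h)"
    unfolding gaussian_law_def g_def[symmetric] by (subst integral_density) (auto simp: g)
  finally show "(\<integral>y. v \<bullet> y \<partial>gaussian_law h) = 0" by simp
qed


text \<open>The part 2p comes from |G y|^2 in |z + G y + h a|^2, with a factor 2 for separating G y
  from h a. The part 8p^2 comes from the square of the linear term 2 <z, G y>, with a factor 2 for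
  separating it from the terms of order h. The moment averages (1 + |y| / sqrt h)^2.\<close>

definition step_const :: "'m::euclidean_space itself \<Rightarrow> nat \<Rightarrow> real" where
  "step_const T p = (2 * real p + 8 * (real p)\<^sup>2) * gauss_moment T 2"

text \<open>Bounds the growth rate of \<open>(e + |z|\<^sup>2)^p\<close> under the infinitesimal step \<open>dz = G dB + a dt\<close>.\<close>

definition growth_rate :: "nat \<Rightarrow> real \<Rightarrow> 'n::real_inner \<Rightarrow> ('m::euclidean_space \<Rightarrow>\<^sub>L 'n) \<Rightarrow> 'n \<Rightarrow> real" where
  "growth_rate p e z G a =
     (2 * real p * (z \<bullet> a) + step_const TYPE('m) p * (norm G)\<^sup>2) / (e + (norm z)\<^sup>2)"

text \<open>Relative to u = e + |z|^2 one step multiplies by 1 + b + w, where b is linear in y and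
  of order sqrt h and w is of order h. In the expansion of (1 + b + w)^p the term b integrates to
  zero, the terms of order h are bounded by \<open>growth_rate\<close>, and all others are of order
  h^(3/2). The bound K enters only the constant of the last group.\<close>

lemma gaussian_step:
  fixes e K :: real and p :: nat
  assumes e: "e > 0" and K: "K \<ge> 0"
  shows "\<exists>C\<ge>0. \<forall>h (G :: 'm::euclidean_space \<Rightarrow>\<^sub>L 'n::euclidean_space) z a.
    0 < h \<longrightarrow> h \<le> 1 \<longrightarrow> norm G \<le> K \<longrightarrow> norm a \<le> K \<longrightarrow>
    (\<integral>\<^sup>+y. ennreal ((e + (norm (z + blinfun_apply G y + h *\<^sub>R a))\<^sup>2)^p) \<partial>gaussian_law h)
      \<le> ennreal ((e + (norm z)\<^sup>2)^p * (1 + h * growth_rate p e z G a + C * (h * sqrt h)))"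
proof -
  \<comment> \<open>Since u >= e and u >= |z|^2, \<open>Q\<close> bounds |z| / u and its square
    bounds 1 / u.\<close>
  define Q where "Q = 1 / sqrt e"
  have Q: "Q \<ge> 0" "Q^2 = 1 / e" using e by (auto simp: Q_def power_divide)
  \<comment> \<open>With R = 1 + |y| / sqrt h these are the constants in |w| <= \<open>C1\<close> h
    R^2 and |b + w| <= \<open>C2\<close> sqrt h R^2.\<close>
  define C1 where "C1 = 2 * Q * K + Q^2 * K^2"
  define C2 where "C2 = 4 * Q * K + Q^2 * K^2"
  have C12: "C1 \<ge> 0" "C2 \<ge> 0" using Q(1) K by (auto simp: C1_def C2_def)
  define C3 where "C3 = 2 * real p * K^2 * Q^2 + 2 * (real p)^2 * C1^2 + (real p)^3 * C2^3 * (1 + C2)^p"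
  have C3: "C3 \<ge> 0" using C12 K by (auto simp: C3_def)
  define P where "P = (2 * real p + 8 * (real p)\<^sup>2)"
  have P0: "P \<ge> 0" by (auto simp: P_def)
  have gm: "gauss_moment TYPE('m) N \<ge> 0" for N
    by (auto simp: gauss_moment_def integral_nonneg_AE)
  show ?thesis
  \<comment> \<open>The cubic remainder contains (R^2)^3 and (R^2)^p, hence the moment of order 2p +
    6; the other error terms have lower powers of R.\<close>
  proof (intro exI[of _ "C3 * gauss_moment TYPE('m) (2*p+6)"] conjI allI impI)
    show "0 \<le> C3 * gauss_moment TYPE('m) (2*p+6)" using C3 gm by simp
    fix h :: real and G :: "'m \<Rightarrow>\<^sub>L 'n" and z a :: 'n
    assume h: "0 < h" "h \<le> 1" and G: "norm G \<le> K" and a: "norm a \<le> K"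
    define s where "s = sqrt h"
    have s: "0 < s" "s \<le> 1" "s^2 = h" using h by (auto simp: s_def)
    have hs: "h \<le> s" using s by (metis mult_left_le power2_eq_square less_imp_le)
    define u where "u = e + (norm z)\<^sup>2"
    have u: "u \<ge> e" "u > 0" "(norm z)\<^sup>2 \<le> u" using e by (auto simp: u_def add_pos_nonneg)
    have iu: "1 / u \<le> Q^2" using u e Q by (simp add: frac_le)
    have zu: "norm z / u \<le> Q"
    proof -
      have "(norm z / u)^2 = ((norm z)^2 / u) * (1 / u)" using u by (simp add: power_divide power2_eq_square)
      also have "\<dots> \<le> 1 * Q^2" using u iu by (intro mult_mono) auto
      finally have "(norm z / u)^2 \<le> Q^2" by simp
      then show ?thesis using Q(1) by (rule power2_le_imp_le)
    qed
    define r where "r y = norm y / s" for y :: 'm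
    define b where "b y = (2 * (z \<bullet> blinfun_apply G y)) / u" for y
    define k where "k y = blinfun_apply G y + h *\<^sub>R a" for y
    define w where "w y = (2 * h * (z \<bullet> a) + (norm (k y))\<^sup>2) / u" for y
    define D where "D = h * (2 * real p * (z \<bullet> a)) / u"
    define bd where "bd y = 1 + real p * b y + D + P * h * (norm G)\<^sup>2 / u * (1 + r y)^2
       + (s^3 * C3) * (1 + r y)^(2*p+6)" for y
    have main: "(e + (norm (z + blinfun_apply G y + h *\<^sub>R a))\<^sup>2)^p \<le> u^p * bd y" for y
    proof -
      have r0: "r y \<ge> 0" and ny: "norm y = s * r y" using s by (auto simp: r_def)
      define R where "R = 1 + r y"
      have R: "R \<ge> 1" "r y \<le> R" using r0 by (auto simp: R_def)
      have Gy: "norm (blinfun_apply G y) \<le> norm G * (s * r y)" using norm_blinfun[of G y] ny by simp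
      have Gy': "norm (blinfun_apply G y) \<le> K * (s * r y)"
        by (rule order_trans[OF Gy mult_right_mono[OF G]]) (use r0 s in simp)
      have "norm (k y) \<le> norm (blinfun_apply G y) + norm (h *\<^sub>R a)" unfolding k_def by (rule norm_triangle_ineq)
      also have "\<dots> \<le> K * (s * r y) + s * K"
        using Gy' a h hs K by (intro add_mono) (auto intro: mult_mono)
      finally have k1: "norm (k y) \<le> K * s * R" by (simp add: R_def algebra_simps)
      have k1': "(norm (k y))\<^sup>2 \<le> K^2 * h * R^2"
        using power_mono[OF k1, of 2] s by (simp add: power_mult_distrib)
      have k2: "(norm (k y))\<^sup>2 \<le> 2 * (norm G)\<^sup>2 * h * (r y)^2 + 2 * h^2 * K^2"
      proof -
        have "(norm (k y))\<^sup>2 \<le> (norm (blinfun_apply G y) + norm (h *\<^sub>R a))\<^sup>2"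
          unfolding k_def by (intro power_mono norm_triangle_ineq) auto
        also have "\<dots> \<le> 2 * (norm (blinfun_apply G y))\<^sup>2 + 2 * (norm (h *\<^sub>R a))\<^sup>2"
          using sum_squares_bound[of "norm (blinfun_apply G y)" "norm (h *\<^sub>R a)"] by (simp add: power2_sum)
        also have "\<dots> \<le> 2 * (norm G * (s * r y))\<^sup>2 + 2 * (h * K)\<^sup>2"
          using Gy a h K by (intro add_mono mult_left_mono power_mono) auto
        finally show ?thesis using s by (simp add: power_mult_distrib algebra_simps)
      qed
      have zGy: "\<bar>z \<bullet> blinfun_apply G y\<bar> \<le> norm z * (norm G * (s * r y))"
        using Cauchy_Schwarz_ineq2[of z "blinfun_apply G y"] mult_left_mono[OF Gy, of "norm z"] by simp
      have b1: "\<bar>b y\<bar> \<le> 2 * Q * K * s * R^2"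
      proof -
        have "\<bar>b y\<bar> = 2 * \<bar>z \<bullet> blinfun_apply G y\<bar> / u" using u by (simp add: b_def abs_mult)
        also have "\<dots> \<le> 2 * (norm z * (norm G * (s * r y))) / u"
          using zGy u by (intro divide_right_mono mult_left_mono) auto
        also have "\<dots> = 2 * ((norm z / u) * (norm G * (s * r y)))" by simp
        also have "\<dots> \<le> 2 * (Q * (K * (s * R)))"
          using zu G s R r0 Q K by (intro mult_left_mono mult_mono) auto
        also have "\<dots> \<le> 2 * (Q * (K * (s * R^2)))"
          using R Q K s by (intro mult_left_mono) (auto simp: power2_eq_square)
        finally show ?thesis by (simp add: mult_ac)
      qed
      have b2: "(b y)^2 \<le> 4 * (norm G)^2 * h * (r y)^2 / u"
      proof -
        have "(b y)^2 = 4 * \<bar>z \<bullet> blinfun_apply G y\<bar>^2 / u^2" by (simp add: b_def power_divide power_mult_distrib)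
        also have "\<dots> \<le> 4 * (norm z * (norm G * (s * r y)))^2 / u^2"
          using zGy by (intro divide_right_mono mult_left_mono power_mono) auto
        also have "\<dots> = 4 * ((norm z)^2 / u) * ((norm G)^2 * h * (r y)^2) / u"
          using s by (simp add: power_mult_distrib power2_eq_square[of u] mult_ac)
        also have "\<dots> \<le> 4 * 1 * ((norm G)^2 * h * (r y)^2) / u"
          using u h by (intro divide_right_mono mult_right_mono mult_left_mono) auto
        finally show ?thesis by simp
      qed
      have R2: "R^2 \<ge> 1" using R by simp
      have w1: "\<bar>w y\<bar> \<le> C1 * h * R^2"
      proof -
        have za: "\<bar>z \<bullet> a\<bar> \<le> norm z * K"
          using Cauchy_Schwarz_ineq2[of z a] mult_left_mono[OF a, of "norm z"] by simp
        have "\<bar>w y\<bar> = \<bar>2 * h * (z \<bullet> a) + (norm (k y))\<^sup>2\<bar> / u" using u by (simp add: w_def)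
        also have "\<dots> \<le> (2 * h * (norm z * K) + K^2 * h * R^2) / u"
        proof (intro divide_right_mono order_trans[OF abs_triangle_ineq] add_mono)
          show "\<bar>2 * h * (z \<bullet> a)\<bar> \<le> 2 * h * (norm z * K)" using h za by (simp add: abs_mult)
        qed (use k1' u in auto)
        also have "\<dots> = 2 * h * ((norm z / u) * K) + K^2 * h * R^2 * (1 / u)" by (simp add: add_divide_distrib)
        also have "\<dots> \<le> 2 * h * (Q * K) + K^2 * h * R^2 * Q^2"
          using h zu K iu R by (intro add_mono mult_left_mono mult_right_mono) auto
        also have "\<dots> \<le> 2 * h * (Q * K) * R^2 + K^2 * h * R^2 * Q^2"
          using h Q K R2 mult_left_mono[OF R2, of "2 * h * (Q * K)"] by simp
        finally show ?thesis by (simp add: C1_def algebra_simps)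
      qed
      have w2: "\<bar>w y\<bar> \<le> C1 * s * R^2"
      proof -
        have "C1 * h * R^2 \<le> C1 * s * R^2"
          using hs C12 by (intro mult_left_mono mult_right_mono) auto
        then show ?thesis using w1 by linarith
      qed
      have sg: "\<bar>b y + w y\<bar> \<le> s * C2 * R^2"
      proof -
        have "\<bar>b y + w y\<bar> \<le> 2 * Q * K * s * R^2 + C1 * s * R^2" using b1 w2 abs_triangle_ineq[of "b y" "w y"] by linarith
        then show ?thesis by (simp add: C1_def C2_def algebra_simps)
      qed
      have eq: "e + (norm (z + blinfun_apply G y + h *\<^sub>R a))\<^sup>2 = u * (1 + (b y + w y))"
      proof -
        have "(norm (z + k y))\<^sup>2 = (norm z)\<^sup>2 + 2 * (z \<bullet> k y) + (norm (k y))\<^sup>2"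
          by (simp add: power2_norm_eq_inner inner_add_left inner_add_right inner_commute)
        also have "z \<bullet> k y = z \<bullet> blinfun_apply G y + h * (z \<bullet> a)" by (simp add: k_def inner_add_right)
        finally have "e + (norm (z + k y))\<^sup>2 = u + u * b y + u * w y"
          using u by (simp add: u_def[symmetric] b_def w_def)
        then show ?thesis by (simp add: k_def add.assoc algebra_simps)
      qed
      have ge: "b y + w y \<ge> -1"
      proof -
        have "0 \<le> u * (1 + (b y + w y))" unfolding eq[symmetric] using e by simp
        then show ?thesis using u by (simp add: zero_le_mult_iff)
      qed
      have "(1 + (b y + w y))^p \<le> 1 + real p * (b y + w y) + (real p)\<^sup>2 * (b y + w y)\<^sup>2
          + (real p)^3 * \<bar>b y + w y\<bar>^3 * (1 + \<bar>b y + w y\<bar>)^p"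
        by (rule one_plus_power_le_cubic[OF ge])
      also have "\<dots> \<le> 1 + real p * (b y + w y) + (real p)\<^sup>2 * (8 * (norm G)^2 * h * (r y)^2 / u + 2 * C1^2 * h^2 * R^4)
          + (real p)^3 * (s * C2 * R^2)^3 * ((1 + C2) * R^2)^p"
      proof (rule add_mono[OF add_mono[OF order_refl]])
        have "(b y + w y)^2 \<le> 2 * (b y)^2 + 2 * (w y)^2"
          using sum_squares_bound[of "b y" "w y"] by (simp add: power2_sum)
        also have "(w y)^2 \<le> (C1 * h * R^2)^2" using power_mono[OF w1, of 2] by simp
        also have "(C1 * h * R^2)^2 = C1^2 * h^2 * R^4" by (simp add: power_mult_distrib flip: power_mult)
        finally have "(b y + w y)^2 \<le> 8 * (norm G)^2 * h * (r y)^2 / u + 2 * C1^2 * h^2 * R^4" using b2 by simp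
        then show "(real p)\<^sup>2 * (b y + w y)\<^sup>2 \<le> (real p)\<^sup>2 * (8 * (norm G)^2 * h * (r y)^2 / u + 2 * C1^2 * h^2 * R^4)"
          by (intro mult_left_mono) auto
        have "s * C2 * R^2 \<le> C2 * R^2" using s C12 by (simp add: mult_right_mono mult_left_le_one_le)
        then have "1 + \<bar>b y + w y\<bar> \<le> (1 + C2) * R^2" using sg R2 by (simp add: algebra_simps)
        then show "(real p)^3 * \<bar>b y + w y\<bar>^3 * (1 + \<bar>b y + w y\<bar>)^p \<le> (real p)^3 * (s * C2 * R^2)^3 * ((1 + C2) * R^2)^p"
          using sg s C12 by (intro mult_mono mult_left_mono power_mono) auto
      qed
      also have "real p * (b y + w y) \<le> real p * (b y) + D + real p * (2 * (norm G)\<^sup>2 * h * (r y)^2 / u + 2 * h^2 * K^2 * Q^2)"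
      proof -
        have "w y \<le> (2 * h * (z \<bullet> a) + (2 * (norm G)\<^sup>2 * h * (r y)^2 + 2 * h^2 * K^2)) / u"
          unfolding w_def using k2 u by (intro divide_right_mono add_left_mono) auto
        also have "\<dots> = 2 * h * (z \<bullet> a) / u + 2 * (norm G)\<^sup>2 * h * (r y)^2 / u + 2 * h^2 * K^2 * (1 / u)"
          by (simp add: add_divide_distrib)
        also have "\<dots> \<le> 2 * h * (z \<bullet> a) / u + 2 * (norm G)\<^sup>2 * h * (r y)^2 / u + 2 * h^2 * K^2 * Q^2"
          using iu h by (intro add_left_mono mult_left_mono) auto
        finally have "real p * w y \<le> real p * (2 * h * (z \<bullet> a) / u + 2 * (norm G)\<^sup>2 * h * (r y)^2 / u + 2 * h^2 * K^2 * Q^2)"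
          by (intro mult_left_mono) auto
        also have "\<dots> = D + real p * (2 * (norm G)\<^sup>2 * h * (r y)^2 / u + 2 * h^2 * K^2 * Q^2)"
          by (simp add: D_def algebra_simps)
        finally show ?thesis by (simp add: algebra_simps)
      qed
      also have "1 + (real p * (b y) + D + real p * (2 * (norm G)\<^sup>2 * h * (r y)^2 / u + 2 * h^2 * K^2 * Q^2))
          + (real p)\<^sup>2 * (8 * (norm G)^2 * h * (r y)^2 / u + 2 * C1^2 * h^2 * R^4)
          + (real p)^3 * (s * C2 * R^2)^3 * ((1 + C2) * R^2)^p
        = 1 + real p * b y + D + P * h * (norm G)\<^sup>2 / u * (r y)^2
          + (2 * real p * K^2 * Q^2 * h^2 + 2 * (real p)^2 * C1^2 * h^2 * R^4 + (real p)^3 * C2^3 * (1 + C2)^p * s^3 * (R^6 * R^(2*p)))"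
      proof -
        have e1: "((1 + C2) * R^2)^p = (1 + C2)^p * R^(2*p)" by (simp only: power_mult_distrib power_mult)
        have e2: "(s * C2 * R^2)^3 = s^3 * C2^3 * R^6" by (simp add: power_mult_distrib flip: power_mult)
        show ?thesis unfolding e1 e2 by (simp add: P_def add_divide_distrib algebra_simps)
      qed
      also have "\<dots> \<le> 1 + real p * b y + D + P * h * (norm G)\<^sup>2 / u * R^2
          + (2 * real p * K^2 * Q^2 * s^3 * R^(2*p+6) + 2 * (real p)^2 * C1^2 * s^3 * R^(2*p+6)
            + (real p)^3 * C2^3 * (1 + C2)^p * s^3 * R^(2*p+6))"
      proof -
        have h2: "h^2 \<le> s^3"
        proof -
          have "h^2 = s^3 * s" using s by (simp add: power2_eq_square power3_eq_cube flip: s(3))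
          then show ?thesis using s by (simp add: mult_left_le)
        qed
        have "P * h * (norm G)\<^sup>2 / u * (r y)^2 \<le> P * h * (norm G)\<^sup>2 / u * R^2"
          using r0 R P0 h u by (intro mult_left_mono power_mono) auto
        moreover have "2 * real p * K^2 * Q^2 * h^2 \<le> 2 * real p * K^2 * Q^2 * s^3 * R^(2*p+6)"
        proof -
          have "2 * real p * K^2 * Q^2 * h^2 * 1 \<le> 2 * real p * K^2 * Q^2 * s^3 * R^(2*p+6)"
            using h2 R s by (intro mult_mono mult_left_mono one_le_power) auto
          then show ?thesis by simp
        qed
        moreover have "2 * (real p)^2 * C1^2 * h^2 * R^4 \<le> 2 * (real p)^2 * C1^2 * s^3 * R^(2*p+6)"
          using h2 R s by (intro mult_mono mult_left_mono power_increasing) auto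
        ultimately show ?thesis by (simp add: power_add mult_ac)
      qed
      also have "\<dots> = bd y" unfolding bd_def C3_def R_def by (simp add: algebra_simps)
      finally have "(1 + (b y + w y))^p \<le> bd y" by simp
      then show ?thesis unfolding eq power_mult_distrib using u by (intro mult_left_mono) auto
    qed
    interpret N: prob_space "gaussian_law h :: 'm measure" by (rule prob_space_gaussian_law[OF h(1)])
    have r_eq: "1 + r y = 1 + norm y / sqrt h" for y by (simp add: r_def s_def)
    have ib: "integrable (gaussian_law h) b" "(\<integral>y. b y \<partial>gaussian_law h) = 0"
    proof -
      \<comment> \<open>The vector representing the linear functional \<open>b\<close>, so that the
        symmetry of the Gaussian law applies to it.\<close>
      define v where "v = (\<Sum>i\<in>Basis. (2 * (z \<bullet> blinfun_apply G i) / u) *\<^sub>R i)"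
      have "b y = v \<bullet> y" for y
      proof -
        have "z \<bullet> blinfun_apply G y = z \<bullet> blinfun_apply G (\<Sum>i\<in>Basis. (y \<bullet> i) *\<^sub>R i)" by (simp add: euclidean_representation)
        also have "\<dots> = (\<Sum>i\<in>Basis. (y \<bullet> i) * (z \<bullet> blinfun_apply G i))"
          by (simp add: blinfun.sum_right blinfun.scaleR_right inner_sum_right)
        finally show ?thesis unfolding b_def v_def inner_sum_left inner_scaleR_left
          by (simp add: sum_divide_distrib sum_distrib_left inner_commute[of y] mult_ac)
      qed
      then have "b = (\<lambda>y. v \<bullet> y)" by auto
      then show "integrable (gaussian_law h) b" "(\<integral>y. b y \<partial>gaussian_law h) = 0"
        using gaussian_law_symmetric[OF h(1), of v] by auto
    qed
    note ir = integrable_gaussian_law[OF h(1), where 'm='m]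
    have ibd: "integrable (gaussian_law h) bd"
      unfolding bd_def r_eq using ib ir
      by (intro Bochner_Integration.integrable_add integrable_mult_right N.integrable_const) auto
    have "(\<integral>y. bd y \<partial>gaussian_law h) = 1 + D + P * h * (norm G)\<^sup>2 / u * (\<integral>y. (1 + norm y / sqrt h)^2 \<partial>(gaussian_law h :: 'm measure))
       + (s^3 * C3) * (\<integral>y. (1 + norm y / sqrt h)^(2*p+6) \<partial>(gaussian_law h :: 'm measure))"
      unfolding bd_def r_eq using ib ir N.prob_space by simp
    also have "\<dots> \<le> 1 + D + P * h * (norm G)\<^sup>2 / u * gauss_moment TYPE('m) 2 + (s^3 * C3) * gauss_moment TYPE('m) (2*p+6)"
      using ir u h P0 s C3 by (intro add_mono mult_left_mono order_refl) auto
    also have "\<dots> = 1 + h * growth_rate p e z G a + C3 * gauss_moment TYPE('m) (2*p+6) * (h * sqrt h)"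
      using u s unfolding growth_rate_def step_const_def u_def[symmetric] P_def[symmetric] D_def s_def[symmetric] s(3)[symmetric]
      by (simp add: field_simps power2_eq_square power3_eq_cube)
    finally have I: "(\<integral>y. bd y \<partial>gaussian_law h) \<le> 1 + h * growth_rate p e z G a + C3 * gauss_moment TYPE('m) (2*p+6) * (h * sqrt h)" .
    have bd0: "bd y \<ge> 0" for y
    proof -
      have "0 \<le> u^p * bd y" using main[of y] e by (meson order_trans zero_le_power add_nonneg_nonneg zero_le_power2 less_imp_le)
      then show ?thesis using zero_less_power[OF u(2), of p] by (auto simp: zero_le_mult_iff)
    qed
    have "(\<integral>\<^sup>+y. ennreal ((e + (norm (z + blinfun_apply G y + h *\<^sub>R a))\<^sup>2)^p) \<partial>gaussian_law h)
      \<le> (\<integral>\<^sup>+y. ennreal (u^p * bd y) \<partial>gaussian_law h)"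
      by (intro nn_integral_mono ennreal_leI main)
    also have "\<dots> = ennreal (\<integral>y. u^p * bd y \<partial>gaussian_law h)"
      using ibd bd0 u by (intro nn_integral_eq_integral) auto
    also have "\<dots> = ennreal (u^p * (\<integral>y. bd y \<partial>gaussian_law h))" by simp
    also have "\<dots> \<le> ennreal (u^p * (1 + h * growth_rate p e z G a + C3 * gauss_moment TYPE('m) (2*p+6) * (h * sqrt h)))"
      using I u by (intro ennreal_leI mult_left_mono) auto
    finally show "(\<integral>\<^sup>+y. ennreal ((e + (norm (z + blinfun_apply G y + h *\<^sub>R a))\<^sup>2)^p) \<partial>gaussian_law h)
      \<le> ennreal ((e + (norm z)\<^sup>2)^p * (1 + h * growth_rate p e z G a + C3 * gauss_moment TYPE('m) (2*p+6) * (h * sqrt h)))"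
      unfolding u_def .
  qed
qed

text \<open>The growth must become a factor that a discount can cancel exactly, whatever its size;
  the additive error then has to be made multiplicative as well.\<close>

lemma gaussian_step_exp:
  fixes e K :: real and p :: nat
  assumes e: "e > 0" and K: "K \<ge> 0"
  shows "\<exists>C\<ge>0. \<forall>h (G :: 'm::euclidean_space \<Rightarrow>\<^sub>L 'n::euclidean_space) z a.
    0 < h \<longrightarrow> h \<le> 1 \<longrightarrow> norm G \<le> K \<longrightarrow> norm a \<le> K \<longrightarrow>
    (\<integral>\<^sup>+y. ennreal ((e + (norm (z + blinfun_apply G y + h *\<^sub>R a))\<^sup>2)^p) \<partial>gaussian_law h)
      \<le> ennreal ((e + (norm z)\<^sup>2)^p * exp (h * growth_rate p e z G a) * (1 + C * (h * sqrt h)))"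
proof -
  obtain C where C: "C \<ge> 0" and step: "\<And>h (G :: 'm \<Rightarrow>\<^sub>L 'n) z a.
    0 < h \<Longrightarrow> h \<le> 1 \<Longrightarrow> norm G \<le> K \<Longrightarrow> norm a \<le> K \<Longrightarrow>
    (\<integral>\<^sup>+y. ennreal ((e + (norm (z + blinfun_apply G y + h *\<^sub>R a))\<^sup>2)^p) \<partial>gaussian_law h)
      \<le> ennreal ((e + (norm z)\<^sup>2)^p * (1 + h * growth_rate p e z G a + C * (h * sqrt h)))"
    using gaussian_step[OF e K, of p, where 'm='m and 'n='n] by blast
  have sc: "step_const TYPE('m) p \<ge> 0"
    by (auto simp: step_const_def gauss_moment_def integral_nonneg_AE)
  \<comment> \<open>The rate is bounded below by \<open>- l\<close>, uniformly in z, because 2|z| <=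
    1 + |z|^2. Hence exp of h times the rate is at least exp (- l), and the additive error is at
    most exp l times a multiple of that exponential.\<close>
  define l where "l = real p * K * (1 + 1 / e)"
  have l0: "l \<ge> 0" using e K by (simp add: l_def)
  have lower: "growth_rate p e z G a \<ge> - l" if a: "norm a \<le> K" for z a :: 'n and G :: "'m \<Rightarrow>\<^sub>L 'n"
  proof -
    define u where "u = e + (norm z)^2"
    have u: "u > 0" "e \<le> u" using e by (auto simp: u_def add_pos_nonneg)
    have "- (z \<bullet> a) \<le> norm z * norm a" using norm_cauchy_schwarz[of z "-a"] by simp
    also have "\<dots> \<le> norm z * K" using a by (intro mult_left_mono) auto
    finally have za: "- (z \<bullet> a) \<le> norm z * K" .
    have nz: "2 * norm z \<le> 1 + (norm z)^2" using sum_squares_bound[of "norm z" 1] by simp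
    have "- growth_rate p e z G a = (2 * real p * (- (z \<bullet> a)) - step_const TYPE('m) p * (norm G)\<^sup>2) / u"
      unfolding growth_rate_def u_def[symmetric] minus_divide_left by (simp add: algebra_simps)
    also have "\<dots> \<le> (2 * real p * (norm z * K) - 0) / u"
      using za u sc by (intro divide_right_mono diff_mono mult_left_mono) auto
    also have "\<dots> = real p * K * (2 * norm z / u)" by simp
    also have "\<dots> \<le> real p * K * (1 + 1 / e)"
    proof (intro mult_left_mono)
      have "2 * norm z / u \<le> (1 + (norm z)^2) / u" using nz u by (intro divide_right_mono) auto
      also have "\<dots> = (norm z)^2 / u + 1 / u" by (simp add: add_divide_distrib)
      also have "\<dots> \<le> 1 + 1 / e" using u e by (intro add_mono) (auto simp: u_def frac_le divide_le_eq)
      finally show "2 * norm z / u \<le> 1 + 1 / e" .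
    qed (use K in auto)
    finally show ?thesis by (simp add: l_def)
  qed
  show ?thesis
  proof (intro exI[of _ "C * exp l"] conjI allI impI)
    show "0 \<le> C * exp l" using C by simp
    fix h :: real and G :: "'m \<Rightarrow>\<^sub>L 'n" and z a :: 'n
    assume h: "0 < h" "h \<le> 1" and G: "norm G \<le> K" and a: "norm a \<le> K"
    define x where "x = h * growth_rate p e z G a"
    have "- l \<le> x"
    proof -
      have "- x \<le> h * l" using mult_left_mono[OF lower[OF a, of z G], of h] h by (simp add: x_def)
      also have "\<dots> \<le> 1 * l" using h l0 by (intro mult_right_mono) auto
      finally show ?thesis by simp
    qed
    then have "1 \<le> exp x * exp l" by (simp flip: exp_add)
    then have "C * (h * sqrt h) \<le> (exp x * exp l) * (C * (h * sqrt h))"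
      using C h mult_right_mono[of 1 "exp x * exp l" "C * (h * sqrt h)"] by simp
    then have "1 + x + C * (h * sqrt h) \<le> exp x + (exp x * exp l) * (C * (h * sqrt h))"
      using exp_ge_add_one_self[of x] by linarith
    then have *: "1 + x + C * (h * sqrt h) \<le> exp x * (1 + C * exp l * (h * sqrt h))" by (simp add: algebra_simps)
    have "(\<integral>\<^sup>+y. ennreal ((e + (norm (z + blinfun_apply G y + h *\<^sub>R a))\<^sup>2)^p) \<partial>gaussian_law h)
      \<le> ennreal ((e + (norm z)\<^sup>2)^p * (1 + x + C * (h * sqrt h)))"
      unfolding x_def by (rule step[OF h G a])
    also have "\<dots> \<le> ennreal ((e + (norm z)\<^sup>2)^p * (exp x * (1 + C * exp l * (h * sqrt h))))"
      using * e by (intro ennreal_leI mult_left_mono) auto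
    finally show "(\<integral>\<^sup>+y. ennreal ((e + (norm (z + blinfun_apply G y + h *\<^sub>R a))\<^sup>2)^p) \<partial>gaussian_law h)
      \<le> ennreal ((e + (norm z)\<^sup>2)^p * exp (h * growth_rate p e z G a) * (1 + C * exp l * (h * sqrt h)))"
      by (simp add: x_def mult.assoc)
  qed
qed

section \<open>The maximal inequality for discrete schemes\<close>

locale brownian_setting = prob_space M for M :: "'w measure" +
  fixes \<F> :: "real \<Rightarrow> 'w measure" and B :: "real \<Rightarrow> 'w \<Rightarrow> 'm::euclidean_space"
  assumes usual: "usual_conditions M \<F>" and bm: "brownian_motion M \<F> B"
begin

lemma space_F[simp]: "space (\<F> t) = space M"
  using usual by (auto simp: usual_conditions_def filtration_def)

lemma sets_F_mono: "s \<le> t \<Longrightarrow> sets (\<F> s) \<subseteq> sets (\<F> t)"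
  using usual by (auto simp: usual_conditions_def filtration_def)

lemma sets_F: "sets (\<F> t) \<subseteq> sets M"
  using usual by (auto simp: usual_conditions_def subalgebra_def)

lemma measurable_F_mono: "f \<in> measurable (\<F> s) N \<Longrightarrow> s \<le> t \<Longrightarrow> f \<in> measurable (\<F> t) N"
  using sets_F_mono[of s t] by (auto simp: measurable_def)

lemma measurable_F: "f \<in> measurable (\<F> s) N \<Longrightarrow> f \<in> measurable M N"
  using sets_F[of s] by (auto simp: measurable_def)

lemma null_sets_F:
  assumes "N \<in> null_sets M" "S \<subseteq> N" "t \<ge> 0"
  shows "S \<in> sets (\<F> t)"
  using assms usual sets_F_mono[of 0 t] unfolding usual_conditions_def by blast

lemma B_measurable: "t \<ge> 0 \<Longrightarrow> B t \<in> borel_measurable (\<F> t)"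
  using bm by (auto simp: brownian_motion_def)

lemma B_continuous: "AE \<omega> in M. continuous_on {0..} (\<lambda>t. B t \<omega>)"
  using bm by (auto simp: brownian_motion_def)

text \<open>Plays the role of conditioning on \<open>\<F> s\<close>. By independence the pair of
  \<open>\<omega>\<close>, seen through \<open>\<F> s\<close>, and the increment has a product law,
  so the increment can be integrated first with \<open>\<omega>\<close> frozen.\<close>

lemma nn_integral_increment:
  assumes s: "0 \<le> s" "s < t" and f[measurable]: "f \<in> borel_measurable (\<F> s \<Otimes>\<^sub>M borel)"
  shows "(\<integral>\<^sup>+\<omega>. f (\<omega>, B t \<omega> - B s \<omega>) \<partial>M) = (\<integral>\<^sup>+\<omega>. (\<integral>\<^sup>+y. f (\<omega>, y) \<partial>gaussian_law (t - s)) \<partial>M)"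
proof -
  define D where "D \<omega> = B t \<omega> - B s \<omega>" for \<omega>
  have [measurable]: "B t \<in> borel_measurable M" "B s \<in> borel_measurable M"
    using s by (auto intro!: measurable_F[OF B_measurable])
  have [measurable]: "D \<in> borel_measurable M" unfolding D_def by measurable
  have id[measurable]: "(\<lambda>\<omega>. \<omega>) \<in> measurable M (\<F> s)"
    using sets_F[of s] by (intro measurableI) (auto simp: Int_absorb2 dest: sets.sets_into_space subsetD)
  have sub: "subalgebra M (\<F> s)" using usual by (auto simp: usual_conditions_def)
  have ind: "indep_set (sets (\<F> s)) {D -` S \<inter> space M | S. S \<in> sets borel}"
    and dist: "distributed M lborel D (\<lambda>y. ennreal (\<Prod>b\<in>Basis. normal_density 0 (sqrt (t - s)) (y \<bullet> b)))"
    using bm s unfolding brownian_motion_def D_def by blast+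
  have law: "distr M borel D = gaussian_law (t - s)"
    using distributed_distr_eq_density[OF dist] unfolding gaussian_law_def
    by (metis distr_cong sets_lborel)
  interpret I: prob_space "distr M (\<F> s) (\<lambda>\<omega>. \<omega>)" by (rule prob_space_distr) measurable
  interpret D: prob_space "distr M borel D" by (rule prob_space_distr) measurable
  have J: "distr M (\<F> s) (\<lambda>\<omega>. \<omega>) \<Otimes>\<^sub>M distr M borel D = distr M (\<F> s \<Otimes>\<^sub>M borel) (\<lambda>x. (x, D x))"
  proof (rule pair_measure_eqI)
    fix A S assume A: "A \<in> sets (distr M (\<F> s) (\<lambda>\<omega>. \<omega>))" and S: "S \<in> sets (distr M borel D)"
    have [measurable]: "A \<in> sets (\<F> s)" "S \<in> sets borel" "A \<in> sets M" using A S sets_F[of s] by auto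
    have sp: "A \<subseteq> space M" using sets.sets_into_space[of A M] by simp
    have "prob (A \<inter> (D -` S \<inter> space M)) = prob A * prob (D -` S \<inter> space M)"
      by (rule indep_setD[OF ind]) auto
    moreover have "(\<lambda>x. (x, D x)) -` (A \<times> S) \<inter> space M = A \<inter> (D -` S \<inter> space M)" by auto
    moreover have "(\<lambda>\<omega>. \<omega>) -` A \<inter> space M = A" using sp by auto
    ultimately show "emeasure (distr M (\<F> s) (\<lambda>\<omega>. \<omega>)) A * emeasure (distr M borel D) S =
        emeasure (distr M (\<F> s \<Otimes>\<^sub>M borel) (\<lambda>x. (x, D x))) (A \<times> S)"
      by (simp add: emeasure_distr emeasure_eq_measure ennreal_mult'[symmetric])
  qed (auto simp: I.sigma_finite_measure_axioms D.sigma_finite_measure_axioms cong: sets_pair_measure_cong)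
  have "(\<integral>\<^sup>+\<omega>. f (\<omega>, B t \<omega> - B s \<omega>) \<partial>M) = (\<integral>\<^sup>+z. f z \<partial>distr M (\<F> s \<Otimes>\<^sub>M borel) (\<lambda>x. (x, D x)))"
    by (subst nn_integral_distr) (auto simp: D_def)
  also have "\<dots> = (\<integral>\<^sup>+z. f z \<partial>(distr M (\<F> s) (\<lambda>\<omega>. \<omega>) \<Otimes>\<^sub>M distr M borel D))" by (simp only: J)
  also have "\<dots> = (\<integral>\<^sup>+\<omega>. (\<integral>\<^sup>+y. f (\<omega>, y) \<partial>distr M borel D) \<partial>distr M (\<F> s) (\<lambda>\<omega>. \<omega>))"
    by (subst D.nn_integral_fst[symmetric]) (auto cong: measurable_cong_sets)
  also have "\<dots> = (\<integral>\<^sup>+\<omega>. (\<integral>\<^sup>+y. f (\<omega>, y) \<partial>distr M borel D) \<partial>M)"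
    by (subst nn_integral_distr) (auto intro!: D.borel_measurable_nn_integral_fst cong: measurable_cong_sets)
  finally show ?thesis unfolding law .
qed

text \<open>The maximal inequality for a nonnegative supermartingale, up to a factor 1 + C h^(3/2)
  lost in each step. The process is frozen once it has exceeded b, its expectation is followed step
  by step, and Markov's inequality is applied at the final index.\<close>

lemma discrete_maximal_inequality:
  fixes e K :: real and p :: nat
  assumes e: "e > 0" and K: "K \<ge> 0"
  shows "\<exists>C\<ge>0. \<forall>h (G :: nat \<Rightarrow> 'w \<Rightarrow> 'm \<Rightarrow>\<^sub>L 'n::euclidean_space) a Z z0 N b.
    0 < h \<longrightarrow> h \<le> 1 \<longrightarrow> b > 0 \<longrightarrow>
    (\<forall>i. G i \<in> borel_measurable (\<F> (real i * h))) \<longrightarrow> (\<forall>i. a i \<in> borel_measurable (\<F> (real i * h))) \<longrightarrow>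
    (\<forall>i. \<forall>\<omega>\<in>space M. norm (G i \<omega>) \<le> K \<and> norm (a i \<omega>) \<le> K) \<longrightarrow>
    (\<forall>\<omega>. Z 0 \<omega> = z0) \<longrightarrow>
    (\<forall>i \<omega>. Z (Suc i) \<omega> = Z i \<omega> + blinfun_apply (G i \<omega>) (B (real (Suc i) * h) \<omega> - B (real i * h) \<omega>) + h *\<^sub>R a i \<omega>) \<longrightarrow>
    outer_prob_le M (\<lambda>\<omega>. \<exists>i<N. (e + (norm (Z i \<omega>))\<^sup>2)^p * exp (- (h * (\<Sum>j<i. growth_rate p e (Z j \<omega>) (G j \<omega>) (a j \<omega>)))) > b)
      ((e + (norm z0)\<^sup>2)^p * (1 + C * (h * sqrt h))^N / b)"
proof -
  obtain C where C: "C \<ge> 0" and step: "\<And>h (G :: 'm \<Rightarrow>\<^sub>L 'n) z a.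
    0 < h \<Longrightarrow> h \<le> 1 \<Longrightarrow> norm G \<le> K \<Longrightarrow> norm a \<le> K \<Longrightarrow>
    (\<integral>\<^sup>+y. ennreal ((e + (norm (z + blinfun_apply G y + h *\<^sub>R a))\<^sup>2)^p) \<partial>gaussian_law h)
      \<le> ennreal ((e + (norm z)\<^sup>2)^p * exp (h * growth_rate p e z G a) * (1 + C * (h * sqrt h)))"
    using gaussian_step_exp[OF e K, of p, where 'm='m and 'n='n] by blast
  show ?thesis
  proof (intro exI[of _ C] conjI C allI impI)
    fix h :: real and G :: "nat \<Rightarrow> 'w \<Rightarrow> 'm \<Rightarrow>\<^sub>L 'n" and a Z z0 N b
    assume h: "0 < h" "h \<le> 1" and b: "0 < (b::real)"
      and G: "\<forall>i. G i \<in> borel_measurable (\<F> (real i * h))" and a: "\<forall>i. a i \<in> borel_measurable (\<F> (real i * h))"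
      and bd: "\<forall>i. \<forall>\<omega>\<in>space M. norm (G i \<omega>) \<le> K \<and> norm (a i \<omega>) \<le> K"
      and Z0: "\<forall>\<omega>. Z 0 \<omega> = z0"
      and ZS: "\<forall>i \<omega>. Z (Suc i) \<omega> = Z i \<omega> + blinfun_apply (G i \<omega>) (B (real (Suc i) * h) \<omega> - B (real i * h) \<omega>) + h *\<^sub>R a i \<omega>"
    define L where "L i \<omega> = h * (\<Sum>j<i. growth_rate p e (Z j \<omega>) (G j \<omega>) (a j \<omega>))" for i \<omega>
    define V where "V z = (e + (norm z)\<^sup>2)^p" for z :: 'n
    have V0: "V z \<ge> 0" for z using e by (auto simp: V_def)
    have [measurable]: "V \<in> borel_measurable borel" unfolding V_def by measurable
    define bad where "bad i \<omega> \<longleftrightarrow> V (Z i \<omega>) * exp (- L i \<omega>) > b" for i \<omega>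
    define \<rho> where "\<rho> = 1 + C * (h * sqrt h)"
    have \<rho>: "\<rho> \<ge> 1" using C h by (simp add: \<rho>_def)
    have Gm: "G i \<in> borel_measurable (\<F> (real j * h))" if "i \<le> j" for i j
      by (rule measurable_F_mono[OF G[rule_format]]) (use that h in \<open>simp add: mult_right_mono\<close>)
    have am: "a i \<in> borel_measurable (\<F> (real j * h))" if "i \<le> j" for i j
      by (rule measurable_F_mono[OF a[rule_format]]) (use that h in \<open>simp add: mult_right_mono\<close>)
    have Bm: "B (real i * h) \<in> borel_measurable (\<F> (real j * h))" if "i \<le> j" for i j
      by (rule measurable_F_mono[OF B_measurable]) (use that h in \<open>simp_all add: mult_right_mono\<close>)
    have Zm: "Z i \<in> borel_measurable (\<F> (real j * h))" if "i \<le> j" for i j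
      using that
    proof (induction i)
      case 0
      then show ?case using Z0 by (simp cong: measurable_cong)
    next
      case (Suc i)
      have [measurable]: "Z i \<in> borel_measurable (\<F> (real j * h))" using Suc by auto
      have ij: "i \<le> j" "Suc i \<le> j" using Suc by auto
      note [measurable] = Gm[OF ij(1)] am[OF ij(1)] Bm[OF ij(1)] Bm[OF ij(2)]
      have eq: "Z (Suc i) = (\<lambda>\<omega>. Z i \<omega> + blinfun_apply (G i \<omega>) (B (real (Suc i) * h) \<omega> - B (real i * h) \<omega>) + h *\<^sub>R a i \<omega>)"
        using ZS by blast
      show ?case unfolding eq by measurable
    qed
    \<comment> \<open>\<open>L i\<close> involves only indices below \<open>i\<close>, so it is
      known one step ahead: the discount is predictable and can be taken out of the Gaussian
      integral.\<close>
    have Lm: "L i \<in> borel_measurable (\<F> (real j * h))" if "i \<le> Suc j" for i j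
    proof -
      have "(\<lambda>\<omega>. growth_rate p e (Z k \<omega>) (G k \<omega>) (a k \<omega>)) \<in> borel_measurable (\<F> (real j * h))" if "k \<le> j" for k
      proof -
        note [measurable] = Gm[OF that] am[OF that] Zm[OF that]
        show ?thesis unfolding growth_rate_def by measurable
      qed
      then show ?thesis unfolding L_def using that by (intro borel_measurable_times borel_measurable_sum) auto
    qed
    have badm: "Measurable.pred (\<F> (real j * h)) (bad i)" if "i \<le> j" for i j
    proof -
      have [measurable]: "Z i \<in> borel_measurable (\<F> (real j * h))" "L i \<in> borel_measurable (\<F> (real j * h))"
        using Zm[of i j] Lm[of i j] that by auto
      show ?thesis unfolding bad_def by measurable
    qed
    \<comment> \<open>Freezing at \<open>b\<close> instead of at the overshoot can only lower the
      value, so the supermartingale bound survives, and at index N the process equals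
      \<open>b\<close> on the whole exceptional event.\<close>
    define q where "q i \<omega> = (if \<exists>j<i. bad j \<omega> then b else V (Z i \<omega>) * exp (- L i \<omega>))" for i \<omega>
    have qstep: "(\<integral>\<^sup>+\<omega>. ennreal (q (Suc i) \<omega>) \<partial>M) \<le> ennreal \<rho> * (\<integral>\<^sup>+\<omega>. ennreal (q i \<omega>) \<partial>M)" for i
    proof -
      define f where "f = (\<lambda>(\<omega>, y). ennreal (if \<exists>j<Suc i. bad j \<omega> then b else
          V (Z i \<omega> + blinfun_apply (G i \<omega>) y + h *\<^sub>R a i \<omega>) * exp (- L (Suc i) \<omega>)))"
      note [measurable] = Gm[of i i, simplified] am[of i i, simplified] Zm[of i i, simplified] Lm[of "Suc i" i, simplified]
      have [measurable]: "Measurable.pred (\<F> (real i * h)) (\<lambda>\<omega>. \<exists>j<Suc i. bad j \<omega>)"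
      proof -
        have "Measurable.pred (\<F> (real i * h)) (\<lambda>\<omega>. \<exists>j\<in>{..<Suc i}. bad j \<omega>)"
          by (intro pred_intros_finite badm) auto
        then show ?thesis by (simp only: Bex_def lessThan_iff)
      qed
      define Bd where "Bd \<omega> \<longleftrightarrow> (\<exists>j<Suc i. bad j \<omega>)" for \<omega>
      define LS where "LS = L (Suc i)"
      have [measurable]: "Measurable.pred (\<F> (real i * h)) Bd" unfolding Bd_def by fact
      have [measurable]: "LS \<in> borel_measurable (\<F> (real i * h))" unfolding LS_def by (rule Lm) simp
      have fm: "f \<in> borel_measurable (\<F> (real i * h) \<Otimes>\<^sub>M borel)"
        unfolding f_def Bd_def[symmetric] LS_def[symmetric] by measurable
      have dt: "real (Suc i) * h - real i * h = h" by (simp add: algebra_simps)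
      have "(\<integral>\<^sup>+\<omega>. ennreal (q (Suc i) \<omega>) \<partial>M) = (\<integral>\<^sup>+\<omega>. f (\<omega>, B (real (Suc i) * h) \<omega> - B (real i * h) \<omega>) \<partial>M)"
        by (simp only: q_def f_def ZS split_conv)
      also have "\<dots> = (\<integral>\<^sup>+\<omega>. (\<integral>\<^sup>+y. f (\<omega>, y) \<partial>gaussian_law h) \<partial>M)"
        using nn_integral_increment[OF _ _ fm, of "real (Suc i) * h"] h unfolding dt by simp
      also have "\<dots> \<le> (\<integral>\<^sup>+\<omega>. ennreal \<rho> * ennreal (q i \<omega>) \<partial>M)"
      proof (intro nn_integral_mono)
        fix \<omega> assume w: "\<omega> \<in> space M"
        show "(\<integral>\<^sup>+y. f (\<omega>, y) \<partial>gaussian_law h) \<le> ennreal \<rho> * ennreal (q i \<omega>)"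
        proof (cases "\<exists>j<Suc i. bad j \<omega>")
          case True
          then have "f (\<omega>, y) = ennreal b" for y unfolding f_def by simp
          then have "(\<integral>\<^sup>+y. f (\<omega>, y) \<partial>(gaussian_law h :: 'm measure)) = ennreal b"
            using prob_space.emeasure_space_1[OF prob_space_gaussian_law[OF h(1), where 'm='m]] by simp
          also have "\<dots> \<le> ennreal (\<rho> * q i \<omega>)"
          proof (rule ennreal_leI)
            have "b \<le> q i \<omega>" using True unfolding q_def bad_def less_Suc_eq by auto
            also have "\<dots> \<le> \<rho> * q i \<omega>" using \<rho> b calculation by simp
            finally show "b \<le> \<rho> * q i \<omega>" .
          qed
          finally show ?thesis using \<rho> by (simp add: ennreal_mult')
        next
          case False
          have "(\<integral>\<^sup>+y. f (\<omega>, y) \<partial>gaussian_law h) = (\<integral>\<^sup>+y. ennreal (exp (- L (Suc i) \<omega>)) *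
               ennreal (V (Z i \<omega> + blinfun_apply (G i \<omega>) y + h *\<^sub>R a i \<omega>)) \<partial>gaussian_law h)"
            using False V0 by (intro nn_integral_cong) (auto simp: f_def ennreal_mult[symmetric] mult.commute)
          also have "\<dots> = ennreal (exp (- L (Suc i) \<omega>)) *
               (\<integral>\<^sup>+y. ennreal (V (Z i \<omega> + blinfun_apply (G i \<omega>) y + h *\<^sub>R a i \<omega>)) \<partial>gaussian_law h)"
            by (rule nn_integral_cmult) measurable
          also have "\<dots> \<le> ennreal (exp (- L (Suc i) \<omega>)) *
             ennreal (V (Z i \<omega>) * exp (h * growth_rate p e (Z i \<omega>) (G i \<omega>) (a i \<omega>)) * \<rho>)"
            unfolding V_def \<rho>_def using bd w h by (intro mult_left_mono step) auto
          also have "\<dots> = ennreal (\<rho> * (V (Z i \<omega>) * exp (- L i \<omega>)))"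
            using V0 \<rho> by (subst ennreal_mult[symmetric])
              (auto simp: L_def algebra_simps mult_exp_exp)
          also have "\<dots> = ennreal \<rho> * ennreal (q i \<omega>)"
          proof -
            have "\<not> (\<exists>j<i. bad j \<omega>)" using False less_Suc_eq by blast
            then have "q i \<omega> = V (Z i \<omega>) * exp (- L i \<omega>)" by (simp only: q_def if_False)
            then show ?thesis using \<rho> by (simp add: ennreal_mult')
          qed
          finally show ?thesis .
        qed
      qed
      also have "\<dots> = ennreal \<rho> * (\<integral>\<^sup>+\<omega>. ennreal (q i \<omega>) \<partial>M)"
      proof (rule nn_integral_cmult)
        have "Measurable.pred M (\<lambda>\<omega>. \<exists>j\<in>{..<i}. bad j \<omega>)"
          by (intro pred_intros_finite measurable_F[OF badm[OF order_refl]]) auto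
        then have [measurable]: "Measurable.pred M (\<lambda>\<omega>. \<exists>j<i. bad j \<omega>)" by (simp only: Bex_def lessThan_iff)
        have [measurable]: "Z i \<in> borel_measurable M" "L i \<in> borel_measurable M"
          using measurable_F[OF Zm[of i i]] measurable_F[OF Lm[of i i]] by auto
        define Bd where "Bd \<omega> \<longleftrightarrow> (\<exists>j<i. bad j \<omega>)" for \<omega>
        have [measurable]: "Measurable.pred M Bd" unfolding Bd_def by fact
        show "(\<lambda>\<omega>. ennreal (q i \<omega>)) \<in> borel_measurable M" unfolding q_def Bd_def[symmetric] by measurable
      qed
      finally show ?thesis .
    qed
    have qle: "(\<integral>\<^sup>+\<omega>. ennreal (q i \<omega>) \<partial>M) \<le> ennreal (V z0 * \<rho>^i)" for i
    proof (induction i)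
      case 0
      show ?case by (simp add: q_def L_def Z0 emeasure_space_1)
    next
      case (Suc i)
      have "(\<integral>\<^sup>+\<omega>. ennreal (q (Suc i) \<omega>) \<partial>M) \<le> ennreal \<rho> * ennreal (V z0 * \<rho>^i)"
        using qstep[of i] Suc by (meson mult_left_mono order_trans zero_le)
      also have "\<dots> = ennreal (V z0 * \<rho>^Suc i)" using \<rho> V0 by (simp add: ennreal_mult'[symmetric] mult_ac)
      finally show ?case .
    qed
    have "Measurable.pred M (\<lambda>\<omega>. \<exists>j\<in>{..<N}. bad j \<omega>)"
      by (intro pred_intros_finite measurable_F[OF badm[OF order_refl]]) auto
    then have badN: "Measurable.pred M (\<lambda>\<omega>. \<exists>j<N. bad j \<omega>)" by (simp only: Bex_def lessThan_iff)
    define E where "E = {\<omega>\<in>space M. \<exists>j<N. bad j \<omega>}"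
    have Em[measurable]: "E \<in> sets M" using badN unfolding E_def by (simp only: pred_def)
    have "ennreal b * emeasure M E = (\<integral>\<^sup>+\<omega>. ennreal b * indicator E \<omega> \<partial>M)" by (subst nn_integral_cmult) auto
    also have "\<dots> \<le> (\<integral>\<^sup>+\<omega>. ennreal (q N \<omega>) \<partial>M)"
      by (intro nn_integral_mono) (auto simp: E_def q_def split: split_indicator)
    also have "\<dots> \<le> ennreal (V z0 * \<rho>^N)" by (rule qle)
    finally have "ennreal (b * prob E) \<le> ennreal (V z0 * \<rho>^N)"
      using b by (simp add: emeasure_eq_measure ennreal_mult')
    then have "prob E \<le> V z0 * \<rho>^N / b"
      using V0 \<rho> b by (subst (asm) ennreal_le_iff) (auto simp: field_simps)
    then have "outer_prob_le M (\<lambda>\<omega>. \<exists>j<N. bad j \<omega>) (V z0 * \<rho>^N / b)"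
      using Em unfolding E_def by (intro outer_prob_leI)
    then show "outer_prob_le M (\<lambda>\<omega>. \<exists>i<N. (e + (norm (Z i \<omega>))\<^sup>2)^p * exp (- (h * (\<Sum>j<i. growth_rate p e (Z j \<omega>) (G j \<omega>) (a j \<omega>)))) > b)
      ((e + (norm z0)\<^sup>2)^p * (1 + C * (h * sqrt h))^N / b)"
      unfolding bad_def L_def V_def \<rho>_def .
  qed
qed

end

section \<open>From dyadic schemes to It\^o processes\<close>

lemma floor_dyadic:
  assumes "real j / 2^m \<le> s" "s < real (Suc j) / 2^m"
  shows "\<lfloor>s * 2^m\<rfloor> = int j"
proof -
  have "real j \<le> s * 2^m" using assms(1) by (simp add: divide_le_eq)
  moreover have "s * 2^m < real j + 1" using assms(2) by (simp add: less_divide_eq add.commute)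
  ultimately show ?thesis by linarith
qed

lemma floor_dyadic_le: "real_of_int \<lfloor>s * 2^m\<rfloor> / 2^m \<le> s"
  by (simp add: divide_le_eq)

lemma floor_dyadic_nonneg: "0 \<le> s \<Longrightarrow> 0 \<le> real_of_int \<lfloor>s * 2^m\<rfloor> / 2^m"
  by simp

lemma floor_dyadic_gt: "s - 1 / 2^m < real_of_int \<lfloor>s * 2^m\<rfloor> / 2^m"
proof -
  have "s * 2^m - 1 < real_of_int \<lfloor>s * 2^m\<rfloor>" by linarith
  then have "(s * 2^m - 1) / 2^m < real_of_int \<lfloor>s * 2^m\<rfloor> / 2^m" by (intro divide_strict_right_mono) auto
  then show ?thesis by (simp add: diff_divide_distrib)
qed

lemma nn_integral_dyadic_step:
  fixes c :: "nat \<Rightarrow> ennreal"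
  shows "(\<integral>\<^sup>+s. c (nat \<lfloor>s * 2^m\<rfloor>) * indicator {0..<real i / 2^m} s \<partial>lborel) = (\<Sum>j<i. c j * ennreal (1 / 2^m))"
proof -
  have "c (nat \<lfloor>s * 2^m\<rfloor>) * indicator {0..<real i / 2^m} s = (\<Sum>j<i. c j * indicator {real j / 2^m..<real (Suc j) / 2^m} s)" for s
  proof (induction i)
    case (Suc i)
    have le: "real i / 2^m \<le> real (Suc i) / 2^m" by (simp add: divide_right_mono)
    have "c (nat \<lfloor>s * 2^m\<rfloor>) * indicator {0..<real (Suc i) / 2^m} s =
      c (nat \<lfloor>s * 2^m\<rfloor>) * indicator {0..<real i / 2^m} s + c i * indicator {real i / 2^m..<real (Suc i) / 2^m} s"
    proof (cases "s \<in> {real i / 2^m..<real (Suc i) / 2^m}")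
      case True
      then have "\<lfloor>s * 2^m\<rfloor> = int i" by (intro floor_dyadic) auto
      moreover have "0 \<le> s" using True by (auto intro: order_trans[of 0 "real i / 2^m"])
      ultimately show ?thesis using True by simp
    next
      case False
      then show ?thesis using le by (auto simp: indicator_def)
    qed
    then show ?case using Suc by simp
  qed simp
  then have "(\<integral>\<^sup>+s. c (nat \<lfloor>s * 2^m\<rfloor>) * indicator {0..<real i / 2^m} s \<partial>lborel)
    = (\<integral>\<^sup>+s. (\<Sum>j<i. c j * indicator {real j / 2^m..<real (Suc j) / 2^m} s) \<partial>lborel)"
    by simp
  also have "\<dots> = (\<Sum>j<i. c j * ennreal (1 / 2^m))"
  proof (subst nn_integral_sum)
    show "(\<Sum>j<i. (\<integral>\<^sup>+s. c j * indicator {real j / 2^m..<real (Suc j) / 2^m} s \<partial>lborel)) = (\<Sum>j<i. c j * ennreal (1 / 2^m))"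
      by (intro sum.cong refl) (simp add: nn_integral_cmult_indicator divide_right_mono diff_divide_distrib[symmetric] add_divide_distrib)
  qed auto
  finally show ?thesis .
qed

text \<open>Weaker than continuity on purpose: the drift of an Euler polygon jumps at grid points,
  but it is constant on the cells of one dyadic level and therefore regular in this sense, see
  \<open>step_function_dyadic_regular\<close>.\<close>

definition dyadic_regular :: "(real \<Rightarrow> 'a::metric_space) \<Rightarrow> real \<Rightarrow> bool" where
  "dyadic_regular f t \<longleftrightarrow>
     (\<forall>\<eta>>0. \<exists>k. \<forall>m\<ge>k. \<forall>s\<in>{0..t}. dist (f s) (f (real_of_int \<lfloor>s * 2^m\<rfloor> / 2^m)) \<le> \<eta>)"

lemma dyadic_regular_continuous:
  assumes "continuous_on {0..t} f"
  shows "dyadic_regular f t"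
  unfolding dyadic_regular_def
proof (intro allI impI)
  fix \<eta> :: real assume "\<eta> > 0"
  have "uniformly_continuous_on {0..t} f" by (rule compact_uniformly_continuous[OF assms]) simp
  then obtain d where d: "d > 0" "\<And>x x'. x \<in> {0..t} \<Longrightarrow> x' \<in> {0..t} \<Longrightarrow> dist x' x < d \<Longrightarrow> dist (f x') (f x) < \<eta>"
    using \<open>\<eta> > 0\<close> unfolding uniformly_continuous_on_def by metis
  obtain k where k: "(1/2)^k < d" using real_arch_pow_inv[OF d(1), of "1/2"] by auto
  show "\<exists>k. \<forall>m\<ge>k. \<forall>s\<in>{0..t}. dist (f s) (f (real_of_int \<lfloor>s * 2^m\<rfloor> / 2^m)) \<le> \<eta>"
  proof (intro exI[of _ k] allI impI ballI)
    fix m s assume m: "m \<ge> k" and s: "s \<in> {0..t}"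
    have "1 / 2^m \<le> (1/2 :: real)^k" using m by (simp add: power_one_over[symmetric] power_decreasing)
    then have "dist s (real_of_int \<lfloor>s * 2^m\<rfloor> / 2^m) < d"
      using k floor_dyadic_gt[of s m] floor_dyadic_le[of s m] by (simp add: dist_real_def)
    moreover have "real_of_int \<lfloor>s * 2^m\<rfloor> / 2^m \<in> {0..t}"
      using s floor_dyadic_le[of s m] floor_dyadic_nonneg[of s m] by auto
    ultimately show "dist (f s) (f (real_of_int \<lfloor>s * 2^m\<rfloor> / 2^m)) \<le> \<eta>"
      using d(2)[OF _ s] d(2)[of "real_of_int \<lfloor>s * 2^m\<rfloor> / 2^m" s] s by (auto simp: less_imp_le)
  qed
qed

lemma dyadic_Riemann_sum:
  fixes a :: "real \<Rightarrow> 'n::euclidean_space"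
  assumes int: "a integrable_on {0..t}"
    and reg: "\<And>s. s \<in> {0..t} \<Longrightarrow> dist (a s) (a (real_of_int \<lfloor>s * 2^m\<rfloor> / 2^m)) \<le> \<eta>"
    and j: "real j / 2^m \<le> t"
  shows "norm ((1 / 2^m) *\<^sub>R (\<Sum>l<j. a (real l / 2^m)) - integral {0..real j / 2^m} a) \<le> real j / 2^m * \<eta>"
  using j
proof (induction j)
  case (Suc j)
  have le: "real j / 2^m \<le> real (Suc j) / 2^m" by (simp add: divide_right_mono)
  have t0: "0 \<le> t" using Suc.prems by (meson order_trans of_nat_0_le_iff divide_nonneg_nonneg zero_le_numeral zero_le_power)
  have \<eta>: "\<eta> \<ge> 0" using reg[of 0] t0 by simp
  have i1: "a integrable_on {0..real (Suc j) / 2^m}"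
    by (rule integrable_subinterval_real[OF int]) (use Suc.prems in auto)
  have i2: "a integrable_on {real j / 2^m..real (Suc j) / 2^m}"
    by (rule integrable_subinterval_real[OF i1]) auto
  have ct: "measure lborel {real j / 2^m..real (Suc j) / 2^m} = 1 / 2^m"
    using le by (simp add: diff_divide_distrib[symmetric])
  have "((\<lambda>s. a s - a (real j / 2^m)) has_integral
     (integral {real j / 2^m..real (Suc j) / 2^m} a - measure lborel {real j / 2^m..real (Suc j) / 2^m} *\<^sub>R a (real j / 2^m)))
     (cbox (real j / 2^m) (real (Suc j) / 2^m))"
    using i2 has_integral_const[of "a (real j / 2^m)" "real j / 2^m" "real (Suc j) / 2^m"]
    by (intro has_integral_diff) (auto simp: integrable_integral)
  then have "norm (integral {real j / 2^m..real (Suc j) / 2^m} a - measure lborel {real j / 2^m..real (Suc j) / 2^m} *\<^sub>R a (real j / 2^m))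
    \<le> \<eta> * measure lborel (cbox (real j / 2^m) (real (Suc j) / 2^m))"
  \<comment> \<open>The right end point is exempted because rounding down already sends it to the
    next cell.\<close>
  proof (rule has_integral_bound_spike_finite[OF \<eta>, of "{real (Suc j) / 2^m}", rotated 1])
    fix s assume s: "s \<in> cbox (real j / 2^m) (real (Suc j) / 2^m) - {real (Suc j) / 2^m}"
    then have "\<lfloor>s * 2^m\<rfloor> = int j" by (intro floor_dyadic) auto
    moreover have "s \<in> {0..t}" using s Suc.prems by (auto intro: order_trans[of 0 "real j / 2^m"])
    ultimately show "norm (a s - a (real j / 2^m)) \<le> \<eta>" using reg[of s] by (simp add: dist_norm)
  qed auto
  then have A: "norm ((1 / 2^m) *\<^sub>R a (real j / 2^m) - integral {real j / 2^m..real (Suc j) / 2^m} a) \<le> 1 / 2^m * \<eta>"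
    unfolding cbox_interval ct by (simp add: norm_minus_commute)
  have "integral {0..real (Suc j) / 2^m} a = integral {0..real j / 2^m} a + integral {real j / 2^m..real (Suc j) / 2^m} a"
    using Henstock_Kurzweil_Integration.integral_combine[OF _ le i1] by simp
  then have "norm ((1 / 2^m) *\<^sub>R (\<Sum>l<Suc j. a (real l / 2^m)) - integral {0..real (Suc j) / 2^m} a)
    = norm (((1 / 2^m) *\<^sub>R (\<Sum>l<j. a (real l / 2^m)) - integral {0..real j / 2^m} a) +
        ((1 / 2^m) *\<^sub>R a (real j / 2^m) - integral {real j / 2^m..real (Suc j) / 2^m} a))"
    by (simp add: algebra_simps)
  also have "\<dots> \<le> real j / 2^m * \<eta> + 1 / 2^m * \<eta>"
    using Suc le by (intro order_trans[OF norm_triangle_ineq] add_mono A) auto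
  finally show ?case by (simp add: add_divide_distrib algebra_simps)
qed simp

text \<open>Growth rate per unit of q. The drift contributes 2p times 2, the noise
  \<open>step_const\<close> times 4. One factor 2 arises because e + |zeta|^2 is at most twice its
  value for the scheme; the second factor 2 of the noise is that of |G|^2 <= 2 |H|^2 + 2 |G -
  H|^2.\<close>

definition growth_const :: "'m::euclidean_space itself \<Rightarrow> nat \<Rightarrow> real" where
  "growth_const T p = 4 * real p + 4 * step_const T p"

lemma step_const_nonneg: "step_const (T :: 'm::euclidean_space itself) p \<ge> 0"
  by (auto simp: step_const_def gauss_moment_def integral_nonneg_AE)

text \<open>The hypotheses under which \<open>\<zeta> = z0 + I + \<integral>a\<close> is controlled up to time \<open>t\<close>, for one path.\<close>

definition controlled_path ::
  "real \<Rightarrow> real \<Rightarrow> 'n::euclidean_space \<Rightarrow> (real \<Rightarrow> 'n) \<Rightarrow> (real \<Rightarrow> 'n) \<Rightarrow> (real \<Rightarrow> 'm::euclidean_space \<Rightarrow>\<^sub>L 'n) \<Rightarrow> (real \<Rightarrow> 'n) \<Rightarrow> real \<Rightarrow> bool" where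
  "controlled_path e q z0 \<zeta> I H a t \<longleftrightarrow>
     dyadic_regular \<zeta> t \<and> dyadic_regular a t \<and> a integrable_on {0..t} \<and> bounded (a ` {0..t}) \<and>
     (\<forall>s\<in>{0..t}. \<zeta> s = z0 + I s + integral {0..s} a \<and>
        (norm (H s))\<^sup>2 \<le> q * (e + (norm (\<zeta> s))\<^sup>2) \<and> \<zeta> s \<bullet> a s \<le> q * (e + (norm (\<zeta> s))\<^sup>2))"

text \<open>The pathwise core: off the exceptional event of a dyadic approximation, the discrete scheme with
  coefficients \<open>G\<close> and \<open>a (j / 2^m)\<close> stays close to \<open>\<zeta>\<close>, and its accumulated growth rate is at most
  \<open>growth_const p * q * T + 1\<close>.\<close>

lemma controlled_path_discrete:
  fixes G :: "nat \<Rightarrow> 'm::euclidean_space \<Rightarrow>\<^sub>L 'n::euclidean_space" and p T m :: nat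
  assumes e: "e > 0" and q: "q \<ge> 0" and t: "t \<in> {0..real T}"
    and cp: "controlled_path e q z0 \<zeta> I H a t"
    and \<kappa>: "\<And>s. s \<in> {0..t} \<Longrightarrow> norm (a s) \<le> \<kappa>"
    and reg\<zeta>: "\<And>s. s \<in> {0..t} \<Longrightarrow> dist (\<zeta> s) (\<zeta> (real_of_int \<lfloor>s * 2^m\<rfloor> / 2^m)) \<le> \<eta>"
    and rega: "\<And>s. s \<in> {0..t} \<Longrightarrow> dist (a s) (a (real_of_int \<lfloor>s * 2^m\<rfloor> / 2^m)) \<le> \<eta>"
    and \<eta>: "\<eta> > 0" "2 * (\<eta> * (2 + real T))\<^sup>2 \<le> e"
      "2 * real p * real T * (\<eta> * (1 + real T)) * \<kappa> / e + 2 * step_const TYPE('m) p * \<eta> / e \<le> 1"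
    and approx: "(\<integral>\<^sup>+s. ennreal ((norm (G (nat \<lfloor>s * 2^m\<rfloor>) - H s))\<^sup>2) * indicator {0..real T} s \<partial>lborel) \<le> ennreal \<eta>"
    and S: "\<And>i. i \<le> T * 2^m \<Longrightarrow> norm (S i - I (real i / 2^m)) \<le> \<eta>"
    and Z: "\<And>i. real i / 2^m \<le> t \<Longrightarrow> Z i = z0 + S i + (1 / 2^m) *\<^sub>R (\<Sum>l<i. a (real l / 2^m))"
    and \<alpha>: "\<And>i. real i / 2^m \<le> t \<Longrightarrow> \<alpha> i = a (real i / 2^m)"
    and b: "(e + (norm (\<zeta> t))\<^sup>2)^p > b"
  shows "\<exists>i<T * 2^m + 1. (e + (norm (Z i))\<^sup>2)^p * exp (- (1 / 2^m * (\<Sum>j<i. growth_rate p e (Z j) (G j) (\<alpha> j))))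
           > b / 2^p * exp (- (growth_const TYPE('m) p * q * real T + 1))"
proof -
  define h :: real where "h = 1 / 2^m"
  have h: "h > 0" by (simp add: h_def)
  define i where "i = nat \<lfloor>t * 2^m\<rfloor>"
  have ir: "real i = real_of_int \<lfloor>t * 2^m\<rfloor>" using t by (simp add: i_def)
  have it: "real i / 2^m \<le> t" unfolding ir by (rule floor_dyadic_le)
  have jt: "real j / 2^m \<le> t" if "j \<le> i" for j
    using that it by (meson divide_right_mono of_nat_le_iff order_trans zero_le_numeral zero_le_power)
  have iT: "i \<le> T * 2^m"
  proof -
    have "real i \<le> t * 2^m" using it by (simp add: divide_le_eq)
    also have "\<dots> \<le> real T * 2^m" using t by (intro mult_right_mono) auto
    finally have "real i \<le> real (T * 2^m)" by simp
    then show ?thesis by (simp only: of_nat_le_iff)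
  qed
  have cp1: "a integrable_on {0..t}" and cp2: "\<And>s. s \<in> {0..t} \<Longrightarrow> \<zeta> s = z0 + I s + integral {0..s} a"
    and cp3: "\<And>s. s \<in> {0..t} \<Longrightarrow> (norm (H s))\<^sup>2 \<le> q * (e + (norm (\<zeta> s))\<^sup>2)"
    and cp4: "\<And>s. s \<in> {0..t} \<Longrightarrow> \<zeta> s \<bullet> a s \<le> q * (e + (norm (\<zeta> s))\<^sup>2)"
    using cp unfolding controlled_path_def by blast+
  define u where "u j = e + (norm (Z j))\<^sup>2" for j
  have u: "u j \<ge> e" "u j > 0" for j using e by (auto simp: u_def add_pos_nonneg)
  \<comment> \<open>One \<open>\<eta>\<close> is the error of the discrete Ito sum, and T times
    \<open>\<eta>\<close> that of the Riemann sum of the drift. Moving inside a cell costs a further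
    \<open>\<eta>\<close> in \<open>close2\<close>.\<close>
  have close: "norm (Z j - \<zeta> (real j / 2^m)) \<le> \<eta> * (1 + real T)" if "j \<le> i" for j
  proof -
    have "Z j - \<zeta> (real j / 2^m) = (S j - I (real j / 2^m)) + ((1 / 2^m) *\<^sub>R (\<Sum>l<j. a (real l / 2^m)) - integral {0..real j / 2^m} a)"
      using jt[OF that] by (simp add: Z cp2 algebra_simps)
    also have "norm \<dots> \<le> \<eta> + real j / 2^m * \<eta>"
      using that iT jt[OF that] by (intro order_trans[OF norm_triangle_ineq] add_mono S dyadic_Riemann_sum[OF cp1 rega]) auto
    also have "\<dots> \<le> \<eta> + real T * \<eta>" using jt[OF that] t \<eta> by (intro add_left_mono mult_right_mono) auto
    finally show ?thesis by (simp add: algebra_simps)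
  qed
  have close2: "norm (\<zeta> s - Z j) \<le> \<eta> * (2 + real T)" if "j \<le> i" "real j / 2^m \<le> s" "s < real (Suc j) / 2^m" "s \<le> t" for s j
  proof -
    have s: "s \<in> {0..t}" using that by (auto intro: order_trans[of 0 "real j / 2^m"])
    have "\<lfloor>s * 2^m\<rfloor> = int j" using that by (intro floor_dyadic)
    then have "norm (\<zeta> s - \<zeta> (real j / 2^m)) \<le> \<eta>" using reg\<zeta>[OF s] by (simp add: dist_norm)
    moreover have "norm (\<zeta> (real j / 2^m) - Z j) \<le> \<eta> * (1 + real T)" using close[OF that(1)] by (simp add: norm_minus_commute)
    ultimately have "norm ((\<zeta> s - \<zeta> (real j / 2^m)) + (\<zeta> (real j / 2^m) - Z j)) \<le> \<eta> + \<eta> * (1 + real T)"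
      by (intro order_trans[OF norm_triangle_ineq] add_mono)
    then show ?thesis by (simp add: algebra_simps)
  qed
  have cmp: "e + (norm (\<zeta> s))\<^sup>2 \<le> 2 * u j" if "j \<le> i" "real j / 2^m \<le> s" "s < real (Suc j) / 2^m" "s \<le> t" for s j
  proof -
    define d where "d = norm (\<zeta> s - Z j)"
    have "norm (\<zeta> s) \<le> norm (Z j) + d" unfolding d_def by (metis norm_triangle_sub)
    then have "(norm (\<zeta> s))\<^sup>2 \<le> (norm (Z j) + d)\<^sup>2" by (intro power_mono) auto
    also have "\<dots> \<le> 2 * (norm (Z j))\<^sup>2 + 2 * d\<^sup>2"
      using sum_squares_bound[of "norm (Z j)" d] by (simp add: power2_sum)
    also have "2 * d\<^sup>2 \<le> 2 * (\<eta> * (2 + real T))\<^sup>2"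
      unfolding d_def using close2[OF that] by (intro mult_left_mono power_mono) auto
    finally show ?thesis using \<eta>(2) by (simp add: u_def)
  qed
  have cmpj: "e + (norm (\<zeta> (real j / 2^m)))\<^sup>2 \<le> 2 * u j" if "j \<le> i" for j
    using cmp[OF that, of "real j / 2^m"] jt[OF that] by (simp add: divide_strict_right_mono)
  have jT: "real j / 2^m \<in> {0..t}" if "j \<le> i" for j using jt[OF that] by auto
  have drift: "(Z j \<bullet> \<alpha> j) / u j \<le> \<eta> * (1 + real T) * \<kappa> / e + 2 * q" if "j < i" for j
  proof -
    define z where "z = \<zeta> (real j / 2^m)"
    define aj where "aj = a (real j / 2^m)"
    have ji: "j \<le> i" using that by simp
    have naj: "norm aj \<le> \<kappa>" unfolding aj_def by (rule \<kappa>[OF jT[OF ji]])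
    have "Z j \<bullet> \<alpha> j = (Z j - z) \<bullet> aj + z \<bullet> aj" using jt[OF ji] by (simp add: \<alpha> aj_def inner_diff_left)
    also have "\<dots> \<le> norm (Z j - z) * norm aj + q * (e + (norm z)\<^sup>2)"
      unfolding z_def aj_def by (intro add_mono norm_cauchy_schwarz cp4 jT ji)
    also have "\<dots> \<le> \<eta> * (1 + real T) * \<kappa> + q * (2 * u j)"
      unfolding z_def using close[OF ji] naj cmpj[OF ji] q \<eta> by (intro add_mono mult_mono mult_left_mono) auto
    finally have "(Z j \<bullet> \<alpha> j) / u j \<le> (\<eta> * (1 + real T) * \<kappa> + q * (2 * u j)) / u j"
      using u[of j] by (intro divide_right_mono) auto
    also have "\<dots> = \<eta> * (1 + real T) * \<kappa> / u j + 2 * q" using u[of j] by (simp add: add_divide_distrib)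
    also have "\<dots> \<le> \<eta> * (1 + real T) * \<kappa> / e + 2 * q"
      using u[of j] e \<eta> order_trans[OF norm_ge_zero naj] by (intro add_right_mono divide_left_mono) auto
    finally show ?thesis .
  qed
  \<comment> \<open>The approximating coefficients are close to H only in mean square, so they obey
    the growth bound only up to an excess. The excess is at most 2 |G - H|^2 at every time of the
    cell; hence its time integral is at most 2 \<open>\<eta>\<close>, which is all that the
    accumulated rate requires.\<close>
  define c where "c j = max 0 ((norm (G j))\<^sup>2 - 4 * q * u j)" for j
  have c0: "c j \<ge> 0" for j by (simp add: c_def)
  have csum: "(\<Sum>j<i. h * c j) \<le> 2 * \<eta>"
  proof -
    have pt: "ennreal (c (nat \<lfloor>s * 2^m\<rfloor>) / 2) * indicator {0..<real i / 2^m} s \<le>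
        ennreal ((norm (G (nat \<lfloor>s * 2^m\<rfloor>) - H s))\<^sup>2) * indicator {0..real T} s" for s
    proof (cases "s \<in> {0..<real i / 2^m}")
      case True
      define j where "j = nat \<lfloor>s * 2^m\<rfloor>"
      have jr: "real j = real_of_int \<lfloor>s * 2^m\<rfloor>" using True by (simp add: j_def)
      have st: "s \<in> {0..t}" "s \<in> {0..real T}" using True it t by auto
      have "s * 2^m < real i" using True by (simp add: less_divide_eq)
      then have ji: "j < i" using jr by linarith
      have s1: "real j / 2^m \<le> s" unfolding jr by (rule floor_dyadic_le)
      have "s * 2^m < real (Suc j)" using jr by (simp add: add.commute) linarith
      then have s2: "s < real (Suc j) / 2^m" by (simp add: less_divide_eq)
      have "norm (G j) \<le> norm (H s) + norm (G j - H s)" by (metis norm_triangle_sub)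
      then have "(norm (G j))\<^sup>2 \<le> (norm (H s) + norm (G j - H s))\<^sup>2" by (intro power_mono) auto
      also have "\<dots> \<le> 2 * (norm (H s))\<^sup>2 + 2 * (norm (G j - H s))\<^sup>2"
        using sum_squares_bound[of "norm (H s)" "norm (G j - H s)"] by (simp add: power2_sum)
      also have "(norm (H s))\<^sup>2 \<le> q * (2 * u j)"
        using cp3[OF st(1)] mult_left_mono[OF cmp[of j s] q] ji s1 s2 st by auto
      finally have "c j \<le> 2 * (norm (G j - H s))\<^sup>2" by (simp add: c_def)
      then have "ennreal (c j / 2) \<le> ennreal ((norm (G j - H s))\<^sup>2)"
        by (intro ennreal_leI) simp
      then show ?thesis using True st by (simp add: j_def)
    qed simp
    have "ennreal (\<Sum>j<i. h * (c j / 2)) = (\<Sum>j<i. ennreal (c j / 2) * ennreal (1 / 2^m))"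
      unfolding h_def using c0 by (subst sum_ennreal[symmetric]) (auto simp: ennreal_mult[symmetric] mult.commute)
    also have "\<dots> = (\<integral>\<^sup>+s. ennreal (c (nat \<lfloor>s * 2^m\<rfloor>) / 2) * indicator {0..<real i / 2^m} s \<partial>lborel)"
      by (rule nn_integral_dyadic_step[symmetric])
    also have "\<dots> \<le> (\<integral>\<^sup>+s. ennreal ((norm (G (nat \<lfloor>s * 2^m\<rfloor>) - H s))\<^sup>2) * indicator {0..real T} s \<partial>lborel)"
      by (intro nn_integral_mono pt)
    also have "\<dots> \<le> ennreal \<eta>" by (rule approx)
    finally have "(\<Sum>j<i. h * (c j / 2)) \<le> \<eta>" using \<eta> by (subst (asm) ennreal_le_iff) auto
    then show ?thesis by (simp add: sum_divide_distrib[symmetric])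
  qed
  define \<kappa>p where "\<kappa>p = step_const TYPE('m) p"
  have \<kappa>p: "\<kappa>p \<ge> 0" unfolding \<kappa>p_def by (rule step_const_nonneg)
  have rate: "growth_rate p e (Z j) (G j) (\<alpha> j) \<le> 2 * real p * (\<eta> * (1 + real T) * \<kappa> / e + 2 * q) + \<kappa>p * (4 * q + c j / e)" if "j < i" for j
  proof -
    have "growth_rate p e (Z j) (G j) (\<alpha> j) = 2 * real p * ((Z j \<bullet> \<alpha> j) / u j) + \<kappa>p * ((norm (G j))\<^sup>2 / u j)"
      by (simp add: growth_rate_def u_def \<kappa>p_def add_divide_distrib)
    also have "\<dots> \<le> 2 * real p * (\<eta> * (1 + real T) * \<kappa> / e + 2 * q) + \<kappa>p * ((norm (G j))\<^sup>2 / u j)"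
      using drift[OF that] by (intro add_right_mono mult_left_mono) auto
    also have "(norm (G j))\<^sup>2 / u j \<le> (4 * q * u j + c j) / u j"
      using u[of j] by (intro divide_right_mono) (auto simp: c_def)
    also have "\<dots> = 4 * q + c j / u j" using u[of j] by (simp add: add_divide_distrib)
    also have "\<dots> \<le> 4 * q + c j / e" using u[of j] e c0[of j] by (intro add_left_mono divide_left_mono) auto
    finally show ?thesis using \<kappa>p by (simp add: mult_left_mono)
  qed
  have hi: "h * real i \<le> real T" using it t by (simp add: h_def)
  have \<kappa>0: "\<kappa> \<ge> 0" using \<kappa>[of 0] t by (meson atLeastAtMost_iff norm_ge_zero order_refl order_trans)
  have "h * (\<Sum>j<i. growth_rate p e (Z j) (G j) (\<alpha> j)) \<le> h * (\<Sum>j<i. 2 * real p * (\<eta> * (1 + real T) * \<kappa> / e + 2 * q) + \<kappa>p * (4 * q + c j / e))"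
    using h rate by (intro mult_left_mono sum_mono) auto
  also have "\<dots> = h * real i * (2 * real p * (\<eta> * (1 + real T) * \<kappa> / e + 2 * q) + \<kappa>p * 4 * q) + \<kappa>p * (\<Sum>j<i. h * c j) / e"
    by (simp add: sum.distrib algebra_simps sum_distrib_left sum_divide_distrib)
  also have "\<dots> \<le> real T * (2 * real p * (\<eta> * (1 + real T) * \<kappa> / e + 2 * q) + \<kappa>p * 4 * q) + \<kappa>p * (2 * \<eta>) / e"
    using hi csum \<kappa>p e q \<eta> \<kappa>0 by (intro add_mono mult_right_mono divide_right_mono mult_left_mono) auto
  also have "\<dots> = growth_const TYPE('m) p * q * real T +
     (2 * real p * real T * (\<eta> * (1 + real T)) * \<kappa> / e + 2 * \<kappa>p * \<eta> / e)"
    unfolding growth_const_def \<kappa>p_def[symmetric] by (simp add: algebra_simps)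
  also have "\<dots> \<le> growth_const TYPE('m) p * q * real T + 1" using \<eta>(3) by (simp add: \<kappa>p_def)
  finally have L: "h * (\<Sum>j<i. growth_rate p e (Z j) (G j) (\<alpha> j)) \<le> growth_const TYPE('m) p * q * real T + 1" .
  \<comment> \<open>The comparison with factor 2 at the grid point below t is the origin of the
    factor 2^p in the maximal inequality.\<close>
  have "b < (2 * u i)^p"
  proof -
    have "s1 < real (Suc i) / 2^m" if "s1 = t" for s1
    proof -
      have "t * 2^m < real (Suc i)" using ir by (simp add: add.commute) linarith
      then show ?thesis using that by (simp add: less_divide_eq)
    qed
    then have "e + (norm (\<zeta> t))\<^sup>2 \<le> 2 * u i" using it by (intro cmp) auto
    then have "(e + (norm (\<zeta> t))\<^sup>2)^p \<le> (2 * u i)^p" using e by (intro power_mono) auto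
    then show ?thesis using b by simp
  qed
  then have "b / 2^p < (u i)^p" by (simp add: power_mult_distrib divide_less_eq mult.commute)
  then have "b / 2^p * exp (- (growth_const TYPE('m) p * q * real T + 1)) < (u i)^p * exp (- (growth_const TYPE('m) p * q * real T + 1))"
    by (intro mult_strict_right_mono) auto
  also have "\<dots> \<le> (u i)^p * exp (- (h * (\<Sum>j<i. growth_rate p e (Z j) (G j) (\<alpha> j))))"
    using L u[of i] by (intro mult_left_mono) auto
  finally show ?thesis using iT by (intro exI[of _ i]) (auto simp: u_def h_def)
qed

section \<open>Approximation on a common grid, and the maximal inequality in continuous time\<close>

context brownian_setting
begin

text \<open>\<open>I\<close> is approximated, in probability and uniformly over the grid points in \<open>[0, T]\<close>, by discrete integrals of
  bounded adapted step functions on every sufficiently fine dyadic grid. As the grid is common to all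
  integrands, this notion is linear.\<close>

definition dyadic_approx :: "(real \<Rightarrow> 'w \<Rightarrow> 'm \<Rightarrow>\<^sub>L 'n::euclidean_space) \<Rightarrow> (real \<Rightarrow> 'w \<Rightarrow> 'n) \<Rightarrow> bool" where
  "dyadic_approx H I \<longleftrightarrow>
     (\<forall>\<omega>\<in>space M. \<forall>T::nat. (\<lambda>s. indicator {0..real T} s *\<^sub>R H s \<omega>) \<in> borel_measurable borel) \<and>
     (\<forall>\<epsilon>>0. \<forall>T::nat. \<exists>K\<ge>0. \<exists>m0. \<forall>m\<ge>m0. \<exists>G.
        (\<forall>i. G i \<in> borel_measurable (\<F> (real i / 2^m))) \<and> (\<forall>i. \<forall>\<omega>\<in>space M. norm (G i \<omega>) \<le> K) \<and>
        outer_prob_le M (\<lambda>\<omega>. \<not> (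
          (\<integral>\<^sup>+s. ennreal ((norm (G (nat \<lfloor>s * 2^m\<rfloor>) \<omega> - H s \<omega>))\<^sup>2) * indicator {0..real T} s \<partial>lborel) \<le> ennreal \<epsilon> \<and>
          (\<forall>i\<le>T * 2^m. norm ((\<Sum>l<i. blinfun_apply (G l \<omega>) (B (real (Suc l) / 2^m) \<omega> - B (real l / 2^m) \<omega>))
             - I (real i / 2^m) \<omega>) \<le> \<epsilon>))) \<epsilon>)"

lemma dyadic_approx_diff:
  fixes H H' :: "real \<Rightarrow> 'w \<Rightarrow> 'm \<Rightarrow>\<^sub>L 'n::euclidean_space"
  assumes "dyadic_approx H I" "dyadic_approx H' I'"
  shows "dyadic_approx (\<lambda>s \<omega>. H s \<omega> - H' s \<omega>) (\<lambda>s \<omega>. I s \<omega> - I' s \<omega>)"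
  unfolding dyadic_approx_def
proof (intro conjI ballI allI impI)
  have m1: "(\<lambda>s. indicator {0..real T} s *\<^sub>R H s \<omega>) \<in> borel_measurable borel"
   and m2: "(\<lambda>s. indicator {0..real T} s *\<^sub>R H' s \<omega>) \<in> borel_measurable borel" if "\<omega> \<in> space M" for \<omega> and T :: nat
    using assms that unfolding dyadic_approx_def by auto
  show "(\<lambda>s. indicator {0..real T} s *\<^sub>R (H s \<omega> - H' s \<omega>)) \<in> borel_measurable borel" if "\<omega> \<in> space M" for \<omega> and T :: nat
    unfolding scaleR_diff_right using m1[OF that] m2[OF that] by measurable
  fix \<epsilon> :: real and T :: nat assume \<epsilon>: "\<epsilon> > 0"
  \<comment> \<open>The squared norm of a difference is at most twice the sum of the squares, so the
    mean-square error becomes 2 \<open>\<delta>\<close> + 2 \<open>\<delta>\<close>.\<close>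
  define \<delta> where "\<delta> = \<epsilon> / 4"
  have \<delta>: "\<delta> > 0" using \<epsilon> by (simp add: \<delta>_def)
  let ?Q = "\<lambda>H I m G. (\<lambda>\<omega>. \<not> (
          (\<integral>\<^sup>+s. ennreal ((norm (G (nat \<lfloor>s * 2^m\<rfloor>) \<omega> - H s \<omega>))\<^sup>2) * indicator {0..real T} s \<partial>lborel) \<le> ennreal \<delta> \<and>
          (\<forall>i\<le>T * 2^m. norm ((\<Sum>l<i. blinfun_apply (G l \<omega>) (B (real (Suc l) / 2^m) \<omega> - B (real l / 2^m) \<omega>))
             - I (real i / 2^m) \<omega>) \<le> \<delta>)))"
  obtain K m0 where K: "K \<ge> 0" "\<And>m. m \<ge> m0 \<Longrightarrow> \<exists>G.
        (\<forall>i. G i \<in> borel_measurable (\<F> (real i / 2^m))) \<and> (\<forall>i. \<forall>\<omega>\<in>space M. norm (G i \<omega>) \<le> K) \<and>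
        outer_prob_le M (?Q H I m G) \<delta>"
    using assms(1) \<delta> unfolding dyadic_approx_def by blast
  obtain K' m0' where K': "K' \<ge> 0" "\<And>m. m \<ge> m0' \<Longrightarrow> \<exists>G.
        (\<forall>i. G i \<in> borel_measurable (\<F> (real i / 2^m))) \<and> (\<forall>i. \<forall>\<omega>\<in>space M. norm (G i \<omega>) \<le> K') \<and>
        outer_prob_le M (?Q H' I' m G) \<delta>"
    using assms(2) \<delta> unfolding dyadic_approx_def by blast
  show "\<exists>K\<ge>0. \<exists>m0. \<forall>m\<ge>m0. \<exists>G.
        (\<forall>i. G i \<in> borel_measurable (\<F> (real i / 2^m))) \<and> (\<forall>i. \<forall>\<omega>\<in>space M. norm (G i \<omega>) \<le> K) \<and>
        outer_prob_le M (\<lambda>\<omega>. \<not> (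
          (\<integral>\<^sup>+s. ennreal ((norm (G (nat \<lfloor>s * 2^m\<rfloor>) \<omega> - (H s \<omega> - H' s \<omega>)))\<^sup>2) * indicator {0..real T} s \<partial>lborel) \<le> ennreal \<epsilon> \<and>
          (\<forall>i\<le>T * 2^m. norm ((\<Sum>l<i. blinfun_apply (G l \<omega>) (B (real (Suc l) / 2^m) \<omega> - B (real l / 2^m) \<omega>))
             - (I (real i / 2^m) \<omega> - I' (real i / 2^m) \<omega>)) \<le> \<epsilon>))) \<epsilon>"
  proof (intro exI[of _ "K + K'"] exI[of _ "max m0 m0'"] conjI allI impI)
    show "0 \<le> K + K'" using K K' by simp
    fix m assume m: "m \<ge> max m0 m0'"
    obtain G where G: "\<And>i. G i \<in> borel_measurable (\<F> (real i / 2^m))" "\<And>i \<omega>. \<omega> \<in> space M \<Longrightarrow> norm (G i \<omega>) \<le> K"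
        "outer_prob_le M (?Q H I m G) \<delta>"
      using K(2)[of m] m by auto
    obtain G' where G': "\<And>i. G' i \<in> borel_measurable (\<F> (real i / 2^m))" "\<And>i \<omega>. \<omega> \<in> space M \<Longrightarrow> norm (G' i \<omega>) \<le> K'"
        "outer_prob_le M (?Q H' I' m G') \<delta>"
      using K'(2)[of m] m by auto
    show "\<exists>G. (\<forall>i. G i \<in> borel_measurable (\<F> (real i / 2^m))) \<and> (\<forall>i. \<forall>\<omega>\<in>space M. norm (G i \<omega>) \<le> K + K') \<and>
        outer_prob_le M (\<lambda>\<omega>. \<not> (
          (\<integral>\<^sup>+s. ennreal ((norm (G (nat \<lfloor>s * 2^m\<rfloor>) \<omega> - (H s \<omega> - H' s \<omega>)))\<^sup>2) * indicator {0..real T} s \<partial>lborel) \<le> ennreal \<epsilon> \<and>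
          (\<forall>i\<le>T * 2^m. norm ((\<Sum>l<i. blinfun_apply (G l \<omega>) (B (real (Suc l) / 2^m) \<omega> - B (real l / 2^m) \<omega>))
             - (I (real i / 2^m) \<omega> - I' (real i / 2^m) \<omega>)) \<le> \<epsilon>))) \<epsilon>"
    proof (intro exI[of _ "\<lambda>i \<omega>. G i \<omega> - G' i \<omega>"] conjI allI ballI)
      show "(\<lambda>\<omega>. G i \<omega> - G' i \<omega>) \<in> borel_measurable (\<F> (real i / 2^m))" for i using G(1) G'(1) by measurable
      show "norm (G i \<omega> - G' i \<omega>) \<le> K + K'" if "\<omega> \<in> space M" for i \<omega>
        using G(2)[OF that, of i] G'(2)[OF that, of i] norm_triangle_ineq4[of "G i \<omega>" "G' i \<omega>"] by linarith
      show "outer_prob_le M (\<lambda>\<omega>. \<not> (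
          (\<integral>\<^sup>+s. ennreal ((norm (G (nat \<lfloor>s * 2^m\<rfloor>) \<omega> - G' (nat \<lfloor>s * 2^m\<rfloor>) \<omega> - (H s \<omega> - H' s \<omega>)))\<^sup>2) * indicator {0..real T} s \<partial>lborel) \<le> ennreal \<epsilon> \<and>
          (\<forall>i\<le>T * 2^m. norm ((\<Sum>l<i. blinfun_apply (G l \<omega> - G' l \<omega>) (B (real (Suc l) / 2^m) \<omega> - B (real l / 2^m) \<omega>))
             - (I (real i / 2^m) \<omega> - I' (real i / 2^m) \<omega>)) \<le> \<epsilon>))) \<epsilon>"
      proof (rule outer_prob_le_mono[OF outer_prob_le_disj[OF G(3) G'(3)]])
        fix \<omega> assume w: "\<omega> \<in> space M"
        assume neg: "\<not> (
          (\<integral>\<^sup>+s. ennreal ((norm (G (nat \<lfloor>s * 2^m\<rfloor>) \<omega> - G' (nat \<lfloor>s * 2^m\<rfloor>) \<omega> - (H s \<omega> - H' s \<omega>)))\<^sup>2) * indicator {0..real T} s \<partial>lborel) \<le> ennreal \<epsilon> \<and>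
          (\<forall>i\<le>T * 2^m. norm ((\<Sum>l<i. blinfun_apply (G l \<omega> - G' l \<omega>) (B (real (Suc l) / 2^m) \<omega> - B (real l / 2^m) \<omega>))
             - (I (real i / 2^m) \<omega> - I' (real i / 2^m) \<omega>)) \<le> \<epsilon>))"
        show "?Q H I m G \<omega> \<or> ?Q H' I' m G' \<omega>"
        proof (rule ccontr)
          let ?d = "\<lambda>G H s. ennreal ((norm (G (nat \<lfloor>s * 2^m\<rfloor>) \<omega> - H s \<omega>))\<^sup>2) * indicator {0..real T} s"
          assume "\<not> ?thesis"
          then have q1: "(\<integral>\<^sup>+s. ?d G H s \<partial>lborel) \<le> ennreal \<delta>" "(\<integral>\<^sup>+s. ?d G' H' s \<partial>lborel) \<le> ennreal \<delta>"
            and q2: "\<And>i. i \<le> T * 2^m \<Longrightarrow> norm ((\<Sum>l<i. blinfun_apply (G l \<omega>) (B (real (Suc l) / 2^m) \<omega> - B (real l / 2^m) \<omega>)) - I (real i / 2^m) \<omega>) \<le> \<delta>"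
              "\<And>i. i \<le> T * 2^m \<Longrightarrow> norm ((\<Sum>l<i. blinfun_apply (G' l \<omega>) (B (real (Suc l) / 2^m) \<omega> - B (real l / 2^m) \<omega>)) - I' (real i / 2^m) \<omega>) \<le> \<delta>"
            by auto
          have meas: "(\<lambda>s. ?d GG HH s) \<in> borel_measurable lborel"
            if HH[measurable]: "(\<lambda>s. indicator {0..real T} s *\<^sub>R HH s \<omega>) \<in> borel_measurable borel" for GG HH :: "_ \<Rightarrow> 'w \<Rightarrow> 'm \<Rightarrow>\<^sub>L 'n"
          proof -
            have eq: "(\<lambda>s. ?d GG HH s) = (\<lambda>s. ennreal ((norm (indicator {0..real T} s *\<^sub>R GG (nat \<lfloor>s * 2^m\<rfloor>) \<omega> - indicator {0..real T} s *\<^sub>R HH s \<omega>))\<^sup>2))"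
              by (auto simp: fun_eq_iff split: split_indicator)
            have [measurable]: "(\<lambda>s::real. GG (nat \<lfloor>s * 2^m\<rfloor>) \<omega>) \<in> borel_measurable borel" by measurable
            show ?thesis unfolding eq by measurable
          qed
          have me: "(\<lambda>s. ?d G H s) \<in> borel_measurable lborel" "(\<lambda>s. ?d G' H' s) \<in> borel_measurable lborel"
            by (rule meas, rule m1[OF w], rule meas, rule m2[OF w])
          have "(\<integral>\<^sup>+s. ennreal ((norm (G (nat \<lfloor>s * 2^m\<rfloor>) \<omega> - G' (nat \<lfloor>s * 2^m\<rfloor>) \<omega> - (H s \<omega> - H' s \<omega>)))\<^sup>2) * indicator {0..real T} s \<partial>lborel)
             \<le> (\<integral>\<^sup>+s. ennreal 2 * ?d G H s + ennreal 2 * ?d G' H' s \<partial>lborel)"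
          proof (intro nn_integral_mono)
            fix s
            define x where "x = G (nat \<lfloor>s * 2^m\<rfloor>) \<omega> - H s \<omega>"
            define y where "y = G' (nat \<lfloor>s * 2^m\<rfloor>) \<omega> - H' s \<omega>"
            have "(norm (x - y))\<^sup>2 \<le> (norm x + norm y)\<^sup>2" by (intro power_mono norm_triangle_ineq4) auto
            also have "\<dots> \<le> 2 * (norm x)\<^sup>2 + 2 * (norm y)\<^sup>2"
              using sum_squares_bound[of "norm x" "norm y"] by (simp add: power2_sum)
            finally have F: "ennreal ((norm (x - y))\<^sup>2) \<le> ennreal 2 * ennreal ((norm x)\<^sup>2) + ennreal 2 * ennreal ((norm y)\<^sup>2)"
              by (subst (1 2) ennreal_mult[symmetric], simp_all add: ennreal_plus[symmetric] ennreal_leI del: ennreal_plus)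
            have eq: "G (nat \<lfloor>s * 2^m\<rfloor>) \<omega> - G' (nat \<lfloor>s * 2^m\<rfloor>) \<omega> - (H s \<omega> - H' s \<omega>) = x - y" by (simp add: x_def y_def)
            show "ennreal ((norm (G (nat \<lfloor>s * 2^m\<rfloor>) \<omega> - G' (nat \<lfloor>s * 2^m\<rfloor>) \<omega> - (H s \<omega> - H' s \<omega>)))\<^sup>2) * indicator {0..real T} s
              \<le> ennreal 2 * ?d G H s + ennreal 2 * ?d G' H' s"
              unfolding eq x_def[symmetric] y_def[symmetric] using F by (auto split: split_indicator)
          qed
          also have "\<dots> = ennreal 2 * (\<integral>\<^sup>+s. ?d G H s \<partial>lborel) + ennreal 2 * (\<integral>\<^sup>+s. ?d G' H' s \<partial>lborel)"
            using me by (simp add: nn_integral_add nn_integral_cmult)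
          also have "\<dots> \<le> ennreal 2 * ennreal \<delta> + ennreal 2 * ennreal \<delta>"
            using q1 by (intro add_mono mult_left_mono) auto
          also have "\<dots> = ennreal \<epsilon>" using \<delta> by (simp add: \<delta>_def ennreal_mult[symmetric] ennreal_plus[symmetric] del: ennreal_plus ennreal_numeral)
          finally have A: "(\<integral>\<^sup>+s. ennreal ((norm (G (nat \<lfloor>s * 2^m\<rfloor>) \<omega> - G' (nat \<lfloor>s * 2^m\<rfloor>) \<omega> - (H s \<omega> - H' s \<omega>)))\<^sup>2) * indicator {0..real T} s \<partial>lborel) \<le> ennreal \<epsilon>" .
          have "norm ((\<Sum>l<i. blinfun_apply (G l \<omega> - G' l \<omega>) (B (real (Suc l) / 2^m) \<omega> - B (real l / 2^m) \<omega>))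
             - (I (real i / 2^m) \<omega> - I' (real i / 2^m) \<omega>)) \<le> \<epsilon>" if i: "i \<le> T * 2^m" for i
          proof -
            have "(\<Sum>l<i. blinfun_apply (G l \<omega> - G' l \<omega>) (B (real (Suc l) / 2^m) \<omega> - B (real l / 2^m) \<omega>))
             - (I (real i / 2^m) \<omega> - I' (real i / 2^m) \<omega>) =
              ((\<Sum>l<i. blinfun_apply (G l \<omega>) (B (real (Suc l) / 2^m) \<omega> - B (real l / 2^m) \<omega>)) - I (real i / 2^m) \<omega>) -
              ((\<Sum>l<i. blinfun_apply (G' l \<omega>) (B (real (Suc l) / 2^m) \<omega> - B (real l / 2^m) \<omega>)) - I' (real i / 2^m) \<omega>)"
              by (simp add: blinfun.diff_left sum_subtractf)
            then show ?thesis using q2[OF i] \<delta> by (simp only:) (rule order_trans[OF norm_triangle_ineq4], simp add: \<delta>_def)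
          qed
          with A neg show False by blast
        qed
      qed (simp add: \<delta>_def \<epsilon> less_imp_le)
    qed
  qed
qed

text \<open>The transfer from \<open>discrete_maximal_inequality\<close> is uniform only on paths
  with a prescribed drift bound \<open>\<kappa>\<close> and a prescribed grid level k of regularity.
  Both restrictions are added to the event and then removed, k first and \<open>\<kappa>\<close>
  second. This is possible because neither occurs in the bound: they only decide how fine the grid
  must be.\<close>

lemma maximal_inequality:
  fixes \<zeta> I a :: "real \<Rightarrow> 'w \<Rightarrow> 'n::euclidean_space" and p T :: nat
  assumes DA: "dyadic_approx H I" and a: "\<And>t. 0 \<le> t \<Longrightarrow> a t \<in> borel_measurable (\<F> t)"
    and e: "e > 0" and q: "q \<ge> 0" and b: "b > 0"
  shows "outer_prob_le M (\<lambda>\<omega>. \<exists>t\<in>{0..real T}.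
      controlled_path e q z0 (\<lambda>s. \<zeta> s \<omega>) (\<lambda>s. I s \<omega>) (\<lambda>s. H s \<omega>) (\<lambda>s. a s \<omega>) t \<and> (e + (norm (\<zeta> t \<omega>))\<^sup>2)^p > b)
    (6 * 2^p * (e + (norm z0)\<^sup>2)^p * exp (growth_const TYPE('m) p * q * real T) / b)"
    (is "outer_prob_le M (\<lambda>\<omega>. \<exists>t\<in>{0..real T}. ?cp \<omega> t \<and> _ \<omega> t) ?R")
proof -
  define reg where "reg k \<eta> \<omega> t \<longleftrightarrow> (\<forall>m\<ge>k. \<forall>s\<in>{0..t}.
     dist (\<zeta> s \<omega>) (\<zeta> (real_of_int \<lfloor>s * 2^m\<rfloor> / 2^m) \<omega>) \<le> \<eta> \<and> dist (a s \<omega>) (a (real_of_int \<lfloor>s * 2^m\<rfloor> / 2^m) \<omega>) \<le> \<eta>)"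
    for k :: nat and \<eta> \<omega> t
  define bnd where "bnd \<kappa> \<omega> t \<longleftrightarrow> (\<forall>s\<in>{0..t}. norm (a s \<omega>) \<le> \<kappa>)" for \<kappa> \<omega> t
  define Vb where "Vb \<omega> t \<longleftrightarrow> (e + (norm (\<zeta> t \<omega>))\<^sup>2)^p > b" for \<omega> t
  \<comment> \<open>The tolerance depends on \<open>\<kappa>\<close> and \<open>\<delta>\<close> but
    is chosen before \<open>k\<close>, so \<open>k\<close> can tend to infinity with the tolerance
    fixed.\<close>
  have core: "\<exists>\<eta>>0. \<forall>k. outer_prob_le M (\<lambda>\<omega>. \<exists>t\<in>{0..real T}. ?cp \<omega> t \<and> Vb \<omega> t \<and> bnd (real \<kappa>) \<omega> t \<and> reg k \<eta> \<omega> t) (?R + \<delta>)"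
    if \<delta>: "\<delta> > 0" for \<kappa> :: nat and \<delta>
  proof -
    define c1 where "c1 = 2 * real p * real T * (1 + real T) * \<kappa> / e + 2 * step_const TYPE('m) p / e"
    have c1: "c1 \<ge> 0" unfolding c1_def using e step_const_nonneg[of "TYPE('m)" p] by simp
    \<comment> \<open>The three terms serve the probability budget \<open>\<delta>\<close>, the
      comparison of e + |zeta|^2 with the scheme, and the requirement that the accumulated rate
      exceeds its limit by at most 1.\<close>
    define \<eta> where "\<eta> = min \<delta> (min (sqrt (e / 2) / (2 + real T)) (1 / (c1 + 1)))"
    have \<eta>: "\<eta> > 0" "\<eta> \<le> \<delta>" "\<eta> \<le> sqrt (e / 2) / (2 + real T)" "\<eta> \<le> 1 / (c1 + 1)"
      using \<delta> e c1 by (auto simp: \<eta>_def)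
    have \<eta>2: "2 * (\<eta> * (2 + real T))\<^sup>2 \<le> e"
    proof -
      have "\<eta> * (2 + real T) \<le> sqrt (e / 2)" using \<eta>(3) by (simp add: pos_le_divide_eq)
      then have "(\<eta> * (2 + real T))\<^sup>2 \<le> (sqrt (e / 2))\<^sup>2" using \<eta>(1) by (intro power_mono) auto
      then show ?thesis using e by simp
    qed
    have \<eta>3: "2 * real p * real T * (\<eta> * (1 + real T)) * \<kappa> / e + 2 * step_const TYPE('m) p * \<eta> / e \<le> 1"
    proof -
      have "2 * real p * real T * (\<eta> * (1 + real T)) * \<kappa> / e + 2 * step_const TYPE('m) p * \<eta> / e = \<eta> * c1"
        by (simp add: c1_def algebra_simps)
      also have "\<dots> \<le> 1 / (c1 + 1) * c1" using \<eta>(4) c1 by (intro mult_right_mono) auto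
      also have "\<dots> \<le> 1" using c1 by (simp add: divide_le_eq)
      finally show ?thesis .
    qed
    have "outer_prob_le M (\<lambda>\<omega>. \<exists>t\<in>{0..real T}. ?cp \<omega> t \<and> Vb \<omega> t \<and> bnd (real \<kappa>) \<omega> t \<and> reg k \<eta> \<omega> t) (?R + \<delta>)" for k
    proof -
      obtain K m0 where K: "K \<ge> 0" "\<And>m. m \<ge> m0 \<Longrightarrow> \<exists>G.
          (\<forall>i. G i \<in> borel_measurable (\<F> (real i / 2^m))) \<and> (\<forall>i. \<forall>\<omega>\<in>space M. norm (G i \<omega>) \<le> K) \<and>
          outer_prob_le M (\<lambda>\<omega>. \<not> (
            (\<integral>\<^sup>+s. ennreal ((norm (G (nat \<lfloor>s * 2^m\<rfloor>) \<omega> - H s \<omega>))\<^sup>2) * indicator {0..real T} s \<partial>lborel) \<le> ennreal \<eta> \<and>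
            (\<forall>i\<le>T * 2^m. norm ((\<Sum>l<i. blinfun_apply (G l \<omega>) (B (real (Suc l) / 2^m) \<omega> - B (real l / 2^m) \<omega>))
               - I (real i / 2^m) \<omega>) \<le> \<eta>))) \<eta>"
        using DA \<eta>(1) unfolding dyadic_approx_def by blast
      define K' where "K' = max K (real \<kappa>)"
      have K'0: "K' \<ge> 0" using K by (simp add: K'_def)
      obtain C where CD: "C \<ge> 0 \<and> (\<forall>h (G :: nat \<Rightarrow> 'w \<Rightarrow> 'm \<Rightarrow>\<^sub>L 'n) a Z z0 N b.
        0 < h \<longrightarrow> h \<le> 1 \<longrightarrow> b > 0 \<longrightarrow>
        (\<forall>i. G i \<in> borel_measurable (\<F> (real i * h))) \<longrightarrow> (\<forall>i. a i \<in> borel_measurable (\<F> (real i * h))) \<longrightarrow>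
        (\<forall>i. \<forall>\<omega>\<in>space M. norm (G i \<omega>) \<le> K' \<and> norm (a i \<omega>) \<le> K') \<longrightarrow>
        (\<forall>\<omega>. Z 0 \<omega> = z0) \<longrightarrow>
        (\<forall>i \<omega>. Z (Suc i) \<omega> = Z i \<omega> + blinfun_apply (G i \<omega>) (B (real (Suc i) * h) \<omega> - B (real i * h) \<omega>) + h *\<^sub>R a i \<omega>) \<longrightarrow>
        outer_prob_le M (\<lambda>\<omega>. \<exists>i<N. (e + (norm (Z i \<omega>))\<^sup>2)^p * exp (- (h * (\<Sum>j<i. growth_rate p e (Z j \<omega>) (G j \<omega>) (a j \<omega>)))) > b)
          ((e + (norm z0)\<^sup>2)^p * (1 + C * (h * sqrt h))^N / b))"
        using discrete_maximal_inequality[OF e K'0, of p, where 'n='n] by (elim exE) (rule that)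
      note C = CD[THEN conjunct1] and D = CD[THEN conjunct2, rule_format]
      have "(\<lambda>m. (real T + 1) * C * sqrt ((1/2)^m)) \<longlonglongrightarrow> (real T + 1) * C * sqrt 0"
        by (intro tendsto_intros LIMSEQ_power_zero) auto
      then have "eventually (\<lambda>m. (real T + 1) * C * sqrt ((1/2)^m) < ln 2) sequentially"
        by (intro order_tendstoD(2)) auto
      then obtain m1 where m1: "\<And>m. m \<ge> m1 \<Longrightarrow> (real T + 1) * C * sqrt ((1/2)^m) < ln 2"
        unfolding eventually_sequentially by auto
      \<comment> \<open>Fine enough for the approximation of the integral (\<open>m0\<close>), for
        the factor (1 + C h^(3/2))^N to be at most 2 (\<open>m1\<close>), and for the prescribed
        regularity (\<open>k\<close>).\<close>
      define m where "m = max m0 (max m1 k)"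
      have m: "m \<ge> m0" "m \<ge> m1" "m \<ge> k" by (auto simp: m_def)
      define h :: real where "h = 1 / 2^m"
      have h: "h > 0" "h \<le> 1" by (auto simp: h_def)
      have ih: "real i * h = real i / 2^m" for i by (simp add: h_def)
      define N where "N = T * 2^m + 1"
      have pw: "(1 + C * (h * sqrt h))^N \<le> 2"
      proof -
        have "1 + C * (h * sqrt h) \<le> exp (C * (h * sqrt h))" by (rule exp_ge_add_one_self)
        then have "(1 + C * (h * sqrt h))^N \<le> (exp (C * (h * sqrt h)))^N"
          using C h by (intro power_mono) auto
        also have "\<dots> = exp (real N * h * (C * sqrt h))" by (simp add: exp_of_nat_mult[symmetric] mult_ac)
        also have "real N * h * (C * sqrt h) \<le> (real T + 1) * (C * sqrt h)"
        proof (intro mult_right_mono)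
          have "real N * h = real T + h" by (simp add: N_def h_def field_simps)
          then show "real N * h \<le> real T + 1" using h by simp
        qed (use C h in auto)
        also have "\<dots> < ln 2" using m1[OF m(2)] by (simp add: h_def power_one_over mult.assoc)
        finally show ?thesis by simp
      qed
      obtain G where G: "\<And>i. G i \<in> borel_measurable (\<F> (real i / 2^m))" "\<And>i \<omega>. \<omega>\<in>space M \<Longrightarrow> norm (G i \<omega>) \<le> K"
        and Gbad: "outer_prob_le M (\<lambda>\<omega>. \<not> (
            (\<integral>\<^sup>+s. ennreal ((norm (G (nat \<lfloor>s * 2^m\<rfloor>) \<omega> - H s \<omega>))\<^sup>2) * indicator {0..real T} s \<partial>lborel) \<le> ennreal \<eta> \<and>
            (\<forall>i\<le>T * 2^m. norm ((\<Sum>l<i. blinfun_apply (G l \<omega>) (B (real (Suc l) / 2^m) \<omega> - B (real l / 2^m) \<omega>))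
               - I (real i / 2^m) \<omega>) \<le> \<eta>))) \<eta>" (is "outer_prob_le M ?bad1 \<eta>")
        using K(2)[OF m(1)] by blast
      \<comment> \<open>The discrete inequality asks for bounded coefficients on all of the
        probability space. On the event under consideration the cut-off changes nothing up to time
        t.\<close>
      define a' where "a' i \<omega> = (if norm (a (real i / 2^m) \<omega>) \<le> real \<kappa> then a (real i / 2^m) \<omega> else 0)" for i \<omega>
      have a'm: "a' i \<in> borel_measurable (\<F> (real i / 2^m))" for i
      proof -
        have [measurable]: "a (real i / 2^m) \<in> borel_measurable (\<F> (real i / 2^m))" by (rule a) simp
        show ?thesis unfolding a'_def by measurable
      qed
      have a'b: "norm (a' i \<omega>) \<le> real \<kappa>" for i \<omega> by (simp add: a'_def)
      define S where "S i \<omega> = (\<Sum>l<i. blinfun_apply (G l \<omega>) (B (real (Suc l) / 2^m) \<omega> - B (real l / 2^m) \<omega>))" for i \<omega>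
      define Z where "Z i \<omega> = z0 + S i \<omega> + h *\<^sub>R (\<Sum>l<i. a' l \<omega>)" for i \<omega>
      define b' where "b' = b / 2^p * exp (- (growth_const TYPE('m) p * q * real T + 1))"
      have b': "b' > 0" using b by (simp add: b'_def)
      have D': "outer_prob_le M (\<lambda>\<omega>. \<exists>i<N. (e + (norm (Z i \<omega>))\<^sup>2)^p * exp (- (h * (\<Sum>j<i. growth_rate p e (Z j \<omega>) (G j \<omega>) (a' j \<omega>)))) > b')
          ((e + (norm z0)\<^sup>2)^p * (1 + C * (h * sqrt h))^N / b')"
      proof (rule D[OF h b'])
        show "norm (G i \<omega>) \<le> K' \<and> norm (a' i \<omega>) \<le> K'" if "\<omega> \<in> space M" for i \<omega>
          using G(2)[OF that, of i] a'b[of i \<omega>] by (auto simp: K'_def)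
        show "Z (Suc i) \<omega> = Z i \<omega> + blinfun_apply (G i \<omega>) (B (real (Suc i) * h) \<omega> - B (real i * h) \<omega>) + h *\<^sub>R a' i \<omega>" for i \<omega>
          unfolding ih by (simp add: Z_def S_def scaleR_add_right)
      qed (use G(1) a'm in \<open>auto simp: ih Z_def S_def\<close>)
      \<comment> \<open>The constant 6 is 2 * 3: the factor 2 bounds the accumulated discretisation
        error, and 3 bounds exp 1, which stems from the slack 1 in the accumulated rate.\<close>
      have le: "(e + (norm z0)\<^sup>2)^p * (1 + C * (h * sqrt h))^N / b' \<le> ?R"
      proof -
        have V0: "(e + (norm z0)\<^sup>2)^p \<ge> 0" using e by simp
        have "(e + (norm z0)\<^sup>2)^p * (1 + C * (h * sqrt h))^N / b' \<le> (e + (norm z0)\<^sup>2)^p * 2 / b'"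
          using pw V0 b' by (intro divide_right_mono mult_left_mono) auto
        also have "\<dots> = (2 * exp 1) * (2^p * (e + (norm z0)\<^sup>2)^p * exp (growth_const TYPE('m) p * q * real T) / b)"
          using b unfolding b'_def exp_minus exp_add by (simp add: field_simps)
        also have "\<dots> \<le> 6 * (2^p * (e + (norm z0)\<^sup>2)^p * exp (growth_const TYPE('m) p * q * real T) / b)"
          using exp_le b V0 by (intro mult_right_mono) auto
        finally show ?thesis by (simp add: mult.assoc)
      qed
      show ?thesis
      proof (rule outer_prob_le_mono[OF outer_prob_le_disj[OF D' Gbad]])
        show "(e + (norm z0)\<^sup>2)^p * (1 + C * (h * sqrt h))^N / b' + \<eta> \<le> ?R + \<delta>" using le \<eta>(2) by simp
        fix \<omega> assume w: "\<omega> \<in> space M" and ex: "\<exists>t\<in>{0..real T}. ?cp \<omega> t \<and> Vb \<omega> t \<and> bnd (real \<kappa>) \<omega> t \<and> reg k \<eta> \<omega> t"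
        then obtain t where t: "t \<in> {0..real T}" "?cp \<omega> t" "Vb \<omega> t" "bnd (real \<kappa>) \<omega> t" "reg k \<eta> \<omega> t" by blast
        show "(\<exists>i<N. (e + (norm (Z i \<omega>))\<^sup>2)^p * exp (- (h * (\<Sum>j<i. growth_rate p e (Z j \<omega>) (G j \<omega>) (a' j \<omega>)))) > b') \<or> ?bad1 \<omega>"
        proof (cases "?bad1 \<omega>")
          case False
          have bn: "norm (a s \<omega>) \<le> real \<kappa>" if "s \<in> {0..t}" for s using t(4) that unfolding bnd_def by blast
          have aa: "a' i \<omega> = a (real i / 2^m) \<omega>" if "real i / 2^m \<le> t" for i
            using bn[of "real i / 2^m"] that by (simp add: a'_def)
          have "\<exists>i<T * 2^m + 1. (e + (norm (Z i \<omega>))\<^sup>2)^p * exp (- (1 / 2^m * (\<Sum>j<i. growth_rate p e (Z j \<omega>) (G j \<omega>) (a' j \<omega>))))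
               > b / 2^p * exp (- (growth_const TYPE('m) p * q * real T + 1))"
          proof (rule controlled_path_discrete[OF e q t(1,2) bn _ _ \<eta>(1) \<eta>2 \<eta>3])
            show "dist (\<zeta> s \<omega>) (\<zeta> (real_of_int \<lfloor>s * 2^m\<rfloor> / 2^m) \<omega>) \<le> \<eta>"
              "dist (a s \<omega>) (a (real_of_int \<lfloor>s * 2^m\<rfloor> / 2^m) \<omega>) \<le> \<eta>" if "s \<in> {0..t}" for s
              using t(5) that m(3) unfolding reg_def by blast+
            show "(\<integral>\<^sup>+s. ennreal ((norm (G (nat \<lfloor>s * 2^m\<rfloor>) \<omega> - H s \<omega>))\<^sup>2) * indicator {0..real T} s \<partial>lborel) \<le> ennreal \<eta>"
              using False by blast
            show "norm (S i \<omega> - I (real i / 2^m) \<omega>) \<le> \<eta>" if "i \<le> T * 2^m" for i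
              using False that unfolding S_def by blast
            show "Z i \<omega> = z0 + S i \<omega> + (1 / 2^m) *\<^sub>R (\<Sum>l<i. a (real l / 2^m) \<omega>)" if "real i / 2^m \<le> t" for i
            proof -
              have "(\<Sum>l<i. a' l \<omega>) = (\<Sum>l<i. a (real l / 2^m) \<omega>)"
              proof (rule sum.cong[OF refl])
                fix l assume "l \<in> {..<i}"
                then have "real l / 2^m \<le> real i / 2^m" by (simp add: divide_right_mono)
                then show "a' l \<omega> = a (real l / 2^m) \<omega>" using that by (intro aa) simp
              qed
              then show ?thesis by (simp add: Z_def h_def)
            qed
            show "a' i \<omega> = a (real i / 2^m) \<omega>" if "real i / 2^m \<le> t" for i by (rule aa[OF that])
            show "b < (e + (norm (\<zeta> t \<omega>))\<^sup>2)^p" using t(3) unfolding Vb_def .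
          qed
          then show ?thesis unfolding N_def h_def b'_def by blast
        qed blast
      qed
    qed
    with \<eta>(1) show ?thesis by blast
  qed
  have step2: "outer_prob_le M (\<lambda>\<omega>. \<exists>t\<in>{0..real T}. ?cp \<omega> t \<and> Vb \<omega> t \<and> bnd (real \<kappa>) \<omega> t) ?R" for \<kappa> :: nat
  proof (rule outer_prob_le_eps)
    fix \<delta> :: real assume "\<delta> > 0"
    then obtain \<eta> where \<eta>: "\<eta> > 0"
      "\<And>k. outer_prob_le M (\<lambda>\<omega>. \<exists>t\<in>{0..real T}. ?cp \<omega> t \<and> Vb \<omega> t \<and> bnd (real \<kappa>) \<omega> t \<and> reg k \<eta> \<omega> t) (?R + \<delta>)"
      using core by blast
    show "outer_prob_le M (\<lambda>\<omega>. \<exists>t\<in>{0..real T}. ?cp \<omega> t \<and> Vb \<omega> t \<and> bnd (real \<kappa>) \<omega> t) (?R + \<delta>)"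
    proof (rule outer_prob_le_liminf[OF \<eta>(2)], intro AE_I2 impI)
      fix \<omega> assume "\<exists>t\<in>{0..real T}. ?cp \<omega> t \<and> Vb \<omega> t \<and> bnd (real \<kappa>) \<omega> t"
      then obtain t where t: "t\<in>{0..real T}" "?cp \<omega> t" "Vb \<omega> t" "bnd (real \<kappa>) \<omega> t" by blast
      have r: "dyadic_regular (\<lambda>s. \<zeta> s \<omega>) t" "dyadic_regular (\<lambda>s. a s \<omega>) t"
        using t(2) unfolding controlled_path_def by simp_all
      obtain k1 where k1: "\<And>m s. m \<ge> k1 \<Longrightarrow> s \<in> {0..t} \<Longrightarrow> dist (\<zeta> s \<omega>) (\<zeta> (real_of_int \<lfloor>s * 2^m\<rfloor> / 2^m) \<omega>) \<le> \<eta>"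
        using r(1)[unfolded dyadic_regular_def, rule_format, OF \<eta>(1)] by blast
      obtain k2 where k2: "\<And>m s. m \<ge> k2 \<Longrightarrow> s \<in> {0..t} \<Longrightarrow> dist (a s \<omega>) (a (real_of_int \<lfloor>s * 2^m\<rfloor> / 2^m) \<omega>) \<le> \<eta>"
        using r(2)[unfolded dyadic_regular_def, rule_format, OF \<eta>(1)] by blast
      have "reg k \<eta> \<omega> t" if "k \<ge> max k1 k2" for k
        unfolding reg_def using k1 k2 that by (meson max.boundedE order_trans)
      then show "\<forall>\<^sub>F k in sequentially. \<exists>t\<in>{0..real T}. ?cp \<omega> t \<and> Vb \<omega> t \<and> bnd (real \<kappa>) \<omega> t \<and> reg k \<eta> \<omega> t"
        unfolding eventually_sequentially using t by (intro exI[of _ "max k1 k2"]) blast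
    qed
  qed
  have "outer_prob_le M (\<lambda>\<omega>. \<exists>t\<in>{0..real T}. ?cp \<omega> t \<and> Vb \<omega> t) ?R"
  proof (rule outer_prob_le_liminf[OF step2], intro AE_I2 impI)
    fix \<omega> assume "\<exists>t\<in>{0..real T}. ?cp \<omega> t \<and> Vb \<omega> t"
    then obtain t where t: "t\<in>{0..real T}" "?cp \<omega> t" "Vb \<omega> t" by blast
    then have "bounded ((\<lambda>s. a s \<omega>) ` {0..t})" unfolding controlled_path_def by simp
    then obtain r where r: "\<And>s. s \<in> {0..t} \<Longrightarrow> norm (a s \<omega>) \<le> r"
      unfolding bounded_iff by blast
    obtain k0 :: nat where k0: "r \<le> k0" using real_arch_simple by blast
    have "bnd (real k) \<omega> t" if "k \<ge> k0" for k
      using r k0 that unfolding bnd_def by (meson of_nat_le_iff order_trans)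
    then show "\<forall>\<^sub>F k in sequentially. \<exists>t\<in>{0..real T}. ?cp \<omega> t \<and> Vb \<omega> t \<and> bnd (real k) \<omega> t"
      unfolding eventually_sequentially using t by (intro exI[of _ k0]) blast
  qed
  then show ?thesis unfolding Vb_def .
qed

end

section \<open>Discrete approximation of It\^o integrals\<close>

lemma floor_dyadic_LIMSEQ: "(\<lambda>m. real_of_int \<lfloor>s * 2^m\<rfloor> / 2^m) \<longlonglongrightarrow> s"
proof (rule tendsto_sandwich[of "\<lambda>m. s - 1 / 2^m" _ _ "\<lambda>_. s"])
  have "(\<lambda>m. s - (1/2)^m) \<longlonglongrightarrow> s - 0" by (intro tendsto_intros LIMSEQ_power_zero) auto
  then show "(\<lambda>m. s - 1 / 2^m) \<longlonglongrightarrow> s" by (simp add: power_one_over)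
qed (auto simp: floor_dyadic_le floor_dyadic_gt less_imp_le)

lemma continuous_on_floor_dyadic:
  fixes f :: "real \<Rightarrow> 'a::topological_space"
  assumes f: "continuous_on {0..T} f" and s: "s \<in> {0..T}"
  shows "(\<lambda>m. f (real (nat \<lfloor>s * 2^m\<rfloor>) / 2^m)) \<longlonglongrightarrow> f s"
proof -
  have "(\<lambda>m. f (real_of_int \<lfloor>s * 2^m\<rfloor> / 2^m)) \<longlonglongrightarrow> f s"
  proof (rule continuous_on_tendsto_compose[OF f floor_dyadic_LIMSEQ s])
    show "\<forall>\<^sub>F m in sequentially. real_of_int \<lfloor>s * 2^m\<rfloor> / 2^m \<in> {0..T}"
      using s floor_dyadic_nonneg[of s] order_trans[OF floor_dyadic_le[of s]] by (intro always_eventually) auto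
  qed
  then show ?thesis using s by simp
qed

lemma nat_floor_dyadic_le: "0 \<le> s \<Longrightarrow> s \<le> T \<Longrightarrow> real (nat \<lfloor>s * 2^m\<rfloor>) / 2^m \<le> T"
  using floor_dyadic_le[of s m] by simp

section \<open>Completeness, the modulus of Brownian motion, and measurability of the approximation
  events\<close>

context brownian_setting
begin

lemma AE_sets:
  assumes A: "A \<in> sets M" and S: "S \<subseteq> space M" and ae: "AE \<omega> in M. \<omega> \<in> S \<longleftrightarrow> \<omega> \<in> A"
  shows "S \<in> sets M"
proof -
  obtain N where N: "{\<omega>\<in>space M. \<not> (\<omega> \<in> S \<longleftrightarrow> \<omega> \<in> A)} \<subseteq> N" "emeasure M N = 0" "N \<in> sets M"
    using ae by (rule AE_E)
  then have n: "N \<in> null_sets M" by auto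
  have "S \<inter> N \<in> sets M" using null_sets_F[OF n, of "S \<inter> N" 0] sets_F[of 0] by auto
  moreover have "S = (A - N) \<union> (S \<inter> N)" using N(1) S sets.sets_into_space[OF A] by auto
  ultimately show ?thesis using A N(3) by (metis sets.Diff sets.Un)
qed

text \<open>The usual conditions place all subsets of null sets in \<open>\<F> 0\<close>. Hence
  limits may be redefined off a good event without losing adaptedness.\<close>

lemma measurable_F_AE_eq:
  fixes f g :: "'w \<Rightarrow> 'a::topological_space"
  assumes g: "g \<in> borel_measurable (\<F> t)" and t: "t \<ge> 0" and ae: "AE \<omega> in M. f \<omega> = g \<omega>"
  shows "f \<in> borel_measurable (\<F> t)"
proof (rule measurableI)
  fix A :: "'a set" assume A: "A \<in> sets borel"
  obtain N where N: "{\<omega>\<in>space M. f \<omega> \<noteq> g \<omega>} \<subseteq> N" "emeasure M N = 0" "N \<in> sets M"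
    using ae by (rule AE_E)
  then have n: "N \<in> null_sets M" by auto
  have "g -` A \<inter> space M \<in> sets (\<F> t)" using measurable_sets[OF g A] by simp
  moreover have "N \<in> sets (\<F> t)" "f -` A \<inter> N \<in> sets (\<F> t)" using null_sets_F[OF n _ t] by auto
  moreover have "f -` A \<inter> space (\<F> t) = ((g -` A \<inter> space M) - N) \<union> (f -` A \<inter> N)"
    using N(1) sets.sets_into_space[OF N(3)] by auto
  ultimately show "f -` A \<inter> space (\<F> t) \<in> sets (\<F> t)" by (metis sets.Diff sets.Un)
qed simp

lemma B_measurable_M: "t \<ge> 0 \<Longrightarrow> B t \<in> borel_measurable M"
  by (rule measurable_F[OF B_measurable])

lemma B_modulus:
  assumes \<eta>: "\<eta> > 0" and \<epsilon>: "\<epsilon> > 0"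
  shows "\<exists>n0. outer_prob_le M (\<lambda>\<omega>. \<exists>s\<in>{0..real T}. \<exists>t\<in>{0..real T}. \<bar>s - t\<bar> \<le> 1 / 2^n0 \<and> norm (B s \<omega> - B t \<omega>) > \<eta>) \<epsilon>"
proof -
  \<comment> \<open>Only dyadic times occur, so these are genuine events. The distance 2 / 2^n,
    against 1 / 2^n in the claim, together with the strict inequality for the norm, leaves room for
    replacing s and t by dyadic times.\<close>
  define P where "P n \<omega> \<longleftrightarrow> (\<exists>k i j. real i / 2^k \<le> real T \<and> real j / 2^k \<le> real T \<and> \<bar>real i / 2^k - real j / 2^k\<bar> < 2 / 2^n \<and>
     norm (B (real i / 2^k) \<omega> - B (real j / 2^k) \<omega>) > \<eta>)" for n :: nat and \<omega>
  have [measurable]: "B (real i / 2^k) \<in> borel_measurable M" for i k :: nat by (rule B_measurable_M) simp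
  have meas: "{\<omega>\<in>space M. P n \<omega>} \<in> sets M" for n unfolding P_def by measurable
  have "AE \<omega> in M. eventually (\<lambda>n. \<not> P n \<omega>) sequentially"
    using B_continuous
  proof eventually_elim
    case (elim \<omega>)
    have "uniformly_continuous_on {0..real T} (\<lambda>t. B t \<omega>)"
      by (rule compact_uniformly_continuous[OF continuous_on_subset[OF elim]]) auto
    then obtain d where d: "d > 0" "\<And>x x'. x \<in> {0..real T} \<Longrightarrow> x' \<in> {0..real T} \<Longrightarrow> dist x' x < d \<Longrightarrow> dist (B x' \<omega>) (B x \<omega>) < \<eta>"
      using \<eta> unfolding uniformly_continuous_on_def by metis
    obtain n0 where n0: "(1/2)^n0 < d / 2" using real_arch_pow_inv[of "d / 2" "1/2"] d(1) by auto
    show ?case unfolding eventually_sequentially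
    proof (intro exI[of _ n0] allI impI notI)
      fix n assume n: "n \<ge> n0" and "P n \<omega>"
      then obtain k i j where ij: "real i / 2^k \<le> real T" "real j / 2^k \<le> real T" "\<bar>real i / 2^k - real j / 2^k\<bar> < 2 / 2^n"
         "norm (B (real i / 2^k) \<omega> - B (real j / 2^k) \<omega>) > \<eta>" unfolding P_def by blast
      have "1 / 2^n \<le> (1/2 :: real)^n0" using n by (simp add: power_one_over[symmetric] power_decreasing)
      then have "2 / 2^n < d" using n0 by simp
      then have "dist (B (real i / 2^k) \<omega>) (B (real j / 2^k) \<omega>) < \<eta>"
        using ij by (intro d(2)) (auto simp: dist_real_def)
      then show False using ij(4) by (simp add: dist_norm)
    qed
  qed
  then obtain n0 where n0: "outer_prob_le M (\<lambda>\<omega>. \<exists>n\<ge>n0. P n \<omega>) \<epsilon>"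
    using outer_prob_le_eventually[where P = P, OF meas _ \<epsilon>] by blast
  show ?thesis
  proof (intro exI[of _ n0] outer_prob_le_AE_mono[OF n0])
    show "AE \<omega> in M. (\<exists>s\<in>{0..real T}. \<exists>t\<in>{0..real T}. \<bar>s - t\<bar> \<le> 1 / 2^n0 \<and> norm (B s \<omega> - B t \<omega>) > \<eta>) \<longrightarrow> (\<exists>n\<ge>n0. P n \<omega>)"
      using B_continuous
    proof eventually_elim
      case (elim \<omega>)
      show ?case
      proof
        assume "\<exists>s\<in>{0..real T}. \<exists>t\<in>{0..real T}. \<bar>s - t\<bar> \<le> 1 / 2^n0 \<and> norm (B s \<omega> - B t \<omega>) > \<eta>"
        then obtain s t where st: "s\<in>{0..real T}" "t\<in>{0..real T}" "\<bar>s - t\<bar> \<le> 1 / 2^n0" "norm (B s \<omega> - B t \<omega>) > \<eta>" by blast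
        define S where "S m = real (nat \<lfloor>s * 2^m\<rfloor>) / 2^m" for m
        define R where "R m = real (nat \<lfloor>t * 2^m\<rfloor>) / 2^m" for m
        have c: "continuous_on {0..real T} (\<lambda>t. B t \<omega>)" by (rule continuous_on_subset[OF elim]) auto
        have "(\<lambda>m. norm (B (S m) \<omega> - B (R m) \<omega>)) \<longlonglongrightarrow> norm (B s \<omega> - B t \<omega>)"
          unfolding S_def R_def by (intro tendsto_intros continuous_on_floor_dyadic[OF c] st)
        then have e1: "eventually (\<lambda>m. norm (B (S m) \<omega> - B (R m) \<omega>) > \<eta>) sequentially"
          using st(4) by (rule order_tendstoD(1))
        have "(\<lambda>m. \<bar>S m - R m\<bar>) \<longlonglongrightarrow> \<bar>s - t\<bar>"
          using floor_dyadic_LIMSEQ[of s] floor_dyadic_LIMSEQ[of t] st(1,2) unfolding S_def R_def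
          by (intro tendsto_intros) simp_all
        moreover have "\<bar>s - t\<bar> < 2 / 2^n0" using st(3) by (rule order.strict_trans1) (simp add: divide_strict_right_mono)
        ultimately have e2: "eventually (\<lambda>m. \<bar>S m - R m\<bar> < 2 / 2^n0) sequentially" by (rule order_tendstoD(2))
        obtain m where "norm (B (S m) \<omega> - B (R m) \<omega>) > \<eta>" "\<bar>S m - R m\<bar> < 2 / 2^n0"
          using eventually_happens[OF eventually_conj[OF e1 e2]] by auto
        moreover have "S m \<le> real T" "R m \<le> real T" using st(1,2) nat_floor_dyadic_le unfolding S_def R_def by auto
        ultimately have "P n0 \<omega>" unfolding P_def S_def R_def by blast
        then show "\<exists>n\<ge>n0. P n \<omega>" by blast
      qed
    qed
  qed simp
qed

lemma progressively_measurable_section: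
  fixes H :: "real \<Rightarrow> 'w \<Rightarrow> 'a::real_normed_vector"
  assumes H: "progressively_measurable \<F> H" and w: "\<omega> \<in> space M" and T: "T \<ge> 0"
  shows "(\<lambda>s. indicator {0..T} s *\<^sub>R H s \<omega>) \<in> borel_measurable borel"
proof -
  have "(\<lambda>(s, \<omega>). H s \<omega>) \<in> borel_measurable (restrict_space borel {0..T} \<Otimes>\<^sub>M \<F> T)"
    using H T unfolding progressively_measurable_def by auto
  then have "(\<lambda>s. (\<lambda>(s, \<omega>). H s \<omega>) (s, \<omega>)) \<in> borel_measurable (restrict_space borel {0..T})"
    by (rule measurable_Pair1) (simp add: w)
  then show ?thesis by (subst (asm) borel_measurable_restrict_space_iff) auto
qed

text \<open>\<open>null_in_probability\<close> speaks about \<open>measure\<close>, which is 0 on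
  non-measurable sets, so it yields information only for sets known to be events. The first one is
  handled by Fubini and progressive measurability. The second agrees, by path continuity, almost
  surely with a condition on countably many dyadic times.\<close>

lemma has_ito_integral_events:
  fixes H :: "real \<Rightarrow> 'w \<Rightarrow> 'm \<Rightarrow>\<^sub>L 'n::euclidean_space"
  assumes H: "progressively_measurable \<F> H" and I: "\<And>t. t \<ge> 0 \<Longrightarrow> I t \<in> borel_measurable (\<F> t)"
    and Ic: "AE \<omega> in M. continuous_on {0..} (\<lambda>t. I t \<omega>)"
    and S: "simple_integrand M \<F> k \<tau> \<eta>" and T: "T > 0" and \<epsilon>: "\<epsilon> \<ge> 0"
  shows "{\<omega>\<in>space M. ennreal \<epsilon> < (\<integral>\<^sup>+s\<in>{0..T}. ennreal ((norm (simple_process k \<tau> \<eta> s \<omega> - H s \<omega>))\<^sup>2) \<partial>lborel)} \<in> sets M"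
    and "{\<omega>\<in>space M. ennreal \<epsilon> < (SUP t\<in>{0..T}. ennreal (norm (simple_integral B k \<tau> \<eta> t \<omega> - I t \<omega>)))} \<in> sets M"
proof -
  have \<tau>0: "\<tau> j \<ge> 0" if "j \<le> k" for j
    using that
  proof (induction j)
    case 0 then show ?case using S unfolding simple_integrand_def by simp
  next
    case (Suc j)
    then have "0 \<le> \<tau> j" "\<tau> j \<le> \<tau> (Suc j)" using S unfolding simple_integrand_def by simp_all
    then show ?case by linarith
  qed
  have \<eta>m: "\<eta> j \<in> borel_measurable M" if "j < k" for j
    using S that measurable_F[of "\<eta> j" "\<tau> j"] unfolding simple_integrand_def by blast
  have idm: "(\<lambda>\<omega>. \<omega>) \<in> measurable M (\<F> T)"
    using sets_F[of T] by (intro measurableI) (auto simp: Int_absorb2 dest: sets.sets_into_space subsetD)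
  define \<nu> where "\<nu> = restrict_space (lborel :: real measure) {0..T}"
  have [measurable_cong]: "sets \<nu> = sets (restrict_space borel {0..T})" unfolding \<nu>_def by (simp cong: sets_restrict_space_cong)
  interpret \<nu>: sigma_finite_measure \<nu> unfolding \<nu>_def by (intro sigma_finite_measure_restrict_space) (auto intro: lborel.sigma_finite_measure_axioms)
  have Hm: "(\<lambda>(s, \<omega>). H s \<omega>) \<in> borel_measurable (restrict_space borel {0..T} \<Otimes>\<^sub>M \<F> T)"
    using H T unfolding progressively_measurable_def by auto
  have Hm2: "(\<lambda>x. H (snd x) (fst x)) \<in> borel_measurable (M \<Otimes>\<^sub>M \<nu>)"
  proof -
    have "(\<lambda>x. (snd x, fst x)) \<in> measurable (M \<Otimes>\<^sub>M \<nu>) (restrict_space borel {0..T} \<Otimes>\<^sub>M \<F> T)"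
      using idm by measurable
    from measurable_compose[OF this Hm] show ?thesis by (simp add: case_prod_beta)
  qed
  have SPm: "(\<lambda>x. simple_process k \<tau> \<eta> (snd x) (fst x)) \<in> borel_measurable (M \<Otimes>\<^sub>M \<nu>)"
    unfolding simple_process_def
  proof (intro borel_measurable_sum borel_measurable_scaleR)
    fix j assume "j \<in> {..<k}"
    then show "(\<lambda>x. \<eta> j (fst x)) \<in> borel_measurable (M \<Otimes>\<^sub>M \<nu>)"
      using \<eta>m[of j] by (intro measurable_compose[OF measurable_fst]) auto
    have "(\<lambda>s. indicat_real {\<tau> j<..\<tau> (Suc j)} s) \<in> borel_measurable \<nu>"
      by (subst measurable_cong_sets[OF \<open>sets \<nu> = _\<close> refl]) (intro measurable_restrict_space1, measurable)
    then show "(\<lambda>x. indicat_real {\<tau> j<..\<tau> (Suc j)} (snd x)) \<in> borel_measurable (M \<Otimes>\<^sub>M \<nu>)"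
      by (rule measurable_compose[OF measurable_snd])
  qed
  have "(\<lambda>x. ennreal ((norm (simple_process k \<tau> \<eta> (snd x) (fst x) - H (snd x) (fst x)))\<^sup>2)) \<in> borel_measurable (M \<Otimes>\<^sub>M \<nu>)"
    using Hm2 SPm by measurable
  then have "(\<lambda>(\<omega>, s). ennreal ((norm (simple_process k \<tau> \<eta> s \<omega> - H s \<omega>))\<^sup>2)) \<in> borel_measurable (M \<Otimes>\<^sub>M \<nu>)"
    by (simp add: case_prod_beta)
  from \<nu>.borel_measurable_nn_integral[OF this]
  have [measurable]: "(\<lambda>\<omega>. \<integral>\<^sup>+s. ennreal ((norm (simple_process k \<tau> \<eta> s \<omega> - H s \<omega>))\<^sup>2) \<partial>\<nu>) \<in> borel_measurable M" .
  have "(\<integral>\<^sup>+s\<in>{0..T}. ennreal ((norm (simple_process k \<tau> \<eta> s \<omega> - H s \<omega>))\<^sup>2) \<partial>lborel)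
    = (\<integral>\<^sup>+s. ennreal ((norm (simple_process k \<tau> \<eta> s \<omega> - H s \<omega>))\<^sup>2) \<partial>\<nu>)" for \<omega>
    unfolding \<nu>_def by (subst nn_integral_restrict_space) auto
  then show "{\<omega>\<in>space M. ennreal \<epsilon> < (\<integral>\<^sup>+s\<in>{0..T}. ennreal ((norm (simple_process k \<tau> \<eta> s \<omega> - H s \<omega>))\<^sup>2) \<partial>lborel)} \<in> sets M"
    by simp
  define D where "D t \<omega> = norm (simple_integral B k \<tau> \<eta> t \<omega> - I t \<omega>)" for t \<omega>
  have Dm[measurable]: "D t \<in> borel_measurable M" if "t \<ge> 0" for t
  proof -
    have [measurable]: "I t \<in> borel_measurable M" using measurable_F[OF I[OF that]] .
    have "(\<lambda>\<omega>. simple_integral B k \<tau> \<eta> t \<omega>) \<in> borel_measurable M"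
      unfolding simple_integral_def
    proof (intro borel_measurable_sum borel_measurable_blinfun_apply borel_measurable_diff)
      fix j assume "j \<in> {..<k}"
      then have "j < k" "\<tau> j \<ge> 0" "\<tau> (Suc j) \<ge> 0" using \<tau>0[of j] \<tau>0[of "Suc j"] by auto
      then show "\<eta> j \<in> borel_measurable M" "(\<lambda>\<omega>. B (min t (\<tau> (Suc j))) \<omega>) \<in> borel_measurable M"
         "(\<lambda>\<omega>. B (min t (\<tau> j)) \<omega>) \<in> borel_measurable M"
        using \<eta>m that by (auto intro!: B_measurable_M)
    qed
    then show ?thesis unfolding D_def by measurable
  qed
  define A where "A = {\<omega>\<in>space M. \<exists>m i. real i / 2^m \<le> T \<and> \<epsilon> < D (real i / 2^m) \<omega>}"
  have A: "A \<in> sets M" unfolding A_def by measurable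
  show "{\<omega>\<in>space M. ennreal \<epsilon> < (SUP t\<in>{0..T}. ennreal (norm (simple_integral B k \<tau> \<eta> t \<omega> - I t \<omega>)))} \<in> sets M"
  proof (rule AE_sets[OF A])
    show "AE \<omega> in M. \<omega> \<in> {\<omega>\<in>space M. ennreal \<epsilon> < (SUP t\<in>{0..T}. ennreal (norm (simple_integral B k \<tau> \<eta> t \<omega> - I t \<omega>)))} \<longleftrightarrow> \<omega> \<in> A"
      using Ic B_continuous AE_space
    proof eventually_elim
      case (elim \<omega>)
      have cB: "continuous_on {0..} (\<lambda>t. B (min t r) \<omega>)" if "r \<ge> 0" for r
        by (rule continuous_on_compose2[OF elim(2)]) (auto intro!: continuous_intros simp: that)
      have cD: "continuous_on {0..} (\<lambda>t. D t \<omega>)"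
        unfolding D_def simple_integral_def using elim(1) \<tau>0 cB
        by (intro continuous_intros) (auto simp: Suc_le_eq)
      have "ennreal \<epsilon> < (SUP t\<in>{0..T}. ennreal (D t \<omega>)) \<longleftrightarrow> (\<exists>m i. real i / 2^m \<le> T \<and> \<epsilon> < D (real i / 2^m) \<omega>)"
      proof
        assume "ennreal \<epsilon> < (SUP t\<in>{0..T}. ennreal (D t \<omega>))"
        then obtain t where t: "t \<in> {0..T}" "\<epsilon> < D t \<omega>"
          unfolding less_SUP_iff using \<epsilon> by (auto simp: ennreal_less_iff)
        have "(\<lambda>m. D (real (nat \<lfloor>t * 2^m\<rfloor>) / 2^m) \<omega>) \<longlonglongrightarrow> D t \<omega>"
          by (rule continuous_on_floor_dyadic[OF continuous_on_subset[OF cD] t(1)]) auto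
        then have "eventually (\<lambda>m. \<epsilon> < D (real (nat \<lfloor>t * 2^m\<rfloor>) / 2^m) \<omega>) sequentially"
          using t(2) by (rule order_tendstoD(1))
        then obtain m where "\<epsilon> < D (real (nat \<lfloor>t * 2^m\<rfloor>) / 2^m) \<omega>" using eventually_happens by force
        moreover have "real (nat \<lfloor>t * 2^m\<rfloor>) / 2^m \<le> T" using t nat_floor_dyadic_le by auto
        ultimately show "\<exists>m i. real i / 2^m \<le> T \<and> \<epsilon> < D (real i / 2^m) \<omega>" by blast
      next
        assume "\<exists>m i. real i / 2^m \<le> T \<and> \<epsilon> < D (real i / 2^m) \<omega>"
        then obtain m i where "real i / 2^m \<le> T" "\<epsilon> < D (real i / 2^m) \<omega>" by blast
        then show "ennreal \<epsilon> < (SUP t\<in>{0..T}. ennreal (D t \<omega>))"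
          unfolding less_SUP_iff using \<epsilon> by (intro bexI[of _ "real i / 2^m"]) (auto simp: ennreal_less_iff)
      qed
      then show ?case using elim(3) unfolding A_def D_def by simp
    qed
  qed auto
qed

end

section \<open>Sampling a simple integrand on a dyadic grid\<close>

lemma less_dyadic_iff:
  assumes "\<tau> \<ge> 0"
  shows "\<tau> < real l / 2^m \<longleftrightarrow> nat \<lfloor>\<tau> * 2^m\<rfloor> + 1 \<le> l"
proof -
  have "\<tau> < real l / 2^m \<longleftrightarrow> \<tau> * 2^m < real l" by (simp add: less_divide_eq)
  also have "\<dots> \<longleftrightarrow> \<lfloor>\<tau> * 2^m\<rfloor> < int l" by (simp add: floor_less_iff)
  also have "\<dots> \<longleftrightarrow> nat \<lfloor>\<tau> * 2^m\<rfloor> + 1 \<le> l" using assms by (auto simp: nat_less_iff Suc_le_eq)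
  finally show ?thesis .
qed

lemma sum_increments_after:
  fixes b :: "nat \<Rightarrow> 'a::ab_group_add"
  shows "(\<Sum>l<i. if a \<le> l then b (Suc l) - b l else 0) = b i - b (min i a)"
proof (induction i)
  case (Suc i)
  then show ?case by (cases "a \<le> i") (auto simp: min_def not_le le_Suc_eq)
qed simp

lemma min_dyadic_close:
  assumes "\<tau> \<ge> 0"
  shows "\<bar>real (min i (nat \<lfloor>\<tau> * 2^m\<rfloor> + 1)) / 2^m - min (real i / 2^m) \<tau>\<bar> \<le> 1 / 2^m"
proof -
  define a where "a = nat \<lfloor>\<tau> * 2^m\<rfloor> + 1"
  have ar: "real a = real_of_int \<lfloor>\<tau> * 2^m\<rfloor> + 1" using assms by (simp add: a_def)
  have 1: "real a / 2^m \<le> \<tau> + 1 / 2^m" using floor_dyadic_le[of \<tau> m] by (simp add: ar add_divide_distrib)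
  have 2: "\<tau> < real a / 2^m" using floor_dyadic_gt[of \<tau> m] by (simp add: ar add_divide_distrib)
  show ?thesis
  proof (cases "i \<le> a")
    case True
    have h0: "0 \<le> 1 / (2::real)^m" by simp
    have "real i / 2^m \<le> real a / 2^m" using True by (simp add: divide_right_mono)
    then show ?thesis using True 1 2 h0 unfolding a_def[symmetric] by (auto simp: min_def)
  next
    case False
    then have "real a / 2^m \<le> real i / 2^m" by (simp add: divide_right_mono)
    then show ?thesis using False 1 2 unfolding a_def[symmetric] by (auto simp: min_def)
  qed
qed

text \<open>Sampling at left grid points amounts to moving every partition time to the first grid
  time strictly after it, hence the + 1: the partition intervals exclude their left end point. After
  summation over the cells only the increments between the moved times remain, so the error in the
  integral is a matter of the modulus of continuity of B.\<close>

lemma simple_process_dyadic_integral: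
  fixes \<eta> :: "nat \<Rightarrow> 'w \<Rightarrow> 'm::euclidean_space \<Rightarrow>\<^sub>L 'n::euclidean_space"
  assumes \<tau>: "\<And>j. j \<le> k \<Longrightarrow> \<tau> j \<ge> 0" "\<And>j. j < k \<Longrightarrow> \<tau> j \<le> \<tau> (Suc j)"
  shows "(\<Sum>l<i. blinfun_apply (simple_process k \<tau> \<eta> (real l / 2^m) \<omega>) (B (real (Suc l) / 2^m) \<omega> - B (real l / 2^m) \<omega>))
    = (\<Sum>j<k. blinfun_apply (\<eta> j \<omega>)
        (B (real (min i (nat \<lfloor>\<tau> (Suc j) * 2^m\<rfloor> + 1)) / 2^m) \<omega> - B (real (min i (nat \<lfloor>\<tau> j * 2^m\<rfloor> + 1)) / 2^m) \<omega>))"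
proof -
  define b where "b l = B (real l / 2^m) \<omega>" for l
  define a where "a j = nat \<lfloor>\<tau> j * 2^m\<rfloor> + 1" for j
  have ind: "indicat_real {\<tau> j<..\<tau> (Suc j)} (real l / 2^m) *\<^sub>R (b (Suc l) - b l)
     = (if a j \<le> l then b (Suc l) - b l else 0) - (if a (Suc j) \<le> l then b (Suc l) - b l else 0)" if "j < k" for j l
  proof -
    have "\<tau> j < real l / 2^m \<longleftrightarrow> a j \<le> l" "\<tau> (Suc j) < real l / 2^m \<longleftrightarrow> a (Suc j) \<le> l"
      unfolding a_def by (intro less_dyadic_iff \<tau>; use that in simp)+
    moreover have "\<tau> j \<le> \<tau> (Suc j)" by (rule \<tau>(2)[OF that])
    ultimately show ?thesis by (auto simp: indicator_def not_less[symmetric])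
  qed
  have "(\<Sum>l<i. blinfun_apply (simple_process k \<tau> \<eta> (real l / 2^m) \<omega>) (b (Suc l) - b l))
    = (\<Sum>l<i. \<Sum>j<k. blinfun_apply (\<eta> j \<omega>) (indicat_real {\<tau> j<..\<tau> (Suc j)} (real l / 2^m) *\<^sub>R (b (Suc l) - b l)))"
    by (simp add: simple_process_def blinfun.sum_left blinfun.scaleR_left blinfun.scaleR_right)
  also have "\<dots> = (\<Sum>j<k. blinfun_apply (\<eta> j \<omega>) (\<Sum>l<i. indicat_real {\<tau> j<..\<tau> (Suc j)} (real l / 2^m) *\<^sub>R (b (Suc l) - b l)))"
    by (subst sum.swap) (simp only: blinfun.sum_right)
  also have "\<dots> = (\<Sum>j<k. blinfun_apply (\<eta> j \<omega>) (b (min i (a (Suc j))) - b (min i (a j))))"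
  proof (intro sum.cong refl arg_cong[where f="blinfun_apply _"])
    fix j assume "j \<in> {..<k}"
    then have "(\<Sum>l<i. indicat_real {\<tau> j<..\<tau> (Suc j)} (real l / 2^m) *\<^sub>R (b (Suc l) - b l)) =
      (\<Sum>l<i. (if a j \<le> l then b (Suc l) - b l else 0)) - (\<Sum>l<i. (if a (Suc j) \<le> l then b (Suc l) - b l else 0))"
      by (simp add: ind sum_subtractf)
    then show "(\<Sum>l<i. indicat_real {\<tau> j<..\<tau> (Suc j)} (real l / 2^m) *\<^sub>R (b (Suc l) - b l)) = b (min i (a (Suc j))) - b (min i (a j))"
      by (simp add: sum_increments_after)
  qed
  finally show ?thesis by (simp add: b_def a_def)
qed

text \<open>Rounding s down changes the value only if a partition time lies at most 2^-m before s;
  there the crude bound by twice the sum of all coefficients is used.\<close>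

lemma simple_process_floor:
  fixes \<eta> :: "nat \<Rightarrow> 'w \<Rightarrow> 'm::euclidean_space \<Rightarrow>\<^sub>L 'n::euclidean_space"
  assumes \<eta>: "\<And>j. j < k \<Longrightarrow> norm (\<eta> j \<omega>) \<le> c j" and s: "s \<ge> 0"
  shows "(norm (simple_process k \<tau> \<eta> (real (nat \<lfloor>s * 2^m\<rfloor>) / 2^m) \<omega> - simple_process k \<tau> \<eta> s \<omega>))\<^sup>2
     \<le> (\<Sum>j\<le>k. (2 * (\<Sum>j<k. c j))\<^sup>2 * indicator {\<tau> j..\<tau> j + 1 / 2^m} s)"
proof (cases "\<exists>j\<le>k. s \<in> {\<tau> j..\<tau> j + 1 / 2^m}")
  case False
  define s' where "s' = real (nat \<lfloor>s * 2^m\<rfloor>) / 2^m"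
  have s': "s' \<le> s" "s - 1 / 2^m < s'"
    using floor_dyadic_le[of s m] floor_dyadic_gt[of s m] s by (auto simp: s'_def)
  have "\<tau> j < s' \<longleftrightarrow> \<tau> j < s" if "j \<le> k" for j using False that s' by force
  then have "indicat_real {\<tau> j<..\<tau> (Suc j)} s' = indicator {\<tau> j<..\<tau> (Suc j)} s" if "j < k" for j
    using that by (auto simp: indicator_def not_less[symmetric] Suc_le_eq)
  then have "simple_process k \<tau> \<eta> s' \<omega> = simple_process k \<tau> \<eta> s \<omega>" by (simp add: simple_process_def)
  then show ?thesis by (simp add: s'_def sum_nonneg)
next
  case True
  have bd: "norm (simple_process k \<tau> \<eta> r \<omega>) \<le> (\<Sum>j<k. c j)" for r
    unfolding simple_process_def
  proof (rule order_trans[OF norm_sum sum_mono])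
    fix j assume "j \<in> {..<k}"
    then have "norm (\<eta> j \<omega>) \<le> c j" "0 \<le> c j" using \<eta>[of j] order_trans[OF norm_ge_zero \<eta>[of j]] by auto
    then show "norm (indicat_real {\<tau> j<..\<tau> (Suc j)} r *\<^sub>R \<eta> j \<omega>) \<le> c j" by (auto simp: indicator_def)
  qed
  from True obtain j0 where j0: "j0 \<le> k" "s \<in> {\<tau> j0..\<tau> j0 + 1 / 2^m}" by blast
  have "(norm (simple_process k \<tau> \<eta> (real (nat \<lfloor>s * 2^m\<rfloor>) / 2^m) \<omega> - simple_process k \<tau> \<eta> s \<omega>))\<^sup>2
     \<le> (2 * (\<Sum>j<k. c j))\<^sup>2"
  proof (intro power_mono)
    show "norm (simple_process k \<tau> \<eta> (real (nat \<lfloor>s * 2^m\<rfloor>) / 2^m) \<omega> - simple_process k \<tau> \<eta> s \<omega>) \<le> 2 * (\<Sum>j<k. c j)"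
      using norm_triangle_ineq4 bd by (smt (verit))
  qed simp
  also have "\<dots> = (\<Sum>j\<in>{j0}. (2 * (\<Sum>j<k. c j))\<^sup>2 * indicator {\<tau> j..\<tau> j + 1 / 2^m} s)" using j0 by simp
  also have "\<dots> \<le> (\<Sum>j\<le>k. (2 * (\<Sum>j<k. c j))\<^sup>2 * indicator {\<tau> j..\<tau> j + 1 / 2^m} s)"
    using j0 by (intro sum_mono2) auto
  finally show ?thesis .
qed

context brownian_setting
begin

lemma null_in_probabilityD:
  assumes n: "null_in_probability M Z" and m: "\<And>n. {\<omega>\<in>space M. ennreal \<epsilon> < Z n \<omega>} \<in> sets M" and \<epsilon>: "\<epsilon> > 0" "\<delta> > 0"
  shows "eventually (\<lambda>n. outer_prob_le M (\<lambda>\<omega>. ennreal \<epsilon> < Z n \<omega>) \<delta>) sequentially"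
proof -
  have "(\<lambda>n. prob {\<omega>\<in>space M. ennreal \<epsilon> < Z n \<omega>}) \<longlonglongrightarrow> 0" using n \<epsilon>(1) unfolding null_in_probability_def by blast
  then have "eventually (\<lambda>n. prob {\<omega>\<in>space M. ennreal \<epsilon> < Z n \<omega>} < \<delta>) sequentially"
    using \<epsilon>(2) by (rule order_tendstoD(2))
  then show ?thesis by eventually_elim (intro outer_prob_leI m, simp)
qed

text \<open>Trades the given partition for every sufficiently fine dyadic grid. This freedom is what
  later allows two integrands to share a grid.\<close>

lemma simple_integrand_dyadic:
  fixes \<eta> :: "nat \<Rightarrow> 'w \<Rightarrow> 'm \<Rightarrow>\<^sub>L 'n::euclidean_space"
  assumes S: "simple_integrand M \<F> k \<tau> \<eta>" and \<epsilon>: "\<epsilon> > 0"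
  shows "\<exists>K\<ge>0. \<exists>m0. (\<forall>t. \<forall>\<omega>\<in>space M. norm (simple_process k \<tau> \<eta> t \<omega>) \<le> K) \<and>
     (\<forall>m i. simple_process k \<tau> \<eta> (real i / 2^m) \<in> borel_measurable (\<F> (real i / 2^m))) \<and>
     (\<forall>m\<ge>m0. \<forall>\<omega>\<in>space M.
        (\<integral>\<^sup>+s. ennreal ((norm (simple_process k \<tau> \<eta> (real (nat \<lfloor>s * 2^m\<rfloor>) / 2^m) \<omega> - simple_process k \<tau> \<eta> s \<omega>))\<^sup>2) * indicator {0..real T} s \<partial>lborel) \<le> ennreal \<epsilon>) \<and>
     (\<forall>m\<ge>m0. outer_prob_le M (\<lambda>\<omega>. \<exists>i\<le>T * 2^m. norm (
        (\<Sum>l<i. blinfun_apply (simple_process k \<tau> \<eta> (real l / 2^m) \<omega>) (B (real (Suc l) / 2^m) \<omega> - B (real l / 2^m) \<omega>))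
        - simple_integral B k \<tau> \<eta> (real i / 2^m) \<omega>) > \<epsilon>) \<epsilon>)"
proof -
  have \<tau>S: "\<tau> j \<le> \<tau> (Suc j)" if "j < k" for j using S that unfolding simple_integrand_def by simp
  have \<tau>0: "\<tau> j \<ge> 0" if "j \<le> k" for j
    using that
  proof (induction j)
    case 0 then show ?case using S unfolding simple_integrand_def by simp
  next
    case (Suc j)
    then have "0 \<le> \<tau> j" "\<tau> j \<le> \<tau> (Suc j)" using \<tau>S by simp_all
    then show ?case by linarith
  qed
  have "\<exists>c. \<forall>\<omega>\<in>space M. norm (\<eta> j \<omega>) \<le> c" if "j < k" for j
    using S that unfolding simple_integrand_def bounded_iff by auto
  then obtain c where c: "\<And>j \<omega>. j < k \<Longrightarrow> \<omega> \<in> space M \<Longrightarrow> norm (\<eta> j \<omega>) \<le> c j" by metis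
  have "\<exists>\<omega>. \<omega> \<in> space M" using not_empty by blast
  then have c0: "c j \<ge> 0" if "j < k" for j using c[OF that] by (meson norm_ge_zero order_trans)
  define K where "K = (\<Sum>j<k. c j)"
  have K: "K \<ge> 0" unfolding K_def using c0 by (intro sum_nonneg) auto
  have bd: "norm (simple_process k \<tau> \<eta> t \<omega>) \<le> K" if "\<omega> \<in> space M" for t \<omega>
    unfolding simple_process_def K_def
  proof (rule order_trans[OF norm_sum sum_mono])
    fix j assume "j \<in> {..<k}"
    then show "norm (indicat_real {\<tau> j<..\<tau> (Suc j)} t *\<^sub>R \<eta> j \<omega>) \<le> c j" using c[of j \<omega>] c0[of j] that by (auto simp: indicator_def)
  qed
  have meas: "simple_process k \<tau> \<eta> t \<in> borel_measurable (\<F> t)" for t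
  proof -
    have "(\<lambda>\<omega>. indicat_real {\<tau> j<..\<tau> (Suc j)} t *\<^sub>R \<eta> j \<omega>) \<in> borel_measurable (\<F> t)" if "j < k" for j
    proof (cases "\<tau> j < t")
      case True
      have "\<eta> j \<in> borel_measurable (\<F> (\<tau> j))" using S that unfolding simple_integrand_def by blast
      then have [measurable]: "\<eta> j \<in> borel_measurable (\<F> t)"
        by (rule measurable_F_mono) (use True in simp)
      show ?thesis by measurable
    qed (simp add: indicator_def)
    then show ?thesis unfolding simple_process_def[abs_def] by (intro borel_measurable_sum) auto
  qed
  \<comment> \<open>Each increment of B is displaced at both ends, so the integral moves by at most
    2 K \<open>\<eta>'\<close>; the + 1 covers K = 0.\<close>
  define \<eta>' where "\<eta>' = \<epsilon> / (2 * K + 1)"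
  have \<eta>': "\<eta>' > 0" using \<epsilon> K by (simp add: \<eta>'_def)
  have K\<eta>': "2 * K * \<eta>' \<le> \<epsilon>"
  proof -
    have "2 * K * \<eta>' \<le> (2 * K + 1) * \<eta>'" using \<eta>' by (intro mult_right_mono) auto
    then show ?thesis using K by (simp add: \<eta>'_def)
  qed
  obtain n0 where n0: "outer_prob_le M (\<lambda>\<omega>. \<exists>s\<in>{0..real T}. \<exists>t\<in>{0..real T}. \<bar>s - t\<bar> \<le> 1 / 2^n0 \<and> norm (B s \<omega> - B t \<omega>) > \<eta>') \<epsilon>"
    using B_modulus[OF \<eta>' \<epsilon>] by blast
  \<comment> \<open>Each of the k + 1 partition times spoils an interval of length 2^-m, on which
    the squared error is at most (2 K)^2.\<close>
  define W where "W = real (Suc k) * (2 * K)\<^sup>2 + 1"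
  have W: "W > 0" by (simp add: W_def add_nonneg_pos)
  obtain n1 where n1: "(1/2)^n1 < \<epsilon> / W" using real_arch_pow_inv[of "\<epsilon> / W" "1/2"] \<epsilon> W by auto
  define m0 where "m0 = max n0 n1"
  show ?thesis
  proof (intro exI[of _ K] conjI K exI[of _ m0] allI ballI impI bd meas)
    fix m \<omega> assume m: "m0 \<le> m" and w: "\<omega> \<in> space M"
    have "1 / 2^m \<le> (1/2 :: real)^n1" using m by (simp add: m0_def power_one_over[symmetric] power_decreasing)
    then have "W * (1 / 2^m) \<le> W * (\<epsilon> / W)" using n1 W by (intro mult_left_mono) auto
    then have small: "W * (1 / 2^m) \<le> \<epsilon>" using W by simp
    have "(\<integral>\<^sup>+s. ennreal ((norm (simple_process k \<tau> \<eta> (real (nat \<lfloor>s * 2^m\<rfloor>) / 2^m) \<omega> - simple_process k \<tau> \<eta> s \<omega>))\<^sup>2) * indicator {0..real T} s \<partial>lborel)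
      \<le> (\<integral>\<^sup>+s. (\<Sum>j\<le>k. ennreal ((2 * K)\<^sup>2) * indicator {\<tau> j..\<tau> j + 1 / 2^m} s) \<partial>lborel)"
    proof (intro nn_integral_mono)
      fix s
      show "ennreal ((norm (simple_process k \<tau> \<eta> (real (nat \<lfloor>s * 2^m\<rfloor>) / 2^m) \<omega> - simple_process k \<tau> \<eta> s \<omega>))\<^sup>2) * indicator {0..real T} s
        \<le> (\<Sum>j\<le>k. ennreal ((2 * K)\<^sup>2) * indicator {\<tau> j..\<tau> j + 1 / 2^m} s)"
      proof (cases "s \<in> {0..real T}")
        case True
        have "ennreal ((norm (simple_process k \<tau> \<eta> (real (nat \<lfloor>s * 2^m\<rfloor>) / 2^m) \<omega> - simple_process k \<tau> \<eta> s \<omega>))\<^sup>2)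
          \<le> ennreal (\<Sum>j\<le>k. (2 * K)\<^sup>2 * indicator {\<tau> j..\<tau> j + 1 / 2^m} s)"
          unfolding K_def using True c w by (intro ennreal_leI simple_process_floor) auto
        also have "\<dots> = (\<Sum>j\<le>k. ennreal ((2 * K)\<^sup>2) * indicator {\<tau> j..\<tau> j + 1 / 2^m} s)"
          by (subst sum_ennreal[symmetric]) (auto simp: ennreal_mult' ennreal_indicator)
        finally show ?thesis using True by simp
      qed simp
    qed
    also have "\<dots> = (\<Sum>j\<le>k. ennreal ((2 * K)\<^sup>2) * ennreal (1 / 2^m))"
      by (subst nn_integral_sum) (auto simp: nn_integral_cmult_indicator)
    also have "\<dots> = ennreal (real (Suc k) * (2 * K)\<^sup>2 * (1 / 2^m))"
      by (simp add: ennreal_mult[symmetric] ennreal_of_nat_eq_real_of_nat mult.assoc del: power_mult_distrib of_nat_Suc)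
    also have "\<dots> \<le> ennreal \<epsilon>"
    proof (rule ennreal_leI)
      have "real (Suc k) * (2 * K)\<^sup>2 * (1 / 2^m) \<le> W * (1 / 2^m)"
        by (intro mult_right_mono) (simp_all add: W_def)
      then show "real (Suc k) * (2 * K)\<^sup>2 * (1 / 2^m) \<le> \<epsilon>" using small by linarith
    qed
    finally show "(\<integral>\<^sup>+s. ennreal ((norm (simple_process k \<tau> \<eta> (real (nat \<lfloor>s * 2^m\<rfloor>) / 2^m) \<omega> - simple_process k \<tau> \<eta> s \<omega>))\<^sup>2) * indicator {0..real T} s \<partial>lborel) \<le> ennreal \<epsilon>" .
  next
    fix m assume m: "m0 \<le> m"
    show "outer_prob_le M (\<lambda>\<omega>. \<exists>i\<le>T * 2^m. norm (
        (\<Sum>l<i. blinfun_apply (simple_process k \<tau> \<eta> (real l / 2^m) \<omega>) (B (real (Suc l) / 2^m) \<omega> - B (real l / 2^m) \<omega>))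
        - simple_integral B k \<tau> \<eta> (real i / 2^m) \<omega>) > \<epsilon>) \<epsilon>"
    proof (rule outer_prob_le_mono[OF n0 _ order_refl], rule ccontr)
      fix \<omega> assume w: "\<omega> \<in> space M"
      assume "\<not> (\<exists>s\<in>{0..real T}. \<exists>t\<in>{0..real T}. \<bar>s - t\<bar> \<le> 1 / 2^n0 \<and> norm (B s \<omega> - B t \<omega>) > \<eta>')"
      then have md: "norm (B s \<omega> - B t \<omega>) \<le> \<eta>'" if "s \<in> {0..real T}" "t \<in> {0..real T}" "\<bar>s - t\<bar> \<le> 1 / 2^n0" for s t
        using that by force
      assume "\<exists>i\<le>T * 2^m. norm (
        (\<Sum>l<i. blinfun_apply (simple_process k \<tau> \<eta> (real l / 2^m) \<omega>) (B (real (Suc l) / 2^m) \<omega> - B (real l / 2^m) \<omega>))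
        - simple_integral B k \<tau> \<eta> (real i / 2^m) \<omega>) > \<epsilon>"
      then obtain i where i: "i \<le> T * 2^m" and big: "norm (
        (\<Sum>l<i. blinfun_apply (simple_process k \<tau> \<eta> (real l / 2^m) \<omega>) (B (real (Suc l) / 2^m) \<omega> - B (real l / 2^m) \<omega>))
        - simple_integral B k \<tau> \<eta> (real i / 2^m) \<omega>) > \<epsilon>" by blast
      define p where "p j = real (min i (nat \<lfloor>\<tau> j * 2^m\<rfloor> + 1)) / 2^m" for j
      define r where "r j = min (real i / 2^m) (\<tau> j)" for j
      have iT: "real i / 2^m \<le> real T"
      proof -
        have "real i \<le> real (T * 2^m)" using i by (simp only: of_nat_le_iff)
        then show ?thesis by (simp add: divide_le_eq)
      qed
      have pr: "norm (B (p j) \<omega> - B (r j) \<omega>) \<le> \<eta>'" if "j \<le> k" for j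
      proof (rule md)
        have "p j \<le> real i / 2^m" unfolding p_def by (simp add: divide_right_mono)
        then show "p j \<in> {0..real T}" using iT by (auto simp: p_def)
        show "r j \<in> {0..real T}" using iT \<tau>0[OF that] by (auto simp: r_def)
        have "\<bar>p j - r j\<bar> \<le> 1 / 2^m" unfolding p_def r_def by (rule min_dyadic_close[OF \<tau>0[OF that]])
        also have "1 / 2^m \<le> 1 / (2::real)^n0" using m by (intro divide_left_mono power_increasing) (auto simp: m0_def)
        finally show "\<bar>p j - r j\<bar> \<le> 1 / 2^n0" .
      qed
      have "(\<Sum>l<i. blinfun_apply (simple_process k \<tau> \<eta> (real l / 2^m) \<omega>) (B (real (Suc l) / 2^m) \<omega> - B (real l / 2^m) \<omega>))
        - simple_integral B k \<tau> \<eta> (real i / 2^m) \<omega>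
        = (\<Sum>j<k. blinfun_apply (\<eta> j \<omega>) (B (p (Suc j)) \<omega> - B (p j) \<omega>)) - (\<Sum>j<k. blinfun_apply (\<eta> j \<omega>) (B (r (Suc j)) \<omega> - B (r j) \<omega>))"
        using \<tau>0 \<tau>S by (subst simple_process_dyadic_integral) (simp_all add: simple_integral_def p_def r_def)
      also have "\<dots> = (\<Sum>j<k. blinfun_apply (\<eta> j \<omega>) ((B (p (Suc j)) \<omega> - B (r (Suc j)) \<omega>) - (B (p j) \<omega> - B (r j) \<omega>)))"
        unfolding sum_subtractf[symmetric] blinfun.diff_right by (intro sum.cong refl) simp
      also have "norm \<dots> \<le> (\<Sum>j<k. c j * (2 * \<eta>'))"
      proof (rule order_trans[OF norm_sum sum_mono])
        fix j assume j: "j \<in> {..<k}"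
        have "norm ((B (p (Suc j)) \<omega> - B (r (Suc j)) \<omega>) - (B (p j) \<omega> - B (r j) \<omega>)) \<le> 2 * \<eta>'"
          using pr[of j] pr[of "Suc j"] j norm_triangle_ineq4[of "B (p (Suc j)) \<omega> - B (r (Suc j)) \<omega>" "B (p j) \<omega> - B (r j) \<omega>"] by simp
        then show "norm (blinfun_apply (\<eta> j \<omega>) ((B (p (Suc j)) \<omega> - B (r (Suc j)) \<omega>) - (B (p j) \<omega> - B (r j) \<omega>))) \<le> c j * (2 * \<eta>')"
          using c[of j \<omega>] c0[of j] j w by (intro order_trans[OF norm_blinfun mult_mono]) auto
      qed
      also have "\<dots> = 2 * K * \<eta>'" by (simp add: K_def sum_distrib_right[symmetric])
      finally show False using big K\<eta>' by linarith
    qed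
  qed
qed

text \<open>Two approximations in a row: one simple integrand is fixed that is good enough in
  probability, and then it alone is sampled. The sampling error concerns a bounded process with
  finitely many jumps, so it can be controlled on every fine grid.\<close>

lemma has_ito_integral_dyadic_approx:
  fixes H :: "real \<Rightarrow> 'w \<Rightarrow> 'm \<Rightarrow>\<^sub>L 'n::euclidean_space"
  assumes ito: "has_ito_integral M \<F> B H I"
  shows "dyadic_approx H I"
  unfolding dyadic_approx_def
proof (intro conjI ballI allI impI)
  have prog: "progressively_measurable \<F> H" and Im: "\<And>t. t \<ge> 0 \<Longrightarrow> I t \<in> borel_measurable (\<F> t)"
    and Ic: "AE \<omega> in M. continuous_on {0..} (\<lambda>t. I t \<omega>)"
    using ito unfolding has_ito_integral_def by auto
  show sec: "(\<lambda>s. indicator {0..real T} s *\<^sub>R H s \<omega>) \<in> borel_measurable borel" if "\<omega> \<in> space M" for \<omega> and T :: nat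
    by (rule progressively_measurable_section[OF prog that]) simp
  obtain k \<tau> \<eta> where S: "\<And>n. simple_integrand M \<F> (k n) (\<tau> n) (\<eta> n)"
    and N1: "\<And>T. T > 0 \<Longrightarrow> null_in_probability M (\<lambda>n \<omega>. \<integral>\<^sup>+s\<in>{0..T}.
             ennreal ((norm (simple_process (k n) (\<tau> n) (\<eta> n) s \<omega> - H s \<omega>))\<^sup>2) \<partial>lborel)"
    and N2: "\<And>T. T > 0 \<Longrightarrow> null_in_probability M (\<lambda>n \<omega>. SUP t\<in>{0..T}.
             ennreal (norm (simple_integral B (k n) (\<tau> n) (\<eta> n) t \<omega> - I t \<omega>)))"
    using ito unfolding has_ito_integral_def by blast
  fix \<epsilon> :: real and T :: nat assume \<epsilon>: "\<epsilon> > 0"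
  \<comment> \<open>Three exceptional events of probability \<open>\<delta>\<close> have to fit into
    \<open>\<epsilon>\<close>, and so has the squared error 2 \<open>\<delta>\<close> + 2
    \<open>\<delta>\<close>.\<close>
  define \<delta> where "\<delta> = \<epsilon> / 4"
  have \<delta>: "\<delta> > 0" using \<epsilon> by (simp add: \<delta>_def)
  \<comment> \<open>The horizon T may be 0 here, whereas the definition of the Ito integral speaks
    about positive horizons.\<close>
  define T' where "T' = real T + 1"
  have T': "T' > 0" by (simp add: T'_def)
  have e1: "eventually (\<lambda>n. outer_prob_le M (\<lambda>\<omega>. ennreal \<delta> < (\<integral>\<^sup>+s\<in>{0..T'}.
             ennreal ((norm (simple_process (k n) (\<tau> n) (\<eta> n) s \<omega> - H s \<omega>))\<^sup>2) \<partial>lborel)) \<delta>) sequentially"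
    using \<delta> by (intro null_in_probabilityD[OF N1[OF T']] has_ito_integral_events(1)[OF prog Im Ic S T']) auto
  have e2: "eventually (\<lambda>n. outer_prob_le M (\<lambda>\<omega>. ennreal \<delta> < (SUP t\<in>{0..T'}.
             ennreal (norm (simple_integral B (k n) (\<tau> n) (\<eta> n) t \<omega> - I t \<omega>)))) \<delta>) sequentially"
    using \<delta> by (intro null_in_probabilityD[OF N2[OF T']] has_ito_integral_events(2)[OF prog Im Ic S T']) auto
  obtain n where n1: "outer_prob_le M (\<lambda>\<omega>. ennreal \<delta> < (\<integral>\<^sup>+s\<in>{0..T'}.
             ennreal ((norm (simple_process (k n) (\<tau> n) (\<eta> n) s \<omega> - H s \<omega>))\<^sup>2) \<partial>lborel)) \<delta>"
     and n2: "outer_prob_le M (\<lambda>\<omega>. ennreal \<delta> < (SUP t\<in>{0..T'}.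
             ennreal (norm (simple_integral B (k n) (\<tau> n) (\<eta> n) t \<omega> - I t \<omega>)))) \<delta>"
    using eventually_happens[OF eventually_conj[OF e1 e2]] by auto
  define P where "P = simple_process (k n) (\<tau> n) (\<eta> n)"
  obtain K m0 where K: "K \<ge> 0" "\<And>t \<omega>. \<omega> \<in> space M \<Longrightarrow> norm (P t \<omega>) \<le> K"
     and Pm: "\<And>m i. P (real i / 2^m) \<in> borel_measurable (\<F> (real i / 2^m))"
     and P1: "\<And>m \<omega>. m \<ge> m0 \<Longrightarrow> \<omega> \<in> space M \<Longrightarrow>
        (\<integral>\<^sup>+s. ennreal ((norm (P (real (nat \<lfloor>s * 2^m\<rfloor>) / 2^m) \<omega> - P s \<omega>))\<^sup>2) * indicator {0..real T} s \<partial>lborel) \<le> ennreal \<delta>"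
     and P2: "\<And>m. m \<ge> m0 \<Longrightarrow> outer_prob_le M (\<lambda>\<omega>. \<exists>i\<le>T * 2^m. norm (
        (\<Sum>l<i. blinfun_apply (P (real l / 2^m) \<omega>) (B (real (Suc l) / 2^m) \<omega> - B (real l / 2^m) \<omega>))
        - simple_integral B (k n) (\<tau> n) (\<eta> n) (real i / 2^m) \<omega>) > \<delta>) \<delta>"
    using simple_integrand_dyadic[OF S[of n] \<delta>, of T] unfolding P_def by blast
  show "\<exists>K\<ge>0. \<exists>m0. \<forall>m\<ge>m0. \<exists>G.
        (\<forall>i. G i \<in> borel_measurable (\<F> (real i / 2^m))) \<and> (\<forall>i. \<forall>\<omega>\<in>space M. norm (G i \<omega>) \<le> K) \<and>
        outer_prob_le M (\<lambda>\<omega>. \<not> (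
          (\<integral>\<^sup>+s. ennreal ((norm (G (nat \<lfloor>s * 2^m\<rfloor>) \<omega> - H s \<omega>))\<^sup>2) * indicator {0..real T} s \<partial>lborel) \<le> ennreal \<epsilon> \<and>
          (\<forall>i\<le>T * 2^m. norm ((\<Sum>l<i. blinfun_apply (G l \<omega>) (B (real (Suc l) / 2^m) \<omega> - B (real l / 2^m) \<omega>))
             - I (real i / 2^m) \<omega>) \<le> \<epsilon>))) \<epsilon>"
  proof (intro exI[of _ K] conjI K(1) exI[of _ m0] allI impI)
    fix m assume m: "m0 \<le> m"
    show "\<exists>G. (\<forall>i. G i \<in> borel_measurable (\<F> (real i / 2^m))) \<and> (\<forall>i. \<forall>\<omega>\<in>space M. norm (G i \<omega>) \<le> K) \<and>
        outer_prob_le M (\<lambda>\<omega>. \<not> (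
          (\<integral>\<^sup>+s. ennreal ((norm (G (nat \<lfloor>s * 2^m\<rfloor>) \<omega> - H s \<omega>))\<^sup>2) * indicator {0..real T} s \<partial>lborel) \<le> ennreal \<epsilon> \<and>
          (\<forall>i\<le>T * 2^m. norm ((\<Sum>l<i. blinfun_apply (G l \<omega>) (B (real (Suc l) / 2^m) \<omega> - B (real l / 2^m) \<omega>))
             - I (real i / 2^m) \<omega>) \<le> \<epsilon>))) \<epsilon>"
    proof (intro exI[of _ "\<lambda>i. P (real i / 2^m)"] conjI allI ballI Pm K(2))
      show "outer_prob_le M (\<lambda>\<omega>. \<not> (
          (\<integral>\<^sup>+s. ennreal ((norm (P (real (nat \<lfloor>s * 2^m\<rfloor>) / 2^m) \<omega> - H s \<omega>))\<^sup>2) * indicator {0..real T} s \<partial>lborel) \<le> ennreal \<epsilon> \<and>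
          (\<forall>i\<le>T * 2^m. norm ((\<Sum>l<i. blinfun_apply (P (real l / 2^m) \<omega>) (B (real (Suc l) / 2^m) \<omega> - B (real l / 2^m) \<omega>))
             - I (real i / 2^m) \<omega>) \<le> \<epsilon>))) \<epsilon>"
      proof (rule outer_prob_le_mono[OF outer_prob_le_disj[OF n1 outer_prob_le_disj[OF n2 P2[OF m]]]], rule ccontr)
        fix \<omega> assume w: "\<omega> \<in> space M"
        assume neg: "\<not> (
          (\<integral>\<^sup>+s. ennreal ((norm (P (real (nat \<lfloor>s * 2^m\<rfloor>) / 2^m) \<omega> - H s \<omega>))\<^sup>2) * indicator {0..real T} s \<partial>lborel) \<le> ennreal \<epsilon> \<and>
          (\<forall>i\<le>T * 2^m. norm ((\<Sum>l<i. blinfun_apply (P (real l / 2^m) \<omega>) (B (real (Suc l) / 2^m) \<omega> - B (real l / 2^m) \<omega>))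
             - I (real i / 2^m) \<omega>) \<le> \<epsilon>))"
        assume "\<not> (ennreal \<delta> < (\<integral>\<^sup>+s\<in>{0..T'}.
             ennreal ((norm (simple_process (k n) (\<tau> n) (\<eta> n) s \<omega> - H s \<omega>))\<^sup>2) \<partial>lborel) \<or>
           ennreal \<delta> < (SUP t\<in>{0..T'}. ennreal (norm (simple_integral B (k n) (\<tau> n) (\<eta> n) t \<omega> - I t \<omega>))) \<or>
           (\<exists>i\<le>T * 2^m. norm (
        (\<Sum>l<i. blinfun_apply (P (real l / 2^m) \<omega>) (B (real (Suc l) / 2^m) \<omega> - B (real l / 2^m) \<omega>))
        - simple_integral B (k n) (\<tau> n) (\<eta> n) (real i / 2^m) \<omega>) > \<delta>))"
        then have q1: "(\<integral>\<^sup>+s\<in>{0..T'}. ennreal ((norm (P s \<omega> - H s \<omega>))\<^sup>2) \<partial>lborel) \<le> ennreal \<delta>"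
          and q2: "(SUP t\<in>{0..T'}. ennreal (norm (simple_integral B (k n) (\<tau> n) (\<eta> n) t \<omega> - I t \<omega>))) \<le> ennreal \<delta>"
          and q3: "\<And>i. i \<le> T * 2^m \<Longrightarrow> norm (
        (\<Sum>l<i. blinfun_apply (P (real l / 2^m) \<omega>) (B (real (Suc l) / 2^m) \<omega> - B (real l / 2^m) \<omega>))
        - simple_integral B (k n) (\<tau> n) (\<eta> n) (real i / 2^m) \<omega>) \<le> \<delta>"
          by (auto simp: P_def not_less)
        have q2': "norm (simple_integral B (k n) (\<tau> n) (\<eta> n) t \<omega> - I t \<omega>) \<le> \<delta>" if "t \<in> {0..T'}" for t
        proof -
          have "ennreal (norm (simple_integral B (k n) (\<tau> n) (\<eta> n) t \<omega> - I t \<omega>)) \<le> ennreal \<delta>"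
            using q2 that by (meson SUP_le_iff)
          then show ?thesis using \<delta> by (subst (asm) ennreal_le_iff) auto
        qed
        have "norm ((\<Sum>l<i. blinfun_apply (P (real l / 2^m) \<omega>) (B (real (Suc l) / 2^m) \<omega> - B (real l / 2^m) \<omega>))
             - I (real i / 2^m) \<omega>) \<le> \<epsilon>" if i: "i \<le> T * 2^m" for i
        proof -
          have "real i \<le> real (T * 2^m)" using i by (simp only: of_nat_le_iff)
          then have "real i / 2^m \<le> real T" by (simp add: divide_le_eq)
          then have "real i / 2^m \<in> {0..T'}" by (simp add: T'_def)
          from norm_triangle_mono[OF q3[OF i] q2'[OF this]] show ?thesis using \<delta> by (simp add: \<delta>_def)
        qed
        moreover have "(\<integral>\<^sup>+s. ennreal ((norm (P (real (nat \<lfloor>s * 2^m\<rfloor>) / 2^m) \<omega> - H s \<omega>))\<^sup>2) * indicator {0..real T} s \<partial>lborel) \<le> ennreal \<epsilon>"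
        proof -
          define f where "f s = ennreal ((norm (P (real (nat \<lfloor>s * 2^m\<rfloor>) / 2^m) \<omega> - P s \<omega>))\<^sup>2) * indicator {0..real T} s" for s
          define g where "g s = ennreal ((norm (P s \<omega> - H s \<omega>))\<^sup>2) * indicator {0..real T} s" for s
          have Ps[measurable]: "(\<lambda>s. P s \<omega>) \<in> borel_measurable borel"
            unfolding P_def simple_process_def by measurable
          have fm: "f \<in> borel_measurable lborel" unfolding f_def by measurable
          have geq: "g = (\<lambda>s. ennreal ((norm (indicator {0..real T} s *\<^sub>R P s \<omega> - indicator {0..real T} s *\<^sub>R H s \<omega>))\<^sup>2))"
            by (auto simp: g_def fun_eq_iff split: split_indicator)
          have gm: "g \<in> borel_measurable lborel" unfolding geq using sec[OF w, of T] by measurable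
          have "(\<integral>\<^sup>+s. ennreal ((norm (P (real (nat \<lfloor>s * 2^m\<rfloor>) / 2^m) \<omega> - H s \<omega>))\<^sup>2) * indicator {0..real T} s \<partial>lborel)
             \<le> (\<integral>\<^sup>+s. ennreal 2 * f s + ennreal 2 * g s \<partial>lborel)"
          proof (intro nn_integral_mono)
            fix s
            define x where "x = P (real (nat \<lfloor>s * 2^m\<rfloor>) / 2^m) \<omega> - P s \<omega>"
            define y where "y = P s \<omega> - H s \<omega>"
            have "(norm (x + y))\<^sup>2 \<le> (norm x + norm y)\<^sup>2" by (intro power_mono norm_triangle_ineq) auto
            also have "\<dots> \<le> 2 * (norm x)\<^sup>2 + 2 * (norm y)\<^sup>2"
              using sum_squares_bound[of "norm x" "norm y"] by (simp add: power2_sum)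
            finally have F: "ennreal ((norm (x + y))\<^sup>2) \<le> ennreal 2 * ennreal ((norm x)\<^sup>2) + ennreal 2 * ennreal ((norm y)\<^sup>2)"
              by (subst (1 2) ennreal_mult[symmetric], simp_all add: ennreal_plus[symmetric] ennreal_leI del: ennreal_plus)
            have eq: "P (real (nat \<lfloor>s * 2^m\<rfloor>) / 2^m) \<omega> - H s \<omega> = x + y" by (simp add: x_def y_def)
            show "ennreal ((norm (P (real (nat \<lfloor>s * 2^m\<rfloor>) / 2^m) \<omega> - H s \<omega>))\<^sup>2) * indicator {0..real T} s \<le> ennreal 2 * f s + ennreal 2 * g s"
              unfolding eq f_def g_def x_def[symmetric] y_def[symmetric] using F by (auto split: split_indicator)
          qed
          also have "\<dots> = ennreal 2 * (\<integral>\<^sup>+s. f s \<partial>lborel) + ennreal 2 * (\<integral>\<^sup>+s. g s \<partial>lborel)"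
            using fm gm by (simp add: nn_integral_add nn_integral_cmult)
          also have "\<dots> \<le> ennreal 2 * ennreal \<delta> + ennreal 2 * ennreal \<delta>"
          proof (intro add_mono mult_left_mono)
            show "(\<integral>\<^sup>+s. f s \<partial>lborel) \<le> ennreal \<delta>" unfolding f_def by (rule P1[OF m w])
            have "(\<integral>\<^sup>+s. g s \<partial>lborel) \<le> (\<integral>\<^sup>+s\<in>{0..T'}. ennreal ((norm (P s \<omega> - H s \<omega>))\<^sup>2) \<partial>lborel)"
              by (intro nn_integral_mono) (auto simp: g_def T'_def split: split_indicator)
            then show "(\<integral>\<^sup>+s. g s \<partial>lborel) \<le> ennreal \<delta>" using q1 by (rule order_trans)
          qed auto
          also have "\<dots> = ennreal \<epsilon>" using \<delta> by (simp add: \<delta>_def ennreal_mult[symmetric] ennreal_plus[symmetric] del: ennreal_plus ennreal_numeral)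
          finally show ?thesis .
        qed
        ultimately show False using neg by blast
      qed (use \<delta> in \<open>simp add: \<delta>_def\<close>)
    qed
  qed
qed

end

section \<open>Estimates for solutions\<close>

lemma norm_blinfun_le_Basis:
  fixes L :: "'m::euclidean_space \<Rightarrow>\<^sub>L 'n::real_normed_vector"
  assumes "\<And>i. i \<in> Basis \<Longrightarrow> norm (blinfun_apply L i) \<le> C"
  shows "norm L \<le> real DIM('m) * C"
proof (rule norm_blinfun_bound)
  have "C \<ge> 0" using assms[OF SOME_Basis] norm_ge_zero order_trans by blast
  then show "0 \<le> real DIM('m) * C" by simp
  fix b :: 'm
  have "blinfun_apply L b = blinfun_apply L (\<Sum>i\<in>Basis. (b \<bullet> i) *\<^sub>R i)" by (simp add: euclidean_representation)
  also have "\<dots> = (\<Sum>i\<in>Basis. (b \<bullet> i) *\<^sub>R blinfun_apply L i)" by (simp add: blinfun.sum_right blinfun.scaleR_right)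
  also have "norm \<dots> \<le> (\<Sum>i\<in>(Basis :: 'm set). norm b * C)"
  proof (rule order_trans[OF norm_sum sum_mono])
    fix i :: 'm assume i: "i \<in> Basis"
    show "norm ((b \<bullet> i) *\<^sub>R blinfun_apply L i) \<le> norm b * C"
      using assms[OF i] Basis_le_norm[OF i, of b] by (auto intro: mult_mono)
  qed
  finally show "norm (blinfun_apply L b) \<le> real DIM('m) * C * norm b" by (simp add: mult_ac)
qed

locale sde_setting = brownian_setting M \<F> B
  for M :: "'w measure" and \<F> and B :: "real \<Rightarrow> 'w \<Rightarrow> 'm::euclidean_space" +
  fixes X :: "'n::euclidean_space \<Rightarrow> 'm \<Rightarrow>\<^sub>L 'n" and A :: "'n \<Rightarrow> 'n" and c :: real
  assumes X_C2: "C2 X" and A_C2: "C2 A"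
    and X_growth: "\<And>x. sqrt (\<Sum>i\<in>Basis. (norm (blinfun_apply (X x) i))\<^sup>2) \<le> c * sqrt (1 + (norm x)\<^sup>2)"
    and A_growth: "\<And>x. x \<bullet> A x \<le> c * (1 + (norm x)\<^sup>2)"
    and DX_growth: "\<And>x. (\<Sum>i\<in>Basis. (onorm (frechet_derivative (\<lambda>y. blinfun_apply (X y) i) (at x)))\<^sup>2)
           \<le> c * (1 + ln (1 + (norm x)\<^sup>2))"
    and DA_growth: "\<And>x v. frechet_derivative A (at x) v \<bullet> v \<le> c * (1 + ln (1 + (norm x)\<^sup>2)) * (norm v)\<^sup>2"
begin

section \<open>Consequences of the growth hypotheses\<close>

lemma c_nonneg: "c \<ge> 0"
  using order_trans[OF real_sqrt_ge_zero[OF sum_nonneg] X_growth[of 0]] by simp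

lemma X_continuous: "continuous_on UNIV X" and A_continuous: "continuous_on UNIV A"
  using X_C2 A_C2 unfolding C2_def
  by (auto intro!: continuous_at_imp_continuous_on dest: has_derivative_continuous)

text \<open>One constant for all four bounds below. The hypotheses control the columns of
  \<open>X\<close>; passing to the operator norm costs DIM('m), which gets squared. The growth of
  \<open>X\<close> is bounded before squaring, whence c^2; that of its derivative after squaring,
  whence c.\<close>

definition growth :: real where
  "growth = max c ((real DIM('m))\<^sup>2 * max c (c\<^sup>2))"

lemma growth_nonneg: "growth \<ge> 0" using c_nonneg by (simp add: growth_def)

lemma X_norm: "(norm (X x))\<^sup>2 \<le> growth * (1 + (norm x)\<^sup>2)"
proof -
  have "norm (X x) \<le> real DIM('m) * (c * sqrt (1 + (norm x)\<^sup>2))"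
  proof (rule norm_blinfun_le_Basis)
    fix i :: 'm assume i: "i \<in> Basis"
    have "(norm (blinfun_apply (X x) i))\<^sup>2 \<le> (\<Sum>i\<in>Basis. (norm (blinfun_apply (X x) i))\<^sup>2)"
      using i by (intro member_le_sum) auto
    then have "norm (blinfun_apply (X x) i) \<le> sqrt (\<Sum>i\<in>Basis. (norm (blinfun_apply (X x) i))\<^sup>2)"
      by (rule real_le_rsqrt)
    then show "norm (blinfun_apply (X x) i) \<le> c * sqrt (1 + (norm x)\<^sup>2)" using X_growth[of x] by linarith
  qed
  then have "(norm (X x))\<^sup>2 \<le> (real DIM('m) * (c * sqrt (1 + (norm x)\<^sup>2)))\<^sup>2" by (intro power_mono) auto
  also have "\<dots> = ((real DIM('m))\<^sup>2 * c\<^sup>2) * (1 + (norm x)\<^sup>2)" by (simp add: power_mult_distrib)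
  also have "\<dots> \<le> growth * (1 + (norm x)\<^sup>2)"
    unfolding growth_def by (intro mult_right_mono) (auto simp: le_max_iff_disj intro!: disjI2 mult_left_mono)
  finally show ?thesis .
qed

lemma A_inner: "x \<bullet> A x \<le> growth * (1 + (norm x)\<^sup>2)"
  using A_growth[of x] mult_right_mono[of c growth "1 + (norm x)\<^sup>2"] by (simp add: growth_def)

text \<open>Identifies the region of the logarithmic bounds as a ball. Its convexity keeps the
  intermediate points of the mean value arguments inside.\<close>

lemma one_plus_norm_cball: "1 + (norm z)\<^sup>2 \<le> \<rho> \<longleftrightarrow> z \<in> cball 0 (sqrt (\<rho> - 1))"
proof -
  have "z \<in> cball 0 (sqrt (\<rho> - 1)) \<longleftrightarrow> norm z \<le> sqrt (\<rho> - 1)" by simp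
  also have "\<dots> \<longleftrightarrow> (norm z)\<^sup>2 \<le> \<rho> - 1"
    by (metis norm_ge_zero real_le_rsqrt real_sqrt_le_iff real_sqrt_unique)
  finally show ?thesis by auto
qed

lemma X_Lipschitz:
  assumes x: "1 + (norm x)\<^sup>2 \<le> \<rho>" and y: "1 + (norm y)\<^sup>2 \<le> \<rho>"
  shows "(norm (X x - X y))\<^sup>2 \<le> growth * (1 + ln \<rho>) * (norm (x - y))\<^sup>2"
proof -
  have \<rho>: "\<rho> \<ge> 1" using x by (smt (verit) zero_le_power2)
  obtain X' where X': "\<And>x. (X has_derivative blinfun_apply (X' x)) (at x)"
    using X_C2 unfolding C2_def by blast
  define l where "l = sqrt (c * (1 + ln \<rho>))"
  have l0: "c * (1 + ln \<rho>) \<ge> 0" using c_nonneg \<rho> by simp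
  have "norm (X x - X y) \<le> real DIM('m) * (l * norm (x - y))"
  proof (rule norm_blinfun_le_Basis)
    fix i :: 'm assume i: "i \<in> Basis"
    define f where "f y = blinfun_apply (X y) i" for y
    have df: "(f has_derivative (\<lambda>v. blinfun_apply (blinfun_apply (X' z) v) i)) (at z)" for z
      unfolding f_def by (rule blinfun.FDERIV[OF X' has_derivative_const, THEN has_derivative_eq_rhs]) (simp add: fun_eq_iff blinfun.zero_right)
    then have df': "(f has_derivative frechet_derivative f (at z)) (at z)" for z
      by (metis frechet_derivative_at)
    have "norm (f x - f y) \<le> l * norm (x - y)"
    proof (rule differentiable_bound[of "cball 0 (sqrt (\<rho> - 1))"])
      fix z :: 'n assume z: "z \<in> cball 0 (sqrt (\<rho> - 1))"
      show "(f has_derivative frechet_derivative f (at z)) (at z within cball 0 (sqrt (\<rho> - 1)))"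
        by (rule has_derivative_at_withinI[OF df'])
      have "(onorm (frechet_derivative f (at z)))\<^sup>2 \<le> (\<Sum>i\<in>Basis. (onorm (frechet_derivative (\<lambda>y. blinfun_apply (X y) i) (at z)))\<^sup>2)"
        unfolding f_def using i by (intro member_le_sum) auto
      also have "\<dots> \<le> c * (1 + ln (1 + (norm z)\<^sup>2))" by (rule DX_growth)
      also have "\<dots> \<le> c * (1 + ln \<rho>)"
        using z \<rho> c_nonneg unfolding one_plus_norm_cball[symmetric]
        by (intro mult_left_mono) (auto simp: add_pos_nonneg)
      finally show "onorm (frechet_derivative f (at z)) \<le> l" unfolding l_def by (rule real_le_rsqrt)
    qed (use x y in \<open>auto simp: one_plus_norm_cball simp del: mem_cball_0\<close>)
    then show "norm (blinfun_apply (X x - X y) i) \<le> l * norm (x - y)" by (simp add: f_def blinfun.diff_left)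
  qed
  then have "(norm (X x - X y))\<^sup>2 \<le> (real DIM('m) * (l * norm (x - y)))\<^sup>2" by (intro power_mono) auto
  also have "\<dots> = ((real DIM('m))\<^sup>2 * c) * (1 + ln \<rho>) * (norm (x - y))\<^sup>2"
    using l0 by (simp add: power_mult_distrib l_def)
  also have "\<dots> \<le> growth * (1 + ln \<rho>) * (norm (x - y))\<^sup>2"
    unfolding growth_def using \<rho> by (intro mult_right_mono) (auto simp: le_max_iff_disj intro!: disjI2 mult_left_mono)
  finally show ?thesis .
qed

text \<open>The derivative of \<open>A\<close> is bounded from one side only, as a quadratic form,
  so the mean value theorem is applied to the scalar function s -> <A (y + s d), d>.\<close>

lemma A_monotone:
  assumes x: "1 + (norm x)\<^sup>2 \<le> \<rho>" and y: "1 + (norm y)\<^sup>2 \<le> \<rho>"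
  shows "(x - y) \<bullet> (A x - A y) \<le> growth * (1 + ln \<rho>) * (norm (x - y))\<^sup>2"
proof -
  have \<rho>: "\<rho> \<ge> 1" using x by (smt (verit) zero_le_power2)
  obtain A' where A': "\<And>x. (A has_derivative blinfun_apply (A' x)) (at x)"
    using A_C2 unfolding C2_def by blast
  have fd: "frechet_derivative A (at z) = blinfun_apply (A' z)" for z
    using frechet_derivative_at[OF A'] by metis
  define d where "d = x - y"
  define \<phi> where "\<phi> s = A (y + s *\<^sub>R d) \<bullet> d" for s
  have "((\<lambda>s. A (y + s *\<^sub>R d)) has_derivative (\<lambda>h. blinfun_apply (A' (y + s *\<^sub>R d)) (h *\<^sub>R d))) (at s)" for s
    by (rule has_derivative_compose[OF _ A', of "\<lambda>s. y + s *\<^sub>R d" "\<lambda>h. h *\<^sub>R d" s UNIV]) (auto intro!: derivative_eq_intros)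
  then have "(\<phi> has_derivative (\<lambda>h. blinfun_apply (A' (y + s *\<^sub>R d)) (h *\<^sub>R d) \<bullet> d)) (at s)" for s
    unfolding \<phi>_def by (rule has_derivative_inner_left)
  then have D: "(\<phi> has_real_derivative (blinfun_apply (A' (y + s *\<^sub>R d)) d \<bullet> d)) (at s)" for s
    unfolding has_field_derivative_def by (rule has_derivative_eq_rhs) (simp add: fun_eq_iff blinfun.scaleR_right)
  obtain s where s: "0 < s" "s < 1" "\<phi> 1 - \<phi> 0 = (1 - 0) * (blinfun_apply (A' (y + s *\<^sub>R d)) d \<bullet> d)"
    using MVT2[of 0 1 \<phi> "\<lambda>s. blinfun_apply (A' (y + s *\<^sub>R d)) d \<bullet> d"] D by auto
  define z where "z = y + s *\<^sub>R d"
  have "z = (1 - s) *\<^sub>R y + s *\<^sub>R x" by (simp add: z_def d_def algebra_simps)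
  then have "z \<in> cball 0 (sqrt (\<rho> - 1))"
    using convexD[OF convex_cball, of y 0 "sqrt (\<rho> - 1)" x "1 - s" s] x y s unfolding one_plus_norm_cball by auto
  then have z: "1 + (norm z)\<^sup>2 \<le> \<rho>" unfolding one_plus_norm_cball .
  have "(x - y) \<bullet> (A x - A y) = \<phi> 1 - \<phi> 0" by (simp add: \<phi>_def d_def inner_diff_left inner_diff_right inner_commute)
  also have "\<dots> = frechet_derivative A (at z) d \<bullet> d" using s by (simp add: fd z_def)
  also have "\<dots> \<le> c * (1 + ln (1 + (norm z)\<^sup>2)) * (norm d)\<^sup>2" by (rule DA_growth)
  also have "\<dots> \<le> c * (1 + ln \<rho>) * (norm d)\<^sup>2"
    using z c_nonneg \<rho> by (intro mult_right_mono mult_left_mono) (auto simp: add_pos_nonneg)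
  also have "\<dots> \<le> growth * (1 + ln \<rho>) * (norm d)\<^sup>2"
    using \<rho> by (intro mult_right_mono) (auto simp: growth_def)
  finally show ?thesis by (simp add: d_def)
qed

section \<open>Tails and moments of one solution\<close>

lemma solution_data:
  assumes sol: "sde_solution M \<F> B X A x0 x \<xi>"
  shows "\<exists>\<sigma> H I a. (\<forall>k::nat. dyadic_approx (H k) (I k)) \<and> (\<forall>t\<ge>0. a t \<in> borel_measurable (\<F> t)) \<and>
    (AE \<omega> in M. (\<forall>t\<ge>0. ereal t < \<xi> \<omega> \<longrightarrow> eventually (\<lambda>k. t \<le> \<sigma> k \<omega>) sequentially) \<and>
       (\<forall>k t. 0 \<le> t \<longrightarrow> t \<le> \<sigma> k \<omega> \<longrightarrow> ereal t < \<xi> \<omega> \<and> continuous_on {0..t} (\<lambda>s. x s \<omega>) \<and> continuous_on {0..t} (\<lambda>s. a s \<omega>) \<and>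
          (\<forall>s\<in>{0..t}. H k s \<omega> = X (x s \<omega>) \<and> a s \<omega> = A (x s \<omega>) \<and> x s \<omega> = x0 + I k s \<omega> + integral {0..s} (\<lambda>s. a s \<omega>))))"
proof -
  \<comment> \<open>Values of x from the explosion on are arbitrary and need not be measurable. The
    default 0 makes the drift adapted at all times.\<close>
  define a where "a t \<omega> = A (if ereal t < \<xi> \<omega> then x t \<omega> else 0)" for t \<omega>
  have am: "a t \<in> borel_measurable (\<F> t)" if "t \<ge> 0" for t
  proof -
    have "(\<lambda>\<omega>. if ereal t < \<xi> \<omega> then x t \<omega> else 0) \<in> borel_measurable (\<F> t)"
      using sol that unfolding sde_solution_def by blast
    then show ?thesis unfolding a_def
      by (rule measurable_compose) (rule borel_measurable_continuous_onI[OF A_continuous])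
  qed
  obtain \<sigma> where \<sigma>: "AE \<omega> in M. incseq (\<lambda>k. \<sigma> k \<omega>) \<and> (\<forall>k. 0 \<le> \<sigma> k \<omega> \<and> ereal (\<sigma> k \<omega>) < \<xi> \<omega>) \<and> (\<lambda>k. ereal (\<sigma> k \<omega>)) \<longlonglongrightarrow> \<xi> \<omega>"
    and I: "\<forall>k. \<exists>I. has_ito_integral M \<F> B (\<lambda>s \<omega>. if s \<le> \<sigma> k \<omega> then X (x s \<omega>) else 0) I \<and>
           (AE \<omega> in M. \<forall>t. 0 \<le> t \<longrightarrow> t \<le> \<sigma> k \<omega> \<longrightarrow> x t \<omega> = x0 + I t \<omega> + integral {0..t} (\<lambda>s. A (x s \<omega>)))"
    using sol unfolding sde_solution_def by (elim conjE exE) (rule that, assumption, assumption)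
  obtain I where II: "\<forall>k. has_ito_integral M \<F> B (\<lambda>s \<omega>. if s \<le> \<sigma> k \<omega> then X (x s \<omega>) else 0) (I k) \<and>
      (AE \<omega> in M. \<forall>t. 0 \<le> t \<longrightarrow> t \<le> \<sigma> k \<omega> \<longrightarrow> x t \<omega> = x0 + I k t \<omega> + integral {0..t} (\<lambda>s. A (x s \<omega>)))"
    using choice[OF I] by (elim exE) (rule that)
  then have I1: "\<And>k. has_ito_integral M \<F> B (\<lambda>s \<omega>. if s \<le> \<sigma> k \<omega> then X (x s \<omega>) else 0) (I k)"
    and I2: "\<And>k. AE \<omega> in M. \<forall>t. 0 \<le> t \<longrightarrow> t \<le> \<sigma> k \<omega> \<longrightarrow> x t \<omega> = x0 + I k t \<omega> + integral {0..t} (\<lambda>s. A (x s \<omega>))"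
    by simp_all
  define H where "H k = (\<lambda>s \<omega>. if s \<le> \<sigma> k \<omega> then X (x s \<omega>) else 0)" for k
  have I2': "AE \<omega> in M. \<forall>k t. 0 \<le> t \<longrightarrow> t \<le> \<sigma> k \<omega> \<longrightarrow> x t \<omega> = x0 + I k t \<omega> + integral {0..t} (\<lambda>s. A (x s \<omega>))"
    using I2 by (simp add: AE_all_countable)
  have xc: "AE \<omega> in M. continuous_on {t. 0 \<le> t \<and> ereal t < \<xi> \<omega>} (\<lambda>t. x t \<omega>)"
  proof -
    have "AE \<omega> in M. 0 < \<xi> \<omega> \<and> x 0 \<omega> = x0 \<and> continuous_on {t. 0 \<le> t \<and> ereal t < \<xi> \<omega>} (\<lambda>t. x t \<omega>)"
      using sol unfolding sde_solution_def by (elim conjE)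
    then show ?thesis by eventually_elim (elim conjE)
  qed
  have "AE \<omega> in M. (\<forall>t\<ge>0. ereal t < \<xi> \<omega> \<longrightarrow> eventually (\<lambda>k. t \<le> \<sigma> k \<omega>) sequentially) \<and>
       (\<forall>k t. 0 \<le> t \<longrightarrow> t \<le> \<sigma> k \<omega> \<longrightarrow> ereal t < \<xi> \<omega> \<and> continuous_on {0..t} (\<lambda>s. x s \<omega>) \<and> continuous_on {0..t} (\<lambda>s. a s \<omega>) \<and>
          (\<forall>s\<in>{0..t}. H k s \<omega> = X (x s \<omega>) \<and> a s \<omega> = A (x s \<omega>) \<and> x s \<omega> = x0 + I k s \<omega> + integral {0..s} (\<lambda>s. a s \<omega>)))"
    using \<sigma> I2' xc
  proof eventually_elim
    case (elim \<omega>)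
    show ?case
    proof (intro conjI allI impI)
      fix t assume "0 \<le> t" "ereal t < \<xi> \<omega>"
      then have "eventually (\<lambda>k. ereal t < ereal (\<sigma> k \<omega>)) sequentially" using elim(1) by (intro order_tendstoD(1)) auto
      then show "eventually (\<lambda>k. t \<le> \<sigma> k \<omega>) sequentially" by eventually_elim simp
    next
      fix k t assume t: "0 \<le> t" "t \<le> \<sigma> k \<omega>"
      have lt: "ereal s < \<xi> \<omega>" if "s \<le> t" for s
        using elim(1) t that by (metis ereal_less_eq(3) order.strict_trans1 order_trans)
      then show "ereal t < \<xi> \<omega>" by simp
      show c1: "continuous_on {0..t} (\<lambda>s. x s \<omega>)" by (rule continuous_on_subset[OF elim(3)]) (auto simp: lt)
      have aeq: "a s \<omega> = A (x s \<omega>)" if "s \<in> {0..t}" for s using lt[of s] that by (simp add: a_def)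
      have "continuous_on {0..t} (\<lambda>s. A (x s \<omega>))"
        by (rule continuous_on_compose2[OF A_continuous c1]) simp
      then show "continuous_on {0..t} (\<lambda>s. a s \<omega>)" by (rule continuous_on_eq) (simp add: aeq)
      show "\<forall>s\<in>{0..t}. H k s \<omega> = X (x s \<omega>) \<and> a s \<omega> = A (x s \<omega>) \<and> x s \<omega> = x0 + I k s \<omega> + integral {0..s} (\<lambda>s. a s \<omega>)"
      proof (intro ballI conjI)
        fix s assume s: "s \<in> {0..t}"
        show "H k s \<omega> = X (x s \<omega>)" using s t by (simp add: H_def)
        show "a s \<omega> = A (x s \<omega>)" by (rule aeq[OF s])
        have "integral {0..s} (\<lambda>s. a s \<omega>) = integral {0..s} (\<lambda>s. A (x s \<omega>))"
          by (rule integral_cong) (use s aeq in auto)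
        then show "x s \<omega> = x0 + I k s \<omega> + integral {0..s} (\<lambda>s. a s \<omega>)" using elim(2) s t by auto
      qed
    qed
  qed
  moreover have "dyadic_approx (H k) (I k)" for k unfolding H_def by (rule has_ito_integral_dyadic_approx[OF I1])
  ultimately show ?thesis using am by blast
qed

lemma controlled_pathI:
  assumes "continuous_on {0..t} \<zeta>" "continuous_on {0..t} a"
    and "\<And>s. s \<in> {0..t} \<Longrightarrow> \<zeta> s = z0 + I s + integral {0..s} a"
    and "\<And>s. s \<in> {0..t} \<Longrightarrow> (norm (H s))\<^sup>2 \<le> q * (e + (norm (\<zeta> s))\<^sup>2)"
    and "\<And>s. s \<in> {0..t} \<Longrightarrow> \<zeta> s \<bullet> a s \<le> q * (e + (norm (\<zeta> s))\<^sup>2)"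
  shows "controlled_path e q z0 \<zeta> I H a t"
  unfolding controlled_path_def using assms
  by (auto intro!: dyadic_regular_continuous integrable_continuous_interval compact_imp_bounded compact_continuous_image)

text \<open>Each localised integral controls the path up to \<open>\<sigma> k\<close>; the bound is
  the same for all k, so it extends to every time before \<open>\<xi>\<close>. The constant is
  common to all initial points, solutions, horizons and levels.\<close>

lemma solution_tail:
  "\<exists>C\<ge>0. \<forall>x0 x \<xi> (T::nat) b. sde_solution M \<F> B X A x0 x \<xi> \<longrightarrow> b > 0 \<longrightarrow>
     outer_prob_le M (\<lambda>\<omega>. \<exists>t\<in>{0..real T}. ereal t < \<xi> \<omega> \<and> (1 + (norm (x t \<omega>))\<^sup>2)^r > b)
       (C * (1 + (norm x0)\<^sup>2)^r * exp (C * real T) / b)"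
proof -
  define C where "C = max (6 * 2^r) (growth_const TYPE('m) r * growth)"
  have C0: "C \<ge> 0" by (simp add: C_def le_max_iff_disj)
  show ?thesis
  proof (intro exI[of _ C] conjI C0 allI impI)
    fix x0 x \<xi> T and b :: real assume sol: "sde_solution M \<F> B X A x0 x \<xi>" and b: "b > 0"
    obtain \<sigma> H I a where d: "\<And>k::nat. dyadic_approx (H k) (I k)" "\<And>t. t \<ge> 0 \<Longrightarrow> a t \<in> borel_measurable (\<F> t)"
      and ae: "AE \<omega> in M. (\<forall>t\<ge>0. ereal t < \<xi> \<omega> \<longrightarrow> eventually (\<lambda>k. t \<le> \<sigma> k \<omega>) sequentially) \<and>
       (\<forall>k t. 0 \<le> t \<longrightarrow> t \<le> \<sigma> k \<omega> \<longrightarrow> ereal t < \<xi> \<omega> \<and> continuous_on {0..t} (\<lambda>s. x s \<omega>) \<and> continuous_on {0..t} (\<lambda>s. a s \<omega>) \<and>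
          (\<forall>s\<in>{0..t}. H k s \<omega> = X (x s \<omega>) \<and> a s \<omega> = A (x s \<omega>) \<and> x s \<omega> = x0 + I k s \<omega> + integral {0..s} (\<lambda>s. a s \<omega>)))"
      using solution_data[OF sol] by (elim exE conjE) (rule that, auto)
    have "outer_prob_le M (\<lambda>\<omega>. \<exists>t\<in>{0..real T}.
        controlled_path 1 growth x0 (\<lambda>s. x s \<omega>) (\<lambda>s. I k s \<omega>) (\<lambda>s. H k s \<omega>) (\<lambda>s. a s \<omega>) t \<and> (1 + (norm (x t \<omega>))\<^sup>2)^r > b)
      (6 * 2^r * (1 + (norm x0)\<^sup>2)^r * exp (growth_const TYPE('m) r * growth * real T) / b)" for k
      by (rule maximal_inequality[OF d]) (auto simp: growth_nonneg b)
    then have "outer_prob_le M (\<lambda>\<omega>. \<exists>t\<in>{0..real T}. ereal t < \<xi> \<omega> \<and> (1 + (norm (x t \<omega>))\<^sup>2)^r > b)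
      (6 * 2^r * (1 + (norm x0)\<^sup>2)^r * exp (growth_const TYPE('m) r * growth * real T) / b)"
    proof (rule outer_prob_le_liminf)
      show "AE \<omega> in M. (\<exists>t\<in>{0..real T}. ereal t < \<xi> \<omega> \<and> (1 + (norm (x t \<omega>))\<^sup>2)^r > b) \<longrightarrow>
        (\<forall>\<^sub>F k in sequentially. \<exists>t\<in>{0..real T}.
        controlled_path 1 growth x0 (\<lambda>s. x s \<omega>) (\<lambda>s. I k s \<omega>) (\<lambda>s. H k s \<omega>) (\<lambda>s. a s \<omega>) t \<and> (1 + (norm (x t \<omega>))\<^sup>2)^r > b)"
        using ae
      proof eventually_elim
        case (elim \<omega>)
        note E = elim[THEN conjunct2, THEN spec, THEN spec, THEN mp, THEN mp]
        show ?case
        proof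
          assume "\<exists>t\<in>{0..real T}. ereal t < \<xi> \<omega> \<and> (1 + (norm (x t \<omega>))\<^sup>2)^r > b"
          then obtain t where t: "t \<in> {0..real T}" "ereal t < \<xi> \<omega>" "(1 + (norm (x t \<omega>))\<^sup>2)^r > b" by blast
          have "eventually (\<lambda>k. t \<le> \<sigma> k \<omega>) sequentially" using elim t by auto
          then show "\<forall>\<^sub>F k in sequentially. \<exists>t\<in>{0..real T}.
              controlled_path 1 growth x0 (\<lambda>s. x s \<omega>) (\<lambda>s. I k s \<omega>) (\<lambda>s. H k s \<omega>) (\<lambda>s. a s \<omega>) t \<and> (1 + (norm (x t \<omega>))\<^sup>2)^r > b"
          proof eventually_elim
            case (elim k)
            have D: "0 \<le> t" "t \<le> \<sigma> k \<omega>" using t(1) elim by auto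
            have c: "continuous_on {0..t} (\<lambda>s. x s \<omega>)" "continuous_on {0..t} (\<lambda>s. a s \<omega>)"
              and q: "\<And>s. s \<in> {0..t} \<Longrightarrow> H k s \<omega> = X (x s \<omega>) \<and> a s \<omega> = A (x s \<omega>) \<and> x s \<omega> = x0 + I k s \<omega> + integral {0..s} (\<lambda>s. a s \<omega>)"
              using E[OF D] by blast+
            have "controlled_path 1 growth x0 (\<lambda>s. x s \<omega>) (\<lambda>s. I k s \<omega>) (\<lambda>s. H k s \<omega>) (\<lambda>s. a s \<omega>) t"
              using q by (intro controlled_pathI c) (auto simp: X_norm A_inner)
            then show ?case using t by blast
          qed
        qed
      qed
    qed
    then show "outer_prob_le M (\<lambda>\<omega>. \<exists>t\<in>{0..real T}. ereal t < \<xi> \<omega> \<and> (1 + (norm (x t \<omega>))\<^sup>2)^r > b)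
       (C * (1 + (norm x0)\<^sup>2)^r * exp (C * real T) / b)"
    proof (rule outer_prob_le_mono)
      show "6 * 2^r * (1 + (norm x0)\<^sup>2)^r * exp (growth_const TYPE('m) r * growth * real T) / b
        \<le> C * (1 + (norm x0)\<^sup>2)^r * exp (C * real T) / b"
        using b C0 by (intro divide_right_mono mult_mono mult_right_mono) (auto simp: C_def intro: mult_right_mono)
    qed
  qed
qed

lemma maximal_solution_global:
  assumes max: "maximal_solution M \<F> B X A x0 x \<xi>"
  shows "AE \<omega> in M. \<xi> \<omega> = \<infinity>"
proof -
  have sol: "sde_solution M \<F> B X A x0 x \<xi>"
    and unb: "AE \<omega> in M. \<xi> \<omega> < \<infinity> \<longrightarrow> \<not> bounded ((\<lambda>t. x t \<omega>) ` {t. 0 \<le> t \<and> ereal t < \<xi> \<omega>})"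
    using max unfolding maximal_solution_def by auto
  obtain C where C: "C \<ge> 0" "\<And>(T::nat) b. b > 0 \<Longrightarrow>
     outer_prob_le M (\<lambda>\<omega>. \<exists>t\<in>{0..real T}. ereal t < \<xi> \<omega> \<and> (1 + (norm (x t \<omega>))\<^sup>2)^1 > b)
       (C * (1 + (norm x0)\<^sup>2)^1 * exp (C * real T) / b)"
    using solution_tail[of 1] sol by blast
  have "AE \<omega> in M. \<not> (\<forall>b>0. \<exists>t\<in>{0..real T}. ereal t < \<xi> \<omega> \<and> 1 + (norm (x t \<omega>))\<^sup>2 > b)" for T :: nat
  proof (rule outer_prob_le_small_AE)
    fix e :: real assume e: "e > 0"
    define D where "D = C * (1 + (norm x0)\<^sup>2) * exp (C * real T)"
    have D: "D \<ge> 0" unfolding D_def using C(1) by simp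
    define b where "b = (D + 1) / e"
    have b: "b > 0" using D e by (simp add: b_def add_nonneg_pos)
    have "outer_prob_le M (\<lambda>\<omega>. \<exists>t\<in>{0..real T}. ereal t < \<xi> \<omega> \<and> 1 + (norm (x t \<omega>))\<^sup>2 > b) (D / b)"
      using C(2)[OF b, of T] by (simp add: D_def)
    then show "outer_prob_le M (\<lambda>\<omega>. \<forall>b>0. \<exists>t\<in>{0..real T}. ereal t < \<xi> \<omega> \<and> 1 + (norm (x t \<omega>))\<^sup>2 > b) e"
    proof (rule outer_prob_le_mono)
      show "D / b \<le> e" using D e b by (simp add: b_def field_simps)
    qed (use b in blast)
  qed
  then have "AE \<omega> in M. \<forall>T::nat. \<not> (\<forall>b>0. \<exists>t\<in>{0..real T}. ereal t < \<xi> \<omega> \<and> 1 + (norm (x t \<omega>))\<^sup>2 > b)"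
    by (simp only: AE_all_countable simp_thms)
  then show ?thesis
    using unb
  proof eventually_elim
    case (elim \<omega>)
    show ?case
    proof (rule ccontr)
      assume "\<xi> \<omega> \<noteq> \<infinity>"
      then have lt: "\<xi> \<omega> < \<infinity>" by simp
      then obtain r where r: "\<xi> \<omega> \<le> ereal r" by (cases "\<xi> \<omega>") auto
      obtain T :: nat where T: "r \<le> real T" using real_arch_simple by blast
      obtain b where b: "b > 0" "\<And>t. t \<in> {0..real T} \<Longrightarrow> ereal t < \<xi> \<omega> \<Longrightarrow> 1 + (norm (x t \<omega>))\<^sup>2 \<le> b"
        using elim(1) by (meson not_less)
      have "bounded ((\<lambda>t. x t \<omega>) ` {t. 0 \<le> t \<and> ereal t < \<xi> \<omega>})"
        unfolding bounded_iff
      proof (intro exI[of _ "sqrt b"] ballI)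
        fix z assume "z \<in> (\<lambda>t. x t \<omega>) ` {t. 0 \<le> t \<and> ereal t < \<xi> \<omega>}"
        then obtain t where t: "z = x t \<omega>" "0 \<le> t" "ereal t < \<xi> \<omega>" by blast
        have "ereal t < ereal r" using t(3) r by (rule less_le_trans)
        then have "1 + (norm z)\<^sup>2 \<le> b" using t T by (auto intro!: b(2))
        then show "norm z \<le> sqrt b" by (intro real_le_rsqrt) simp
      qed
      then show False using elim(2) lt by blast
    qed
  qed
qed

text \<open>The tail of the r-th power at level b decays like 1/b. With r >= 2p, raising a threshold
  for the p-th power by 2^k lowers the probability by (2^k)^(r/p) >= 4^k, which is the decay that
  \<open>nn_integral_le_of_tails\<close> asks for.\<close>

lemma solution_moments:
  assumes p: "p > 0"
  shows "\<exists>c1 c2. \<forall>x0 x \<xi>. maximal_solution M \<F> B X A x0 x \<xi> \<longrightarrow>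
       (\<forall>t\<ge>0. (\<integral>\<^sup>+\<omega>. ennreal (norm (x t \<omega>) powr (2 * p)) \<partial>M)
          \<le> ennreal (c1 * (1 + (norm x0)\<^sup>2) powr p * exp (c2 * t)))"
proof -
  obtain r :: nat where r: "real r \<ge> 2 * p" using real_arch_simple by blast
  have r0: "real r > 0" using r p by linarith
  obtain C where C: "C \<ge> 0" "\<And>x0 x \<xi> (T::nat) b. sde_solution M \<F> B X A x0 x \<xi> \<Longrightarrow> b > 0 \<Longrightarrow>
     outer_prob_le M (\<lambda>\<omega>. \<exists>t\<in>{0..real T}. ereal t < \<xi> \<omega> \<and> (1 + (norm (x t \<omega>))\<^sup>2)^r > b)
       (C * (1 + (norm x0)\<^sup>2)^r * exp (C * real T) / b)"
    using solution_tail[of r] by blast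
  \<comment> \<open>The 5 comes from the layer-cake estimate, and the exponential pays for rounding
    t up to a natural number T <= t + 1.\<close>
  define c1 where "c1 = 5 * ((C + 1) powr (p / r) * exp (C * p / r))"
  define c2 where "c2 = C * p / r"
  show ?thesis
  proof (rule exI[of _ c1], rule exI[of _ c2], intro allI impI)
    fix x0 x \<xi> and t :: real assume max: "maximal_solution M \<F> B X A x0 x \<xi>" and t: "t \<ge> 0"
    have sol: "sde_solution M \<F> B X A x0 x \<xi>" using max unfolding maximal_solution_def by auto
    define T where "T = nat \<lceil>t\<rceil>"
    have T: "t \<le> real T" "real T \<le> t + 1" using t by (auto simp: T_def)
    define S where "S = 1 + (norm x0)\<^sup>2"
    have S: "S > 0" by (simp add: S_def add_pos_nonneg)
    \<comment> \<open>With C + 1 in place of C this is positive and still dominates the numerator of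
      the tail bound; \<open>D\<close> is the level at which that bound becomes nontrivial.\<close>
    define W where "W = (C + 1) * exp (C * real T) * S^r"
    have W: "W > 0" using C S by (simp add: W_def)
    define D where "D = W powr (p / r)"
    have D: "D > 0" using W by (simp add: D_def)
    have Dle: "5 * D \<le> c1 * S powr p * exp (c2 * t)"
    proof -
      have "D = (C + 1) powr (p / r) * exp (C * real T) powr (p / r) * (S^r) powr (p / r)"
        unfolding D_def W_def using C S by (simp add: powr_mult)
      also have "(S^r) powr (p / r) = S powr p" using S r0 by (simp add: powr_realpow[symmetric] powr_powr)
      also have "exp (C * real T) powr (p / r) = exp (C * p / r * real T)" by (simp add: exp_powr_real mult_ac)
      finally have "D = (C + 1) powr (p / r) * exp (C * p / r * real T) * S powr p" .
      also have "\<dots> \<le> (C + 1) powr (p / r) * exp (C * p / r * (t + 1)) * S powr p"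
        using T C p r0 by (intro mult_right_mono mult_left_mono) (auto intro!: divide_right_mono mult_left_mono)
      also have "exp (C * p / r * (t + 1)) = exp (C * p / r) * exp (C * p / r * t)"
        unfolding exp_add[symmetric] by (rule arg_cong[where f = exp]) (simp add: distrib_left)
      finally show ?thesis unfolding c1_def c2_def by (simp add: mult_ac)
    qed
    have "(\<integral>\<^sup>+\<omega>. ennreal (norm (x t \<omega>) powr (2 * p)) \<partial>M) \<le> ennreal (5 * D)"
    proof (rule nn_integral_le_of_tails)
      show "D \<ge> 0" using D by simp
      fix k :: nat
      define b where "b = (D * 2^k) powr (r / p)"
      have b: "b > 0" using D by (simp add: b_def)
      have bW: "W * 4^k \<le> b"
      proof -
        have b1: "b = D powr (r / p) * (2^k) powr (r / p)" unfolding b_def using D by (simp add: powr_mult)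
        have b2: "D powr (r / p) = W" unfolding D_def using W p r0 by (simp add: powr_powr)
        have "(2^k) powr (r / p) \<ge> (2^k :: real) powr 2"
          using r p by (intro powr_mono) (auto simp: field_simps)
        then have "W * (2^k :: real) powr 2 \<le> W * (2^k) powr (r / p)" using W by (intro mult_left_mono) auto
        moreover have "(2^k :: real) powr 2 = 4^k"
          by (simp add: power_mult_distrib[symmetric] power2_eq_square)
        ultimately show ?thesis unfolding b1 b2 by simp
      qed
      show "outer_prob_le M (\<lambda>\<omega>. ennreal (D * 2^k) < ennreal (norm (x t \<omega>) powr (2 * p))) (1 / 4^k)"
      proof (rule outer_prob_le_AE_mono[OF C(2)[OF sol b, of T]])
        show "AE \<omega> in M. ennreal (D * 2^k) < ennreal (norm (x t \<omega>) powr (2 * p)) \<longrightarrow>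
           (\<exists>t\<in>{0..real T}. ereal t < \<xi> \<omega> \<and> (1 + (norm (x t \<omega>))\<^sup>2)^r > b)"
          using maximal_solution_global[OF max]
        proof eventually_elim
          case (elim \<omega>)
          show ?case
          proof
            define n where "n = 1 + (norm (x t \<omega>))\<^sup>2"
            have n: "n > 0" by (simp add: n_def add_pos_nonneg)
            assume "ennreal (D * 2^k) < ennreal (norm (x t \<omega>) powr (2 * p))"
            then have "D * 2^k < norm (x t \<omega>) powr (2 * p)" using D by (simp add: ennreal_less_iff)
            also have "norm (x t \<omega>) powr (2 * p) = ((norm (x t \<omega>))\<^sup>2) powr p"
              by (cases "x t \<omega> = 0") (simp_all add: powr_powr powr_numeral[symmetric] del: powr_numeral)
            also have "\<dots> \<le> n powr p" using p by (intro powr_mono2) (auto simp: n_def)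
            finally have "b < (n powr p) powr (r / p)"
              unfolding b_def using D p r0 by (intro powr_less_mono2) auto
            also have "\<dots> = n^r" using n p by (simp add: powr_powr powr_realpow)
            finally have "b < (1 + (norm (x t \<omega>))\<^sup>2)^r" by (simp add: n_def)
            then show "\<exists>t\<in>{0..real T}. ereal t < \<xi> \<omega> \<and> (1 + (norm (x t \<omega>))\<^sup>2)^r > b"
              using t T elim by (intro bexI[of _ t]) auto
          qed
        qed
        have "C * (1 + (norm x0)\<^sup>2)^r * exp (C * real T) / b \<le> W / b"
          using b S C unfolding W_def S_def by (intro divide_right_mono) (auto simp: algebra_simps)
        also have "\<dots> \<le> W / (W * 4^k)" using bW W b by (intro divide_left_mono) auto
        also have "\<dots> = 1 / 4^k" using W by simp
        finally show "C * (1 + (norm x0)\<^sup>2)^r * exp (C * real T) / b \<le> 1 / 4^k" .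
      qed
    qed
    also have "\<dots> \<le> ennreal (c1 * S powr p * exp (c2 * t))" by (rule ennreal_leI[OF Dle])
    finally show "(\<integral>\<^sup>+\<omega>. ennreal (norm (x t \<omega>) powr (2 * p)) \<partial>M)
          \<le> ennreal (c1 * (1 + (norm x0)\<^sup>2) powr p * exp (c2 * t))"
      by (simp only: S_def)
  qed
qed

section \<open>Dependence of solutions on the initial point\<close>

lemma pair_tail:
  assumes solx: "sde_solution M \<F> B X A x0 x \<xi>" and soly: "sde_solution M \<F> B X A y0 y \<xi>'"
    and ne: "x0 \<noteq> y0" and \<rho>: "\<rho> \<ge> 1" and l: "l > 0" and r: "r > 0"
  shows "outer_prob_le M (\<lambda>\<omega>. \<exists>t\<in>{0..real T}. ereal t < \<xi> \<omega> \<and> ereal t < \<xi>' \<omega> \<and>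
        (\<forall>s\<in>{0..t}. 1 + (norm (x s \<omega>))\<^sup>2 \<le> \<rho> \<and> 1 + (norm (y s \<omega>))\<^sup>2 \<le> \<rho>) \<and> norm (x t \<omega> - y t \<omega>) > l)
     (6 * 4^r * (norm (x0 - y0) / l)^(2 * r) * exp (growth_const TYPE('m) r * (growth * (1 + ln \<rho>)) * real T))"
proof -
  obtain \<sigma> H I a where d: "\<And>k::nat. dyadic_approx (H k) (I k)" "\<And>t. t \<ge> 0 \<Longrightarrow> a t \<in> borel_measurable (\<F> t)"
    and ae: "AE \<omega> in M. (\<forall>t\<ge>0. ereal t < \<xi> \<omega> \<longrightarrow> eventually (\<lambda>k. t \<le> \<sigma> k \<omega>) sequentially) \<and>
     (\<forall>k t. 0 \<le> t \<longrightarrow> t \<le> \<sigma> k \<omega> \<longrightarrow> ereal t < \<xi> \<omega> \<and> continuous_on {0..t} (\<lambda>s. x s \<omega>) \<and> continuous_on {0..t} (\<lambda>s. a s \<omega>) \<and>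
        (\<forall>s\<in>{0..t}. H k s \<omega> = X (x s \<omega>) \<and> a s \<omega> = A (x s \<omega>) \<and> x s \<omega> = x0 + I k s \<omega> + integral {0..s} (\<lambda>s. a s \<omega>)))"
    using solution_data[OF solx] by (elim exE conjE) (rule that, auto)
  obtain \<sigma>' H' I' a' where d': "\<And>k::nat. dyadic_approx (H' k) (I' k)" "\<And>t. t \<ge> 0 \<Longrightarrow> a' t \<in> borel_measurable (\<F> t)"
    and ae': "AE \<omega> in M. (\<forall>t\<ge>0. ereal t < \<xi>' \<omega> \<longrightarrow> eventually (\<lambda>k. t \<le> \<sigma>' k \<omega>) sequentially) \<and>
     (\<forall>k t. 0 \<le> t \<longrightarrow> t \<le> \<sigma>' k \<omega> \<longrightarrow> ereal t < \<xi>' \<omega> \<and> continuous_on {0..t} (\<lambda>s. y s \<omega>) \<and> continuous_on {0..t} (\<lambda>s. a' s \<omega>) \<and>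
        (\<forall>s\<in>{0..t}. H' k s \<omega> = X (y s \<omega>) \<and> a' s \<omega> = A (y s \<omega>) \<and> y s \<omega> = y0 + I' k s \<omega> + integral {0..s} (\<lambda>s. a' s \<omega>)))"
    using solution_data[OF soly] by (elim exE conjE) (rule that, auto)
  \<comment> \<open>With this choice e + |x0 - y0|^2 is 2e, so the estimate scales with the distance
    and only the ratio of |x0 - y0| to l remains. The 4^r is this factor 2^r times that of the
    maximal inequality.\<close>
  define e where "e = (norm (x0 - y0))\<^sup>2"
  define q where "q = growth * (1 + ln \<rho>)"
  have e: "e > 0" using ne by (simp add: e_def)
  have q: "q \<ge> 0" using growth_nonneg \<rho> by (simp add: q_def)
  define b where "b = l^(2 * r)"
  have b: "b > 0" using l by (simp add: b_def)
  define cp where "cp k \<omega> t \<longleftrightarrow> controlled_path e q (x0 - y0) (\<lambda>s. x s \<omega> - y s \<omega>) (\<lambda>s. I k s \<omega> - I' k s \<omega>)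
     (\<lambda>s. H k s \<omega> - H' k s \<omega>) (\<lambda>s. a s \<omega> - a' s \<omega>) t" for k \<omega> t
  have "outer_prob_le M (\<lambda>\<omega>. \<exists>t\<in>{0..real T}. cp k \<omega> t \<and> (e + (norm (x t \<omega> - y t \<omega>))\<^sup>2)^r > b)
    (6 * 2^r * (e + (norm (x0 - y0))\<^sup>2)^r * exp (growth_const TYPE('m) r * q * real T) / b)" for k
    unfolding cp_def
    by (rule maximal_inequality[OF dyadic_approx_diff[OF d(1) d'(1)] _ e q b])
      (intro borel_measurable_diff d(2) d'(2))
  then have "outer_prob_le M (\<lambda>\<omega>. \<exists>t\<in>{0..real T}. ereal t < \<xi> \<omega> \<and> ereal t < \<xi>' \<omega> \<and>
        (\<forall>s\<in>{0..t}. 1 + (norm (x s \<omega>))\<^sup>2 \<le> \<rho> \<and> 1 + (norm (y s \<omega>))\<^sup>2 \<le> \<rho>) \<and> norm (x t \<omega> - y t \<omega>) > l)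
    (6 * 2^r * (e + (norm (x0 - y0))\<^sup>2)^r * exp (growth_const TYPE('m) r * q * real T) / b)"
  proof (rule outer_prob_le_liminf)
    show "AE \<omega> in M. (\<exists>t\<in>{0..real T}. ereal t < \<xi> \<omega> \<and> ereal t < \<xi>' \<omega> \<and>
        (\<forall>s\<in>{0..t}. 1 + (norm (x s \<omega>))\<^sup>2 \<le> \<rho> \<and> 1 + (norm (y s \<omega>))\<^sup>2 \<le> \<rho>) \<and> norm (x t \<omega> - y t \<omega>) > l) \<longrightarrow>
      (\<forall>\<^sub>F k in sequentially. \<exists>t\<in>{0..real T}. cp k \<omega> t \<and> (e + (norm (x t \<omega> - y t \<omega>))\<^sup>2)^r > b)"
      using ae ae'
    proof eventually_elim
      case (elim \<omega>)
      note E = elim(1)[THEN conjunct2, THEN spec, THEN spec, THEN mp, THEN mp]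
      note E' = elim(2)[THEN conjunct2, THEN spec, THEN spec, THEN mp, THEN mp]
      show ?case
      proof
        assume "\<exists>t\<in>{0..real T}. ereal t < \<xi> \<omega> \<and> ereal t < \<xi>' \<omega> \<and>
          (\<forall>s\<in>{0..t}. 1 + (norm (x s \<omega>))\<^sup>2 \<le> \<rho> \<and> 1 + (norm (y s \<omega>))\<^sup>2 \<le> \<rho>) \<and> norm (x t \<omega> - y t \<omega>) > l"
        then obtain t where t: "t \<in> {0..real T}" "ereal t < \<xi> \<omega>" "ereal t < \<xi>' \<omega>"
          "\<And>s. s \<in> {0..t} \<Longrightarrow> 1 + (norm (x s \<omega>))\<^sup>2 \<le> \<rho>" "\<And>s. s \<in> {0..t} \<Longrightarrow> 1 + (norm (y s \<omega>))\<^sup>2 \<le> \<rho>"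
          "norm (x t \<omega> - y t \<omega>) > l" by blast
        have "b < (norm (x t \<omega> - y t \<omega>))^(2 * r)"
          unfolding b_def using t(6) l r by (intro power_strict_mono) auto
        also have "\<dots> \<le> (e + (norm (x t \<omega> - y t \<omega>))\<^sup>2)^r"
          unfolding power_mult using e by (intro power_mono) auto
        finally have V: "(e + (norm (x t \<omega> - y t \<omega>))\<^sup>2)^r > b" .
        have "eventually (\<lambda>k. t \<le> \<sigma> k \<omega>) sequentially" "eventually (\<lambda>k. t \<le> \<sigma>' k \<omega>) sequentially" using elim t(1-3) by auto
        then show "\<forall>\<^sub>F k in sequentially. \<exists>t\<in>{0..real T}. cp k \<omega> t \<and> (e + (norm (x t \<omega> - y t \<omega>))\<^sup>2)^r > b"
        proof eventually_elim
          case (elim k)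
          have D: "0 \<le> t" "t \<le> \<sigma> k \<omega>" "t \<le> \<sigma>' k \<omega>" using t(1) elim by auto
          have c: "continuous_on {0..t} (\<lambda>s. x s \<omega>)" "continuous_on {0..t} (\<lambda>s. a s \<omega>)"
            and q1: "\<And>s. s \<in> {0..t} \<Longrightarrow> H k s \<omega> = X (x s \<omega>) \<and> a s \<omega> = A (x s \<omega>) \<and> x s \<omega> = x0 + I k s \<omega> + integral {0..s} (\<lambda>s. a s \<omega>)"
            using E[OF D(1,2)] by blast+
          have c': "continuous_on {0..t} (\<lambda>s. y s \<omega>)" "continuous_on {0..t} (\<lambda>s. a' s \<omega>)"
            and q2: "\<And>s. s \<in> {0..t} \<Longrightarrow> H' k s \<omega> = X (y s \<omega>) \<and> a' s \<omega> = A (y s \<omega>) \<and> y s \<omega> = y0 + I' k s \<omega> + integral {0..s} (\<lambda>s. a' s \<omega>)"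
            using E'[OF D(1,3)] by blast+
          have qd: "q * (norm z)\<^sup>2 \<le> q * (e + (norm z)\<^sup>2)" for z :: 'n using q e by (intro mult_left_mono) auto
          have "cp k \<omega> t" unfolding cp_def
          proof (intro controlled_pathI continuous_intros c c')
            fix s assume s: "s \<in> {0..t}"
            have i: "(\<lambda>s. a s \<omega>) integrable_on {0..s}" "(\<lambda>s. a' s \<omega>) integrable_on {0..s}"
              using s by (auto intro!: integrable_continuous_interval continuous_on_subset[OF c(2)] continuous_on_subset[OF c'(2)])
            have "x s \<omega> - y s \<omega> = (x0 + I k s \<omega> + integral {0..s} (\<lambda>s. a s \<omega>)) - (y0 + I' k s \<omega> + integral {0..s} (\<lambda>s. a' s \<omega>))"
              using q1[OF s] q2[OF s] by metis
            also have "\<dots> = x0 - y0 + (I k s \<omega> - I' k s \<omega>) + integral {0..s} (\<lambda>s. a s \<omega> - a' s \<omega>)"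
              using integral_diff[OF i] by simp
            finally show "x s \<omega> - y s \<omega> = x0 - y0 + (I k s \<omega> - I' k s \<omega>) + integral {0..s} (\<lambda>s. a s \<omega> - a' s \<omega>)" .
            have eqs: "H k s \<omega> = X (x s \<omega>)" "H' k s \<omega> = X (y s \<omega>)" "a s \<omega> = A (x s \<omega>)" "a' s \<omega> = A (y s \<omega>)"
              using q1[OF s] q2[OF s] by blast+
            show "(norm (H k s \<omega> - H' k s \<omega>))\<^sup>2 \<le> q * (e + (norm (x s \<omega> - y s \<omega>))\<^sup>2)"
              unfolding eqs using X_Lipschitz[OF t(4)[OF s] t(5)[OF s]] qd unfolding q_def by (rule order_trans)
            show "(x s \<omega> - y s \<omega>) \<bullet> (a s \<omega> - a' s \<omega>) \<le> q * (e + (norm (x s \<omega> - y s \<omega>))\<^sup>2)"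
              unfolding eqs using A_monotone[OF t(4)[OF s] t(5)[OF s]] qd unfolding q_def by (rule order_trans)
          qed
          then show ?case using t(1) V by blast
        qed
      qed
    qed
  qed
  moreover have "6 * 2^r * (e + (norm (x0 - y0))\<^sup>2)^r * exp (growth_const TYPE('m) r * q * real T) / b =
     6 * 4^r * (norm (x0 - y0) / l)^(2 * r) * exp (growth_const TYPE('m) r * (growth * (1 + ln \<rho>)) * real T)"
  proof -
    have "2^r * (e + (norm (x0 - y0))\<^sup>2)^r / b = 4^r * (norm (x0 - y0) / l)^(2 * r)"
    proof -
      have f: "(4::real)^r = 2^r * 2^r" using power_mult_distrib[of "2::real" 2 r] by simp
      have "(e + (norm (x0 - y0))\<^sup>2)^r = (2 * e)^r" by (simp add: e_def)
      also have "\<dots> = 2^r * e^r" by (rule power_mult_distrib)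
      finally have "(e + (norm (x0 - y0))\<^sup>2)^r = 2^r * e^r" .
      moreover have "e^r = (norm (x0 - y0))^(2 * r)" by (simp add: e_def power_mult)
      ultimately show ?thesis unfolding b_def f power_divide by simp
    qed
    then have "6 * (2^r * (e + (norm (x0 - y0))\<^sup>2)^r / b) * exp (growth_const TYPE('m) r * q * real T)
       = 6 * (4^r * (norm (x0 - y0) / l)^(2 * r)) * exp (growth_const TYPE('m) r * q * real T)" by (simp only:)
    then show ?thesis unfolding q_def by simp
  qed
  ultimately show ?thesis by simp
qed

text \<open>Combines the estimate on balls with the tails of the two solutions, the radius being a small power of \<open>u\<close>.\<close>

lemma flow_tail:
  fixes R :: real and T p :: nat
  assumes p: "p > 0" and R: "R \<ge> 0"
  shows "\<exists>C\<ge>0. \<forall>x0 y0 x y \<xi> \<xi>' u. sde_solution M \<F> B X A x0 x \<xi> \<longrightarrow> sde_solution M \<F> B X A y0 y \<xi>' \<longrightarrow>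
     norm x0 \<le> R \<longrightarrow> norm y0 \<le> R \<longrightarrow> x0 \<noteq> y0 \<longrightarrow> u \<ge> 1 \<longrightarrow>
     outer_prob_le M (\<lambda>\<omega>. \<exists>t\<in>{0..real T}. ereal t < \<xi> \<omega> \<and> ereal t < \<xi>' \<omega> \<and> norm (x t \<omega> - y t \<omega>) > u * norm (x0 - y0)) (C / u^p)"
proof -
  define g where "g = growth_const TYPE('m) p * growth * real T"
  have g: "g \<ge> 0" using growth_nonneg step_const_nonneg[of "TYPE('m)" p] by (simp add: g_def growth_const_def)
  \<comment> \<open>A sufficiently high moment for leaving the ball: it has to compensate the power
    rho^g lost by the two-point estimate on the ball.\<close>
  obtain r :: nat where r: "real r \<ge> g + 1" using real_arch_simple by blast
  obtain C where C: "C \<ge> 0" "\<And>x0 x \<xi> (T::nat) b. sde_solution M \<F> B X A x0 x \<xi> \<Longrightarrow> b > 0 \<Longrightarrow>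
     outer_prob_le M (\<lambda>\<omega>. \<exists>t\<in>{0..real T}. ereal t < \<xi> \<omega> \<and> (1 + (norm (x t \<omega>))\<^sup>2)^r > b)
       (C * (1 + (norm x0)\<^sup>2)^r * exp (C * real T) / b)"
    using solution_tail[of r] by blast
  define C1 where "C1 = C * (1 + R\<^sup>2)^r * exp (C * real T)"
  have C1: "C1 \<ge> 0" using C by (simp add: C1_def)
  define C2 where "C2 = 6 * 4^p * exp g"
  have C2: "C2 \<ge> 0" by (simp add: C2_def)
  show ?thesis
  proof (intro exI[of _ "C2 + (C1 + C1)"] conjI allI impI)
    show "0 \<le> C2 + (C1 + C1)" using C1 C2 by simp
    fix x0 y0 x y \<xi> \<xi>' and u :: real
    assume sol: "sde_solution M \<F> B X A x0 x \<xi>" "sde_solution M \<F> B X A y0 y \<xi>'"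
      and nR: "norm x0 \<le> R" "norm y0 \<le> R" and ne: "x0 \<noteq> y0" and u: "u \<ge> 1"
    \<comment> \<open>The two-point estimate has order u^(-2p) rho^g, and rho^g <= u^p leaves u^-p.
      Leaving the ball has probability of order rho^-r, and rho^r >= u^p because r >= g + 1.\<close>
    define \<rho> where "\<rho> = u powr (p / (g + 1))"
    have \<rho>: "\<rho> \<ge> 1" unfolding \<rho>_def using u g by (intro ge_one_powr_ge_zero) auto
    have \<rho>r: "\<rho>^r \<ge> u^p"
    proof -
      have "\<rho>^r = u powr (real p * (real r / (g + 1)))" unfolding \<rho>_def using u g by (simp add: powr_powr powr_realpow[symmetric])
      also have "\<dots> \<ge> u powr (real p * 1)" using u r g p by (intro powr_mono mult_left_mono) auto
      finally show ?thesis using u by (simp add: powr_realpow)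
    qed
    have \<rho>g: "exp (g * ln \<rho>) \<le> u^p"
    proof -
      have "exp (g * ln \<rho>) = \<rho> powr g" using \<rho> by (simp add: powr_def)
      also have "\<dots> = u powr (real p * (g / (g + 1)))" unfolding \<rho>_def by (simp add: powr_powr)
      also have "\<dots> \<le> u powr (real p * 1)" using u g p by (intro powr_mono mult_left_mono) auto
      finally show ?thesis using u by (simp add: powr_realpow)
    qed
    have up: "u^p > 0" using u by simp
    define l where "l = u * norm (x0 - y0)"
    have l: "l > 0" using u ne by (simp add: l_def)
    have big: "outer_prob_le M (\<lambda>\<omega>. \<exists>t\<in>{0..real T}. ereal t < \<zeta> \<omega> \<and> (1 + (norm (z t \<omega>))\<^sup>2)^r > \<rho>^r) (C1 / u^p)"
      if s: "sde_solution M \<F> B X A z0 z \<zeta>" and z0: "norm z0 \<le> R" for z0 z \<zeta>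
    proof (rule outer_prob_le_mono[OF C(2)[OF s]])
      show "\<rho>^r > 0" using \<rho> by simp
      have "C * (1 + (norm z0)\<^sup>2)^r * exp (C * real T) \<le> C1"
        unfolding C1_def using z0 C(1) by (intro mult_right_mono mult_left_mono power_mono add_left_mono) auto
      then show "C * (1 + (norm z0)\<^sup>2)^r * exp (C * real T) / \<rho>^r \<le> C1 / u^p"
        using \<rho>r up C1 C(1) by (intro frac_le) auto
    qed
    have pt: "outer_prob_le M (\<lambda>\<omega>. \<exists>t\<in>{0..real T}. ereal t < \<xi> \<omega> \<and> ereal t < \<xi>' \<omega> \<and>
        (\<forall>s\<in>{0..t}. 1 + (norm (x s \<omega>))\<^sup>2 \<le> \<rho> \<and> 1 + (norm (y s \<omega>))\<^sup>2 \<le> \<rho>) \<and> norm (x t \<omega> - y t \<omega>) > l) (C2 / u^p)"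
    proof (rule outer_prob_le_mono[OF pair_tail[OF sol ne \<rho> l p]])
      have e1: "growth_const TYPE('m) p * (growth * (1 + ln \<rho>)) * real T = g + g * ln \<rho>"
        by (simp add: g_def algebra_simps)
      have e2: "norm (x0 - y0) / l = 1 / u" using ne by (simp add: l_def)
      have "6 * 4^p * (norm (x0 - y0) / l)^(2 * p) * exp (growth_const TYPE('m) p * (growth * (1 + ln \<rho>)) * real T)
        = C2 * exp (g * ln \<rho>) / (u^p * u^p)"
        unfolding e1 e2 C2_def exp_add by (simp add: power_divide mult_2 power_add)
      also have "\<dots> \<le> C2 * u^p / (u^p * u^p)" using \<rho>g C2 up by (intro divide_right_mono mult_left_mono) auto
      also have "\<dots> = C2 / u^p" using up by simp
      finally show "6 * 4^p * (norm (x0 - y0) / l)^(2 * p) * exp (growth_const TYPE('m) p * (growth * (1 + ln \<rho>)) * real T) \<le> C2 / u^p" .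
    qed
    show "outer_prob_le M (\<lambda>\<omega>. \<exists>t\<in>{0..real T}. ereal t < \<xi> \<omega> \<and> ereal t < \<xi>' \<omega> \<and> norm (x t \<omega> - y t \<omega>) > u * norm (x0 - y0)) ((C2 + (C1 + C1)) / u^p)"
    proof (rule outer_prob_le_mono[OF outer_prob_le_disj[OF pt outer_prob_le_disj[OF big[OF sol(1) nR(1)] big[OF sol(2) nR(2)]]]])
      show "C2 / u^p + (C1 / u^p + C1 / u^p) \<le> (C2 + (C1 + C1)) / u^p" by (simp add: add_divide_distrib)
      fix \<omega> assume "\<exists>t\<in>{0..real T}. ereal t < \<xi> \<omega> \<and> ereal t < \<xi>' \<omega> \<and> norm (x t \<omega> - y t \<omega>) > u * norm (x0 - y0)"
      then obtain t where t: "t \<in> {0..real T}" "ereal t < \<xi> \<omega>" "ereal t < \<xi>' \<omega>" "norm (x t \<omega> - y t \<omega>) > l"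
        unfolding l_def by blast
      have mono: "z^r > \<rho>^r" if "\<not> z \<le> \<rho>" for z :: real
        using that \<rho> r g by (intro power_strict_mono) auto
      show "(\<exists>t\<in>{0..real T}. ereal t < \<xi> \<omega> \<and> ereal t < \<xi>' \<omega> \<and>
        (\<forall>s\<in>{0..t}. 1 + (norm (x s \<omega>))\<^sup>2 \<le> \<rho> \<and> 1 + (norm (y s \<omega>))\<^sup>2 \<le> \<rho>) \<and> norm (x t \<omega> - y t \<omega>) > l) \<or>
        (\<exists>t\<in>{0..real T}. ereal t < \<xi> \<omega> \<and> (1 + (norm (x t \<omega>))\<^sup>2)^r > \<rho>^r) \<or>
        (\<exists>t\<in>{0..real T}. ereal t < \<xi>' \<omega> \<and> (1 + (norm (y t \<omega>))\<^sup>2)^r > \<rho>^r)"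
      proof (cases "\<forall>s\<in>{0..t}. 1 + (norm (x s \<omega>))\<^sup>2 \<le> \<rho> \<and> 1 + (norm (y s \<omega>))\<^sup>2 \<le> \<rho>")
        case True
        then show ?thesis using t by blast
      next
        case False
        then obtain s where s: "s \<in> {0..t}" "\<not> 1 + (norm (x s \<omega>))\<^sup>2 \<le> \<rho> \<or> \<not> 1 + (norm (y s \<omega>))\<^sup>2 \<le> \<rho>" by blast
        have le: "ereal s \<le> ereal t" using s by simp
        have "ereal s < \<xi> \<omega>" "ereal s < \<xi>' \<omega>" by (rule le_less_trans[OF le t(2)], rule le_less_trans[OF le t(3)])
        moreover have "s \<in> {0..real T}" using s t by auto
        ultimately show ?thesis using s(2) mono by blast
      qed
    qed
  qed
qed

end

section \<open>Euler polygons and existence\<close>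

definition step_integral :: "nat \<Rightarrow> (nat \<Rightarrow> 'm::euclidean_space \<Rightarrow>\<^sub>L 'n::euclidean_space) \<Rightarrow> (real \<Rightarrow> 'm) \<Rightarrow> real \<Rightarrow> 'n" where
  "step_integral n g b t = (\<Sum>l<nat \<lfloor>t * 2^n\<rfloor>. blinfun_apply (g l) (b (real (Suc l) / 2^n) - b (real l / 2^n)))
     + blinfun_apply (g (nat \<lfloor>t * 2^n\<rfloor>)) (b t - b (real (nat \<lfloor>t * 2^n\<rfloor>) / 2^n))"

lemma nat_floor_dyadic:
  assumes "real j / 2^m \<le> s" "s < real (Suc j) / 2^m"
  shows "nat \<lfloor>s * 2^m\<rfloor> = j"
  using floor_dyadic[OF assms] by simp

lemma nat_floor_dyadic_real [simp]: "nat \<lfloor>real j / 2^m * 2^m\<rfloor> = j"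
  by simp

lemma nat_floor_dyadic_cell:
  assumes "0 \<le> s"
  shows "real (nat \<lfloor>s * 2^m\<rfloor>) / 2^m \<le> s" "s < real (Suc (nat \<lfloor>s * 2^m\<rfloor>)) / 2^m"
proof -
  have r: "real (nat \<lfloor>s * 2^m\<rfloor>) = real_of_int \<lfloor>s * 2^m\<rfloor>" using assms by simp
  show "real (nat \<lfloor>s * 2^m\<rfloor>) / 2^m \<le> s" unfolding r by (rule floor_dyadic_le)
  have "s * 2^m < real (Suc (nat \<lfloor>s * 2^m\<rfloor>))" unfolding of_nat_Suc r by linarith
  then show "s < real (Suc (nat \<lfloor>s * 2^m\<rfloor>)) / 2^m" by (simp add: less_divide_eq)
qed

lemma dyadic_le_Suc: "real j / 2^m \<le> real (Suc j) / 2^m"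
  by (simp add: divide_right_mono)

text \<open>At the right end point the index jumps, but there the formulas of the adjacent cells
  agree. Having the formula on closed cells is what makes increments and continuity
  accessible.\<close>

lemma step_integral_cell:
  assumes u: "real j / 2^n \<le> u" "u \<le> real (Suc j) / 2^n"
  shows "step_integral n g b u = (\<Sum>l<j. blinfun_apply (g l) (b (real (Suc l) / 2^n) - b (real l / 2^n)))
     + blinfun_apply (g j) (b u - b (real j / 2^n))"
proof (cases "u < real (Suc j) / 2^n")
  case True
  then show ?thesis using nat_floor_dyadic[OF u(1)] by (simp add: step_integral_def)
next
  case False
  then have "u = real (Suc j) / 2^n" using u by simp
  moreover have "nat \<lfloor>real (Suc j) / 2^n * 2^n\<rfloor> = Suc j" by (rule nat_floor_dyadic_real)
  ultimately show ?thesis unfolding step_integral_def by (simp only:) (simp add: blinfun.zero_right)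
qed

lemma step_integral_increment:
  assumes "real j / 2^n \<le> s" "s \<le> u" "u \<le> real (Suc j) / 2^n"
  shows "step_integral n g b u - step_integral n g b s = blinfun_apply (g j) (b u - b s)"
proof -
  have "step_integral n g b u = (\<Sum>l<j. blinfun_apply (g l) (b (real (Suc l) / 2^n) - b (real l / 2^n)))
     + blinfun_apply (g j) (b u - b (real j / 2^n))"
    using assms by (intro step_integral_cell) auto
  moreover have "step_integral n g b s = (\<Sum>l<j. blinfun_apply (g l) (b (real (Suc l) / 2^n) - b (real l / 2^n)))
     + blinfun_apply (g j) (b s - b (real j / 2^n))"
    using assms by (intro step_integral_cell) auto
  ultimately show ?thesis by (simp add: blinfun.diff_right)
qed

lemma step_integral_0 [simp]: "step_integral n g b 0 = 0"
  by (simp add: step_integral_def blinfun.zero_right)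

text \<open>A form in which t occurs only inside \<open>min\<close>: it shows continuity in t and
  has the shape of \<open>simple_integral\<close>.\<close>

lemma step_integral_min:
  assumes t: "0 \<le> t" "t \<le> real N / 2^n"
  shows "step_integral n g b t = (\<Sum>j<N. blinfun_apply (g j) (b (min t (real (Suc j) / 2^n)) - b (min t (real j / 2^n))))"
  using t
proof (induction N arbitrary: t)
  case 0
  then show ?case by simp
next
  case (Suc N)
  show ?case
  proof (cases "t \<le> real N / 2^n")
    case True
    then have "min t (real (Suc N) / 2^n) = t" "min t (real N / 2^n) = t" using dyadic_le_Suc[of N n] by auto
    then show ?thesis using Suc.IH[OF Suc.prems(1) True] by (simp add: blinfun.zero_right)
  next
    case False
    have "step_integral n g b t = step_integral n g b (real N / 2^n) + blinfun_apply (g N) (b t - b (real N / 2^n))"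
      using step_integral_increment[of N n "real N / 2^n" t g b] False Suc.prems by (simp add: algebra_simps)
    also have "step_integral n g b (real N / 2^n) = (\<Sum>j<N. blinfun_apply (g j) (b (min (real N / 2^n) (real (Suc j) / 2^n)) - b (min (real N / 2^n) (real j / 2^n))))"
      by (rule Suc.IH) auto
    also have "\<dots> = (\<Sum>j<N. blinfun_apply (g j) (b (min t (real (Suc j) / 2^n)) - b (min t (real j / 2^n))))"
    proof (intro sum.cong refl)
      fix j assume "j \<in> {..<N}"
      then have "real (Suc j) / 2^n \<le> real N / 2^n" "real j / 2^n \<le> real N / 2^n" by (auto intro!: divide_right_mono)
      then show "blinfun_apply (g j) (b (min (real N / 2^n) (real (Suc j) / 2^n)) - b (min (real N / 2^n) (real j / 2^n))) =
        blinfun_apply (g j) (b (min t (real (Suc j) / 2^n)) - b (min t (real j / 2^n)))"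
        using False by (simp add: min_def)
    qed
    finally show ?thesis using False Suc.prems by (simp add: min_def)
  qed
qed

lemma step_integral_continuous:
  assumes b: "continuous_on {0..} b"
  shows "continuous_on {0..real T} (step_integral n g b)"
proof -
  have "continuous_on {0..real T} (\<lambda>t. \<Sum>j<T * 2^n. blinfun_apply (g j) (b (min t (real (Suc j) / 2^n)) - b (min t (real j / 2^n))))"
    by (intro continuous_intros continuous_on_compose2[OF b]) auto
  then show ?thesis
    by (rule continuous_on_eq) (rule step_integral_min[symmetric], auto)
qed

lemma step_function_has_integral_cell:
  fixes f :: "nat \<Rightarrow> 'n::euclidean_space"
  assumes u: "real j / 2^n \<le> u" "u \<le> real (Suc j) / 2^n"
  shows "((\<lambda>s. f (nat \<lfloor>s * 2^n\<rfloor>)) has_integral (u - real j / 2^n) *\<^sub>R f j) {real j / 2^n..u}"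
proof (rule has_integral_spike_finite[of "{u}"])
  show "((\<lambda>s. f j) has_integral (u - real j / 2^n) *\<^sub>R f j) {real j / 2^n..u}"
    using has_integral_const_real[of "f j" "real j / 2^n" u] u by simp
  fix s assume "s \<in> {real j / 2^n..u} - {u}"
  then show "f (nat \<lfloor>s * 2^n\<rfloor>) = f j" using nat_floor_dyadic[of j n s] u by simp
qed simp

lemma step_function_has_integral:
  fixes f :: "nat \<Rightarrow> 'n::euclidean_space"
  assumes u: "real j / 2^n \<le> u" "u \<le> real (Suc j) / 2^n"
  shows "((\<lambda>s. f (nat \<lfloor>s * 2^n\<rfloor>)) has_integral ((1 / 2^n) *\<^sub>R (\<Sum>l<j. f l) + (u - real j / 2^n) *\<^sub>R f j)) {0..u}"
  using u
proof (induction j arbitrary: u)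
  case 0
  then show ?case using step_function_has_integral_cell[of 0 n u f] by simp
next
  case (Suc j)
  have le: "real j / 2^n \<le> real (Suc j) / 2^n" by (rule dyadic_le_Suc)
  have "((\<lambda>s. f (nat \<lfloor>s * 2^n\<rfloor>)) has_integral
    ((1 / 2^n) *\<^sub>R (\<Sum>l<j. f l) + (real (Suc j) / 2^n - real j / 2^n) *\<^sub>R f j) + (u - real (Suc j) / 2^n) *\<^sub>R f (Suc j)) {0..u}"
    by (rule has_integral_combine[OF _ Suc.prems(1) Suc.IH[OF le order_refl] step_function_has_integral_cell[OF Suc.prems]]) simp
  moreover have "real (Suc j) / 2^n - real j / 2^n = 1 / 2^n" by (simp add: diff_divide_distrib[symmetric])
  ultimately show ?case by (simp add: scaleR_add_right)
qed

lemma step_function_integrable: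
  fixes f :: "nat \<Rightarrow> 'n::euclidean_space" and t :: real
  shows "(\<lambda>s. f (nat \<lfloor>s * 2^n\<rfloor>)) integrable_on {0..t}"
proof (cases "0 \<le> t")
  case True
  from step_function_has_integral[OF nat_floor_dyadic_cell(1)[OF this] less_imp_le[OF nat_floor_dyadic_cell(2)[OF this]]]
  show ?thesis by blast
qed (simp add: integrable_on_empty)

lemma dyadic_refine:
  assumes "n \<le> m"
  shows "real (i div 2^(m - n)) / 2^n \<le> real i / 2^m" "real (Suc i) / 2^m \<le> real (Suc (i div 2^(m - n))) / 2^n"
proof -
  define d :: nat where "d = 2^(m - n)"
  have d: "d > 0" by (simp add: d_def)
  have p: "(2::real)^m = real d * 2^n" using assms by (simp add: d_def power_add[symmetric])
  have "(i div d) * d \<le> i" by simp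
  then have "real (i div d) * real d \<le> real i" by (metis of_nat_le_iff of_nat_mult)
  then show "real (i div 2^(m - n)) / 2^n \<le> real i / 2^m"
    unfolding p d_def[symmetric] using d by (simp add: field_simps)
  have "Suc i \<le> Suc (i div d) * d" using dividend_less_div_times[OF d, of i] by simp
  then have "real (Suc i) \<le> real (Suc (i div d)) * real d" by (metis of_nat_le_iff of_nat_mult)
  then have "real (Suc i) / real d \<le> real (Suc (i div d))" using d by (simp add: pos_divide_le_eq)
  then have "real (Suc i) / real d / 2^n \<le> real (Suc (i div d)) / 2^n" by (intro divide_right_mono) auto
  then show "real (Suc i) / 2^m \<le> real (Suc (i div 2^(m - n))) / 2^n"
    unfolding p d_def[symmetric] by simp
qed

lemma nat_floor_refine:
  assumes "n \<le> m"
  shows "nat \<lfloor>real i / 2^m * 2^n\<rfloor> = i div 2^(m - n)"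
proof (rule nat_floor_dyadic[OF dyadic_refine(1)[OF assms]])
  have "real i / 2^m < real (Suc i) / 2^m" by (simp add: divide_strict_right_mono)
  then show "real i / 2^m < real (Suc (i div 2^(m - n))) / 2^n" using dyadic_refine(2)[OF assms, of i] by linarith
qed

lemma nat_floor_floor:
  fixes s :: real
  assumes "n \<le> m" "0 \<le> s"
  shows "nat \<lfloor>real (nat \<lfloor>s * 2^m\<rfloor>) / 2^m * 2^n\<rfloor> = nat \<lfloor>s * 2^n\<rfloor>"
proof -
  define i where "i = nat \<lfloor>s * 2^m\<rfloor>"
  have i: "real i / 2^m \<le> s" "s < real (Suc i) / 2^m" unfolding i_def by (rule nat_floor_dyadic_cell[OF assms(2)])+
  have "nat \<lfloor>s * 2^n\<rfloor> = i div 2^(m - n)"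
    using dyadic_refine[OF assms(1), of i] i by (intro nat_floor_dyadic) linarith+
  then show ?thesis unfolding i_def[symmetric] using nat_floor_refine[OF assms(1), of i] by simp
qed

lemma step_integral_refine:
  assumes "n \<le> m"
  shows "(\<Sum>l<i. blinfun_apply (g (l div 2^(m - n))) (b (real (Suc l) / 2^m) - b (real l / 2^m))) = step_integral n g b (real i / 2^m)"
proof (induction i)
  case (Suc i)
  then show ?case
    using step_integral_increment[OF dyadic_refine(1)[OF assms, of i] dyadic_le_Suc dyadic_refine(2)[OF assms, of i], of g b]
    by (simp add: algebra_simps)
qed simp

lemma step_function_dyadic_regular:
  fixes f :: "nat \<Rightarrow> 'n::metric_space"
  shows "dyadic_regular (\<lambda>s. f (nat \<lfloor>s * 2^n\<rfloor>)) t"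
  unfolding dyadic_regular_def
proof (intro allI impI exI[of _ n] ballI)
  fix \<eta> :: real and m s assume "\<eta> > 0" "n \<le> m" "s \<in> {0..t}"
  then have "f (nat \<lfloor>real_of_int \<lfloor>s * 2^m\<rfloor> / 2^m * 2^n\<rfloor>) = f (nat \<lfloor>s * 2^n\<rfloor>)"
    using nat_floor_floor[of n m s] by simp
  then show "dist (f (nat \<lfloor>s * 2^n\<rfloor>)) (f (nat \<lfloor>real_of_int \<lfloor>s * 2^m\<rfloor> / 2^m * 2^n\<rfloor>)) \<le> \<eta>"
    using \<open>\<eta> > 0\<close> by simp
qed

lemma dyadic_regular_diff:
  fixes f g :: "real \<Rightarrow> 'n::real_normed_vector"
  assumes "dyadic_regular f t" "dyadic_regular g t"
  shows "dyadic_regular (\<lambda>s. f s - g s) t"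
  unfolding dyadic_regular_def
proof (intro allI impI)
  fix \<eta> :: real assume "\<eta> > 0"
  then have h: "\<eta> / 2 > 0" by simp
  obtain k where k: "\<And>m s. m \<ge> k \<Longrightarrow> s \<in> {0..t} \<Longrightarrow> dist (f s) (f (real_of_int \<lfloor>s * 2^m\<rfloor> / 2^m)) \<le> \<eta> / 2"
    using assms(1)[unfolded dyadic_regular_def, rule_format, OF h] by blast
  obtain k' where k': "\<And>m s. m \<ge> k' \<Longrightarrow> s \<in> {0..t} \<Longrightarrow> dist (g s) (g (real_of_int \<lfloor>s * 2^m\<rfloor> / 2^m)) \<le> \<eta> / 2"
    using assms(2)[unfolded dyadic_regular_def, rule_format, OF h] by blast
  show "\<exists>k. \<forall>m\<ge>k. \<forall>s\<in>{0..t}. dist (f s - g s) (f (real_of_int \<lfloor>s * 2^m\<rfloor> / 2^m) - g (real_of_int \<lfloor>s * 2^m\<rfloor> / 2^m)) \<le> \<eta>"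
  proof (intro exI[of _ "max k k'"] allI impI ballI)
    fix m s assume "m \<ge> max k k'" "s \<in> {0..t}"
    then have "dist (f s) (f (real_of_int \<lfloor>s * 2^m\<rfloor> / 2^m)) \<le> \<eta> / 2" "dist (g s) (g (real_of_int \<lfloor>s * 2^m\<rfloor> / 2^m)) \<le> \<eta> / 2"
      using k k' by auto
    then show "dist (f s - g s) (f (real_of_int \<lfloor>s * 2^m\<rfloor> / 2^m) - g (real_of_int \<lfloor>s * 2^m\<rfloor> / 2^m)) \<le> \<eta>"
      unfolding dist_norm by norm
  qed
qed

section \<open>Euler polygons\<close>

context sde_setting
begin

primrec euler :: "nat \<Rightarrow> 'n \<Rightarrow> nat \<Rightarrow> 'w \<Rightarrow> 'n" where
  "euler n x0 0 = (\<lambda>\<omega>. x0)"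
| "euler n x0 (Suc j) = (\<lambda>\<omega>. euler n x0 j \<omega>
     + blinfun_apply (X (euler n x0 j \<omega>)) (B (real (Suc j) / 2^n) \<omega> - B (real j / 2^n) \<omega>)
     + (1 / 2^n) *\<^sub>R A (euler n x0 j \<omega>))"

definition euler_diffusion :: "nat \<Rightarrow> 'n \<Rightarrow> real \<Rightarrow> 'w \<Rightarrow> 'n" where
  "euler_diffusion n x0 t \<omega> = step_integral n (\<lambda>j. X (euler n x0 j \<omega>)) (\<lambda>t. B t \<omega>) t"

definition euler_path :: "nat \<Rightarrow> 'n \<Rightarrow> real \<Rightarrow> 'w \<Rightarrow> 'n" where
  "euler_path n x0 t \<omega> = x0 + euler_diffusion n x0 t \<omega> + integral {0..t} (\<lambda>s. A (euler n x0 (nat \<lfloor>s * 2^n\<rfloor>) \<omega>))"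

lemma euler_sum:
  "euler n x0 j \<omega> = x0 + (\<Sum>l<j. blinfun_apply (X (euler n x0 l \<omega>)) (B (real (Suc l) / 2^n) \<omega> - B (real l / 2^n) \<omega>))
     + (1 / 2^n) *\<^sub>R (\<Sum>l<j. A (euler n x0 l \<omega>))"
  by (induction j) (simp_all add: scaleR_add_right algebra_simps)

lemma euler_path_cell:
  assumes u: "real j / 2^n \<le> u" "u \<le> real (Suc j) / 2^n"
  shows "euler_path n x0 u \<omega> = euler n x0 j \<omega> + blinfun_apply (X (euler n x0 j \<omega>)) (B u \<omega> - B (real j / 2^n) \<omega>)
     + (u - real j / 2^n) *\<^sub>R A (euler n x0 j \<omega>)"
  unfolding euler_path_def euler_diffusion_def step_integral_cell[OF u]
    integral_unique[OF step_function_has_integral[OF u, where f = "\<lambda>j. A (euler n x0 j \<omega>)"]]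
  using euler_sum[of n x0 j \<omega>] by (simp add: algebra_simps)

lemma euler_path_grid [simp]: "euler_path n x0 (real j / 2^n) \<omega> = euler n x0 j \<omega>"
  using euler_path_cell[of j n "real j / 2^n" x0 \<omega>] dyadic_le_Suc[of j n] by (simp add: blinfun.zero_right)

lemma euler_path_0 [simp]: "euler_path n x0 0 \<omega> = x0"
  by (simp add: euler_path_def euler_diffusion_def)

lemma X_measurable: "X \<in> borel_measurable borel" and A_measurable: "A \<in> borel_measurable borel"
  by (auto intro: borel_measurable_continuous_onI X_continuous A_continuous)

lemma euler_measurable: "real j / 2^n \<le> t \<Longrightarrow> euler n x0 j \<in> borel_measurable (\<F> t)"
proof (induction j)
  case 0
  then show ?case by simp
next
  case (Suc j)
  have jt: "real j / 2^n \<le> t" using Suc.prems dyadic_le_Suc[of j n] by linarith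
  note [measurable] = Suc.IH[OF jt]
  have [measurable]: "B (real j / 2^n) \<in> borel_measurable (\<F> t)" by (rule measurable_F_mono[OF B_measurable jt]) simp
  have [measurable]: "B (real (Suc j) / 2^n) \<in> borel_measurable (\<F> t)" by (rule measurable_F_mono[OF B_measurable Suc.prems]) simp
  note [measurable] = X_measurable A_measurable
  show ?case unfolding euler.simps(2) by measurable
qed

lemma euler_path_measurable:
  assumes t: "t \<ge> 0"
  shows "euler_path n x0 t \<in> borel_measurable (\<F> t)"
proof -
  define j where "j = nat \<lfloor>t * 2^n\<rfloor>"
  have j: "real j / 2^n \<le> t" "t < real (Suc j) / 2^n" unfolding j_def by (rule nat_floor_dyadic_cell[OF t])+
  note [measurable] = euler_measurable[OF j(1)] X_measurable A_measurable B_measurable[OF t]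
  have [measurable]: "B (real j / 2^n) \<in> borel_measurable (\<F> t)" by (rule measurable_F_mono[OF B_measurable j(1)]) simp
  have eq: "euler_path n x0 t = (\<lambda>\<omega>. euler n x0 j \<omega> + blinfun_apply (X (euler n x0 j \<omega>)) (B t \<omega> - B (real j / 2^n) \<omega>)
     + (t - real j / 2^n) *\<^sub>R A (euler n x0 j \<omega>))"
    by (rule ext) (rule euler_path_cell[OF j(1) less_imp_le[OF j(2)]])
  show ?thesis unfolding eq by measurable
qed

lemma euler_path_continuous:
  assumes "continuous_on {0..} (\<lambda>t. B t \<omega>)"
  shows "continuous_on {0..real T} (\<lambda>t. euler_path n x0 t \<omega>)"
  unfolding euler_path_def euler_diffusion_def
  by (intro continuous_intros step_integral_continuous assms indefinite_integral_continuous_1 step_function_integrable[where f = "\<lambda>j. A (euler n x0 j \<omega>)"])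

text \<open>The integrand is constant on the cells of level n, so on every finer grid it is
  represented without error. What has to be arranged is boundedness: only finitely many values occur
  up to T, so cutting off at a large k changes them with small probability only.\<close>

lemma euler_dyadic_approx:
  "dyadic_approx (\<lambda>s \<omega>. X (euler n x0 (nat \<lfloor>s * 2^n\<rfloor>) \<omega>)) (euler_diffusion n x0)"
  unfolding dyadic_approx_def
proof (intro conjI ballI allI impI)
  show "(\<lambda>s. indicator {0..real T} s *\<^sub>R X (euler n x0 (nat \<lfloor>s * 2^n\<rfloor>) \<omega>)) \<in> borel_measurable borel" for T :: nat and \<omega>
  proof -
    have [measurable]: "(\<lambda>s::real. X (euler n x0 (nat \<lfloor>s * 2^n\<rfloor>) \<omega>)) \<in> borel_measurable borel"
      by measurable
    show ?thesis by measurable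
  qed
  fix \<epsilon> :: real and T :: nat assume \<epsilon>: "\<epsilon> > 0"
  define P where "P k \<omega> \<longleftrightarrow> (\<exists>j\<le>T * 2^n. norm (X (euler n x0 j \<omega>)) > real k)" for k :: nat and \<omega>
  have em[measurable]: "euler n x0 j \<in> borel_measurable M" for j
    by (rule measurable_F[OF euler_measurable[OF order_refl]])
  have "{\<omega>\<in>space M. P k \<omega>} \<in> sets M" for k
  proof -
    note [measurable] = X_measurable
    have "{\<omega>\<in>space M. P k \<omega>} = (\<Union>j\<in>{..T * 2^n}. {\<omega>\<in>space M. norm (X (euler n x0 j \<omega>)) > real k})"
      by (auto simp: P_def)
    also have "\<dots> \<in> sets M" by (intro sets.finite_UN) (auto, measurable)
    finally show ?thesis .
  qed
  moreover have "AE \<omega> in M. eventually (\<lambda>k. \<not> P k \<omega>) sequentially"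
  proof (intro AE_I2)
    fix \<omega>
    obtain k0 :: nat where k0: "(\<Sum>j\<le>T * 2^n. norm (X (euler n x0 j \<omega>))) \<le> k0" using real_arch_simple by blast
    have "\<not> P k \<omega>" if "k \<ge> k0" for k
    proof -
      have "norm (X (euler n x0 j \<omega>)) \<le> real k" if "j \<le> T * 2^n" for j
      proof -
        have "norm (X (euler n x0 j \<omega>)) \<le> (\<Sum>j\<le>T * 2^n. norm (X (euler n x0 j \<omega>)))"
          using that by (intro member_le_sum) auto
        then show ?thesis using k0 \<open>k \<ge> k0\<close> by linarith
      qed
      then show ?thesis unfolding P_def by (auto simp: not_less)
    qed
    then show "eventually (\<lambda>k. \<not> P k \<omega>) sequentially" unfolding eventually_sequentially by blast
  qed
  ultimately obtain k where "outer_prob_le M (\<lambda>\<omega>. \<exists>l\<ge>k. P l \<omega>) \<epsilon>"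
    using outer_prob_le_eventually[where P = P, OF _ _ \<epsilon>] by blast
  then have Pk: "outer_prob_le M (P k) \<epsilon>" by (rule outer_prob_le_mono) auto
  define clip where "clip L = (if norm L \<le> real k then L else 0)" for L :: "'m \<Rightarrow>\<^sub>L 'n"
  show "\<exists>K\<ge>0. \<exists>m0. \<forall>m\<ge>m0. \<exists>G.
        (\<forall>i. G i \<in> borel_measurable (\<F> (real i / 2^m))) \<and> (\<forall>i. \<forall>\<omega>\<in>space M. norm (G i \<omega>) \<le> K) \<and>
        outer_prob_le M (\<lambda>\<omega>. \<not> (
          (\<integral>\<^sup>+s. ennreal ((norm (G (nat \<lfloor>s * 2^m\<rfloor>) \<omega> - X (euler n x0 (nat \<lfloor>s * 2^n\<rfloor>) \<omega>)))\<^sup>2) * indicator {0..real T} s \<partial>lborel) \<le> ennreal \<epsilon> \<and>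
          (\<forall>i\<le>T * 2^m. norm ((\<Sum>l<i. blinfun_apply (G l \<omega>) (B (real (Suc l) / 2^m) \<omega> - B (real l / 2^m) \<omega>))
             - euler_diffusion n x0 (real i / 2^m) \<omega>) \<le> \<epsilon>))) \<epsilon>"
  proof (intro exI[of _ "real k"] conjI exI[of _ n] allI impI)
    fix m assume m: "n \<le> m"
    \<comment> \<open>The quotient is the index of the cell of level n that contains the i-th cell
      of level m.\<close>
    define G where "G i \<omega> = clip (X (euler n x0 (i div 2^(m - n)) \<omega>))" for i \<omega>
    have Gm: "G i \<in> borel_measurable (\<F> (real i / 2^m))" for i
    proof -
      note [measurable] = euler_measurable[OF dyadic_refine(1)[OF m, of i]] X_measurable
      show ?thesis unfolding G_def clip_def by measurable
    qed
    have Gb: "norm (G i \<omega>) \<le> real k" for i \<omega> by (simp add: G_def clip_def)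
    have "outer_prob_le M (\<lambda>\<omega>. \<not> (
          (\<integral>\<^sup>+s. ennreal ((norm (G (nat \<lfloor>s * 2^m\<rfloor>) \<omega> - X (euler n x0 (nat \<lfloor>s * 2^n\<rfloor>) \<omega>)))\<^sup>2) * indicator {0..real T} s \<partial>lborel) \<le> ennreal \<epsilon> \<and>
          (\<forall>i\<le>T * 2^m. norm ((\<Sum>l<i. blinfun_apply (G l \<omega>) (B (real (Suc l) / 2^m) \<omega> - B (real l / 2^m) \<omega>))
             - euler_diffusion n x0 (real i / 2^m) \<omega>) \<le> \<epsilon>))) \<epsilon>"
    proof (rule outer_prob_le_mono[OF Pk _ order_refl], rule ccontr)
      fix \<omega> assume "\<not> P k \<omega>"
      then have nP: "norm (X (euler n x0 j \<omega>)) \<le> real k" if "j \<le> T * 2^n" for j using that unfolding P_def by (auto simp: not_less)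
      have divT: "i div 2^(m - n) \<le> T * 2^n" if "i \<le> T * 2^m" for i
      proof -
        have "(2::nat)^m = 2^n * 2^(m - n)" using m by (simp add: power_add[symmetric])
        then have "i \<le> (T * 2^n) * 2^(m - n)" using that by (simp add: mult.assoc)
        then show ?thesis by (metis div_le_mono nonzero_mult_div_cancel_right power_not_zero zero_neq_numeral)
      qed
      have GX: "G i \<omega> = X (euler n x0 (i div 2^(m - n)) \<omega>)" if "i \<le> T * 2^m" for i
        using nP[OF divT[OF that]] by (simp add: G_def clip_def)
      have z: "ennreal ((norm (G (nat \<lfloor>s * 2^m\<rfloor>) \<omega> - X (euler n x0 (nat \<lfloor>s * 2^n\<rfloor>) \<omega>)))\<^sup>2) * indicator {0..real T} s = 0" for s
      proof (cases "s \<in> {0..real T}")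
        case True
        have "real (nat \<lfloor>s * 2^m\<rfloor>) / 2^m \<le> real T" using nat_floor_dyadic_le True by auto
        then have "real (nat \<lfloor>s * 2^m\<rfloor>) \<le> real (T * 2^m)" by (simp add: divide_le_eq)
        then have le: "nat \<lfloor>s * 2^m\<rfloor> \<le> T * 2^m" by (simp only: of_nat_le_iff)
        have "nat \<lfloor>s * 2^m\<rfloor> div 2^(m - n) = nat \<lfloor>s * 2^n\<rfloor>"
          using nat_floor_floor[OF m, of s] nat_floor_refine[OF m, of "nat \<lfloor>s * 2^m\<rfloor>"] True by simp
        then show ?thesis using GX[OF le] by simp
      qed simp
      have "(\<Sum>l<i. blinfun_apply (G l \<omega>) (B (real (Suc l) / 2^m) \<omega> - B (real l / 2^m) \<omega>)) = euler_diffusion n x0 (real i / 2^m) \<omega>"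
        if "i \<le> T * 2^m" for i
        unfolding euler_diffusion_def step_integral_refine[OF m, symmetric] using that by (intro sum.cong refl) (simp add: GX)
      moreover assume "\<not> (
          (\<integral>\<^sup>+s. ennreal ((norm (G (nat \<lfloor>s * 2^m\<rfloor>) \<omega> - X (euler n x0 (nat \<lfloor>s * 2^n\<rfloor>) \<omega>)))\<^sup>2) * indicator {0..real T} s \<partial>lborel) \<le> ennreal \<epsilon> \<and>
          (\<forall>i\<le>T * 2^m. norm ((\<Sum>l<i. blinfun_apply (G l \<omega>) (B (real (Suc l) / 2^m) \<omega> - B (real l / 2^m) \<omega>))
             - euler_diffusion n x0 (real i / 2^m) \<omega>) \<le> \<epsilon>))"
      ultimately show False using \<epsilon> by (simp add: z)
    qed
    then show "\<exists>G. (\<forall>i. G i \<in> borel_measurable (\<F> (real i / 2^m))) \<and> (\<forall>i. \<forall>\<omega>\<in>space M. norm (G i \<omega>) \<le> real k) \<and>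
        outer_prob_le M (\<lambda>\<omega>. \<not> (
          (\<integral>\<^sup>+s. ennreal ((norm (G (nat \<lfloor>s * 2^m\<rfloor>) \<omega> - X (euler n x0 (nat \<lfloor>s * 2^n\<rfloor>) \<omega>)))\<^sup>2) * indicator {0..real T} s \<partial>lborel) \<le> ennreal \<epsilon> \<and>
          (\<forall>i\<le>T * 2^m. norm ((\<Sum>l<i. blinfun_apply (G l \<omega>) (B (real (Suc l) / 2^m) \<omega> - B (real l / 2^m) \<omega>))
             - euler_diffusion n x0 (real i / 2^m) \<omega>) \<le> \<epsilon>))) \<epsilon>"
      using Gm Gb by blast
  qed simp
qed

end

text \<open>Supplies a time at which the path sits on the boundary of a ball without having left it
  before. Up to that time the coefficients are bounded, which the estimate of the Euler lag
  requires.\<close>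

lemma continuous_first_hit:
  fixes f :: "real \<Rightarrow> real"
  assumes f: "continuous_on {0..T} f" and 0: "f 0 < R" and t: "t \<in> {0..T}" "f t \<ge> R"
  shows "\<exists>t\<in>{0..T}. f t = R \<and> (\<forall>s\<in>{0..t}. f s \<le> R)"
proof -
  define S where "S = {s\<in>{0..T}. f s \<ge> R}"
  have "closed S" unfolding S_def
    using continuous_closed_preimage[OF f closed_atLeastAtMost closed_atLeast[of R]] by (simp add: vimage_def Int_def)
  moreover have ne: "S \<noteq> {}" using t by (auto simp: S_def)
  moreover have bb: "bdd_below S" by (intro bdd_belowI[of _ 0]) (auto simp: S_def)
  ultimately have mem: "Inf S \<in> S" by (intro closed_contains_Inf)
  define u where "u = Inf S"
  have u: "u \<in> {0..T}" "f u \<ge> R" using mem by (auto simp: S_def u_def)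
  have below: "f s < R" if "s \<in> {0..T}" "s < u" for s
    using cInf_lower[OF _ bb, of s] that unfolding S_def[symmetric] u_def[symmetric] by (force simp: S_def)
  have "\<exists>s\<ge>0. s \<le> u \<and> f s = R"
    by (rule IVT') (use 0 u in \<open>auto intro: continuous_on_subset[OF f]\<close>)
  then obtain s where s: "0 \<le> s" "s \<le> u" "f s = R" by blast
  then have "s = u" using below[of s] u by fastforce
  then have fu: "f u = R" using s by simp
  have "f r \<le> R" if "r \<in> {0..u}" for r using below[of r] u fu that by (cases "r = u") auto
  then show ?thesis using u fu by blast
qed

section \<open>Tightness and Cauchy property of the Euler polygons\<close>

context sde_setting
begin

lemma coefficients_bounded: "\<exists>K\<ge>0. \<forall>z. norm z \<le> R \<longrightarrow> norm (X z) \<le> K \<and> norm (A z) \<le> K"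
proof -
  have "bounded (X ` cball 0 R)" "bounded (A ` cball 0 R)"
    by (auto intro!: compact_imp_bounded compact_continuous_image
        continuous_on_subset[OF X_continuous] continuous_on_subset[OF A_continuous])
  then obtain K1 K2 where "\<forall>x\<in>X ` cball 0 R. norm x \<le> K1" "\<forall>x\<in>A ` cball 0 R. norm x \<le> K2"
    unfolding bounded_iff by blast
  then have "\<And>z. norm z \<le> R \<Longrightarrow> norm (X z) \<le> K1" "\<And>z. norm z \<le> R \<Longrightarrow> norm (A z) \<le> K2" by auto
  then show ?thesis by (intro exI[of _ "max 0 (max K1 K2)"]) (auto simp: le_max_iff_disj)
qed

text \<open>Within one cell the noise moves the polygon by at most K \<open>\<nu>\<close> and the
  drift by at most K / 2^n, as long as the coefficients are evaluated in the ball.\<close>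

lemma euler_lag:
  assumes K: "\<And>z. norm z \<le> R \<Longrightarrow> norm (X z) \<le> K \<and> norm (A z) \<le> K"
    and md: "\<And>s r. s \<in> {0..real T} \<Longrightarrow> r \<in> {0..real T} \<Longrightarrow> \<bar>s - r\<bar> \<le> 1 / 2^n0 \<Longrightarrow> norm (B s \<omega> - B r \<omega>) \<le> \<nu>"
    and n: "n0 \<le> n" "1 / 2^n \<le> \<nu>" and t: "t \<le> real T"
    and R: "\<And>s. s \<in> {0..t} \<Longrightarrow> norm (euler_path n x0 s \<omega>) \<le> R" and s: "s \<in> {0..t}"
  shows "norm (euler n x0 (nat \<lfloor>s * 2^n\<rfloor>) \<omega>) \<le> R"
    and "norm (euler_path n x0 s \<omega> - euler n x0 (nat \<lfloor>s * 2^n\<rfloor>) \<omega>) \<le> 2 * K * \<nu>"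
proof -
  define j where "j = nat \<lfloor>s * 2^n\<rfloor>"
  have j: "real j / 2^n \<le> s" "s < real (Suc j) / 2^n"
    unfolding j_def by (rule nat_floor_dyadic_cell, use s in simp)+
  have "norm (euler_path n x0 (real j / 2^n) \<omega>) \<le> R" using j s by (intro R) auto
  then have e: "norm (euler n x0 j \<omega>) \<le> R" by simp
  then show "norm (euler n x0 (nat \<lfloor>s * 2^n\<rfloor>) \<omega>) \<le> R" by (simp add: j_def)
  have sj: "s - real j / 2^n \<le> 1 / 2^n" using j(2) by (simp add: add_divide_distrib)
  have "1 / 2^n \<le> 1 / (2::real)^n0" using n by (intro divide_left_mono power_increasing) auto
  then have Bd: "norm (B s \<omega> - B (real j / 2^n) \<omega>) \<le> \<nu>" using sj j s t by (intro md) auto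
  have "euler_path n x0 s \<omega> - euler n x0 j \<omega> = blinfun_apply (X (euler n x0 j \<omega>)) (B s \<omega> - B (real j / 2^n) \<omega>)
     + (s - real j / 2^n) *\<^sub>R A (euler n x0 j \<omega>)"
    using euler_path_cell[OF j(1) less_imp_le[OF j(2)]] by simp
  also have "norm \<dots> \<le> K * \<nu> + \<nu> * K"
  proof (rule order_trans[OF norm_triangle_ineq add_mono])
    show "norm (blinfun_apply (X (euler n x0 j \<omega>)) (B s \<omega> - B (real j / 2^n) \<omega>)) \<le> K * \<nu>"
      using K[OF e] Bd by (intro order_trans[OF norm_blinfun mult_mono]) (auto intro: order_trans[OF norm_ge_zero])
    have "\<bar>s - real j / 2^n\<bar> \<le> \<nu>" using sj n j(1) by simp
    then show "norm ((s - real j / 2^n) *\<^sub>R A (euler n x0 j \<omega>)) \<le> \<nu> * K"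
      using K[OF e] by (simp add: mult_mono)
  qed
  finally show "norm (euler_path n x0 s \<omega> - euler n x0 (nat \<lfloor>s * 2^n\<rfloor>) \<omega>) \<le> 2 * K * \<nu>"
    by (simp add: j_def algebra_simps)
qed

lemma euler_drift_measurable:
  assumes "t \<ge> 0"
  shows "(\<lambda>\<omega>. A (euler n x0 (nat \<lfloor>t * 2^n\<rfloor>) \<omega>)) \<in> borel_measurable (\<F> t)"
  by (rule measurable_compose[OF euler_measurable A_measurable]) (rule nat_floor_dyadic_cell(1)[OF assms])

text \<open>The coefficients are evaluated at the last grid value, not at the current position, so
  the growth conditions hold only up to the lag. The radius R is chosen from the limiting bound, and
  only afterwards is the mesh chosen to make the lag small for the coefficient bound K of that ball.
  This avoids a circular dependence of R on K.\<close>

lemma euler_tight: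
  assumes \<epsilon>: "\<epsilon> > 0"
  shows "\<exists>R>0. \<exists>n0. \<forall>n\<ge>n0. outer_prob_le M (\<lambda>\<omega>. \<exists>t\<in>{0..real T}. norm (euler_path n x0 t \<omega>) \<ge> R) \<epsilon>"
proof -
  \<comment> \<open>If |x - z| <= 1 then 1 + |z|^2 <= 3 (1 + |x|^2); the + 1 pays for the error <x -
    z, A z> <= 1 in the drift.\<close>
  define q where "q = 3 * growth + 1"
  have q: "q \<ge> 0" using growth_nonneg by (simp add: q_def)
  define D where "D = 6 * 2^1 * (1 + (norm x0)\<^sup>2)^1 * exp (growth_const TYPE('m) 1 * q * real T)"
  have D: "D \<ge> 0" by (simp add: D_def)
  \<comment> \<open>Makes the polygon start strictly inside the ball and, since R >= 1, gives D /
    R^2 <= \<open>\<epsilon>\<close> / 2.\<close>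
  define R where "R = max (norm x0 + 1) (2 * D / \<epsilon> + 1)"
  have R: "R > norm x0" "R \<ge> 2 * D / \<epsilon>" "R \<ge> 1"
    using divide_nonneg_pos[of "2 * D" \<epsilon>] D \<epsilon> by (auto simp: R_def max_def)
  have R0: "R > 0" using R(3) by simp
  have DR: "D / R\<^sup>2 \<le> \<epsilon> / 2"
  proof -
    have "2 * D / \<epsilon> \<le> R * R" using R(2,3) mult_left_mono[of 1 R R] by linarith
    then have "2 * D \<le> \<epsilon> * R\<^sup>2" using \<epsilon> by (simp add: pos_divide_le_eq power2_eq_square mult.commute)
    then show ?thesis using R0 by (simp add: divide_le_eq mult.commute)
  qed
  obtain K where K: "K \<ge> 0" "\<And>z. norm z \<le> R \<Longrightarrow> norm (X z) \<le> K \<and> norm (A z) \<le> K" using coefficients_bounded[of R] by blast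
  define \<mu> where "\<mu> = 1 / (K + 1)"
  have \<mu>: "\<mu> > 0" "\<mu> \<le> 1" "\<mu> * K \<le> 1" using K(1) by (auto simp: \<mu>_def)
  define \<nu> where "\<nu> = \<mu> / (2 * (K + 1))"
  have \<nu>: "\<nu> > 0" using \<mu> K(1) by (simp add: \<nu>_def)
  have K\<nu>: "2 * K * \<nu> \<le> \<mu>"
  proof -
    have "2 * K * \<nu> \<le> 2 * (K + 1) * \<nu>" using \<nu> by (intro mult_right_mono) auto
    then show ?thesis using K(1) by (simp add: \<nu>_def)
  qed
  obtain n1 where n1: "(1/2)^n1 < \<nu>" using real_arch_pow_inv[of \<nu> "1/2"] \<nu> by auto
  obtain n2 where n2: "outer_prob_le M (\<lambda>\<omega>. \<exists>s\<in>{0..real T}. \<exists>t\<in>{0..real T}. \<bar>s - t\<bar> \<le> 1 / 2^n2 \<and> norm (B s \<omega> - B t \<omega>) > \<nu>) (\<epsilon> / 2)"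
    using B_modulus[OF \<nu>, of "\<epsilon> / 2" T] \<epsilon> by auto
  have "outer_prob_le M (\<lambda>\<omega>. \<exists>t\<in>{0..real T}. norm (euler_path n x0 t \<omega>) \<ge> R) \<epsilon>" if n: "n \<ge> max n1 n2" for n
  proof -
    define a where "a s \<omega> = A (euler n x0 (nat \<lfloor>s * 2^n\<rfloor>) \<omega>)" for s :: real and \<omega>
    have nn: "n2 \<le> n" "1 / 2^n \<le> \<nu>"
    proof -
      have "1 / 2^n \<le> (1/2 :: real)^n1" using n by (simp add: power_one_over[symmetric] power_decreasing)
      then show "1 / 2^n \<le> \<nu>" using n1 by linarith
    qed (use n in simp)
    have mi: "outer_prob_le M (\<lambda>\<omega>. \<exists>t\<in>{0..real T}. controlled_path 1 q x0 (\<lambda>s. euler_path n x0 s \<omega>) (\<lambda>s. euler_diffusion n x0 s \<omega>)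
        (\<lambda>s. X (euler n x0 (nat \<lfloor>s * 2^n\<rfloor>) \<omega>)) (\<lambda>s. a s \<omega>) t \<and> (1 + (norm (euler_path n x0 t \<omega>))\<^sup>2)^1 > R\<^sup>2) (D / R\<^sup>2)"
      unfolding D_def a_def
      by (rule maximal_inequality[OF euler_dyadic_approx euler_drift_measurable]) (use q R0 in auto)
    show ?thesis
    proof (rule outer_prob_le_AE_mono[OF outer_prob_le_disj[OF mi n2]])
      show "D / R\<^sup>2 + \<epsilon> / 2 \<le> \<epsilon>" using DR by linarith
      show "AE \<omega> in M. (\<exists>t\<in>{0..real T}. norm (euler_path n x0 t \<omega>) \<ge> R) \<longrightarrow>
        ((\<exists>t\<in>{0..real T}. controlled_path 1 q x0 (\<lambda>s. euler_path n x0 s \<omega>) (\<lambda>s. euler_diffusion n x0 s \<omega>)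
        (\<lambda>s. X (euler n x0 (nat \<lfloor>s * 2^n\<rfloor>) \<omega>)) (\<lambda>s. a s \<omega>) t \<and> (1 + (norm (euler_path n x0 t \<omega>))\<^sup>2)^1 > R\<^sup>2) \<or>
        (\<exists>s\<in>{0..real T}. \<exists>t\<in>{0..real T}. \<bar>s - t\<bar> \<le> 1 / 2^n2 \<and> norm (B s \<omega> - B t \<omega>) > \<nu>))"
        using B_continuous
      proof eventually_elim
        case (elim \<omega>)
        show ?case
        proof (intro impI disjCI)
          assume "\<not> (\<exists>s\<in>{0..real T}. \<exists>t\<in>{0..real T}. \<bar>s - t\<bar> \<le> 1 / 2^n2 \<and> norm (B s \<omega> - B t \<omega>) > \<nu>)"
          then have md: "norm (B s \<omega> - B t \<omega>) \<le> \<nu>" if "s \<in> {0..real T}" "t \<in> {0..real T}" "\<bar>s - t\<bar> \<le> 1 / 2^n2" for s t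
            using that by force
          have cont: "continuous_on {0..real T} (\<lambda>t. euler_path n x0 t \<omega>)" by (rule euler_path_continuous[OF elim])
          assume "\<exists>t\<in>{0..real T}. norm (euler_path n x0 t \<omega>) \<ge> R"
          then obtain t0 where t0: "t0 \<in> {0..real T}" "norm (euler_path n x0 t0 \<omega>) \<ge> R" by blast
          have "norm (euler_path n x0 0 \<omega>) < R" using R(1) by simp
          from continuous_first_hit[OF continuous_on_norm[OF cont] this t0]
          obtain t where t: "t \<in> {0..real T}" "norm (euler_path n x0 t \<omega>) = R"
            "\<And>s. s \<in> {0..t} \<Longrightarrow> norm (euler_path n x0 s \<omega>) \<le> R"
            by (elim bexE conjE) (rule that, assumption, assumption, erule bspec)
          have lag: "norm (euler n x0 (nat \<lfloor>s * 2^n\<rfloor>) \<omega>) \<le> R"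
            "norm (euler_path n x0 s \<omega> - euler n x0 (nat \<lfloor>s * 2^n\<rfloor>) \<omega>) \<le> \<mu>" if "s \<in> {0..t}" for s
          proof -
            have tT: "t \<le> real T" using t(1) by simp
            note L = euler_lag[where T = T, OF K(2) md nn tT t(3) that]
            show "norm (euler n x0 (nat \<lfloor>s * 2^n\<rfloor>) \<omega>) \<le> R" by (rule L(1))
            show "norm (euler_path n x0 s \<omega> - euler n x0 (nat \<lfloor>s * 2^n\<rfloor>) \<omega>) \<le> \<mu>" by (rule order_trans[OF L(2) K\<nu>])
          qed
          have "controlled_path 1 q x0 (\<lambda>s. euler_path n x0 s \<omega>) (\<lambda>s. euler_diffusion n x0 s \<omega>)
              (\<lambda>s. X (euler n x0 (nat \<lfloor>s * 2^n\<rfloor>) \<omega>)) (\<lambda>s. a s \<omega>) t"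
            unfolding controlled_path_def
          proof (intro conjI ballI)
            show "dyadic_regular (\<lambda>s. euler_path n x0 s \<omega>) t"
              using t(1) by (intro dyadic_regular_continuous continuous_on_subset[OF cont]) auto
            show "dyadic_regular (\<lambda>s. a s \<omega>) t" unfolding a_def by (rule step_function_dyadic_regular)
            show "(\<lambda>s. a s \<omega>) integrable_on {0..t}" unfolding a_def by (rule step_function_integrable)
            show "bounded ((\<lambda>s. a s \<omega>) ` {0..t})" unfolding bounded_iff a_def using K(2) lag(1) by blast
            fix s assume s: "s \<in> {0..t}"
            show "euler_path n x0 s \<omega> = x0 + euler_diffusion n x0 s \<omega> + integral {0..s} (\<lambda>s. a s \<omega>)"
              by (simp add: euler_path_def a_def)
            define x where "x = euler_path n x0 s \<omega>"
            define z where "z = euler n x0 (nat \<lfloor>s * 2^n\<rfloor>) \<omega>"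
            have xz: "norm (x - z) \<le> \<mu>" using lag(2)[OF s] by (simp add: x_def z_def)
            have "norm z \<le> norm x + norm (x - z)" by (metis norm_minus_commute norm_triangle_sub)
            then have "norm z \<le> norm x + 1" using xz \<mu> by linarith
            then have "(norm z)\<^sup>2 \<le> (norm x + 1)\<^sup>2" by (intro power_mono) auto
            also have "\<dots> \<le> 2 * (norm x)\<^sup>2 + 2" using sum_squares_bound[of "norm x" 1] by (simp add: power2_sum)
            finally have z2: "1 + (norm z)\<^sup>2 \<le> 3 * (1 + (norm x)\<^sup>2)"
              using zero_le_power2[of "norm x"] by (simp only: distrib_left)
            then have gz: "growth * (1 + (norm z)\<^sup>2) \<le> 3 * growth * (1 + (norm x)\<^sup>2)"
              using mult_left_mono[OF z2 growth_nonneg] by (simp only: mult.assoc mult.left_commute)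
            have "(norm (X z))\<^sup>2 \<le> 3 * growth * (1 + (norm x)\<^sup>2)" using X_norm[of z] gz by linarith
            also have "\<dots> \<le> q * (1 + (norm x)\<^sup>2)" unfolding q_def by (intro mult_right_mono) auto
            finally show "(norm (X (euler n x0 (nat \<lfloor>s * 2^n\<rfloor>) \<omega>)))\<^sup>2 \<le> q * (1 + (norm (euler_path n x0 s \<omega>))\<^sup>2)"
              by (simp add: x_def z_def)
            have "x \<bullet> A z = z \<bullet> A z + (x - z) \<bullet> A z" by (simp add: inner_diff_left)
            also have "\<dots> \<le> growth * (1 + (norm z)\<^sup>2) + norm (x - z) * norm (A z)"
              by (intro add_mono A_inner norm_cauchy_schwarz)
            also have "\<dots> \<le> 3 * growth * (1 + (norm x)\<^sup>2) + \<mu> * K"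
            proof (rule add_mono[OF gz mult_mono[OF xz]])
              show "norm (A z) \<le> K" using K(2) lag(1)[OF s] by (simp add: z_def)
            qed (use \<mu> in auto)
            also have "\<dots> \<le> 3 * growth * (1 + (norm x)\<^sup>2) + (1 + (norm x)\<^sup>2)" 
              using \<mu>(3) zero_le_power2[of "norm x"] by linarith
            also have "\<dots> = q * (1 + (norm x)\<^sup>2)" by (simp add: q_def algebra_simps)
            finally show "euler_path n x0 s \<omega> \<bullet> a s \<omega> \<le> q * (1 + (norm (euler_path n x0 s \<omega>))\<^sup>2)"
              by (simp add: x_def z_def a_def)
          qed
          then show "\<exists>t\<in>{0..real T}. controlled_path 1 q x0 (\<lambda>s. euler_path n x0 s \<omega>) (\<lambda>s. euler_diffusion n x0 s \<omega>)
              (\<lambda>s. X (euler n x0 (nat \<lfloor>s * 2^n\<rfloor>) \<omega>)) (\<lambda>s. a s \<omega>) t \<and> (1 + (norm (euler_path n x0 t \<omega>))\<^sup>2)^1 > R\<^sup>2"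
            using t(1,2) by (intro bexI[of _ t]) auto
        qed
      qed
    qed
  qed
  then show ?thesis using R0 by blast
qed

text \<open>Both polygons start at x0, so their difference starts at 0 and e is free to serve as a
  budget for the lag error. In the ball given by \<open>euler_tight\<close> the coefficients satisfy
  Lipschitz and monotonicity bounds with the constant l; these are applied at the grid values and
  carried over to the polygons.\<close>

lemma euler_Cauchy:
  assumes \<epsilon>: "\<epsilon> > 0" and \<eta>: "\<eta> > 0"
  shows "\<exists>n0. \<forall>n\<ge>n0. \<forall>n'\<ge>n0. outer_prob_le M (\<lambda>\<omega>. \<exists>t\<in>{0..real T}. norm (euler_path n x0 t \<omega> - euler_path n' x0 t \<omega>) > \<eta>) \<epsilon>"
proof -
  obtain R n3 where R: "R > 0" and n3: "\<And>n. n \<ge> n3 \<Longrightarrow>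
     outer_prob_le M (\<lambda>\<omega>. \<exists>t\<in>{0..real T}. norm (euler_path n x0 t \<omega>) \<ge> R) (\<epsilon> / 4)"
    using euler_tight[of "\<epsilon> / 4" T x0] \<epsilon> by auto
  define l where "l = growth * (1 + ln (1 + R\<^sup>2))"
  have l: "l \<ge> 0" using growth_nonneg by (simp add: l_def)
  \<comment> \<open>The factor 2 arises when the distance of the grid values is replaced by that of
    the polygons plus twice the lag; the + 1 lets q times e dominate the lag error e.\<close>
  define q where "q = 2 * l + 1"
  have q: "q \<ge> 0" using l by (simp add: q_def)
  define g where "g = exp (growth_const TYPE('m) 1 * q * real T)"
  have g: "g > 0" by (simp add: g_def)
  \<comment> \<open>Makes the bound 12 e g / \<open>\<eta>\<close>^2 of the maximal inequality equal
    to \<open>\<epsilon>\<close> / 4.\<close>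
  define e where "e = \<epsilon> * \<eta>\<^sup>2 / (48 * g)"
  have e: "e > 0" using \<epsilon> \<eta> g by (simp add: e_def)
  obtain K where K: "K \<ge> 0" "\<And>z. norm z \<le> R \<Longrightarrow> norm (X z) \<le> K \<and> norm (A z) \<le> K" using coefficients_bounded[of R] by blast
  \<comment> \<open>A lag of at most \<open>\<mu>\<close> in either polygon produces the errors 8 l
    \<open>\<mu>\<close>^2 from squaring the distance and 4 K \<open>\<mu>\<close> in the drift;
    together they stay below e.\<close>
  define \<mu> where "\<mu> = min 1 (e / (8 * l + 4 * K + 1))"
  have \<mu>: "\<mu> > 0" "\<mu> \<le> 1" using e l K(1) by (auto simp: \<mu>_def)
  have \<mu>e: "8 * l * \<mu>\<^sup>2 + 4 * K * \<mu> \<le> e"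
  proof -
    have "\<mu>\<^sup>2 \<le> \<mu>" using \<mu> by (simp add: power2_eq_square mult_left_le)
    then have "8 * l * \<mu>\<^sup>2 + 4 * K * \<mu> \<le> 8 * l * \<mu> + 4 * K * \<mu>" using l K(1) by (intro add_mono mult_left_mono) auto
    also have "\<dots> \<le> (8 * l + 4 * K + 1) * \<mu>" using \<mu> by (simp add: algebra_simps)
    also have "\<dots> \<le> (8 * l + 4 * K + 1) * (e / (8 * l + 4 * K + 1))"
      using l K(1) by (intro mult_left_mono) (auto simp: \<mu>_def)
    also have "\<dots> = e" using l K(1) by simp
    finally show ?thesis .
  qed
  define \<nu> where "\<nu> = \<mu> / (2 * (K + 1))"
  have \<nu>: "\<nu> > 0" using \<mu> K(1) by (simp add: \<nu>_def)
  have K\<nu>: "2 * K * \<nu> \<le> \<mu>"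
  proof -
    have "2 * K * \<nu> \<le> 2 * (K + 1) * \<nu>" using \<nu> by (intro mult_right_mono) auto
    then show ?thesis using K(1) by (simp add: \<nu>_def)
  qed
  obtain n1 where n1: "(1/2)^n1 < \<nu>" using real_arch_pow_inv[of \<nu> "1/2"] \<nu> by auto
  obtain n2 where n2: "outer_prob_le M (\<lambda>\<omega>. \<exists>s\<in>{0..real T}. \<exists>t\<in>{0..real T}. \<bar>s - t\<bar> \<le> 1 / 2^n2 \<and> norm (B s \<omega> - B t \<omega>) > \<nu>) (\<epsilon> / 4)"
    using B_modulus[OF \<nu>, of "\<epsilon> / 4" T] \<epsilon> by auto
  define n0 where "n0 = max n1 (max n2 n3)"
  have nn: "n2 \<le> n" "1 / 2^n \<le> \<nu>" "n3 \<le> n" if "n \<ge> n0" for n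
  proof -
    have "1 / 2^n \<le> (1/2 :: real)^n1" using that by (simp add: power_one_over[symmetric] power_decreasing n0_def)
    then show "1 / 2^n \<le> \<nu>" using n1 by linarith
  qed (use that in \<open>simp_all add: n0_def\<close>)
  have "outer_prob_le M (\<lambda>\<omega>. \<exists>t\<in>{0..real T}. norm (euler_path n x0 t \<omega> - euler_path n' x0 t \<omega>) > \<eta>) \<epsilon>"
    if n: "n \<ge> n0" and n': "n' \<ge> n0" for n n'
  proof -
    let ?z = "\<lambda>n s \<omega>. euler n x0 (nat \<lfloor>s * 2^n\<rfloor>) \<omega>"
    let ?cp = "\<lambda>t \<omega>. controlled_path e q (0::'n) (\<lambda>s. euler_path n x0 s \<omega> - euler_path n' x0 s \<omega>)
        (\<lambda>s. euler_diffusion n x0 s \<omega> - euler_diffusion n' x0 s \<omega>)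
        (\<lambda>s. X (?z n s \<omega>) - X (?z n' s \<omega>)) (\<lambda>s. A (?z n s \<omega>) - A (?z n' s \<omega>)) t"
    have mi: "outer_prob_le M (\<lambda>\<omega>. \<exists>t\<in>{0..real T}. ?cp t \<omega> \<and> (e + (norm (euler_path n x0 t \<omega> - euler_path n' x0 t \<omega>))\<^sup>2)^1 > \<eta>\<^sup>2)
       (6 * 2^1 * (e + (norm (0::'n))\<^sup>2)^1 * g / \<eta>\<^sup>2)"
      unfolding g_def
      by (rule maximal_inequality[OF dyadic_approx_diff[OF euler_dyadic_approx euler_dyadic_approx]])
        (use e q \<eta> in \<open>auto intro!: borel_measurable_diff euler_drift_measurable\<close>)
    have eps: "6 * 2^1 * (e + (norm (0::'n))\<^sup>2)^1 * g / \<eta>\<^sup>2 = \<epsilon> / 4" using g \<eta> by (simp add: e_def)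
    show ?thesis
    proof (rule outer_prob_le_AE_mono[OF outer_prob_le_disj[OF mi[unfolded eps] outer_prob_le_disj[OF n2
          outer_prob_le_disj[OF n3[OF nn(3)[OF n]] n3[OF nn(3)[OF n']]]]]])
      show "\<epsilon> / 4 + (\<epsilon> / 4 + (\<epsilon> / 4 + \<epsilon> / 4)) \<le> \<epsilon>" by simp
      show "AE \<omega> in M. (\<exists>t\<in>{0..real T}. norm (euler_path n x0 t \<omega> - euler_path n' x0 t \<omega>) > \<eta>) \<longrightarrow>
        ((\<exists>t\<in>{0..real T}. ?cp t \<omega> \<and> (e + (norm (euler_path n x0 t \<omega> - euler_path n' x0 t \<omega>))\<^sup>2)^1 > \<eta>\<^sup>2) \<or>
         (\<exists>s\<in>{0..real T}. \<exists>t\<in>{0..real T}. \<bar>s - t\<bar> \<le> 1 / 2^n2 \<and> norm (B s \<omega> - B t \<omega>) > \<nu>) \<or>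
         (\<exists>t\<in>{0..real T}. norm (euler_path n x0 t \<omega>) \<ge> R) \<or> (\<exists>t\<in>{0..real T}. norm (euler_path n' x0 t \<omega>) \<ge> R))"
        using B_continuous
      proof eventually_elim
        case (elim \<omega>)
        show ?case
        proof (intro impI disjCI)
          assume no: "\<not> ((\<exists>s\<in>{0..real T}. \<exists>t\<in>{0..real T}. \<bar>s - t\<bar> \<le> 1 / 2^n2 \<and> norm (B s \<omega> - B t \<omega>) > \<nu>) \<or>
            (\<exists>t\<in>{0..real T}. norm (euler_path n x0 t \<omega>) \<ge> R) \<or> (\<exists>t\<in>{0..real T}. norm (euler_path n' x0 t \<omega>) \<ge> R))"
          have md: "norm (B s \<omega> - B t \<omega>) \<le> \<nu>" if "s \<in> {0..real T}" "t \<in> {0..real T}" "\<bar>s - t\<bar> \<le> 1 / 2^n2" for s t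
            by (rule ccontr) (use no that not_le in blast)
          have Rn1: "norm (euler_path n x0 s \<omega>) \<le> R" if "s \<in> {0..real T}" for s
            by (rule ccontr) (use no that in \<open>meson linear\<close>)
          have Rn2: "norm (euler_path n' x0 s \<omega>) \<le> R" if "s \<in> {0..real T}" for s
            by (rule ccontr) (use no that in \<open>meson linear\<close>)
          note Rn = Rn1 Rn2
          have cont: "continuous_on {0..real T} (\<lambda>t. euler_path n x0 t \<omega>)" "continuous_on {0..real T} (\<lambda>t. euler_path n' x0 t \<omega>)"
            by (rule euler_path_continuous[OF elim])+
          assume "\<exists>t\<in>{0..real T}. norm (euler_path n x0 t \<omega> - euler_path n' x0 t \<omega>) > \<eta>"
          then obtain t where t: "t \<in> {0..real T}" "norm (euler_path n x0 t \<omega> - euler_path n' x0 t \<omega>) > \<eta>" by blast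
          have sT: "s \<in> {0..real T}" if "s \<in> {0..t}" for s using that t(1) by auto
          have lag: "norm (?z n s \<omega>) \<le> R" "norm (euler_path n x0 s \<omega> - ?z n s \<omega>) \<le> \<mu>" if "s \<in> {0..real T}" for s
          proof -
            note L = euler_lag[where T = T, OF K(2) md nn(1)[OF n] nn(2)[OF n] order_refl Rn(1) that]
            show "norm (?z n s \<omega>) \<le> R" by (rule L(1))
            show "norm (euler_path n x0 s \<omega> - ?z n s \<omega>) \<le> \<mu>" by (rule order_trans[OF L(2) K\<nu>])
          qed
          have lag': "norm (?z n' s \<omega>) \<le> R" "norm (euler_path n' x0 s \<omega> - ?z n' s \<omega>) \<le> \<mu>" if "s \<in> {0..real T}" for s
          proof -
            note L = euler_lag[where T = T, OF K(2) md nn(1)[OF n'] nn(2)[OF n'] order_refl Rn(2) that]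
            show "norm (?z n' s \<omega>) \<le> R" by (rule L(1))
            show "norm (euler_path n' x0 s \<omega> - ?z n' s \<omega>) \<le> \<mu>" by (rule order_trans[OF L(2) K\<nu>])
          qed
          have "?cp t \<omega>"
            unfolding controlled_path_def
          proof (intro conjI ballI)
            show "dyadic_regular (\<lambda>s. euler_path n x0 s \<omega> - euler_path n' x0 s \<omega>) t"
              using t(1) by (intro dyadic_regular_continuous continuous_on_diff continuous_on_subset[OF cont(1)] continuous_on_subset[OF cont(2)]) auto
            show "dyadic_regular (\<lambda>s. A (?z n s \<omega>) - A (?z n' s \<omega>)) t"
              by (intro dyadic_regular_diff step_function_dyadic_regular[where f = "\<lambda>j. A (euler _ x0 j \<omega>)"])
            have int: "(\<lambda>s. A (?z n s \<omega>)) integrable_on {0..r}" "(\<lambda>s. A (?z n' s \<omega>)) integrable_on {0..r}" for r :: real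
              by (rule step_function_integrable[where f = "\<lambda>j. A (euler _ x0 j \<omega>)"])+
            show "(\<lambda>s. A (?z n s \<omega>) - A (?z n' s \<omega>)) integrable_on {0..t}" by (intro integrable_diff int)
            have "norm (A (?z n s \<omega>) - A (?z n' s \<omega>)) \<le> K + K" if "s \<in> {0..t}" for s
              using K(2)[OF lag(1)[OF sT[OF that]]] K(2)[OF lag'(1)[OF sT[OF that]]] by (intro order_trans[OF norm_triangle_ineq4 add_mono]) auto
            then show "bounded ((\<lambda>s. A (?z n s \<omega>) - A (?z n' s \<omega>)) ` {0..t})" unfolding bounded_iff by blast
            fix s assume s: "s \<in> {0..t}"
            show "euler_path n x0 s \<omega> - euler_path n' x0 s \<omega> = 0 + (euler_diffusion n x0 s \<omega> - euler_diffusion n' x0 s \<omega>)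
               + integral {0..s} (\<lambda>s. A (?z n s \<omega>) - A (?z n' s \<omega>))"
              unfolding euler_path_def integral_diff[OF int] by simp
            define x where "x = euler_path n x0 s \<omega>"
            define y where "y = euler_path n' x0 s \<omega>"
            define u where "u = ?z n s \<omega>"
            define v where "v = ?z n' s \<omega>"
            have uR: "norm u \<le> R" "norm v \<le> R" "norm (x - u) \<le> \<mu>" "norm (y - v) \<le> \<mu>"
              using lag[OF sT[OF s]] lag'[OF sT[OF s]] by (auto simp: x_def y_def u_def v_def)
            have uR2: "1 + (norm u)\<^sup>2 \<le> 1 + R\<^sup>2" "1 + (norm v)\<^sup>2 \<le> 1 + R\<^sup>2" using uR R by (auto intro: power_mono)
            have "norm (u - v) \<le> norm (x - y) + 2 * \<mu>" using uR(3,4) by norm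
            then have "(norm (u - v))\<^sup>2 \<le> (norm (x - y) + 2 * \<mu>)\<^sup>2" by (intro power_mono) auto
            also have "\<dots> \<le> 2 * (norm (x - y))\<^sup>2 + 8 * \<mu>\<^sup>2"
              using sum_squares_bound[of "norm (x - y)" "2 * \<mu>"] by (simp add: power2_sum power_mult_distrib)
            finally have uv: "(norm (u - v))\<^sup>2 \<le> 2 * (norm (x - y))\<^sup>2 + 8 * \<mu>\<^sup>2" .
            have luv: "l * (norm (u - v))\<^sup>2 \<le> 2 * l * (norm (x - y))\<^sup>2 + 8 * l * \<mu>\<^sup>2"
              using mult_left_mono[OF uv l] by (simp add: algebra_simps)
            have fin: "2 * l * (norm (x - y))\<^sup>2 + e \<le> q * (e + (norm (x - y))\<^sup>2)"
              using l e by (simp add: q_def algebra_simps)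
            have "(norm (X u - X v))\<^sup>2 \<le> l * (norm (u - v))\<^sup>2" unfolding l_def by (rule X_Lipschitz[OF uR2])
            also have "\<dots> \<le> 2 * l * (norm (x - y))\<^sup>2 + e"
            proof -
              have "0 \<le> 4 * K * \<mu>" using K(1) \<mu> by simp
              then show ?thesis using luv \<mu>e by linarith
            qed
            also note fin
            finally show "(norm (X (?z n s \<omega>) - X (?z n' s \<omega>)))\<^sup>2 \<le> q * (e + (norm (euler_path n x0 s \<omega> - euler_path n' x0 s \<omega>))\<^sup>2)"
              by (simp add: x_def y_def u_def v_def)
            have "(x - y) \<bullet> (A u - A v) = (u - v) \<bullet> (A u - A v) + ((x - u) - (y - v)) \<bullet> (A u - A v)"
              by (simp add: inner_diff_left)
            also have "\<dots> \<le> l * (norm (u - v))\<^sup>2 + norm ((x - u) - (y - v)) * norm (A u - A v)"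
              unfolding l_def by (intro add_mono A_monotone uR2 norm_cauchy_schwarz)
            also have "\<dots> \<le> l * (norm (u - v))\<^sup>2 + (2 * \<mu>) * (2 * K)"
            proof (intro add_left_mono mult_mono)
              show "norm ((x - u) - (y - v)) \<le> 2 * \<mu>" using uR(3,4) norm_triangle_ineq4[of "x - u" "y - v"] by linarith
              show "norm (A u - A v) \<le> 2 * K" using K(2)[OF uR(1)] K(2)[OF uR(2)] norm_triangle_ineq4[of "A u" "A v"] by linarith
            qed (use \<mu> in auto)
            also have "\<dots> \<le> 2 * l * (norm (x - y))\<^sup>2 + e" using luv \<mu>e by (simp add: algebra_simps)
            also note fin
            finally show "(euler_path n x0 s \<omega> - euler_path n' x0 s \<omega>) \<bullet> (A (?z n s \<omega>) - A (?z n' s \<omega>))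
                 \<le> q * (e + (norm (euler_path n x0 s \<omega> - euler_path n' x0 s \<omega>))\<^sup>2)"
              by (simp add: x_def y_def u_def v_def)
          qed
          moreover have "(e + (norm (euler_path n x0 t \<omega> - euler_path n' x0 t \<omega>))\<^sup>2)^1 > \<eta>\<^sup>2"
          proof -
            have "\<eta>\<^sup>2 < (norm (euler_path n x0 t \<omega> - euler_path n' x0 t \<omega>))\<^sup>2" using t(2) \<eta> by (intro power_strict_mono) auto
            then show ?thesis using e by simp
          qed
          ultimately show "\<exists>t\<in>{0..real T}. ?cp t \<omega> \<and> (e + (norm (euler_path n x0 t \<omega> - euler_path n' x0 t \<omega>))\<^sup>2)^1 > \<eta>\<^sup>2"
            using t(1) by blast
        qed
      qed
    qed
  qed
  then show ?thesis by blast
qed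

end

section \<open>Uniform limits, grid processes and adapted integrals\<close>

lemma geometric_uniform_limit:
  fixes f :: "nat \<Rightarrow> 'a \<Rightarrow> 'b::banach"
  assumes d: "\<And>k x. k \<ge> K \<Longrightarrow> x \<in> S \<Longrightarrow> norm (f k x - f (Suc k) x) \<le> c * q^k" and q: "0 \<le> q" "q < 1"
  shows "uniform_limit S f (\<lambda>x. lim (\<lambda>k. f k x)) sequentially"
    and "\<And>k x. k \<ge> K \<Longrightarrow> x \<in> S \<Longrightarrow> norm (f k x - lim (\<lambda>k. f k x)) \<le> c * q^k / (1 - q)"
proof -
  have tel: "norm (f m x - f n x) \<le> c * (q^m - q^n) / (1 - q)" if "K \<le> m" "m \<le> n" "x \<in> S" for m n x
    using that(2)
  proof (induction rule: dec_induct)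
    case (step n)
    have "norm (f m x - f (Suc n) x) \<le> norm (f m x - f n x) + norm (f n x - f (Suc n) x)"
      using norm_triangle_ineq[of "f m x - f n x" "f n x - f (Suc n) x"] by simp
    also have "\<dots> \<le> c * (q^m - q^n) / (1 - q) + c * q^n"
      using step that by (intro add_mono d) auto
    also have "\<dots> = c * (q^m - q^Suc n) / (1 - q)" using q by (simp add: field_simps)
    finally show ?case .
  qed simp
  have c: "c * q^m \<ge> 0" if "K \<le> m" "x \<in> S" for m x using d[OF that] norm_ge_zero order_trans by blast
  have le: "c * (q^m - q^n) / (1 - q) \<le> c * q^m / (1 - q)" if "K \<le> m" "m \<le> n" "x \<in> S" for m n x
    using c[of n x] that q by (intro divide_right_mono) (auto simp: algebra_simps)
  have lim0: "(\<lambda>m. c * q^m / (1 - q)) \<longlonglongrightarrow> c * 0 / (1 - q)"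
    using q by (intro tendsto_intros LIMSEQ_power_zero) auto
  have "uniformly_Cauchy_on S f"
  proof (rule uniformly_Cauchy_onI')
    fix e :: real assume "e > 0"
    then have "eventually (\<lambda>m. c * q^m / (1 - q) < e) sequentially" using lim0 by (intro order_tendstoD(2)) auto
    then obtain M where M: "\<And>m. m \<ge> M \<Longrightarrow> c * q^m / (1 - q) < e" unfolding eventually_sequentially by auto
    show "\<exists>M. \<forall>x\<in>S. \<forall>m\<ge>M. \<forall>n>m. dist (f m x) (f n x) < e"
    proof (intro exI[of _ "max M K"] ballI allI impI)
      fix x m n assume x: "x \<in> S" "m \<ge> max M K" "n > m"
      then show "dist (f m x) (f n x) < e"
        using tel[of m n x] le[of m n x] M[of m] by (auto simp: dist_norm)
    qed
  qed
  then have "uniformly_convergent_on S f" by (rule Cauchy_uniformly_convergent)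
  then show ul: "uniform_limit S f (\<lambda>x. lim (\<lambda>k. f k x)) sequentially"
    by (simp add: uniformly_convergent_uniform_limit_iff)
  fix k x assume k: "k \<ge> K" "x \<in> S"
  have "(\<lambda>n. norm (f k x - f n x)) \<longlonglongrightarrow> norm (f k x - lim (\<lambda>k. f k x))"
    by (intro tendsto_intros tendsto_uniform_limitI[OF ul k(2)])
  moreover have "\<exists>N. \<forall>n\<ge>N. norm (f k x - f n x) \<le> c * q^k / (1 - q)"
    using tel[of k _ x] le[of k _ x] k by (intro exI[of _ k]) (auto intro: order_trans)
  ultimately show "norm (f k x - lim (\<lambda>k. f k x)) \<le> c * q^k / (1 - q)" by (rule LIMSEQ_le_const2)
qed

lemma continuous_on_atLeast_nat:
  fixes f :: "real \<Rightarrow> 'b::topological_space"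
  assumes "\<And>T::nat. continuous_on {0..real T} f"
  shows "continuous_on {0..} f"
  unfolding continuous_on_eq_continuous_within
proof
  fix x :: real assume x: "x \<in> {0..}"
  obtain T :: nat where T: "x < real T" using reals_Archimedean2 by blast
  have "continuous (at x within {0..real T}) f"
    using assms[of T] x T unfolding continuous_on_eq_continuous_within by auto
  moreover have "at x within {0..real T} = at x within {0..}"
    by (rule at_within_nhd[of _ "{..<real T}"]) (use T in auto)
  ultimately show "continuous (at x within {0..}) f" by simp
qed

lemma simple_process_grid:
  assumes j: "j < N" and s: "real j / 2^n < s" "s \<le> real (Suc j) / 2^n"
  shows "simple_process N (\<lambda>l. real l / 2^n) \<phi> s \<omega> = \<phi> j \<omega>"
proof -
  have "simple_process N (\<lambda>l. real l / 2^n) \<phi> s \<omega> = (\<Sum>l<N. if l = j then \<phi> l \<omega> else 0)"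
    unfolding simple_process_def
  proof (intro sum.cong refl)
    fix l
    show "indicat_real {real l / 2^n<..real (Suc l) / 2^n} s *\<^sub>R \<phi> l \<omega> = (if l = j then \<phi> l \<omega> else 0)"
    proof (cases "l = j")
      case True
      then show ?thesis using s by simp
    next
      case False
      have "s \<notin> {real l / 2^n<..real (Suc l) / 2^n}"
      proof
        assume "s \<in> {real l / 2^n<..real (Suc l) / 2^n}"
        then have "real l / 2^n < real (Suc j) / 2^n" "real j / 2^n < real (Suc l) / 2^n" using s by auto
        then have "l < Suc j" "j < Suc l" by (simp_all only: divide_less_cancel of_nat_less_iff) auto
        then show False using False by simp
      qed
      then show ?thesis using False by simp
    qed
  qed
  then show ?thesis using j by simp
qed

lemma simple_process_grid_beyond:
  assumes "real N / 2^n < s"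
  shows "simple_process N (\<lambda>l. real l / 2^n) \<phi> s \<omega> = 0"
  unfolding simple_process_def
proof (rule sum.neutral, rule ballI)
  fix l assume "l \<in> {..<N}"
  then have "real (Suc l) / 2^n \<le> real N / 2^n" by (intro divide_right_mono) auto
  then show "indicat_real {real l / 2^n<..real (Suc l) / 2^n} s *\<^sub>R \<phi> l \<omega> = 0" using assms by simp
qed

context brownian_setting
begin

lemma null_in_probabilityI:
  assumes Z: "\<And>\<epsilon>. \<epsilon> > 0 \<Longrightarrow> AE \<omega> in M. eventually (\<lambda>n. Z n \<omega> \<le> ennreal \<epsilon>) sequentially"
  shows "null_in_probability M Z"
  unfolding null_in_probability_def
proof (intro allI impI LIMSEQ_I)
  fix \<epsilon> \<delta> :: real assume \<epsilon>: "\<epsilon> > 0" and \<delta>: "\<delta> > 0"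
  \<comment> \<open>\<open>measure\<close> is 0 on non-measurable sets, so replacing such a set by
    the empty set does not alter its measure and makes the Borel-Cantelli type argument
    applicable.\<close>
  define S where "S n = (if {\<omega>\<in>space M. ennreal \<epsilon> < Z n \<omega>} \<in> sets M then {\<omega>\<in>space M. ennreal \<epsilon> < Z n \<omega>} else {})" for n
  have S: "S n \<in> sets M" for n by (simp add: S_def)
  have "AE \<omega> in M. eventually (\<lambda>n. \<not> \<omega> \<in> S n) sequentially"
    using Z[OF \<epsilon>]
  proof eventually_elim
    case (elim \<omega>)
    then show ?case by eventually_elim (auto simp: S_def)
  qed
  moreover have "{\<omega>\<in>space M. \<omega> \<in> S n} = S n" for n using sets.sets_into_space[OF S[of n]] by auto
  ultimately obtain n0 where n0: "outer_prob_le M (\<lambda>\<omega>. \<exists>n\<ge>n0. \<omega> \<in> S n) (\<delta> / 2)"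
    using outer_prob_le_eventually[where P = "\<lambda>n \<omega>. \<omega> \<in> S n" and e = "\<delta> / 2"] S \<delta> by auto
  show "\<exists>no. \<forall>n\<ge>no. norm (prob {\<omega>\<in>space M. ennreal \<epsilon> < Z n \<omega>} - 0) < \<delta>"
  proof (intro exI[of _ n0] allI impI)
    fix n assume n: "n \<ge> n0"
    obtain E where E: "E \<in> sets M" "{\<omega>\<in>space M. \<exists>n\<ge>n0. \<omega> \<in> S n} \<subseteq> E" "prob E \<le> \<delta> / 2"
      using n0 unfolding outer_prob_le_def by blast
    have "S n \<subseteq> E" using E(2) n sets.sets_into_space[OF S[of n]] by blast
    then have "prob (S n) \<le> \<delta> / 2" using finite_measure_mono[OF _ E(1), of "S n"] E(3) by linarith
    moreover have "prob {\<omega>\<in>space M. ennreal \<epsilon> < Z n \<omega>} = prob (S n)" by (simp add: S_def measure_notin_sets)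
    ultimately show "norm (prob {\<omega>\<in>space M. ennreal \<epsilon> < Z n \<omega>} - 0) < \<delta>" using \<delta> by simp
  qed
qed

lemma continuous_adapted_measurable:
  fixes y :: "real \<Rightarrow> 'w \<Rightarrow> 'a::metric_space"
  assumes ym: "\<And>t. t \<ge> 0 \<Longrightarrow> y t \<in> borel_measurable (\<F> t)"
    and yc: "\<And>\<omega>. \<omega> \<in> space M \<Longrightarrow> continuous_on {0..} (\<lambda>t. y t \<omega>)" and t: "t \<ge> 0"
  shows "(\<lambda>(s, \<omega>). y s \<omega>) \<in> borel_measurable (restrict_space borel {0..t} \<Otimes>\<^sub>M \<F> t)"
proof (rule borel_measurable_LIMSEQ_metric)
  let ?N = "restrict_space borel {0..t} \<Otimes>\<^sub>M \<F> t"
  \<comment> \<open>The minimum keeps every sampled time within [0, t], so each of the countably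
    many pieces is measurable for \<open>\<F> t\<close>; on the domain itself it is
    inactive.\<close>
  define f where "f m = (\<lambda>z :: real \<times> 'w. y (min t (real (nat \<lfloor>fst z * 2^m\<rfloor>) / 2^m)) (snd z))" for m :: nat
  show "f m \<in> borel_measurable ?N" for m
    unfolding f_def
  proof (rule measurable_compose_countable[where f = "\<lambda>i z. y (min t (real i / 2^m)) (snd z)"])
    fix i
    have "y (min t (real i / 2^m)) \<in> borel_measurable (\<F> t)"
      by (rule measurable_F_mono[OF ym]) (use t in auto)
    then show "(\<lambda>z. y (min t (real i / 2^m)) (snd z)) \<in> borel_measurable ?N" by (rule measurable_compose[OF measurable_snd])
  next
    have "(\<lambda>s::real. nat \<lfloor>s * 2^m\<rfloor>) \<in> measurable (restrict_space borel {0..t}) (count_space UNIV)"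
      by (rule measurable_restrict_space1) measurable
    then show "(\<lambda>z. nat \<lfloor>fst z * 2^m\<rfloor>) \<in> measurable ?N (count_space UNIV)" by (rule measurable_compose[OF measurable_fst])
  qed
  fix z assume "z \<in> space ?N"
  then obtain s \<omega> where z: "z = (s, \<omega>)" "s \<in> {0..t}" "\<omega> \<in> space M"
    by (cases z) (auto simp: space_pair_measure space_restrict_space)
  have le: "real (nat \<lfloor>s * 2^m\<rfloor>) / 2^m \<le> t" for m using z(2) by (intro nat_floor_dyadic_le) auto
  have "(\<lambda>m. y (real (nat \<lfloor>s * 2^m\<rfloor>) / 2^m) \<omega>) \<longlonglongrightarrow> y s \<omega>"
    by (rule continuous_on_floor_dyadic[OF continuous_on_subset[OF yc[OF z(3)]] z(2)]) auto
  then show "(\<lambda>m. f m z) \<longlonglongrightarrow> (case z of (s, \<omega>) \<Rightarrow> y s \<omega>)" using le by (simp add: f_def z min_absorb2)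
qed

lemma integral_adapted:
  fixes y :: "real \<Rightarrow> 'w \<Rightarrow> 'a::euclidean_space"
  assumes ym: "\<And>t. t \<ge> 0 \<Longrightarrow> y t \<in> borel_measurable (\<F> t)"
    and yc: "\<And>\<omega>. \<omega> \<in> space M \<Longrightarrow> continuous_on {0..} (\<lambda>t. y t \<omega>)" and u: "u \<ge> 0"
  shows "(\<lambda>\<omega>. integral {0..u} (\<lambda>s. y s \<omega>)) \<in> borel_measurable (\<F> u)"
proof -
  define \<nu> where "\<nu> = restrict_space (lborel :: real measure) {0..u}"
  have [measurable_cong]: "sets \<nu> = sets (restrict_space borel {0..u})" unfolding \<nu>_def by (simp cong: sets_restrict_space_cong)
  interpret \<nu>: sigma_finite_measure \<nu> unfolding \<nu>_def by (intro sigma_finite_measure_restrict_space) (auto intro: lborel.sigma_finite_measure_axioms)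
  have "(\<lambda>x. (snd x, fst x)) \<in> measurable (\<F> u \<Otimes>\<^sub>M \<nu>) (restrict_space borel {0..u} \<Otimes>\<^sub>M \<F> u)" by measurable
  from measurable_compose[OF this continuous_adapted_measurable[OF ym yc u]]
  have "(\<lambda>(\<omega>, s). y s \<omega>) \<in> borel_measurable (\<F> u \<Otimes>\<^sub>M \<nu>)" by (simp add: case_prod_beta)
  from \<nu>.borel_measurable_lebesgue_integral[OF this]
  have m: "(\<lambda>\<omega>. \<integral>s. y s \<omega> \<partial>\<nu>) \<in> borel_measurable (\<F> u)" .
  have "(\<integral>s. y s \<omega> \<partial>\<nu>) = integral {0..u} (\<lambda>s. y s \<omega>)" if "\<omega> \<in> space (\<F> u)" for \<omega>
  proof -
    have "continuous_on {0..u} (\<lambda>s. y s \<omega>)" by (rule continuous_on_subset[OF yc]) (use that in auto)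
    then have "set_integrable lborel {0..u} (\<lambda>s. y s \<omega>)" by (rule borel_integrable_atLeastAtMost')
    then have "(LINT s:{0..u}|lborel. y s \<omega>) = integral {0..u} (\<lambda>s. y s \<omega>)" by (rule set_borel_integral_eq_integral(2))
    then show ?thesis unfolding \<nu>_def by (subst integral_restrict_space) (auto simp: set_lebesgue_integral_def)
  qed
  from measurable_cong[where f = "\<lambda>\<omega>. \<integral>s. y s \<omega> \<partial>\<nu>" and M = "\<F> u", OF this] m show ?thesis by (simp only:)
qed

end

section \<open>The limit of the Euler polygons\<close>

context sde_setting
begin

text \<open>Convergence in probability is upgraded along a fast subsequence: Borel-Cantelli with
  errors 2^-k on [0, k] gives almost sure uniform convergence on every bounded interval.\<close>

lemma euler_limit:
  "\<exists>(r :: nat \<Rightarrow> nat) y. (\<forall>k. r k \<ge> k) \<and> (\<forall>t\<ge>0. y t \<in> borel_measurable (\<F> t)) \<and> (\<forall>\<omega>. continuous_on {0..} (\<lambda>t. y t \<omega>)) \<and>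
     (AE \<omega> in M. \<forall>T::nat. uniform_limit {0..real T} (\<lambda>k t. euler_path (r k) x0 t \<omega>) (\<lambda>t. y t \<omega>) sequentially)"
proof -
  have "\<forall>k::nat. \<exists>n0. \<forall>n\<ge>n0. \<forall>n'\<ge>n0. outer_prob_le M (\<lambda>\<omega>. \<exists>t\<in>{0..real k}. norm (euler_path n x0 t \<omega> - euler_path n' x0 t \<omega>) > (1/2)^k) ((1/2)^k)"
    by (rule allI, rule euler_Cauchy) auto
  from choice[OF this] obtain r0 where r0: "\<forall>k. \<forall>n\<ge>r0 k. \<forall>n'\<ge>r0 k.
      outer_prob_le M (\<lambda>\<omega>. \<exists>t\<in>{0..real k}. norm (euler_path n x0 t \<omega> - euler_path n' x0 t \<omega>) > (1/2)^k) ((1/2)^k)"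
    by (elim exE) (rule that)
  \<comment> \<open>The partial sum makes consecutive indices both exceed \<open>r0 k\<close>; the
    summand k makes the meshes shrink at least like 2^-k.\<close>
  define r where "r k = k + (\<Sum>j\<le>k. r0 j)" for k
  have r: "r k \<ge> k" "r k \<ge> r0 k" "r (Suc k) \<ge> r0 k" for k
    using member_le_sum[of k "{..k}" r0] by (auto simp: r_def)
  define P where "P k \<omega> \<longleftrightarrow> (\<exists>t\<in>{0..real k}. norm (euler_path (r k) x0 t \<omega> - euler_path (r (Suc k)) x0 t \<omega>) > (1/2)^k)" for k \<omega>
  have ev: "AE \<omega> in M. eventually (\<lambda>k. \<not> P k \<omega>) sequentially"
  proof (rule outer_prob_le_Borel_Cantelli)
    show "outer_prob_le M (P k) ((1/2)^k)" for k
      unfolding P_def by (rule r0[rule_format, OF r(2,3)])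
    show "summable (\<lambda>k. (1/2::real)^k)" by (rule summable_geometric) simp
  qed
  define good where "good \<omega> \<longleftrightarrow> continuous_on {0..} (\<lambda>t. B t \<omega>) \<and> eventually (\<lambda>k. \<not> P k \<omega>) sequentially" for \<omega>
  have ae: "AE \<omega> in M. good \<omega>" using ev B_continuous unfolding good_def by eventually_elim auto
  \<comment> \<open>The constant default keeps every path continuous, not just almost every one, as
    the measurability of the drift integral requires.\<close>
  define y where "y t \<omega> = (if good \<omega> then lim (\<lambda>k. euler_path (r k) x0 t \<omega>) else x0)" for t \<omega>
  have ul: "uniform_limit {0..real T} (\<lambda>k t. euler_path (r k) x0 t \<omega>) (\<lambda>t. y t \<omega>) sequentially" if g: "good \<omega>" for T \<omega>
  proof -
    obtain k0 where k0: "\<And>k. k \<ge> k0 \<Longrightarrow> \<not> P k \<omega>" using g unfolding good_def eventually_sequentially by blast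
    have D: "norm (euler_path (r k) x0 t \<omega> - euler_path (r (Suc k)) x0 t \<omega>) \<le> 1 * (1/2)^k" if "k \<ge> max k0 T" "t \<in> {0..real T}" for k t
      using k0[of k] that unfolding P_def by (auto simp: not_less)
    have "uniform_limit {0..real T} (\<lambda>k t. euler_path (r k) x0 t \<omega>) (\<lambda>t. lim (\<lambda>k. euler_path (r k) x0 t \<omega>)) sequentially"
      by (rule geometric_uniform_limit(1)[where K = "max k0 T" and c = 1 and q = "1/2", OF D]) auto
    then show ?thesis using g by (simp add: y_def)
  qed
  have "y t \<in> borel_measurable (\<F> t)" if t: "t \<ge> 0" for t
  proof (rule measurable_F_AE_eq[OF _ t])
    show "(\<lambda>\<omega>. lim (\<lambda>k. euler_path (r k) x0 t \<omega>)) \<in> borel_measurable (\<F> t)"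
      by (rule borel_measurable_lim_metric[OF euler_path_measurable[OF t]])
    show "AE \<omega> in M. y t \<omega> = lim (\<lambda>k. euler_path (r k) x0 t \<omega>)" using ae by eventually_elim (simp add: y_def)
  qed
  moreover have "continuous_on {0..} (\<lambda>t. y t \<omega>)" for \<omega>
  proof (cases "good \<omega>")
    case True
    show ?thesis
    proof (rule continuous_on_atLeast_nat)
      fix T :: nat
      show "continuous_on {0..real T} (\<lambda>t. y t \<omega>)"
        by (rule uniform_limit_theorem[OF _ ul[OF True]])
          (use True in \<open>auto simp: good_def intro!: always_eventually euler_path_continuous\<close>)
    qed
  qed (simp add: y_def)
  moreover have "AE \<omega> in M. \<forall>T::nat. uniform_limit {0..real T} (\<lambda>k t. euler_path (r k) x0 t \<omega>) (\<lambda>t. y t \<omega>) sequentially"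
    using ae by eventually_elim (use ul in blast)
  ultimately show ?thesis using r(1) by blast
qed

text \<open>The last clause admits s on both sides of the grid point, end points included: simple
  integrands are constant on left-open cells, the Euler drift on right-open ones, and both have to
  be compared with the limit. The bound by n shows that a cut-off at level n is eventually
  inactive.\<close>

lemma euler_limit_coefficients:
  assumes r: "\<And>n. r n \<ge> n" and yc: "continuous_on {0..} y" and \<theta>: "\<theta> > 0"
    and ul: "uniform_limit {0..real k} (\<lambda>n t. euler_path (r n) x0 t \<omega>) y sequentially"
  shows "eventually (\<lambda>n. (\<forall>l\<le>k * 2^r n. norm (X (euler (r n) x0 l \<omega>)) \<le> real n) \<and>
      (\<forall>s\<in>{0..real k}. norm (euler_path (r n) x0 s \<omega> - y s) \<le> \<theta>) \<and>
      (\<forall>l\<le>k * 2^r n. \<forall>s\<in>{0..real k}. \<bar>s - real l / 2^r n\<bar> \<le> 1 / 2^r n \<longrightarrow>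
         norm (X (euler (r n) x0 l \<omega>) - X (y s)) \<le> \<theta> \<and> norm (A (euler (r n) x0 l \<omega>) - A (y s)) \<le> \<theta>)) sequentially"
proof -
  have yk: "continuous_on {0..real k} y" by (rule continuous_on_subset[OF yc]) auto
  have "bounded (y ` {0..real k})" by (intro compact_imp_bounded compact_continuous_image yk) auto
  then obtain \<rho> where \<rho>: "\<And>s. s \<in> {0..real k} \<Longrightarrow> norm (y s) \<le> \<rho>" unfolding bounded_iff by blast
  obtain K where K: "K \<ge> 0" "\<And>z. norm z \<le> \<rho> + 1 \<Longrightarrow> norm (X z) \<le> K \<and> norm (A z) \<le> K"
    using coefficients_bounded[of "\<rho> + 1"] by blast
  have "uniformly_continuous_on (cball 0 (\<rho> + 1)) X" "uniformly_continuous_on (cball 0 (\<rho> + 1)) A"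
    by (auto intro!: compact_uniformly_continuous continuous_on_subset[OF X_continuous] continuous_on_subset[OF A_continuous])
  then obtain dX dA where dX: "dX > 0" "\<And>z z'. z \<in> cball 0 (\<rho> + 1) \<Longrightarrow> z' \<in> cball 0 (\<rho> + 1) \<Longrightarrow> dist z' z < dX \<Longrightarrow> dist (X z') (X z) < \<theta>"
    and dA: "dA > 0" "\<And>z z'. z \<in> cball 0 (\<rho> + 1) \<Longrightarrow> z' \<in> cball 0 (\<rho> + 1) \<Longrightarrow> dist z' z < dA \<Longrightarrow> dist (A z') (A z) < \<theta>"
    using \<theta> unfolding uniformly_continuous_on_def by metis
  define d where "d = min (min dX dA) (min 1 \<theta>)"
  have d: "d > 0" "d \<le> dX" "d \<le> dA" "d \<le> 1" "d \<le> \<theta>" using dX dA \<theta> by (auto simp: d_def)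
  have "uniformly_continuous_on {0..real k} y" by (rule compact_uniformly_continuous[OF yk]) auto
  moreover have "d / 2 > 0" using d by simp
  ultimately obtain d' where d': "d' > 0" "\<And>s s'. s \<in> {0..real k} \<Longrightarrow> s' \<in> {0..real k} \<Longrightarrow> dist s' s < d' \<Longrightarrow> dist (y s') (y s) < d / 2"
    unfolding uniformly_continuous_on_def by metis
  have e1: "eventually (\<lambda>n. \<forall>s\<in>{0..real k}. dist (euler_path (r n) x0 s \<omega>) (y s) < d / 2) sequentially"
    using ul[unfolded uniform_limit_iff, rule_format, of "d / 2"] d(1) by simp
  have "(\<lambda>n. (1/2)^n) \<longlonglongrightarrow> (0::real)" by (intro LIMSEQ_power_zero) auto
  then have e2: "eventually (\<lambda>n. (1/2)^n < d') sequentially" using d'(1) by (rule order_tendstoD(2))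
  obtain n0 :: nat where n0: "K \<le> n0" using real_arch_simple by blast
  show ?thesis
    using e1 e2 eventually_ge_at_top[of n0]
  proof eventually_elim
    case (elim n)
    have h: "1 / 2^r n < d'"
    proof -
      have "1 / 2^r n \<le> (1/2 :: real)^n" using r[of n] by (simp add: power_one_over[symmetric] power_decreasing)
      then show ?thesis using elim(2) by linarith
    qed
    have grid: "real l / 2^r n \<in> {0..real k}" if "l \<le> k * 2^r n" for l
    proof -
      have "real l \<le> real (k * 2^r n)" using that by (simp only: of_nat_le_iff)
      then show ?thesis by (simp add: divide_le_eq)
    qed
    have el: "norm (euler (r n) x0 l \<omega> - y (real l / 2^r n)) < d / 2" if "l \<le> k * 2^r n" for l
      using bspec[OF elim(1) grid[OF that]] by (simp add: dist_norm)
    have ball: "norm (euler (r n) x0 l \<omega>) \<le> \<rho> + 1" if "l \<le> k * 2^r n" for l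
      using el[OF that] \<rho>[OF grid[OF that]] d norm_triangle_sub[of "euler (r n) x0 l \<omega>" "y (real l / 2^r n)"] by linarith
    show ?case
    proof (intro conjI allI ballI impI)
      fix l assume l: "l \<le> k * 2^r n"
      have "norm (X (euler (r n) x0 l \<omega>)) \<le> K" using K(2)[OF ball[OF l]] by blast
      moreover have "real n0 \<le> real n" using elim(3) by simp
      ultimately show "norm (X (euler (r n) x0 l \<omega>)) \<le> real n" using n0 by linarith
    next
      fix s assume "s \<in> {0..real k}"
      then have "dist (euler_path (r n) x0 s \<omega>) (y s) < d / 2" using elim(1) by blast
      then show "norm (euler_path (r n) x0 s \<omega> - y s) \<le> \<theta>" using d by (simp add: dist_norm)
    next
      fix l s assume l: "l \<le> k * 2^r n" and s: "s \<in> {0..real k}" and sl: "\<bar>s - real l / 2^r n\<bar> \<le> 1 / 2^r n"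
      have "dist (y (real l / 2^r n)) (y s) < d / 2"
        using sl h by (intro d'(2) s grid l) (simp add: dist_real_def abs_minus_commute)
      then have "dist (euler (r n) x0 l \<omega>) (y s) < d"
        using el[OF l] dist_triangle[of "euler (r n) x0 l \<omega>" "y s" "y (real l / 2^r n)"] by (simp add: dist_norm)
      moreover have "y s \<in> cball 0 (\<rho> + 1)" "euler (r n) x0 l \<omega> \<in> cball 0 (\<rho> + 1)" using \<rho>[OF s] ball[OF l] by auto
      ultimately have "dist (X (euler (r n) x0 l \<omega>)) (X (y s)) < \<theta>" "dist (A (euler (r n) x0 l \<omega>)) (A (y s)) < \<theta>"
        using d by (auto intro!: dX(2) dA(2))
      then show "norm (X (euler (r n) x0 l \<omega>) - X (y s)) \<le> \<theta>" "norm (A (euler (r n) x0 l \<omega>) - A (y s)) \<le> \<theta>"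
        by (auto simp: dist_norm)
    qed
  qed
qed

end

lemma ceiling_dyadic_cell:
  assumes "s > 0"
  shows "\<exists>l. real l / 2^n < s \<and> s \<le> real (Suc l) / 2^n"
proof -
  define l where "l = nat (\<lceil>s * 2^n\<rceil> - 1)"
  have "s * 2^n > 0" using assms by simp
  then have "\<lceil>s * 2^n\<rceil> \<ge> 1" by linarith
  then have lr: "real l = real_of_int \<lceil>s * 2^n\<rceil> - 1" by (simp add: l_def)
  have "real l < s * 2^n" "s * 2^n \<le> real (Suc l)" unfolding of_nat_Suc lr by linarith+
  then show ?thesis by (intro exI[of _ l]) (auto simp: divide_less_eq le_divide_eq simp del: of_nat_Suc)
qed

section \<open>The limit solves the equation\<close>

context sde_setting
begin

text \<open>The stochastic integral is read off from the equation: I is defined as what is left of y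
  after subtracting x0 and the drift. Euler polygons satisfy the discretised equation exactly, so
  their simple integrals equal polygon minus x0 minus discretised drift, and these converge
  uniformly to I, while the integrands converge to X(y).\<close>

lemma euler_limit_has_ito_integral:
  fixes k :: nat
  assumes r: "\<And>n. r n \<ge> n" and ym: "\<And>t. t \<ge> 0 \<Longrightarrow> y t \<in> borel_measurable (\<F> t)"
    and yc: "\<And>\<omega>. \<omega> \<in> space M \<Longrightarrow> continuous_on {0..} (\<lambda>t. y t \<omega>)"
    and ul: "AE \<omega> in M. \<forall>T::nat. uniform_limit {0..real T} (\<lambda>n t. euler_path (r n) x0 t \<omega>) (\<lambda>t. y t \<omega>) sequentially"
  shows "has_ito_integral M \<F> B (\<lambda>s \<omega>. if s \<le> real k then X (y s \<omega>) else 0)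
     (\<lambda>t \<omega>. y (min t (real k)) \<omega> - x0 - integral {0..min t (real k)} (\<lambda>s. A (y s \<omega>)))"
proof -
  define H where "H = (\<lambda>s \<omega>. if s \<le> real k then X (y s \<omega>) else 0)"
  define I where "I = (\<lambda>t \<omega>. y (min t (real k)) \<omega> - x0 - integral {0..min t (real k)} (\<lambda>s. A (y s \<omega>)))"
  define N where "N n = k * 2^r n" for n
  define \<tau> where "\<tau> n l = real l / 2^r n" for n l :: nat
  \<comment> \<open>Simple integrands are bounded, so the coefficients are cut off; almost surely the cut-off is eventually inactive.\<close>
  define \<eta> where "\<eta> n l \<omega> = (if norm (X (euler (r n) x0 l \<omega>)) \<le> real n then X (euler (r n) x0 l \<omega>) else 0)" for n l \<omega>
  have ayc: "continuous_on {0..} (\<lambda>t. A (y t \<omega>))" if "\<omega> \<in> space M" for \<omega>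
    by (rule continuous_on_compose2[OF A_continuous yc[OF that]]) simp
  have aym: "(\<lambda>\<omega>. A (y t \<omega>)) \<in> borel_measurable (\<F> t)" if "t \<ge> 0" for t
    by (rule measurable_compose[OF ym[OF that] A_measurable])
  have prog: "progressively_measurable \<F> H"
    unfolding progressively_measurable_def
  proof (intro allI impI)
    fix t :: real assume t: "t \<ge> 0"
    let ?N = "restrict_space borel {0..t} \<Otimes>\<^sub>M \<F> t"
    have Y: "(\<lambda>z. X (y (fst z) (snd z))) \<in> borel_measurable ?N"
      using measurable_compose[OF continuous_adapted_measurable[OF ym yc t] X_measurable] unfolding case_prod_beta .
    have "(\<lambda>s::real. s \<le> real k) \<in> measurable (restrict_space borel {0..t}) (count_space UNIV)"
      by (rule measurable_restrict_space1) measurable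
    then have S: "(\<lambda>z. fst z \<le> real k) \<in> measurable ?N (count_space UNIV)" by (rule measurable_compose[OF measurable_fst])
    have "(\<lambda>z. if fst z \<le> real k then X (y (fst z) (snd z)) else 0) \<in> borel_measurable ?N"
      using Y S by measurable
    then show "(\<lambda>(s, \<omega>). H s \<omega>) \<in> borel_measurable ?N" unfolding H_def case_prod_beta .
  qed
  have Im: "I t \<in> borel_measurable (\<F> t)" if t: "t \<ge> 0" for t
  proof -
    have u: "min t (real k) \<ge> 0" "min t (real k) \<le> t" using t by auto
    have [measurable]: "y (min t (real k)) \<in> borel_measurable (\<F> t)" by (rule measurable_F_mono[OF ym u(2)]) (use t u in auto)
    have [measurable]: "(\<lambda>\<omega>. integral {0..min t (real k)} (\<lambda>s. A (y s \<omega>))) \<in> borel_measurable (\<F> t)"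
      by (rule measurable_F_mono[OF integral_adapted u(2)]) (auto intro: aym ayc t)
    show ?thesis unfolding I_def by measurable
  qed
  have Ic: "AE \<omega> in M. continuous_on {0..} (\<lambda>t. I t \<omega>)"
  proof (rule AE_I2)
    fix \<omega> assume w: "\<omega> \<in> space M"
    have "(\<lambda>s. A (y s \<omega>)) integrable_on {0..real k}"
      by (intro integrable_continuous_interval continuous_on_subset[OF ayc[OF w]]) auto
    note c2 = indefinite_integral_continuous_1[OF this]
    have "continuous_on {0..} (\<lambda>t. integral {0..min t (real k)} (\<lambda>s. A (y s \<omega>)))"
      by (rule continuous_on_compose2[OF c2]) (auto intro!: continuous_intros)
    moreover have "continuous_on {0..} (\<lambda>t. y (min t (real k)) \<omega>)"
      by (rule continuous_on_compose2[OF yc[OF w]]) (auto intro!: continuous_intros)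
    ultimately show "continuous_on {0..} (\<lambda>t. I t \<omega>)" unfolding I_def by (intro continuous_intros)
  qed
  have S: "simple_integrand M \<F> (N n) (\<tau> n) (\<eta> n)" for n
    unfolding simple_integrand_def
  proof (intro conjI allI impI)
    fix l
    show "\<tau> n l \<le> \<tau> n (Suc l)" unfolding \<tau>_def by (rule dyadic_le_Suc)
    note [measurable] = euler_measurable[of l "r n" "\<tau> n l" x0, unfolded \<tau>_def, OF order_refl] X_measurable
    show "\<eta> n l \<in> borel_measurable (\<F> (\<tau> n l))" unfolding \<eta>_def \<tau>_def by measurable
    show "bounded (\<eta> n l ` space M)" unfolding bounded_iff by (intro exI[of _ "real n"]) (auto simp: \<eta>_def)
  qed (simp add: \<tau>_def)
  have Nk: "real (N n) / 2^r n = real k" for n by (simp add: N_def)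
  have ev: "AE \<omega> in M. eventually (\<lambda>n. (\<forall>l\<le>N n. \<eta> n l \<omega> = X (euler (r n) x0 l \<omega>)) \<and>
      (\<forall>s\<in>{0..real k}. norm (euler_path (r n) x0 s \<omega> - y s \<omega>) \<le> \<theta>) \<and>
      (\<forall>l\<le>N n. \<forall>s\<in>{0..real k}. \<bar>s - real l / 2^r n\<bar> \<le> 1 / 2^r n \<longrightarrow>
         norm (X (euler (r n) x0 l \<omega>) - X (y s \<omega>)) \<le> \<theta> \<and> norm (A (euler (r n) x0 l \<omega>) - A (y s \<omega>)) \<le> \<theta>)) sequentially"
    if \<theta>: "\<theta> > 0" for \<theta>
    using ul AE_space
  proof eventually_elim
    case (elim \<omega>)
    from euler_limit_coefficients[OF r yc[OF elim(2)] \<theta> elim(1)[rule_format, of k]]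
    show ?case by eventually_elim (auto simp: N_def \<eta>_def)
  qed
  have cell: "l < N n" if "real l / 2^r n < s" "s \<le> real k" for l s n
  proof -
    have "real l / 2^r n < real (N n) / 2^r n" using that by (simp add: Nk)
    then show ?thesis by (simp add: divide_less_cancel)
  qed
  have null1: "null_in_probability M (\<lambda>n \<omega>. \<integral>\<^sup>+s\<in>{0..T}.
             ennreal ((norm (simple_process (N n) (\<tau> n) (\<eta> n) s \<omega> - H s \<omega>))\<^sup>2) \<partial>lborel)" if T: "T > 0" for T
  proof (rule null_in_probabilityI)
    fix \<epsilon> :: real assume \<epsilon>: "\<epsilon> > 0"
    define \<theta> where "\<theta> = sqrt (\<epsilon> / T)"
    have \<theta>: "\<theta> > 0" "\<theta>\<^sup>2 * T = \<epsilon>" using \<epsilon> T by (auto simp: \<theta>_def)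
    show "AE \<omega> in M. eventually (\<lambda>n. (\<integral>\<^sup>+s\<in>{0..T}.
             ennreal ((norm (simple_process (N n) (\<tau> n) (\<eta> n) s \<omega> - H s \<omega>))\<^sup>2) \<partial>lborel) \<le> ennreal \<epsilon>) sequentially"
      using ev[OF \<theta>(1)]
    proof eventually_elim
      case (elim \<omega>)
      then show ?case
      proof eventually_elim
        case (elim n)
        have pt: "norm (simple_process (N n) (\<tau> n) (\<eta> n) s \<omega> - H s \<omega>) \<le> \<theta>" if s: "s > 0" for s
        proof (cases "s \<le> real k")
          case True
          obtain l where l: "real l / 2^r n < s" "s \<le> real (Suc l) / 2^r n" using ceiling_dyadic_cell[OF s] by blast
          have lN: "l < N n" by (rule cell[OF l(1) True])
          have "simple_process (N n) (\<tau> n) (\<eta> n) s \<omega> = \<eta> n l \<omega>" unfolding \<tau>_def by (rule simple_process_grid[OF lN l])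
          also have "\<dots> = X (euler (r n) x0 l \<omega>)" using elim lN by auto
          finally have eq: "simple_process (N n) (\<tau> n) (\<eta> n) s \<omega> = X (euler (r n) x0 l \<omega>)" .
          have "\<bar>s - real l / 2^r n\<bar> \<le> 1 / 2^r n" using l by (simp add: add_divide_distrib)
          then have "norm (X (euler (r n) x0 l \<omega>) - X (y s \<omega>)) \<le> \<theta>" using elim lN True s by auto
          then show ?thesis using True by (simp add: eq H_def)
        next
          case False
          then have "simple_process (N n) (\<tau> n) (\<eta> n) s \<omega> = 0"
            unfolding \<tau>_def by (intro simple_process_grid_beyond) (simp add: Nk)
          then show ?thesis using False \<theta> by (simp add: H_def)
        qed
        have "(\<integral>\<^sup>+s\<in>{0..T}. ennreal ((norm (simple_process (N n) (\<tau> n) (\<eta> n) s \<omega> - H s \<omega>))\<^sup>2) \<partial>lborel)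
          \<le> (\<integral>\<^sup>+s. ennreal (\<theta>\<^sup>2) * indicator {0..T} s \<partial>lborel)"
        proof (rule nn_integral_mono_AE)
          show "AE s in lborel. ennreal ((norm (simple_process (N n) (\<tau> n) (\<eta> n) s \<omega> - H s \<omega>))\<^sup>2) * indicator {0..T} s
              \<le> ennreal (\<theta>\<^sup>2) * indicator {0..T} s"
            \<comment> \<open>The left-open cells do not cover time 0, where the simple process
              vanishes.\<close>
            using AE_lborel_singleton[of "0::real"]
          proof eventually_elim
            case (elim s)
            show ?case
            proof (cases "s \<in> {0..T}")
              case True
              then have "s > 0" using elim by simp
              then have "(norm (simple_process (N n) (\<tau> n) (\<eta> n) s \<omega> - H s \<omega>))\<^sup>2 \<le> \<theta>\<^sup>2" by (intro power_mono pt) auto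
              then show ?thesis using True by (simp add: ennreal_leI)
            qed simp
          qed
        qed
        also have "\<dots> = ennreal (\<theta>\<^sup>2) * ennreal T" using T by (simp add: nn_integral_cmult_indicator)
        also have "\<dots> = ennreal \<epsilon>" using \<theta> T by (simp add: ennreal_mult[symmetric])
        finally show ?case .
      qed
    qed
  qed
  have null2: "null_in_probability M (\<lambda>n \<omega>. SUP t\<in>{0..T}. ennreal (norm (simple_integral B (N n) (\<tau> n) (\<eta> n) t \<omega> - I t \<omega>)))"
    if T: "T > 0" for T
  proof (rule null_in_probabilityI)
    fix \<epsilon> :: real assume \<epsilon>: "\<epsilon> > 0"
    \<comment> \<open>One \<open>\<theta>\<close> for the distance of the polygon from y, and k
      times \<open>\<theta>\<close> for the drift integrated over at most [0, k].\<close>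
    define \<theta> where "\<theta> = \<epsilon> / (1 + real k)"
    have "\<theta> + \<theta> * real k = \<theta> * (1 + real k)" by (simp add: distrib_left)
    then have \<theta>: "\<theta> > 0" "\<theta> + \<theta> * real k = \<epsilon>" using \<epsilon> by (auto simp: \<theta>_def)
    show "AE \<omega> in M. eventually (\<lambda>n. (SUP t\<in>{0..T}. ennreal (norm (simple_integral B (N n) (\<tau> n) (\<eta> n) t \<omega> - I t \<omega>))) \<le> ennreal \<epsilon>) sequentially"
      using ev[OF \<theta>(1)] AE_space
    proof eventually_elim
      case (elim \<omega>)
      note w = elim(2)
      from elim(1) show ?case
      proof eventually_elim
        case (elim n)
        show ?case
        proof (rule SUP_least, rule ennreal_leI)
          fix t assume t: "t \<in> {0..T}"
          define u where "u = min t (real k)"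
          have u: "0 \<le> u" "u \<le> real k" using t by (auto simp: u_def)
          define a where "a = (\<lambda>s::real. A (euler (r n) x0 (nat \<lfloor>s * 2^r n\<rfloor>) \<omega>))"
          have "simple_integral B (N n) (\<tau> n) (\<eta> n) t \<omega>
            = (\<Sum>j<N n. blinfun_apply (X (euler (r n) x0 j \<omega>)) (B (min u (real (Suc j) / 2^r n)) \<omega> - B (min u (real j / 2^r n)) \<omega>))"
            unfolding simple_integral_def
          proof (intro sum.cong refl)
            fix j assume j: "j \<in> {..<N n}"
            have "real (Suc j) / 2^r n \<le> real (N n) / 2^r n" "real j / 2^r n \<le> real (N n) / 2^r n"
              using j by (auto intro!: divide_right_mono)
            then have "min t (real (Suc j) / 2^r n) = min u (real (Suc j) / 2^r n)" "min t (real j / 2^r n) = min u (real j / 2^r n)"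
              unfolding Nk u_def by auto
            moreover have "\<eta> n j \<omega> = X (euler (r n) x0 j \<omega>)" using elim j by auto
            ultimately show "blinfun_apply (\<eta> n j \<omega>) (B (min t (\<tau> n (Suc j))) \<omega> - B (min t (\<tau> n j)) \<omega>) =
               blinfun_apply (X (euler (r n) x0 j \<omega>)) (B (min u (real (Suc j) / 2^r n)) \<omega> - B (min u (real j / 2^r n)) \<omega>)"
              by (simp only: \<tau>_def)
          qed
          also have "\<dots> = euler_diffusion (r n) x0 u \<omega>"
            unfolding euler_diffusion_def by (rule step_integral_min[symmetric]) (use u in \<open>simp_all add: Nk\<close>)
          also have "\<dots> = euler_path (r n) x0 u \<omega> - x0 - integral {0..u} a"
            by (simp add: euler_path_def a_def)
          finally have eq: "simple_integral B (N n) (\<tau> n) (\<eta> n) t \<omega> - I t \<omega>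
             = (euler_path (r n) x0 u \<omega> - y u \<omega>) - (integral {0..u} a - integral {0..u} (\<lambda>s. A (y s \<omega>)))"
            by (simp add: I_def u_def[symmetric])
          have i1: "a integrable_on {0..u}" unfolding a_def by (rule step_function_integrable)
          have i2: "(\<lambda>s. A (y s \<omega>)) integrable_on {0..u}"
            by (intro integrable_continuous_interval continuous_on_subset[OF ayc[OF w]]) auto
          have "((\<lambda>s. a s - A (y s \<omega>)) has_integral (integral {0..u} a - integral {0..u} (\<lambda>s. A (y s \<omega>)))) (cbox 0 u)"
            using has_integral_diff[OF integrable_integral[OF i1] integrable_integral[OF i2]] by simp
          then have "norm (integral {0..u} a - integral {0..u} (\<lambda>s. A (y s \<omega>))) \<le> \<theta> * measure lborel (cbox 0 u)"
          proof (rule has_integral_bound[rotated])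
            fix s assume "s \<in> cbox 0 u"
            then have s: "0 \<le> s" "s \<le> real k" using u by auto
            define l where "l = nat \<lfloor>s * 2^r n\<rfloor>"
            have l: "real l / 2^r n \<le> s" "s < real (Suc l) / 2^r n" unfolding l_def by (rule nat_floor_dyadic_cell[OF s(1)])+
            have "real l / 2^r n \<le> real (N n) / 2^r n" using l s by (simp add: Nk)
            then have "l \<le> N n" by (simp add: divide_le_cancel)
            moreover have "\<bar>s - real l / 2^r n\<bar> \<le> 1 / 2^r n" using l by (simp add: add_divide_distrib)
            ultimately show "norm (a s - A (y s \<omega>)) \<le> \<theta>" unfolding a_def l_def[symmetric] using elim s by auto
          qed (use \<theta> in simp)
          also have "\<dots> \<le> \<theta> * real k" using u \<theta> by (intro mult_left_mono) auto
          finally have "norm (integral {0..u} a - integral {0..u} (\<lambda>s. A (y s \<omega>))) \<le> \<theta> * real k" .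
          moreover have "norm (euler_path (r n) x0 u \<omega> - y u \<omega>) \<le> \<theta>" using elim u by auto
          ultimately have "norm ((euler_path (r n) x0 u \<omega> - y u \<omega>) - (integral {0..u} a - integral {0..u} (\<lambda>s. A (y s \<omega>)))) \<le> \<theta> + \<theta> * real k"
            by (intro order_trans[OF norm_triangle_ineq4 add_mono])
          then show "norm (simple_integral B (N n) (\<tau> n) (\<eta> n) t \<omega> - I t \<omega>) \<le> \<epsilon>" using eq \<theta>(2) by simp
        qed
      qed
    qed
  qed
  have "has_ito_integral M \<F> B H I"
    unfolding has_ito_integral_def
  proof (intro conjI allI impI prog Im Ic)
    show "\<exists>k \<tau> \<eta>. (\<forall>n. simple_integrand M \<F> (k n) (\<tau> n) (\<eta> n)) \<and>
        (\<forall>T>0.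
           null_in_probability M (\<lambda>n \<omega>. \<integral>\<^sup>+s\<in>{0..T}.
             ennreal ((norm (simple_process (k n) (\<tau> n) (\<eta> n) s \<omega> - H s \<omega>))\<^sup>2) \<partial>lborel) \<and>
           null_in_probability M (\<lambda>n \<omega>. SUP t\<in>{0..T}.
             ennreal (norm (simple_integral B (k n) (\<tau> n) (\<eta> n) t \<omega> - I t \<omega>))))"
      by (rule exI[of _ N], rule exI[of _ \<tau>], rule exI[of _ \<eta>]) (intro conjI allI impI S null1 null2)
  qed
  then show ?thesis unfolding H_def I_def .
qed

lemma euler_limit_sde_solution:
  assumes r: "\<And>n. r n \<ge> n" and ym: "\<And>t. t \<ge> 0 \<Longrightarrow> y t \<in> borel_measurable (\<F> t)"
    and yc: "\<And>\<omega>. \<omega> \<in> space M \<Longrightarrow> continuous_on {0..} (\<lambda>t. y t \<omega>)"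
    and ul: "AE \<omega> in M. \<forall>T::nat. uniform_limit {0..real T} (\<lambda>n t. euler_path (r n) x0 t \<omega>) (\<lambda>t. y t \<omega>) sequentially"
  shows "sde_solution M \<F> B X A x0 y (\<lambda>_. \<infinity>)"
  unfolding sde_solution_def
proof (intro conjI allI impI)
  show "Measurable.pred (\<F> t) (\<lambda>\<omega>. \<infinity> \<le> ereal t)" for t by simp
  show "(\<lambda>\<omega>. if ereal t < \<infinity> then y t \<omega> else 0) \<in> borel_measurable (\<F> t)" if "0 \<le> t" for t using ym[OF that] by simp
  show "AE \<omega> in M. 0 < (\<infinity>::ereal) \<and> y 0 \<omega> = x0 \<and> continuous_on {t. 0 \<le> t \<and> ereal t < \<infinity>} (\<lambda>t. y t \<omega>)"
    using ul AE_space
  proof eventually_elim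
    case (elim \<omega>)
    have "(\<lambda>n. euler_path (r n) x0 0 \<omega>) \<longlonglongrightarrow> y 0 \<omega>"
      by (rule tendsto_uniform_limitI[OF elim(1)[rule_format, of 0]]) simp
    then have "y 0 \<omega> = x0" by (simp add: LIMSEQ_const_iff)
    moreover have "{t. 0 \<le> t \<and> ereal t < \<infinity>} = {0..}" by auto
    ultimately show ?case using yc[OF elim(2)] by simp
  qed
  show "\<exists>\<sigma>. (\<forall>k. stopping_time \<F> (\<sigma> k)) \<and>
        (AE \<omega> in M. incseq (\<lambda>k. \<sigma> k \<omega>) \<and> (\<forall>k. 0 \<le> \<sigma> k \<omega> \<and> ereal (\<sigma> k \<omega>) < \<infinity>) \<and>
           (\<lambda>k. ereal (\<sigma> k \<omega>)) \<longlonglongrightarrow> \<infinity>) \<and>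
        (\<forall>k. \<exists>I. has_ito_integral M \<F> B (\<lambda>s \<omega>. if s \<le> \<sigma> k \<omega> then X (y s \<omega>) else 0) I \<and>
           (AE \<omega> in M. \<forall>t. 0 \<le> t \<longrightarrow> t \<le> \<sigma> k \<omega> \<longrightarrow>
              y t \<omega> = x0 + I t \<omega> + integral {0..t} (\<lambda>s. A (y s \<omega>))))"
  proof (intro exI[of _ "\<lambda>k \<omega>. real k"] conjI allI)
    show "stopping_time \<F> (\<lambda>\<omega>. real k)" for k by (rule stopping_time_const)
    show "AE \<omega> in M. incseq (\<lambda>k. real k) \<and> (\<forall>k. 0 \<le> real k \<and> ereal (real k) < \<infinity>) \<and> (\<lambda>k. ereal (real k)) \<longlonglongrightarrow> \<infinity>"
      by (intro AE_I2) (auto simp: incseq_def intro: id_nat_ereal_tendsto_PInf)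
    fix k :: nat
    show "\<exists>I. has_ito_integral M \<F> B (\<lambda>s \<omega>. if s \<le> real k then X (y s \<omega>) else 0) I \<and>
           (AE \<omega> in M. \<forall>t. 0 \<le> t \<longrightarrow> t \<le> real k \<longrightarrow> y t \<omega> = x0 + I t \<omega> + integral {0..t} (\<lambda>s. A (y s \<omega>)))"
      by (rule exI, rule conjI, rule euler_limit_has_ito_integral[OF r ym yc ul]) (auto simp: min_absorb1)
  qed
qed

end

section \<open>Kolmogorov chaining\<close>

definition dyadic_grid :: "nat \<Rightarrow> nat \<Rightarrow> 'a::euclidean_space set" where
  "dyadic_grid N k = (\<lambda>f. \<Sum>i\<in>Basis. (real_of_int (f i) / 2^k) *\<^sub>R i) ` PiE Basis (\<lambda>_. {- int (N * 2^k)..int (N * 2^k)})"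

definition dyadic_floor :: "nat \<Rightarrow> 'a::euclidean_space \<Rightarrow> 'a" where
  "dyadic_floor k x = (\<Sum>i\<in>Basis. (real_of_int \<lfloor>(x \<bullet> i) * 2^k\<rfloor> / 2^k) *\<^sub>R i)"

lemma dyadic_floor_inner: "i \<in> Basis \<Longrightarrow> dyadic_floor k x \<bullet> i = real_of_int \<lfloor>(x \<bullet> i) * 2^k\<rfloor> / 2^k"
  by (simp add: dyadic_floor_def)

lemma finite_dyadic_grid: "finite (dyadic_grid N k :: 'a::euclidean_space set)"
  unfolding dyadic_grid_def by (intro finite_imageI finite_PiE) auto

lemma card_dyadic_grid: "card (dyadic_grid N k :: 'a::euclidean_space set) \<le> (2 * N * 2^k + 1) ^ DIM('a)"
proof -
  have "card (dyadic_grid N k :: 'a set) \<le> card (PiE (Basis :: 'a set) (\<lambda>_. {- int (N * 2^k)..int (N * 2^k)}))"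
    unfolding dyadic_grid_def by (intro card_image_le finite_PiE) auto
  also have "\<dots> = (nat (2 * int (N * 2^k) + 1)) ^ DIM('a)" by (simp add: card_PiE algebra_simps)
  also have "nat (2 * int (N * 2^k) + 1) = 2 * N * 2^k + 1" by (simp add: nat_add_distrib nat_mult_distrib nat_power_eq)
  finally show ?thesis .
qed

lemma norm_dyadic_grid:
  fixes u :: "'a::euclidean_space"
  assumes "u \<in> dyadic_grid N k"
  shows "norm u \<le> real (DIM('a) * N)"
proof -
  obtain f where f: "f \<in> PiE (Basis :: 'a set) (\<lambda>_. {- int (N * 2^k)..int (N * 2^k)})"
    and u: "u = (\<Sum>i\<in>Basis. (real_of_int (f i) / 2^k) *\<^sub>R i)" using assms by (auto simp: dyadic_grid_def)
  have "\<bar>u \<bullet> i\<bar> \<le> real N" if i: "i \<in> Basis" for i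
  proof -
    have "f i \<in> {- int (N * 2^k)..int (N * 2^k)}" using f i by (rule PiE_mem)
    then have "\<bar>f i\<bar> \<le> int (N * 2^k)" by auto
    then have "\<bar>real_of_int (f i)\<bar> \<le> real (N * 2^k)" by linarith
    then show ?thesis using i by (simp add: u divide_le_eq)
  qed
  then have "(\<Sum>i\<in>Basis. \<bar>u \<bullet> i\<bar>) \<le> (\<Sum>i\<in>(Basis::'a set). real N)" by (rule sum_mono)
  then show ?thesis using norm_le_l1[of u] by simp
qed

lemma dyadic_gridI:
  assumes "\<And>i. i \<in> Basis \<Longrightarrow> \<exists>j::int. u \<bullet> i = j / 2^k" and "\<And>i. i \<in> Basis \<Longrightarrow> \<bar>u \<bullet> i\<bar> \<le> real N"
  shows "u \<in> dyadic_grid N k"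
proof -
  obtain f :: "'a \<Rightarrow> int" where f: "\<And>i. i \<in> Basis \<Longrightarrow> u \<bullet> i = f i / 2^k" using assms(1) by metis
  have "u = (\<Sum>i\<in>Basis. (real_of_int (restrict f Basis i) / 2^k) *\<^sub>R i)"
    by (rule euclidean_eqI) (simp add: f)
  moreover have "restrict f Basis \<in> PiE Basis (\<lambda>_. {- int (N * 2^k)..int (N * 2^k)})"
  proof (rule restrict_PiE_iff[THEN iffD2], rule ballI)
    fix i :: 'a assume i: "i \<in> Basis"
    have "\<bar>real_of_int (f i)\<bar> \<le> real N * 2^k" using assms(2)[OF i] f[OF i] by (simp add: divide_le_eq)
    then have "real_of_int \<bar>f i\<bar> \<le> real_of_int (int (N * 2^k))" by simp
    then have "\<bar>f i\<bar> \<le> int (N * 2^k)" by (rule of_int_le_iff[THEN iffD1])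
    then show "f i \<in> {- int (N * 2^k)..int (N * 2^k)}" by auto
  qed
  ultimately show ?thesis unfolding dyadic_grid_def by blast
qed

text \<open>The second membership puts the approximations of x at levels k and k + 1 into one grid,
  where they are neighbours and the estimate for adjacent grid points applies.\<close>

lemma dyadic_floor_in_grid:
  fixes x :: "'a::euclidean_space"
  assumes "norm x \<le> real N"
  shows "dyadic_floor k x \<in> dyadic_grid N k" "dyadic_floor k x \<in> dyadic_grid N (Suc k)"
proof -
  have b: "\<bar>dyadic_floor k x \<bullet> i\<bar> \<le> real N" if i: "i \<in> Basis" for i
  proof -
    have "\<bar>x \<bullet> i\<bar> \<le> real N" using Basis_le_norm[OF i, of x] assms by linarith
    then have "\<bar>(x \<bullet> i) * 2^k\<bar> \<le> real (N * 2^k)" by (simp add: abs_mult)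
    then have "\<bar>\<lfloor>(x \<bullet> i) * 2^k\<rfloor>\<bar> \<le> int (N * 2^k)" by linarith
    then have "\<bar>real_of_int \<lfloor>(x \<bullet> i) * 2^k\<rfloor>\<bar> \<le> real (N * 2^k)" by linarith
    then show ?thesis by (simp add: dyadic_floor_inner[OF i] divide_le_eq)
  qed
  show "dyadic_floor k x \<in> dyadic_grid N k"
    by (rule dyadic_gridI) (use b dyadic_floor_inner in blast)+
  show "dyadic_floor k x \<in> dyadic_grid N (Suc k)"
  proof (rule dyadic_gridI)
    fix i :: 'a assume i: "i \<in> Basis"
    have "dyadic_floor k x \<bullet> i = real_of_int (2 * \<lfloor>(x \<bullet> i) * 2^k\<rfloor>) / 2^Suc k" by (simp add: dyadic_floor_inner[OF i])
    then show "\<exists>j::int. dyadic_floor k x \<bullet> i = j / 2^Suc k" by blast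
  qed (rule b)
qed

lemma norm_le_of_coordinates:
  fixes x :: "'a::euclidean_space"
  assumes "\<And>i. i \<in> Basis \<Longrightarrow> \<bar>x \<bullet> i\<bar> \<le> h"
  shows "norm x \<le> real DIM('a) * h"
  using norm_le_l1[of x] sum_mono[of Basis "\<lambda>i. \<bar>x \<bullet> i\<bar>" "\<lambda>_. h"] assms by simp

lemma norm_dyadic_floor_diff: "norm (x - dyadic_floor k x) \<le> real DIM('a) / 2^k" for x :: "'a::euclidean_space"
proof -
  have "\<bar>(x - dyadic_floor k x) \<bullet> i\<bar> \<le> 1 / 2^k" if i: "i \<in> Basis" for i
  proof -
    have "x \<bullet> i - real_of_int \<lfloor>(x \<bullet> i) * 2^k\<rfloor> / 2^k = ((x \<bullet> i) * 2^k - real_of_int \<lfloor>(x \<bullet> i) * 2^k\<rfloor>) / 2^k"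
      by (simp add: field_simps)
    moreover have "\<bar>(x \<bullet> i) * 2^k - real_of_int \<lfloor>(x \<bullet> i) * 2^k\<rfloor>\<bar> \<le> 1" by linarith
    ultimately show ?thesis by (simp add: inner_diff_left dyadic_floor_inner[OF i] divide_right_mono)
  qed
  then show ?thesis using norm_le_of_coordinates[of "x - dyadic_floor k x" "1 / 2^k"] by simp
qed

lemma norm_dyadic_floor_close:
  fixes x z :: "'a::euclidean_space"
  assumes "norm (x - z) \<le> 1 / 2^k"
  shows "norm (dyadic_floor k x - dyadic_floor k z) \<le> real DIM('a) / 2^k"
proof -
  have "\<bar>(dyadic_floor k x - dyadic_floor k z) \<bullet> i\<bar> \<le> 1 / 2^k" if i: "i \<in> Basis" for i
  proof -
    have "\<bar>x \<bullet> i - z \<bullet> i\<bar> \<le> 1 / 2^k" using Basis_le_norm[OF i, of "x - z"] assms by (simp add: inner_diff_left)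
    then have "\<bar>(x \<bullet> i) * 2^k - (z \<bullet> i) * 2^k\<bar> \<le> 1" by (simp add: abs_mult le_divide_eq flip: left_diff_distrib)
    then have "\<bar>\<lfloor>(x \<bullet> i) * 2^k\<rfloor> - \<lfloor>(z \<bullet> i) * 2^k\<rfloor>\<bar> \<le> 1" by linarith
    then have "\<bar>real_of_int \<lfloor>(x \<bullet> i) * 2^k\<rfloor> - real_of_int \<lfloor>(z \<bullet> i) * 2^k\<rfloor>\<bar> \<le> 1" by linarith
    then show ?thesis
      by (simp add: inner_diff_left dyadic_floor_inner[OF i] divide_right_mono flip: diff_divide_distrib)
  qed
  then show ?thesis using norm_le_of_coordinates[of "dyadic_floor k x - dyadic_floor k z" "1 / 2^k"] by simp
qed

lemma norm_dyadic_floor_Suc: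
  fixes x :: "'a::euclidean_space"
  shows "norm (dyadic_floor k x - dyadic_floor (Suc k) x) \<le> real DIM('a) / 2^Suc k"
proof -
  have "\<bar>(dyadic_floor k x - dyadic_floor (Suc k) x) \<bullet> i\<bar> \<le> 1 / 2^Suc k" if i: "i \<in> Basis" for i
  proof -
    have "\<bar>2 * \<lfloor>(x \<bullet> i) * 2^k\<rfloor> - \<lfloor>2 * ((x \<bullet> i) * 2^k)\<rfloor>\<bar> \<le> 1" by linarith
    then have 1: "\<bar>2 * real_of_int \<lfloor>(x \<bullet> i) * 2^k\<rfloor> - real_of_int \<lfloor>(x \<bullet> i) * 2^Suc k\<rfloor>\<bar> \<le> 1" by (simp add: mult_ac)
    have "(dyadic_floor k x - dyadic_floor (Suc k) x) \<bullet> i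
       = (2 * real_of_int \<lfloor>(x \<bullet> i) * 2^k\<rfloor> - real_of_int \<lfloor>(x \<bullet> i) * 2^Suc k\<rfloor>) / 2^Suc k"
      by (simp add: inner_diff_left dyadic_floor_inner[OF i] diff_divide_distrib)
    then show ?thesis using 1 by (simp add: divide_right_mono del: power_Suc)
  qed
  then show ?thesis using norm_le_of_coordinates[of "dyadic_floor k x - dyadic_floor (Suc k) x" "1 / 2^Suc k"] by simp
qed

text \<open>Each x is reached through its own dyadic approximations: consecutive ones are
  neighbours, so the values converge at the rate (3/4)^k, uniformly on bounded sets. Points at
  distance at most 2^-k have neighbouring approximations at level k. Only values of f on the grids
  enter, so f may be arbitrary at all other points.\<close>

lemma dyadic_chaining:
  fixes f :: "real \<Rightarrow> 'a::euclidean_space \<Rightarrow> 'b::banach"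
  assumes adj: "\<And>N T :: nat. eventually (\<lambda>k. \<forall>u\<in>dyadic_grid N k. \<forall>v\<in>dyadic_grid N k. norm (u - v) \<le> real DIM('a) / 2^k \<longrightarrow>
      (\<forall>t\<in>{0..real T}. norm (f t u - f t v) \<le> (3/4)^k)) sequentially"
    and cont: "\<And>N k u. u \<in> dyadic_grid N k \<Longrightarrow> continuous_on {0..} (\<lambda>t. f t u)"
  shows "continuous_on ({0..} \<times> UNIV) (\<lambda>(t, x). lim (\<lambda>k. f t (dyadic_floor k x)))"
    and "\<And>t x. t \<ge> 0 \<Longrightarrow> (\<lambda>k. f t (dyadic_floor k x)) \<longlonglongrightarrow> lim (\<lambda>k. f t (dyadic_floor k x))"
proof -
  define \<Phi> where "\<Phi> t x = lim (\<lambda>k. f t (dyadic_floor k x))" for t x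
  have key: "\<exists>K. (\<forall>k\<ge>K. \<forall>t\<in>{0..real T}. \<forall>x\<in>cball 0 (real N). norm (f t (dyadic_floor k x) - \<Phi> t x) \<le> 4 * (3/4)^k) \<and>
     (\<forall>k\<ge>K. \<forall>t\<in>{0..real T}. \<forall>x\<in>cball 0 (real N). \<forall>z\<in>cball 0 (real N). norm (x - z) \<le> 1 / 2^k \<longrightarrow>
        norm (f t (dyadic_floor k x) - f t (dyadic_floor k z)) \<le> (3/4)^k) \<and>
     (\<forall>t\<in>{0..real T}. \<forall>x\<in>cball 0 (real N). (\<lambda>k. f t (dyadic_floor k x)) \<longlonglongrightarrow> \<Phi> t x)" for N T :: nat
  proof -
    obtain K where K: "\<And>k u v t. k \<ge> K \<Longrightarrow> u \<in> dyadic_grid N k \<Longrightarrow> v \<in> dyadic_grid N k \<Longrightarrow> norm (u - v) \<le> real DIM('a) / 2^k \<Longrightarrow>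
       t \<in> {0..real T} \<Longrightarrow> norm (f t u - f t v) \<le> (3/4)^k"
      using adj[of N T] unfolding eventually_sequentially by blast
    have d: "norm (f (fst z) (dyadic_floor k (snd z)) - f (fst z) (dyadic_floor (Suc k) (snd z))) \<le> 1 * (3/4)^k"
      if "k \<ge> K" "z \<in> {0..real T} \<times> cball 0 (real N)" for k z
    proof -
      have z: "norm (snd z) \<le> real N" using that by auto
      have "norm (f (fst z) (dyadic_floor k (snd z)) - f (fst z) (dyadic_floor (Suc k) (snd z))) \<le> (3/4)^Suc k"
        by (rule K) (use that z in \<open>auto intro: dyadic_floor_in_grid norm_dyadic_floor_Suc simp del: power_Suc\<close>)
      also have "\<dots> \<le> (3/4)^k" by (intro power_decreasing) auto
      finally show ?thesis by simp
    qed
    note g = geometric_uniform_limit[where f = "\<lambda>k z. f (fst z) (dyadic_floor k (snd z))" and c = 1 and K = K and S = "{0..real T} \<times> cball 0 (real N)" and q = "3/4::real", OF d]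
    show ?thesis
    proof (rule exI[of _ K], intro conjI allI impI ballI)
      fix k t x assume "k \<ge> K" "t \<in> {0..real T}" "x \<in> cball (0::'a) (real N)"
      then show "norm (f t (dyadic_floor k x) - \<Phi> t x) \<le> 4 * (3/4)^k"
        using g(2)[of k "(t, x)"] unfolding \<Phi>_def by (simp add: mult.commute)
    next
      fix k t x z assume "k \<ge> K" "t \<in> {0..real T}" "x \<in> cball (0::'a) (real N)" "z \<in> cball (0::'a) (real N)" "norm (x - z) \<le> 1 / 2^k"
      then show "norm (f t (dyadic_floor k x) - f t (dyadic_floor k z)) \<le> (3/4)^k"
        by (intro K) (auto intro: dyadic_floor_in_grid norm_dyadic_floor_close)
    next
      fix t x assume tx: "t \<in> {0..real T}" "x \<in> cball (0::'a) (real N)"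
      show "(\<lambda>k. f t (dyadic_floor k x)) \<longlonglongrightarrow> \<Phi> t x"
        using tendsto_uniform_limitI[OF g(1), of "(t, x)"] tx unfolding \<Phi>_def by simp
    qed
  qed
  show "(\<lambda>k. f t (dyadic_floor k x)) \<longlonglongrightarrow> lim (\<lambda>k. f t (dyadic_floor k x))" if "t \<ge> 0" for t x
  proof -
    obtain T N :: nat where "t \<le> real T" "norm x \<le> real N" using real_arch_simple by blast
    then show ?thesis using key[of T N] that unfolding \<Phi>_def by auto
  qed
  have "continuous_on ({0..} \<times> UNIV) (\<lambda>z. \<Phi> (fst z) (snd z))"
    unfolding continuous_on_iff
  proof (intro ballI allI impI)
    fix z :: "real \<times> 'a" and e :: real assume z: "z \<in> {0..} \<times> UNIV" and e: "e > 0"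
    obtain t x where tx: "z = (t, x)" by (cases z)
    have t: "t \<ge> 0" using z tx by simp
    obtain T N :: nat where T: "t + 1 \<le> real T" and N: "norm x + 1 \<le> real N" using real_arch_simple by blast
    obtain K where K: "\<And>k t x. k \<ge> K \<Longrightarrow> t \<in> {0..real T} \<Longrightarrow> x \<in> cball 0 (real N) \<Longrightarrow> norm (f t (dyadic_floor k x) - \<Phi> t x) \<le> 4 * (3/4)^k"
      "\<And>k t x z. k \<ge> K \<Longrightarrow> t \<in> {0..real T} \<Longrightarrow> x \<in> cball 0 (real N) \<Longrightarrow> z \<in> cball 0 (real N) \<Longrightarrow> norm (x - z) \<le> 1 / 2^k \<Longrightarrow>
        norm (f t (dyadic_floor k x) - f t (dyadic_floor k z)) \<le> (3/4)^k"
      using key[of T N] by blast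
    \<comment> \<open>Here 9 = 4 + 1 + 4: the limits at both points are replaced by values at level
      k, and these are compared across one pair of neighbours. The other half of e is kept for the
      change of time.\<close>
    have L: "(\<lambda>k. 9 * (3/4::real)^k) \<longlonglongrightarrow> 0" by (intro tendsto_mult_right_zero LIMSEQ_power_zero) auto
    then have "eventually (\<lambda>k. 9 * (3/4::real)^k < e / 2) sequentially" using order_tendstoD(2)[OF L, of "e / 2"] e by simp
    then obtain k where k: "k \<ge> K" "9 * (3/4::real)^k < e / 2"
      using eventually_happens[OF eventually_conj[OF eventually_ge_at_top[of K]]] by (auto simp: conj_commute)
    have xN: "norm x \<le> real N" using N by simp
    have "continuous_on {0..} (\<lambda>t. f t (dyadic_floor k x))" by (rule cont[OF dyadic_floor_in_grid(1)[OF xN]])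
    then obtain d where d: "d > 0" "\<And>s. s \<ge> 0 \<Longrightarrow> dist s t < d \<Longrightarrow> dist (f s (dyadic_floor k x)) (f t (dyadic_floor k x)) < e / 2"
      using t e unfolding continuous_on_iff by (metis atLeast_iff half_gt_zero)
    show "\<exists>d>0. \<forall>z'\<in>{0..} \<times> UNIV. dist z' z < d \<longrightarrow> dist (\<Phi> (fst z') (snd z')) (\<Phi> (fst z) (snd z)) < e"
    proof (intro exI[of _ "min d (min 1 (1 / 2^k))"] conjI ballI impI)
      show "0 < min d (min 1 (1 / 2^k))" using d by simp
      fix z' :: "real \<times> 'a" assume z': "z' \<in> {0..} \<times> UNIV" "dist z' z < min d (min 1 (1 / 2^k))"
      obtain s y where sy: "z' = (s, y)" by (cases z')
      have s: "s \<ge> 0" using z' sy by simp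
      have ds: "dist s t < min d (min 1 (1 / 2^k))" "dist y x < min d (min 1 (1 / 2^k))"
        using dist_fst_le[of z' z] dist_snd_le[of z' z] z'(2) unfolding tx sy by auto
      have ds1: "dist s t < 1" "dist y x < 1" "dist y x < 1 / 2^k" "dist s t < d" using ds unfolding min_less_iff_conj by blast+
      have sT: "s \<in> {0..real T}" "t \<in> {0..real T}" using s t ds1(1) T by (auto simp: dist_real_def)
      have "norm y \<le> norm x + dist y x" by (simp add: dist_norm norm_triangle_sub)
      then have yN: "y \<in> cball 0 (real N)" "x \<in> cball 0 (real N)" using ds1(2) N xN by auto
      have "norm (x - y) \<le> 1 / 2^k" using ds1(3) by (simp add: dist_norm norm_minus_commute)
      then have 1: "norm (f s (dyadic_floor k x) - f s (dyadic_floor k y)) \<le> (3/4)^k" using sT yN k by (intro K(2))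
      have 2: "norm (f s (dyadic_floor k y) - \<Phi> s y) \<le> 4 * (3/4)^k" "norm (f t (dyadic_floor k x) - \<Phi> t x) \<le> 4 * (3/4)^k"
        using sT yN k by (auto intro: K(1))
      have 3: "norm (f s (dyadic_floor k x) - f t (dyadic_floor k x)) < e / 2" using d(2)[OF s ds1(4)] by (simp add: dist_norm)
      have "\<Phi> s y - \<Phi> t x = - (f s (dyadic_floor k y) - \<Phi> s y) - (f s (dyadic_floor k x) - f s (dyadic_floor k y))
         + (f s (dyadic_floor k x) - f t (dyadic_floor k x)) + (f t (dyadic_floor k x) - \<Phi> t x)" by simp
      also have "norm \<dots> \<le> norm (f s (dyadic_floor k y) - \<Phi> s y) + norm (f s (dyadic_floor k x) - f s (dyadic_floor k y))
         + norm (f s (dyadic_floor k x) - f t (dyadic_floor k x)) + norm (f t (dyadic_floor k x) - \<Phi> t x)"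
        by (intro order_trans[OF norm_triangle_ineq add_mono] order_trans[OF norm_triangle_ineq4 add_mono] order_refl)
           (simp add: norm_minus_commute)
      finally show "dist (\<Phi> (fst z') (snd z')) (\<Phi> (fst z) (snd z)) < e"
        using 1 2 3 k(2) by (simp add: tx sy dist_norm)
    qed
  qed
  then show "continuous_on ({0..} \<times> UNIV) (\<lambda>(t, x). lim (\<lambda>k. f t (dyadic_floor k x)))"
    by (simp add: case_prod_beta \<Phi>_def)
qed

lemma (in prob_space) outer_prob_le_impossible:
  assumes "\<And>\<omega>. \<not> P \<omega>" "0 \<le> d"
  shows "outer_prob_le M P d"
  using assms by (intro outer_prob_leI) simp_all

section \<open>Chaining for the solution map\<close>

context sde_setting
begin

text \<open>The growth factor 3/2 is a compromise: neighbours at distance of order 2^-k are allowed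
  to move apart by (3/4)^k, which is still summable, while the excess factor of order (3/2)^k in the
  two-point tail makes a violation rare.\<close>

lemma dyadic_neighbours:
  fixes N T :: nat
  assumes sol: "\<And>x. sde_solution M \<F> B X A x (\<lambda>t. F t x) (\<xi> x)"
  shows "AE \<omega> in M. eventually (\<lambda>k. \<not> (\<exists>p\<in>dyadic_grid N k \<times> dyadic_grid N k. norm (fst p - snd p) \<le> real DIM('n) / 2^k \<and>
     (\<exists>t\<in>{0..real T}. ereal t < \<xi> (fst p) \<omega> \<and> ereal t < \<xi> (snd p) \<omega> \<and> norm (F t (fst p) \<omega> - F t (snd p) \<omega>) > (3/4)^k))) sequentially"
proof -
  define D where "D = DIM('n)"
  have D: "D \<ge> 1" by (simp add: D_def Suc_leI)
  define R where "R = real (D * N)"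
  obtain C where C: "C \<ge> 0" "\<And>x0 y0 x y \<xi> \<xi>' u. sde_solution M \<F> B X A x0 x \<xi> \<Longrightarrow> sde_solution M \<F> B X A y0 y \<xi>' \<Longrightarrow>
     norm x0 \<le> R \<Longrightarrow> norm y0 \<le> R \<Longrightarrow> x0 \<noteq> y0 \<Longrightarrow> u \<ge> 1 \<Longrightarrow>
     outer_prob_le M (\<lambda>\<omega>. \<exists>t\<in>{0..real T}. ereal t < \<xi> \<omega> \<and> ereal t < \<xi>' \<omega> \<and> norm (x t \<omega> - y t \<omega>) > u * norm (x0 - y0)) (C / u^(4 * D))"
    using flow_tail[of "4 * D" R T] D by (auto simp: R_def)
  \<comment> \<open>With exponent \<open>4 D\<close> the tail decays like \<open>(16/81)^(D k)\<close>, which beats the \<open>4^(D k)\<close> pairs of grid points.\<close>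
  define e where "e k = (C + 1) * (real D / (3/2)^k)^(4 * D)" for k :: nat
  define Q where "Q k p \<omega> \<longleftrightarrow> norm (fst p - snd p) \<le> real D / 2^k \<and>
     (\<exists>t\<in>{0..real T}. ereal t < \<xi> (fst p) \<omega> \<and> ereal t < \<xi> (snd p) \<omega> \<and> norm (F t (fst p) \<omega> - F t (snd p) \<omega>) > (3/4)^k)" for k p \<omega>
  have e0: "e k \<ge> 0" for k using C by (simp add: e_def)
  have pair: "outer_prob_le M (Q k p) (e k)" if p: "p \<in> dyadic_grid N k \<times> dyadic_grid N k" for k p
  \<comment> \<open>At low levels the multiple u could drop below 1, where the two-point tail does
    not apply. There \<open>e k\<close> is at least 1, so the claim is trivial; this is why
    \<open>e k\<close> contains C + 1.\<close>
  proof (cases "(3/2::real)^k \<le> D \<or> fst p = snd p \<or> norm (fst p - snd p) > real D / 2^k")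
    case True
    then consider "(3/2::real)^k \<le> D" | "fst p = snd p \<or> norm (fst p - snd p) > real D / 2^k" by blast
    then show ?thesis
    proof cases
      case 1
      then have "1 \<le> real D / (3/2)^k" by simp
      then have "1 \<le> (real D / (3/2)^k)^(4 * D)" by (rule one_le_power)
      then have "1 * 1 \<le> e k" unfolding e_def using C by (intro mult_mono) auto
      then show ?thesis by (intro outer_prob_le_one) simp
    next
      case 2
      then have "\<not> Q k p \<omega>" for \<omega> by (auto simp: Q_def not_less)
      then show ?thesis using e0[of k] by (intro outer_prob_le_impossible)
    qed
  next
    case False
    define \<delta> where "\<delta> = norm (fst p - snd p)"
    have \<delta>: "\<delta> > 0" "\<delta> \<le> real D / 2^k" "(3/2::real)^k > D" using False by (auto simp: \<delta>_def)
    \<comment> \<open>Expresses the allowed oscillation (3/4)^k as a multiple of the largest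
      distance D / 2^k of neighbours.\<close>
    define u where "u = (3/2)^k / real D"
    have u: "u \<ge> 1" using \<delta>(3) D by (simp add: u_def)
    have "u * \<delta> \<le> (3/2)^k / real D * (real D / 2^k)" unfolding u_def using \<delta>(2) by (intro mult_left_mono) auto
    also have "\<dots> = (3/4)^k" using D by (simp add: power_divide field_simps flip: power_mult_distrib)
    finally have ud: "u * \<delta> \<le> (3/4)^k" .
    have gr: "norm (fst p) \<le> R" "norm (snd p) \<le> R" using p norm_dyadic_grid unfolding R_def D_def by (auto simp: mem_Times_iff)
    have "outer_prob_le M (\<lambda>\<omega>. \<exists>t\<in>{0..real T}. ereal t < \<xi> (fst p) \<omega> \<and> ereal t < \<xi> (snd p) \<omega> \<and>
        norm (F t (fst p) \<omega> - F t (snd p) \<omega>) > u * norm (fst p - snd p)) (C / u^(4 * D))"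
      by (rule C(2)[OF sol sol gr _ u]) (use False in auto)
    then show ?thesis
    proof (rule outer_prob_le_mono)
      show "\<exists>t\<in>{0..real T}. ereal t < \<xi> (fst p) \<omega> \<and> ereal t < \<xi> (snd p) \<omega> \<and>
        norm (F t (fst p) \<omega> - F t (snd p) \<omega>) > u * norm (fst p - snd p)" if "Q k p \<omega>" for \<omega>
        using that ud unfolding Q_def \<delta>_def by (auto intro: order_le_less_trans)
      have "C / u^(4 * D) = C * (real D / (3/2)^k)^(4 * D)" by (simp add: u_def power_divide mult.commute)
      also have "\<dots> \<le> e k" unfolding e_def by (intro mult_right_mono) auto
      finally show "C / u^(4 * D) \<le> e k" .
    qed
  qed
  define d where "d k = real (card (dyadic_grid N k \<times> dyadic_grid N k :: ('n \<times> 'n) set)) * e k" for k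
  have "outer_prob_le M (\<lambda>\<omega>. \<exists>p\<in>dyadic_grid N k \<times> dyadic_grid N k. Q k p \<omega>) (d k)" for k
  proof -
    have "outer_prob_le M (\<lambda>\<omega>. \<exists>p\<in>dyadic_grid N k \<times> dyadic_grid N k. Q k p \<omega>) (\<Sum>p\<in>(dyadic_grid N k \<times> dyadic_grid N k :: ('n \<times> 'n) set). e k)"
      by (rule outer_prob_le_finite_ex[where P = "Q k" and d = "\<lambda>_. e k"]) (auto intro: finite_dyadic_grid pair)
    then show ?thesis by (simp add: d_def)
  qed
  moreover have "summable d"
  proof (rule summable_comparison_test')
    define a where "a = (real (2 * N + 1))^(2 * D) * ((C + 1) * real D^(4 * D))"
    show "summable (\<lambda>k. a * ((64/81)^D)^k)"
    proof (intro summable_mult summable_geometric)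
      have "(64/81::real)^D < 1" using power_strict_decreasing[of 0 D "64/81::real"] D by simp
      then show "norm ((64/81::real)^D) < 1" by simp
    qed
    show "norm (d k) \<le> a * ((64/81)^D)^k" for k
    proof -
      have "2 * N * 2^k + 1 \<le> (2 * N + 1) * 2^k" by simp
      then have "card (dyadic_grid N k :: 'n set) \<le> ((2 * N + 1) * 2^k)^D"
        using card_dyadic_grid[where 'a = 'n, of N k] power_mono[of "2 * N * 2^k + 1" "(2 * N + 1) * 2^k" D] unfolding D_def by linarith
      then have "card (dyadic_grid N k \<times> dyadic_grid N k :: ('n \<times> 'n) set) \<le> ((2 * N + 1) * 2^k)^D * ((2 * N + 1) * 2^k)^D"
        unfolding card_cartesian_product by (intro mult_mono) auto
      also have "\<dots> = ((2 * N + 1) * 2^k)^(2 * D)" by (simp add: mult_2 power_add)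
      finally have "real (card (dyadic_grid N k \<times> dyadic_grid N k :: ('n \<times> 'n) set)) \<le> real (((2 * N + 1) * 2^k)^(2 * D))" by (rule of_nat_mono)
      then have "d k \<le> real (((2 * N + 1) * 2^k)^(2 * D)) * e k" unfolding d_def by (intro mult_right_mono e0)
      also have "\<dots> = a * ((2^k)^(2 * D) / ((3/2)^k)^(4 * D))"
      proof -
        have "real (((2 * N + 1) * 2^k)^(2 * D)) = (real (2 * N + 1))^(2 * D) * (2^k)^(2 * D)"
          by (simp only: of_nat_mult of_nat_power power_mult_distrib of_nat_numeral)
        then show ?thesis by (simp only: a_def e_def power_divide) simp
      qed
      also have "(2^k)^(2 * D) / ((3/2)^k)^(4 * D) = ((2^2)^(D * k) / ((3/2)^4)^(D * k) :: real)"
        by (simp only: power_mult[symmetric] mult_ac)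
      also have "\<dots> = (64/81)^(D * k)" by (subst power_divide[symmetric]) (simp add: power_divide)
      finally show ?thesis using e0[of k] by (simp add: d_def power_mult)
    qed
  qed
  ultimately have "AE \<omega> in M. eventually (\<lambda>k. \<not> (\<exists>p\<in>dyadic_grid N k \<times> dyadic_grid N k. Q k p \<omega>)) sequentially"
    by (rule outer_prob_le_Borel_Cantelli)
  then show ?thesis unfolding Q_def D_def .
qed

text \<open>All grid points together are countable, so the exceptional sets attached to single
  initial points can be united into one null set.\<close>

lemma dyadic_flow:
  assumes sol: "\<And>x. sde_solution M \<F> B X A x (\<lambda>t. F t x) (\<xi> x)" and inf: "\<And>x. AE \<omega> in M. \<xi> x \<omega> = \<infinity>"
  shows "AE \<omega> in M. continuous_on ({0..} \<times> UNIV) (\<lambda>(t, x). lim (\<lambda>k. F t (dyadic_floor k x) \<omega>)) \<and>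
     (\<forall>t\<ge>0. \<forall>x. (\<lambda>k. F t (dyadic_floor k x) \<omega>) \<longlonglongrightarrow> lim (\<lambda>k. F t (dyadic_floor k x) \<omega>)) \<and>
     (\<forall>N k. \<forall>u\<in>dyadic_grid N k. \<xi> u \<omega> = \<infinity>)"
proof -
  have "AE \<omega> in M. \<forall>N k. \<forall>u\<in>dyadic_grid N k. \<xi> u \<omega> = \<infinity> \<and> continuous_on {0..} (\<lambda>t. F t u \<omega>)"
    unfolding AE_all_countable
  proof (intro allI AE_finite_allI finite_dyadic_grid)
    fix u :: 'n
    have "AE \<omega> in M. continuous_on {t. 0 \<le> t \<and> ereal t < \<xi> u \<omega>} (\<lambda>t. F t u \<omega>)"
      using sol[of u] unfolding sde_solution_def by auto
    then show "AE \<omega> in M. \<xi> u \<omega> = \<infinity> \<and> continuous_on {0..} (\<lambda>t. F t u \<omega>)"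
      using inf[of u]
    proof eventually_elim
      case (elim \<omega>)
      moreover have "{t. 0 \<le> t \<and> ereal t < \<infinity>} = {0..}" by auto
      ultimately show ?case by simp
    qed
  qed
  moreover have "AE \<omega> in M. \<forall>N T :: nat. eventually (\<lambda>k. \<not> (\<exists>p\<in>dyadic_grid N k \<times> dyadic_grid N k. norm (fst p - snd p) \<le> real DIM('n) / 2^k \<and>
     (\<exists>t\<in>{0..real T}. ereal t < \<xi> (fst p) \<omega> \<and> ereal t < \<xi> (snd p) \<omega> \<and> norm (F t (fst p) \<omega> - F t (snd p) \<omega>) > (3/4)^k))) sequentially"
    unfolding AE_all_countable by (intro allI dyadic_neighbours sol)
  ultimately show ?thesis
  proof eventually_elim
    case (elim \<omega>)
    have adj: "eventually (\<lambda>k. \<forall>u\<in>dyadic_grid N k. \<forall>v\<in>dyadic_grid N k. norm (u - v) \<le> real DIM('n) / 2^k \<longrightarrow>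
      (\<forall>t\<in>{0..real T}. norm (F t u \<omega> - F t v \<omega>) \<le> (3/4)^k)) sequentially" for N T :: nat
      using elim(2)[rule_format, of N T]
    proof eventually_elim
      case (elim k)
      show ?case
      proof (intro ballI impI)
        fix u v :: 'n and t assume *: "u \<in> dyadic_grid N k" "v \<in> dyadic_grid N k" "norm (u - v) \<le> real DIM('n) / 2^k" "t \<in> {0..real T}"
        have "\<xi> u \<omega> = \<infinity>" "\<xi> v \<omega> = \<infinity>" using * \<open>\<forall>N k. \<forall>u\<in>dyadic_grid N k. \<xi> u \<omega> = \<infinity> \<and> continuous_on {0..} (\<lambda>t. F t u \<omega>)\<close> by blast+
        then have "\<not> norm (F t u \<omega> - F t v \<omega>) > (3/4)^k" using elim * by fastforce
        then show "norm (F t u \<omega> - F t v \<omega>) \<le> (3/4)^k" by simp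
      qed
    qed
    have cont: "continuous_on {0..} (\<lambda>t. F t u \<omega>)" if "u \<in> dyadic_grid N k" for N k u using elim(1) that by blast
    show ?case
    proof (intro conjI allI impI ballI)
      show "continuous_on ({0..} \<times> UNIV) (\<lambda>(t, x). lim (\<lambda>k. F t (dyadic_floor k x) \<omega>))" by (rule dyadic_chaining(1)[where f = "\<lambda>t x. F t x \<omega>", OF adj]) (rule cont)
      show "(\<lambda>k. F t (dyadic_floor k x) \<omega>) \<longlonglongrightarrow> lim (\<lambda>k. F t (dyadic_floor k x) \<omega>)" if "0 \<le> t" for t x by (rule dyadic_chaining(2)[where f = "\<lambda>t x. F t x \<omega>", OF adj]) (use that in \<open>auto intro: cont\<close>)
      show "\<xi> u \<omega> = \<infinity>" if "u \<in> dyadic_grid N k" for N k u using elim(1) that by blast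
    qed
  qed
qed

text \<open>Identifies the chained limit at a fixed x with the solution started there. Each level
  contributes a single pair, so tail exponent 1 is enough: (3/2)^-k is summable for Borel-Cantelli,
  and (3/2)^k times the distance of order 2^-k tends to 0.\<close>

lemma dyadic_flow_modification:
  assumes sol: "\<And>x. sde_solution M \<F> B X A x (\<lambda>t. F t x) (\<lambda>_. \<infinity>)"
  shows "AE \<omega> in M. \<forall>t\<ge>0. (\<lambda>k. F t (dyadic_floor k x) \<omega>) \<longlonglongrightarrow> F t x \<omega>"
proof -
  have "AE \<omega> in M. eventually (\<lambda>k. \<not> (\<exists>t\<in>{0..real T}. norm (F t x \<omega> - F t (dyadic_floor k x) \<omega>) > (3/2)^k * norm (x - dyadic_floor k x))) sequentially" for T :: nat
  proof -
    define R where "R = norm x + real DIM('n)"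
    obtain C where C: "C \<ge> 0" "\<And>x0 y0 x y \<xi> \<xi>' u. sde_solution M \<F> B X A x0 x \<xi> \<Longrightarrow> sde_solution M \<F> B X A y0 y \<xi>' \<Longrightarrow>
       norm x0 \<le> R \<Longrightarrow> norm y0 \<le> R \<Longrightarrow> x0 \<noteq> y0 \<Longrightarrow> u \<ge> 1 \<Longrightarrow>
       outer_prob_le M (\<lambda>\<omega>. \<exists>t\<in>{0..real T}. ereal t < \<xi> \<omega> \<and> ereal t < \<xi>' \<omega> \<and> norm (x t \<omega> - y t \<omega>) > u * norm (x0 - y0)) (C / u^1)"
      using flow_tail[of 1 R T] by (auto simp: R_def)
    show ?thesis
    proof (rule outer_prob_le_Borel_Cantelli)
      show "summable (\<lambda>k. C * (2/3)^k)" by (intro summable_mult summable_geometric) auto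
      fix k :: nat
      show "outer_prob_le M (\<lambda>\<omega>. \<exists>t\<in>{0..real T}. norm (F t x \<omega> - F t (dyadic_floor k x) \<omega>) > (3/2)^k * norm (x - dyadic_floor k x)) (C * (2/3)^k)"
      proof (cases "x = dyadic_floor k x")
        case True
        then have "norm (F t x \<omega> - F t (dyadic_floor k x) \<omega>) = 0" for t \<omega> by simp
        then show ?thesis using C by (intro outer_prob_le_impossible) (auto simp: not_less)
      next
        case False
        have "norm (dyadic_floor k x) \<le> norm x + norm (x - dyadic_floor k x)" using norm_triangle_ineq4[of x "x - dyadic_floor k x"] by simp
        also have "norm (x - dyadic_floor k x) \<le> real DIM('n) / 1"
          by (rule order_trans[OF norm_dyadic_floor_diff]) (intro divide_left_mono, auto)
        finally have r: "norm (dyadic_floor k x) \<le> R" "norm x \<le> R" by (auto simp: R_def)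
        have "outer_prob_le M (\<lambda>\<omega>. \<exists>t\<in>{0..real T}. ereal t < \<infinity> \<and> ereal t < \<infinity> \<and>
            norm (F t x \<omega> - F t (dyadic_floor k x) \<omega>) > (3/2)^k * norm (x - dyadic_floor k x)) (C / ((3/2)^k)^1)"
          by (rule C(2)[OF sol sol r(2,1) False]) (simp add: one_le_power)
        then show ?thesis by (simp add: power_divide)
      qed
    qed
  qed
  then have "AE \<omega> in M. \<forall>T::nat. eventually (\<lambda>k. \<not> (\<exists>t\<in>{0..real T}. norm (F t x \<omega> - F t (dyadic_floor k x) \<omega>) > (3/2)^k * norm (x - dyadic_floor k x))) sequentially"
    unfolding AE_all_countable by blast
  then show ?thesis
  proof eventually_elim
    case (elim \<omega>)
    show ?case
    proof (intro allI impI)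
      fix t :: real assume t: "t \<ge> 0"
      obtain T :: nat where T: "t \<le> real T" using real_arch_simple by blast
      have "(\<lambda>k. F t (dyadic_floor k x) \<omega> - F t x \<omega>) \<longlonglongrightarrow> 0"
      proof (rule Lim_null_comparison)
        show "eventually (\<lambda>k. norm (F t (dyadic_floor k x) \<omega> - F t x \<omega>) \<le> real DIM('n) * (3/4)^k) sequentially"
          using elim[rule_format, of T]
        proof eventually_elim
          case (elim k)
          then have "norm (F t x \<omega> - F t (dyadic_floor k x) \<omega>) \<le> (3/2)^k * norm (x - dyadic_floor k x)" using t T by (auto simp: not_less)
          also have "\<dots> \<le> (3/2)^k * (real DIM('n) / 2^k)" by (intro mult_left_mono norm_dyadic_floor_diff) auto
          also have "\<dots> = real DIM('n) * (3/4)^k" by (simp add: power_divide field_simps flip: power_mult_distrib)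
          finally show ?case by (simp add: norm_minus_commute)
        qed
        show "(\<lambda>k. real DIM('n) * (3/4)^k) \<longlonglongrightarrow> 0" by (intro tendsto_mult_right_zero LIMSEQ_power_zero) auto
      qed
      then show "(\<lambda>k. F t (dyadic_floor k x) \<omega>) \<longlonglongrightarrow> F t x \<omega>" by (simp add: LIM_zero_iff)
    qed
  qed
qed

text \<open>For each x the modified process is again an almost sure limit of the same Euler
  polygons. It is therefore recognised as a solution by the argument that served for the unmodified
  one.\<close>

lemma sde_strongly_complete: "strongly_complete M \<F> B X A"
proof -
  have "\<forall>x0. \<exists>z :: (nat \<Rightarrow> nat) \<times> (real \<Rightarrow> 'w \<Rightarrow> 'n). (\<forall>k. fst z k \<ge> k) \<and> (\<forall>t\<ge>0. snd z t \<in> borel_measurable (\<F> t)) \<and>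
      (\<forall>\<omega>. continuous_on {0..} (\<lambda>t. snd z t \<omega>)) \<and>
      (AE \<omega> in M. \<forall>T::nat. uniform_limit {0..real T} (\<lambda>k t. euler_path (fst z k) x0 t \<omega>) (\<lambda>t. snd z t \<omega>) sequentially)"
  proof
    fix x0
    show "\<exists>z :: (nat \<Rightarrow> nat) \<times> (real \<Rightarrow> 'w \<Rightarrow> 'n). (\<forall>k. fst z k \<ge> k) \<and> (\<forall>t\<ge>0. snd z t \<in> borel_measurable (\<F> t)) \<and>
      (\<forall>\<omega>. continuous_on {0..} (\<lambda>t. snd z t \<omega>)) \<and>
      (AE \<omega> in M. \<forall>T::nat. uniform_limit {0..real T} (\<lambda>k t. euler_path (fst z k) x0 t \<omega>) (\<lambda>t. snd z t \<omega>) sequentially)"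
      using euler_limit[of x0]
    proof (elim exE)
      fix r y
      assume "(\<forall>k. r k \<ge> k) \<and> (\<forall>t\<ge>0. y t \<in> borel_measurable (\<F> t)) \<and> (\<forall>\<omega>. continuous_on {0..} (\<lambda>t. y t \<omega>)) \<and>
        (AE \<omega> in M. \<forall>T::nat. uniform_limit {0..real T} (\<lambda>k t. euler_path (r k) x0 t \<omega>) (\<lambda>t. y t \<omega>) sequentially)"
      then show ?thesis by (intro exI[of _ "(r, y)"]) (unfold fst_conv snd_conv)
    qed
  qed
  from choice[OF this] obtain Z :: "'n \<Rightarrow> (nat \<Rightarrow> nat) \<times> (real \<Rightarrow> 'w \<Rightarrow> 'n)" where
    Z: "\<forall>x0. (\<forall>k. fst (Z x0) k \<ge> k) \<and> (\<forall>t\<ge>0. snd (Z x0) t \<in> borel_measurable (\<F> t)) \<and>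
      (\<forall>\<omega>. continuous_on {0..} (\<lambda>t. snd (Z x0) t \<omega>)) \<and>
      (AE \<omega> in M. \<forall>T::nat. uniform_limit {0..real T} (\<lambda>k t. euler_path (fst (Z x0) k) x0 t \<omega>) (\<lambda>t. snd (Z x0) t \<omega>) sequentially)"
    by (elim exE) (rule that)
  define r where "r x = fst (Z x)" for x
  define y where "y t x = snd (Z x) t" for t x
  have r: "r x k \<ge> k" and ym: "t \<ge> 0 \<Longrightarrow> y t x \<in> borel_measurable (\<F> t)" and yc: "continuous_on {0..} (\<lambda>t. y t x \<omega>)"
    and ul: "AE \<omega> in M. \<forall>T::nat. uniform_limit {0..real T} (\<lambda>k t. euler_path (r x k) x t \<omega>) (\<lambda>t. y t x \<omega>) sequentially" for x k t \<omega>
    using Z[rule_format, of x] unfolding r_def y_def by (elim conjE, blast)+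
  have sol: "sde_solution M \<F> B X A x (\<lambda>t. y t x) (\<lambda>_. \<infinity>)" for x
    by (rule euler_limit_sde_solution[of "r x"]) (use r ym yc ul in auto)
  define G where "G \<omega> \<longleftrightarrow> continuous_on ({0..} \<times> UNIV) (\<lambda>(t, x). lim (\<lambda>k. y t (dyadic_floor k x) \<omega>))" for \<omega>
  \<comment> \<open>The default makes the map continuous for every \<open>\<omega>\<close>, so each
    path meets the pathwise continuity hypothesis of
    \<open>euler_limit_sde_solution\<close>.\<close>
  define \<Phi> where "\<Phi> t x \<omega> = (if G \<omega> then lim (\<lambda>k. y t (dyadic_floor k x) \<omega>) else 0)" for t x \<omega>
  have \<Phi>G: "continuous_on ({0..} \<times> UNIV) (\<lambda>(t, x). \<Phi> t x \<omega>)" for \<omega>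
  proof (cases "G \<omega>")
    case True
    then show ?thesis unfolding \<Phi>_def G_def by simp
  next
    case False
    then show ?thesis by (simp add: \<Phi>_def case_prod_beta)
  qed
  have \<Phi>c: "continuous_on {0..} (\<lambda>t. \<Phi> t x \<omega>)" for x \<omega>
  proof -
    have "continuous_on {0..} (\<lambda>t. case (t, x) of (t, x) \<Rightarrow> \<Phi> t x \<omega>)"
      by (rule continuous_on_compose2[OF \<Phi>G]) (auto intro: continuous_intros)
    then show ?thesis by simp
  qed
  have AEG: "AE \<omega> in M. G \<omega>"
    using dyadic_flow[OF sol] unfolding G_def by (rule AE_mp) (auto intro: AE_I2)
  have eq: "AE \<omega> in M. \<forall>t\<ge>0. \<Phi> t x \<omega> = y t x \<omega>" for x
    using AEG dyadic_flow_modification[OF sol, of x]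
  proof eventually_elim
    case (elim \<omega>)
    then show ?case by (auto simp: \<Phi>_def intro: limI)
  qed
  have "sde_solution M \<F> B X A x (\<lambda>t. \<Phi> t x) (\<lambda>_. \<infinity>)" for x
  proof (rule euler_limit_sde_solution[of "r x"])
    show "\<Phi> t x \<in> borel_measurable (\<F> t)" if t: "t \<ge> 0" for t
    proof (rule measurable_F_AE_eq[OF ym[OF t] t])
      show "AE \<omega> in M. \<Phi> t x \<omega> = y t x \<omega>" using eq[of x] by eventually_elim (use t in blast)
    qed
    show "AE \<omega> in M. \<forall>T::nat. uniform_limit {0..real T} (\<lambda>k t. euler_path (r x k) x t \<omega>) (\<lambda>t. \<Phi> t x \<omega>) sequentially"
      using ul[of x] eq[of x]
    proof eventually_elim
      case (elim \<omega>)
      show ?case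
      proof
        fix T :: nat
        show "uniform_limit {0..real T} (\<lambda>k t. euler_path (r x k) x t \<omega>) (\<lambda>t. \<Phi> t x \<omega>) sequentially"
          using elim(1)[rule_format, of T] by (rule uniform_limit_cong'[THEN iffD1, rotated -1]) (use elim(2) in auto)
      qed
    qed
  qed (auto intro: r \<Phi>c)
  then show ?thesis unfolding strongly_complete_def using \<Phi>G by (intro exI[of _ \<Phi>]) auto
qed

section \<open>Partial flows and their derivatives\<close>

text \<open>Non-explosion is known almost surely for each x, but the null set depends on x. Off one
  null set it holds at all grid points and explosion means unboundedness at all x at once.
  Approximating x by grid points and using continuity of F on its domain identifies the trajectory
  of x with a continuous, hence bounded, path.\<close>

lemma partial_flow_global:
  assumes flow: "partial_flow M \<F> B X A F \<xi>"
  shows "AE \<omega> in M. \<forall>x. \<xi> x \<omega> = \<infinity>"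
proof -
  have max: "maximal_solution M \<F> B X A x (\<lambda>t. F t x) (\<xi> x)" for x using flow unfolding partial_flow_def by blast
  have sol: "sde_solution M \<F> B X A x (\<lambda>t. F t x) (\<xi> x)" for x using max[of x] unfolding maximal_solution_def by blast
  have "AE \<omega> in M. (\<forall>x. \<xi> x \<omega> < \<infinity> \<longrightarrow> \<not> bounded ((\<lambda>t. F t x \<omega>) ` {t. 0 \<le> t \<and> ereal t < \<xi> x \<omega>})) \<and>
      continuous_on {(t, x). 0 \<le> t \<and> ereal t < \<xi> x \<omega>} (\<lambda>(t, x). F t x \<omega>)"
    using flow unfolding partial_flow_def by (elim conjE) (erule AE_mp, rule AE_I2, blast)
  then show ?thesis
    using dyadic_flow[OF sol maximal_solution_global[OF max]]
  proof eventually_elim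
    case (elim \<omega>)
    define S where "S = {(t, x). 0 \<le> t \<and> ereal t < \<xi> x \<omega>}"
    define \<Phi> where "\<Phi> t x = lim (\<lambda>k. F t (dyadic_floor k x) \<omega>)" for t x
    have cont: "continuous_on S (\<lambda>(t, x). F t x \<omega>)" using elim(1) by (simp add: S_def)
    have \<Phi>: "continuous_on ({0..} \<times> UNIV) (\<lambda>(t, x). \<Phi> t x)" using elim(2) by (simp add: \<Phi>_def)
    show ?case
    proof (rule allI, rule ccontr)
      fix x assume ne: "\<xi> x \<omega> \<noteq> \<infinity>"
      then obtain T :: nat where T: "\<xi> x \<omega> < ereal (real T)" using less_PInf_Ex_of_nat by auto
      obtain N :: nat where N: "norm x \<le> real N" using real_arch_simple by blast
      have "F t x \<omega> = \<Phi> t x" if t: "0 \<le> t" "ereal t < \<xi> x \<omega>" for t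
      proof -
        have "(\<lambda>k. real DIM('n) * (1/2)^k) \<longlonglongrightarrow> 0" by (intro tendsto_mult_right_zero LIMSEQ_power_zero) auto
        then have "(\<lambda>k. dyadic_floor k x - x) \<longlonglongrightarrow> 0"
          by (rule Lim_null_comparison[rotated])
             (use norm_dyadic_floor_diff[of x] in \<open>auto simp: norm_minus_commute power_divide\<close>)
        then have "(\<lambda>k. (t, dyadic_floor k x)) \<longlonglongrightarrow> (t, x)" by (intro tendsto_intros) (simp add: LIM_zero_iff)
        moreover have "\<xi> (dyadic_floor k x) \<omega> = \<infinity>" for k using elim(2) dyadic_floor_in_grid(1)[OF N, of k] by blast
        then have "eventually (\<lambda>k. (t, dyadic_floor k x) \<in> S) sequentially" using t by (simp add: S_def)
        ultimately have "(\<lambda>k. case (t, dyadic_floor k x) of (t, x) \<Rightarrow> F t x \<omega>) \<longlonglongrightarrow> (case (t, x) of (t, x) \<Rightarrow> F t x \<omega>)"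
          using t by (intro continuous_on_tendsto_compose[OF cont]) (auto simp: S_def)
        then have "(\<lambda>k. F t (dyadic_floor k x) \<omega>) \<longlonglongrightarrow> F t x \<omega>" by simp
        then show ?thesis unfolding \<Phi>_def by (rule limI[symmetric])
      qed
      moreover have "t \<in> {0..real T}" if "0 \<le> t" "ereal t < \<xi> x \<omega>" for t
        using that less_trans[OF that(2) T] by simp
      ultimately have sub: "(\<lambda>t. F t x \<omega>) ` {t. 0 \<le> t \<and> ereal t < \<xi> x \<omega>} \<subseteq> (\<lambda>t. \<Phi> t x) ` {0..real T}" by auto
      have "continuous_on {0..real T} (\<lambda>t. case (t, x) of (t, x) \<Rightarrow> \<Phi> t x)"
        by (rule continuous_on_compose2[OF \<Phi>]) (auto intro: continuous_intros)
      then have "compact ((\<lambda>t. \<Phi> t x) ` {0..real T})" by (intro compact_continuous_image) auto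
      then have "bounded ((\<lambda>t. F t x \<omega>) ` {t. 0 \<le> t \<and> ereal t < \<xi> x \<omega>})" using sub by (meson bounded_subset compact_imp_bounded)
      then show False using elim(1) ne by simp
    qed
  qed
qed

lemma partial_flow_derivative:
  assumes flow: "partial_flow M \<F> B X A F \<xi>"
  shows "AE \<omega> in M. \<forall>s\<ge>0. \<forall>x. ((\<lambda>y. F s y \<omega>) has_derivative frechet_derivative (\<lambda>y. F s y \<omega>) (at x)) (at x)"
proof -
  have "AE \<omega> in M. \<exists>DF :: real \<Rightarrow> 'n \<Rightarrow> 'n \<Rightarrow>\<^sub>L 'n. \<forall>t x. 0 \<le> t \<longrightarrow> ereal t < \<xi> x \<omega> \<longrightarrow>
              ((\<lambda>y. F t y \<omega>) has_derivative blinfun_apply (DF t x)) (at x)"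
    using flow unfolding partial_flow_def by (elim conjE) (erule AE_mp, rule AE_I2, blast)
  then show ?thesis
    using partial_flow_global[OF flow]
  proof eventually_elim
    case (elim \<omega>)
    show ?case
    proof (intro allI impI)
      fix s :: real and x assume "0 \<le> s"
      then have "(\<lambda>y. F s y \<omega>) differentiable (at x)" using elim unfolding differentiable_def by fastforce
      then show "((\<lambda>y. F s y \<omega>) has_derivative frechet_derivative (\<lambda>y. F s y \<omega>) (at x)) (at x)"
        by (simp add: frechet_derivative_works)
    qed
  qed
qed

text \<open>If the derivative in direction i exceeds l at some time s, then at this same s the
  difference quotients exceed l for all small increments, and exceeding l at one time is all that
  the two-point event requires. The increments are at most 1, whence the margin 1 between |x| and
  R.\<close>

lemma derivative_tail:
  assumes flow: "partial_flow M \<F> B X A F \<xi>" and x: "norm x + 1 \<le> R" and i: "i \<in> Basis" and l: "l \<ge> 1"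
    and C: "\<And>x0 y0 x y \<xi> \<xi>' u. sde_solution M \<F> B X A x0 x \<xi> \<Longrightarrow> sde_solution M \<F> B X A y0 y \<xi>' \<Longrightarrow>
     norm x0 \<le> R \<Longrightarrow> norm y0 \<le> R \<Longrightarrow> x0 \<noteq> y0 \<Longrightarrow> u \<ge> 1 \<Longrightarrow>
     outer_prob_le M (\<lambda>\<omega>. \<exists>t\<in>{0..real T}. ereal t < \<xi> \<omega> \<and> ereal t < \<xi>' \<omega> \<and> norm (x t \<omega> - y t \<omega>) > u * norm (x0 - y0)) (C / u^r)"
  shows "outer_prob_le M (\<lambda>\<omega>. \<exists>s\<in>{0..real T}. norm (frechet_derivative (\<lambda>y. F s y \<omega>) (at x) i) > l) (C / l^r)"
proof (rule outer_prob_le_liminf)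
  define h where "h j = inverse (real (Suc j))" for j
  have h: "h j > 0" "h j \<le> 1" for j by (auto simp: h_def inverse_eq_divide)
  have ni: "norm i = 1" using i by simp
  have sol: "sde_solution M \<F> B X A x (\<lambda>t. F t x) (\<xi> x)" for x
    using flow unfolding partial_flow_def maximal_solution_def by blast
  show "outer_prob_le M (\<lambda>\<omega>. \<exists>s\<in>{0..real T}. ereal s < \<xi> (x + h j *\<^sub>R i) \<omega> \<and> ereal s < \<xi> x \<omega> \<and>
      norm (F s (x + h j *\<^sub>R i) \<omega> - F s x \<omega>) > l * norm ((x + h j *\<^sub>R i) - x)) (C / l^r)" for j
  proof (rule C[OF sol sol _ _ _ l])
    show "norm (x + h j *\<^sub>R i) \<le> R" using norm_triangle_ineq[of x "h j *\<^sub>R i"] x h[of j] ni by simp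
    show "norm x \<le> R" using x by simp
    show "x + h j *\<^sub>R i \<noteq> x" using h[of j] i by auto
  qed
  show "AE \<omega> in M. (\<exists>s\<in>{0..real T}. norm (frechet_derivative (\<lambda>y. F s y \<omega>) (at x) i) > l) \<longrightarrow>
     eventually (\<lambda>j. \<exists>s\<in>{0..real T}. ereal s < \<xi> (x + h j *\<^sub>R i) \<omega> \<and> ereal s < \<xi> x \<omega> \<and>
      norm (F s (x + h j *\<^sub>R i) \<omega> - F s x \<omega>) > l * norm ((x + h j *\<^sub>R i) - x)) sequentially"
    using partial_flow_derivative[OF flow] partial_flow_global[OF flow]
  proof eventually_elim
    case (elim \<omega>)
    show ?case
    proof (rule impI, erule bexE)
      fix s assume s: "s \<in> {0..real T}" and big: "norm (frechet_derivative (\<lambda>y. F s y \<omega>) (at x) i) > l"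
      have "h \<longlonglongrightarrow> 0" unfolding h_def by (rule LIMSEQ_inverse_real_of_nat)
      define L where "L = frechet_derivative (\<lambda>y. F s y \<omega>) (at x)"
      have L: "((\<lambda>y. F s y \<omega>) has_derivative L) (at x)" using elim s unfolding L_def by simp
      then have lin: "linear L" by (rule has_derivative_linear)
      have "filterlim (\<lambda>j. h j *\<^sub>R i) (at 0) sequentially"
        unfolding filterlim_at
      proof
        show "eventually (\<lambda>j. h j *\<^sub>R i \<in> UNIV \<and> h j *\<^sub>R i \<noteq> 0) sequentially" using h(1) ni by (auto simp: less_imp_neq[symmetric])
        show "(\<lambda>j. h j *\<^sub>R i) \<longlonglongrightarrow> 0" using tendsto_scaleR[OF \<open>h \<longlonglongrightarrow> 0\<close> tendsto_const[of i]] by simp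
      qed
      then have "(\<lambda>j. norm (F s (x + h j *\<^sub>R i) \<omega> - F s x \<omega> - L (h j *\<^sub>R i)) / norm (h j *\<^sub>R i)) \<longlonglongrightarrow> 0"
        by (rule filterlim_compose[OF L[unfolded has_derivative_at, THEN conjunct2]])
      moreover have "norm (F s (x + h j *\<^sub>R i) \<omega> - F s x \<omega> - L (h j *\<^sub>R i)) / norm (h j *\<^sub>R i)
          = norm ((F s (x + h j *\<^sub>R i) \<omega> - F s x \<omega>) /\<^sub>R h j - L i)" for j
      proof -
        have "(F s (x + h j *\<^sub>R i) \<omega> - F s x \<omega>) /\<^sub>R h j - L i = (F s (x + h j *\<^sub>R i) \<omega> - F s x \<omega> - L (h j *\<^sub>R i)) /\<^sub>R h j"
          using h(1)[of j] by (simp add: linear_scale[OF lin] scaleR_diff_right)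
        then show ?thesis using h(1)[of j] ni by (simp add: divide_inverse_commute)
      qed
      ultimately have "(\<lambda>j. (F s (x + h j *\<^sub>R i) \<omega> - F s x \<omega>) /\<^sub>R h j) \<longlonglongrightarrow> frechet_derivative (\<lambda>y. F s y \<omega>) (at x) i"
        by (simp add: tendsto_norm_zero_iff LIM_zero_iff L_def)
      then have "(\<lambda>j. norm ((F s (x + h j *\<^sub>R i) \<omega> - F s x \<omega>) /\<^sub>R h j)) \<longlonglongrightarrow> norm (frechet_derivative (\<lambda>y. F s y \<omega>) (at x) i)"
        by (rule tendsto_norm)
      then have "eventually (\<lambda>j. l < norm ((F s (x + h j *\<^sub>R i) \<omega> - F s x \<omega>) /\<^sub>R h j)) sequentially"
        using big by (rule order_tendstoD(1))
      then show "eventually (\<lambda>j. \<exists>s\<in>{0..real T}. ereal s < \<xi> (x + h j *\<^sub>R i) \<omega> \<and> ereal s < \<xi> x \<omega> \<and>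
          norm (F s (x + h j *\<^sub>R i) \<omega> - F s x \<omega>) > l * norm ((x + h j *\<^sub>R i) - x)) sequentially"
      proof eventually_elim
        case (elim j)
        have "norm ((F s (x + h j *\<^sub>R i) \<omega> - F s x \<omega>) /\<^sub>R h j) = norm (F s (x + h j *\<^sub>R i) \<omega> - F s x \<omega>) / h j"
          using h[of j] by (simp add: divide_inverse_commute)
        then have "l * h j < norm (F s (x + h j *\<^sub>R i) \<omega> - F s x \<omega>)" using elim h[of j] by (simp add: less_divide_eq)
        moreover have "norm ((x + h j *\<^sub>R i) - x) = h j" using h[of j] ni by simp
        ultimately show ?case using s \<open>\<forall>x. \<xi> x \<omega> = \<infinity>\<close> by (intro bexI[of _ s]) auto
      qed
    qed
  qed
qed

lemma derivative_moments:
  assumes flow: "partial_flow M \<F> B X A F \<xi>" and p: "p > 0" and t: "t > 0" and K: "compact K"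
  shows "(SUP x\<in>K. \<integral>\<^sup>+\<omega>. (SUP s\<in>{0..t}. ennreal (onorm (frechet_derivative (\<lambda>y. F s y \<omega>) (at x)) powr p)) \<partial>M) < \<infinity>"
proof -
  define D where "D = real DIM('n)"
  have D: "D \<ge> 1" by (simp add: D_def Suc_leI)
  obtain T :: nat where T: "t \<le> real T" using real_arch_simple by blast
  obtain R0 where R0: "\<And>x. x \<in> K \<Longrightarrow> norm x \<le> R0" using compact_imp_bounded[OF K] unfolding bounded_iff by blast
  define R where "R = \<bar>R0\<bar> + 1"
  \<comment> \<open>Doubling the p-th power of the threshold then lowers the tail by at least a
    factor 4.\<close>
  obtain r :: nat where r: "real r \<ge> 2 * p" using real_arch_simple by blast
  have r0: "r > 0" using r p by (cases r) auto
  obtain C where C: "C \<ge> 0" "\<And>x0 y0 x y \<xi> \<xi>' u. sde_solution M \<F> B X A x0 x \<xi> \<Longrightarrow> sde_solution M \<F> B X A y0 y \<xi>' \<Longrightarrow>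
     norm x0 \<le> R \<Longrightarrow> norm y0 \<le> R \<Longrightarrow> x0 \<noteq> y0 \<Longrightarrow> u \<ge> 1 \<Longrightarrow>
     outer_prob_le M (\<lambda>\<omega>. \<exists>t\<in>{0..real T}. ereal t < \<xi> \<omega> \<and> ereal t < \<xi>' \<omega> \<and> norm (x t \<omega> - y t \<omega>) > u * norm (x0 - y0)) (C / u^r)"
    using flow_tail[OF r0, of R T] by (auto simp: R_def)
  \<comment> \<open>At the threshold m b the D directions together fail with probability at most D C
    / (m b)^r. As m >= 1, m^r is at least D C, which leaves b^-r.\<close>
  define m where "m = 1 + D * C"
  have m: "m \<ge> 1" using D C by (simp add: m_def)
  define E where "E = (D * m) powr p"
  have "(\<integral>\<^sup>+\<omega>. (SUP s\<in>{0..t}. ennreal (onorm (frechet_derivative (\<lambda>y. F s y \<omega>) (at x)) powr p)) \<partial>M) \<le> ennreal (5 * E)"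
    if x: "x \<in> K" for x
  proof (rule nn_integral_le_of_tails)
    show "E \<ge> 0" by (simp add: E_def)
    fix k :: nat
    \<comment> \<open>The p-th root of the dyadic level 2^k.\<close>
    define b where "b = 2 powr (k / p)"
    have b: "b \<ge> 1" using p by (simp add: b_def ge_one_powr_ge_zero)
    define l where "l = m * b"
    have l: "l \<ge> 1" using m b mult_mono[of 1 m 1 b] by (simp add: l_def)
    have xR: "norm x + 1 \<le> R" using R0[OF x] by (simp add: R_def)
    have Dl: "(D * l) powr p = E * 2^k"
      using D m p by (simp add: l_def E_def b_def powr_mult powr_powr powr_realpow)
    have "outer_prob_le M (\<lambda>\<omega>. \<exists>i\<in>Basis. \<exists>s\<in>{0..real T}. norm (frechet_derivative (\<lambda>y. F s y \<omega>) (at x) i) > l) (\<Sum>i\<in>(Basis :: 'n set). C / l^r)"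
      by (rule outer_prob_le_finite_ex) (auto intro: derivative_tail[OF flow xR _ l C(2)])
    then show "outer_prob_le M (\<lambda>\<omega>. (SUP s\<in>{0..t}. ennreal (onorm (frechet_derivative (\<lambda>y. F s y \<omega>) (at x)) powr p)) > ennreal (E * 2^k)) (1 / 4^k)"
    proof (rule outer_prob_le_AE_mono)
      have "(4::real)^k = 2^(2 * k)" by (simp add: power_mult)
      also have "\<dots> = 2 powr (2 * real k)" using powr_realpow[of 2 "2 * k"] by simp
      also have "\<dots> \<le> 2 powr (k / p * r)"
      proof -
        have "2 * real k \<le> k / p * r" using mult_left_mono[OF r, of "k / p"] p by (simp add: field_simps)
        then show ?thesis by simp
      qed
      also have "\<dots> = b^r" using powr_realpow[of b r] b by (simp add: b_def powr_powr)
      finally have "m * 4^k \<le> m^r * b^r" using m r0 self_le_power[of m r] by (intro mult_mono) auto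
      then have "D * C * 4^k \<le> l^r" unfolding l_def power_mult_distrib m_def by (rule order_trans[rotated]) (simp add: distrib_right)
      then have "D * C * 4^k \<le> 1 * l^r" by simp
      then have "D * C / l^r \<le> 1 / 4^k" using l by (intro frac_le_eq[THEN iffD2] ) (auto simp: field_simps)
      then show "(\<Sum>i\<in>(Basis :: 'n set). C / l^r) \<le> 1 / 4^k" by (simp add: D_def)
      show "AE \<omega> in M. (SUP s\<in>{0..t}. ennreal (onorm (frechet_derivative (\<lambda>y. F s y \<omega>) (at x)) powr p)) > ennreal (E * 2^k) \<longrightarrow>
         (\<exists>i\<in>Basis. \<exists>s\<in>{0..real T}. norm (frechet_derivative (\<lambda>y. F s y \<omega>) (at x) i) > l)"
        using partial_flow_derivative[OF flow]
      proof eventually_elim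
        case (elim \<omega>)
        show ?case
        proof
          assume "(SUP s\<in>{0..t}. ennreal (onorm (frechet_derivative (\<lambda>y. F s y \<omega>) (at x)) powr p)) > ennreal (E * 2^k)"
          then obtain s where s: "s \<in> {0..t}" "ennreal (onorm (frechet_derivative (\<lambda>y. F s y \<omega>) (at x)) powr p) > ennreal (E * 2^k)"
            unfolding less_SUP_iff by blast
          define L where "L = frechet_derivative (\<lambda>y. F s y \<omega>) (at x)"
          have "((\<lambda>y. F s y \<omega>) has_derivative L) (at x)" using elim s unfolding L_def by auto
          then have lin: "bounded_linear L" by (rule has_derivative_bounded_linear)
          have big: "onorm L powr p > (D * l) powr p" using s(2) unfolding L_def Dl by (simp add: ennreal_less_iff E_def)
          have "\<exists>i\<in>Basis. norm (L i) > l"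
          proof (rule ccontr)
            assume "\<not> ?thesis"
            then have le: "\<And>i. i \<in> Basis \<Longrightarrow> norm (blinfun_apply (Blinfun L) i) \<le> l" by (auto simp: not_less bounded_linear_Blinfun_apply[OF lin])
            have "norm (Blinfun L) \<le> D * l" unfolding D_def by (rule norm_blinfun_le_Basis[OF le])
            then have "onorm L \<le> D * l" by (simp add: norm_blinfun.rep_eq bounded_linear_Blinfun_apply[OF lin])
            then have "onorm L powr p \<le> (D * l) powr p" using onorm_pos_le[OF lin] p by (intro powr_mono2) auto
            then show False using big by simp
          qed
          then show "\<exists>i\<in>Basis. \<exists>s\<in>{0..real T}. norm (frechet_derivative (\<lambda>y. F s y \<omega>) (at x) i) > l"
            using s T unfolding L_def by fastforce
        qed
      qed
    qed
  qed
  then have "(SUP x\<in>K. \<integral>\<^sup>+\<omega>. (SUP s\<in>{0..t}. ennreal (onorm (frechet_derivative (\<lambda>y. F s y \<omega>) (at x)) powr p)) \<partial>M) \<le> ennreal (5 * E)"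
    by (rule SUP_least)
  also have "\<dots> < \<infinity>" by simp
  finally show ?thesis .
qed

end

theorem theorem6p2:
  fixes M :: "'w measure"
    and \<F> :: "real \<Rightarrow> 'w measure"
    and B :: "real \<Rightarrow> 'w \<Rightarrow> real ^ 'm"
    and X :: "real ^ 'n \<Rightarrow> (real ^ 'm) \<Rightarrow>\<^sub>L (real ^ 'n)"
    and A :: "real ^ 'n \<Rightarrow> real ^ 'n"
    and c :: real
  assumes "prob_space M"
    and "usual_conditions M \<F>"
    and "brownian_motion M \<F> B"
    and "C2 X"
    and "C2 A"
    and "\<And>x. sqrt (\<Sum>i\<in>Basis. (norm (blinfun_apply (X x) i))\<^sup>2) \<le> c * sqrt (1 + (norm x)\<^sup>2)"
    and "\<And>x. x \<bullet> A x \<le> c * (1 + (norm x)\<^sup>2)"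
    and "\<And>x. (\<Sum>i\<in>Basis. (onorm (frechet_derivative (\<lambda>y. blinfun_apply (X y) i) (at x)))\<^sup>2)
           \<le> c * (1 + ln (1 + (norm x)\<^sup>2))"
    and "\<And>x v. frechet_derivative A (at x) v \<bullet> v \<le> c * (1 + ln (1 + (norm x)\<^sup>2)) * (norm v)\<^sup>2"
  shows "strongly_complete M \<F> B X A \<and>
    (\<forall>F \<xi>. partial_flow M \<F> B X A F \<xi> \<longrightarrow> (AE \<omega> in M. (INF x. \<xi> x \<omega>) = \<infinity>)) \<and>
    (\<forall>p>0. \<exists>c1 c2. \<forall>x0 x \<xi>. maximal_solution M \<F> B X A x0 x \<xi> \<longrightarrow>
       (\<forall>t\<ge>0. (\<integral>\<^sup>+\<omega>. ennreal (norm (x t \<omega>) powr (2 * p)) \<partial>M)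
          \<le> ennreal (c1 * (1 + (norm x0)\<^sup>2) powr p * exp (c2 * t)))) \<and>
    (\<forall>F \<xi>. partial_flow M \<F> B X A F \<xi> \<longrightarrow>
       (\<forall>p>0. \<forall>t>0. \<forall>K. compact K \<longrightarrow>
          (SUP x\<in>K. \<integral>\<^sup>+\<omega>. (SUP s\<in>{0..t}.
             ennreal (onorm (frechet_derivative (\<lambda>y. F s y \<omega>) (at x)) powr p)) \<partial>M) < \<infinity>))"
proof -
  interpret prob_space M by fact
  interpret sde_setting M \<F> B X A c by unfold_locales (fact assms)+
  have "AE \<omega> in M. (INF x. \<xi> x \<omega>) = \<infinity>" if "partial_flow M \<F> B X A F \<xi>" for F \<xi>
    using partial_flow_global[OF that] by eventually_elim simp
  then show ?thesis
    by (intro conjI allI impI sde_strongly_complete solution_moments derivative_moments)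
qed

end
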